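(* Let $V$ be a non-degenerate real quadratic space and $\sigma\in\mathrm{O}(V)$. Let $(r,s)$ be the signature of $V_\sigma^{\mathrm{odd}}:=\bigoplus_{(p,l)\in I_0^{\mathrm{odd}}\cup I_1^{\mathrm{odd}}}V_{p,\sigma}^{(l)}$ and $n=r+s$. Consider the equation $$(\ast)\qquad\frac n2-\frac{\epsilon_0}{2}-\epsilon_1+\sum_{(p,l)\in I_0^{\mathrm{odd}}}w_{p,l}+2\sum_{(p,l)\in I_1^{\mathrm{odd}}}z_{p,l}=r$$ in integers $0\le w_{p,l}\le\epsilon_{p,\sigma}^{(l)}$ ($(p,l)\in I_0^{\mathrm{odd}}$) and $0\le z_{p,l}\le\epsilon_{p,\sigma}^{(l)}$ ($(p,l)\in I_1^{\mathrm{odd}}$). Then $(\ast)$ has exactly one solution if and only if at least one of the following conditions holds: (i) $\#I_0^{\mathrm{odd}}+\#I_1^{\mathrm{odd}}\le1$. (ii) $q$ is (positive or negative) definite. (iii) $\#I_0^{\mathrm{odd}}=1$, $q_0$ is $1$-dimensional, and either $\#I_1^{\mathrm{odd}}=1$ or $q_1$ is definite. (iv) $\#I_0^{\mathrm{odd}}=1$, $q_0$ is a hyperbolic plane, and either $\#I_1^{\mathrm{odd}}=1$ or $q_1$ is definite. (v) $\#I_0^{\mathrm{odd}}=1$, and, denoting by $(r_0,s_0)$ the signature of $q_0$, one of the following two cases occurs: $r_0\ge2$, $s_0=1$ and $q_1$ is positive definite; or $r_0=1$, $s_0\ge2$ and $q_1$ is negative definite. Consequently, every $\tau\in\mathrm{O}(V)$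 which is conjugate to $\sigma$ in $\mathrm{GL}(V)$ is conjugate to $\sigma$ in $\mathrm{O}(V)$ if and only if $I_1^{\mathrm{ev}}=\emptyset$ and at least one of (i)-(v) holds.
   Context: A non-degenerate real quadratic space is a finite-dimensional real vector space $V$ with a non-degenerate symmetric bilinear form $\langle\cdot,\cdot\rangle$; $\mathrm{O}(V)$ is its group of linear isometries. Signature $(r,s)$ means $r$ positive and $s$ negative squares. A hyperbolic plane is a $2$-dimensional real quadratic space of signature $(1,1)$. For a polynomial $g\in\mathbb{R}[x]$ with $g(0)\ne0$ put $g^*(x)=g(0)^{-1}x^{\deg g}g(x^{-1})$; $g$ is reciprocal if $g=g^*$. Let $\sigma\in\mathrm{O}(V)$ with characteristic polynomial $f$ (which is reciprocal). Define: - $I_0(f)$: the set of reciprocal $p\in\mathbb{R}[x]$ with $\deg p=1$ and $p\mid f$ (a subset of $\{x+1,x-1\}$); - $I_1(f)$: the set of irreducible reciprocal $p\in\mathbb{R}[x]$ with $\deg p=2$ and $p\mid f$; - $I_2(f)$: the set of products $qq^*$ with $q\in\mathbb{R}[x]$ monic, irreducible, non-reciprocal and $q\mid f$; - $I(f)=I_0(f)\cup I_1(f)\cup I_2(f)$. Regard $V$ as an $\mathbb{R}[x]$-module $V_\sigma$ with $x$ acting as $\sigma$. There is an orthogonal decomposition into $\sigma$-stable subspaces $V_\sigma=\bigoplus_{p\in I(f)}\bigoplus_{l\ge1}V_{p,\sigma}^{(l)}$ in which each $V_{p,\sigma}^{(l)}$ is a free $\mathbb{R}[x]/(p^l)$-module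 and $\bigoplus_{l\ge1}V_{p,\sigma}^{(l)}=\{v\in V: p(\sigma)^kv=0\text{ for } k\gg0\}$ is the $p$-primary component; fix such a decomposition. For $i=0,1$: $I_i^{\mathrm{odd}}=\{(p,l):p\in I_i(f),\ l\text{ odd},\ V_{p,\sigma}^{(l)}\ne0\}$ and $I_i^{\mathrm{ev}}=\{(p,l):p\in I_i(f),\ l\text{ even},\ V_{p,\sigma}^{(l)}\ne0\}$. For $p\in I_0(f)\cup I_1(f)$, $\epsilon_{p,\sigma}^{(l)}$ is the rank of the free $\mathbb{R}[x]/(p^l)$-module $V_{p,\sigma}^{(l)}$. Put $\epsilon_i=\sum_{(p,l)\in I_i^{\mathrm{odd}}}\epsilon_{p,\sigma}^{(l)}$ for $i=0,1$. For $(t,l)\in I_0^{\mathrm{odd}}$, $b_{t,l}$ is the non-degenerate symmetric bilinear form on the real vector space $V_{t,\sigma}^{(l)}/tV_{t,\sigma}^{(l)}$ given by $b_{t,l}(\overline u,\overline v)=\langle(\sigma-\sigma^{-1})^{l-1}u,v\rangle$. For $(p,l)\in I_1^{\mathrm{odd}}$, $h_{p,l}$ is the non-degenerate Hermitian form on the vector space $V_{p,\sigma}^{(l)}/pV_{p,\sigma}^{(l)}$ over $\mathbb{R}[x]/(p)\cong\mathbb{C}$ (with respect to the involution $x\mapsto x^{-1}$, i.e. complex conjugation) determined by $\mathrm{tr}_{\mathbb{C}/\mathbb{R}}(h_{p,l}(\overline u,\overline v))=\langle(\sigma^{-1}p(\sigma))^{l-1}u,v\rangle$. Define the real quadratic forms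 (orthogonal sums) $q_0=\bigoplus_{(t,l)\in I_0^{\mathrm{odd}}}(-1)^{(l-1)/2}b_{t,l}$, $q_1=\bigoplus_{(p,l)\in I_1^{\mathrm{odd}}}\mathrm{tr}_{\mathbb{C}/\mathbb{R}}(h_{p,l})$ and $q=q_0\perp q_1$. *)

theory Defs
  imports
    Complex_Main
    "HOL-Library.FuncSet"
    "HOL-Computational_Algebra.Polynomial"
    "Jordan_Normal_Form.Char_Poly"
begin

text \<open>
  The ambient space \<open>V\<close> is a type \<open>'a::real_vector\<close> that is spanned by a finite set; unlike
  \<open>euclidean_space\<close>, this does not exclude the zero space.
\<close>

definition finite_dimensional_type :: "'a::real_vector itself \<Rightarrow> bool" where
  "finite_dimensional_type _ \<longleftrightarrow> (\<exists>S::'a set. finite S \<and> span S = UNIV)"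

definition nondegenerate_form :: "('a::real_vector \<Rightarrow> 'a \<Rightarrow> real) \<Rightarrow> bool" where
  "nondegenerate_form B \<longleftrightarrow>
     (\<forall>x. linear (B x)) \<and> (\<forall>x y. B x y = B y x) \<and> (\<forall>x. (\<forall>y. B x y = 0) \<longrightarrow> x = 0)"

definition GL :: "('a::real_vector \<Rightarrow> 'a) set" where
  "GL = {g. linear g \<and> bij g}"

definition O_group :: "('a::real_vector \<Rightarrow> 'a \<Rightarrow> real) \<Rightarrow> ('a \<Rightarrow> 'a) set" where
  "O_group B = {g \<in> GL. \<forall>x y. B (g x) (g y) = B x y}"

definition conjugate_in :: "('a \<Rightarrow> 'a) set \<Rightarrow> ('a \<Rightarrow> 'a) \<Rightarrow> ('a \<Rightarrow> 'a) \<Rightarrow> bool" where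
  "conjugate_in G \<sigma> \<tau> \<longleftrightarrow> (\<exists>g\<in>G. \<tau> = g \<circ> \<sigma> \<circ> inv_into UNIV g)"

definition poly_act :: "real poly \<Rightarrow> ('a::real_vector \<Rightarrow> 'a) \<Rightarrow> 'a \<Rightarrow> 'a" where
  "poly_act p \<sigma> v = (\<Sum>i\<le>degree p. coeff p i *\<^sub>R (\<sigma> ^^ i) v)"

definition ordered_basis :: "'a::real_vector list \<Rightarrow> bool" where
  "ordered_basis bs \<longleftrightarrow> distinct bs \<and> independent (set bs) \<and> span (set bs) = UNIV"

definition matrix_wrt :: "'a::real_vector list \<Rightarrow> ('a \<Rightarrow> 'a) \<Rightarrow> real mat" where
  "matrix_wrt bs \<sigma> = mat (length bs) (length bs)
     (\<lambda>(i, j). representation (set bs) (\<sigma> (bs ! j)) (bs ! i))"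

definition endo_char_poly :: "('a::real_vector \<Rightarrow> 'a) \<Rightarrow> real poly" where
  "endo_char_poly \<sigma> = char_poly (matrix_wrt (SOME bs. ordered_basis bs) \<sigma>)"

text \<open>For \<open>g(0) \<noteq> 0\<close>, \<open>reflect_poly g\<close> is \<open>x^(deg g) g(1/x)\<close>.\<close>

definition star_poly :: "real poly \<Rightarrow> real poly" where
  "star_poly g = Polynomial.smult (inverse (coeff g 0)) (reflect_poly g)"

definition reciprocal :: "real poly \<Rightarrow> bool" where
  "reciprocal g \<longleftrightarrow> coeff g 0 \<noteq> 0 \<and> g = star_poly g"

definition I0 :: "real poly \<Rightarrow> real poly set" where
  "I0 f = {p. reciprocal p \<and> degree p = 1 \<and> p dvd f}"

definition I1 :: "real poly \<Rightarrow> real poly set" where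
  "I1 f = {p. irreducible p \<and> reciprocal p \<and> degree p = 2 \<and> p dvd f}"

definition I2 :: "real poly \<Rightarrow> real poly set" where
  "I2 f = {q * star_poly q | q.
     lead_coeff q = 1 \<and> irreducible q \<and> \<not> reciprocal q \<and> q dvd f}"

definition I_all :: "real poly \<Rightarrow> real poly set" where
  "I_all f = I0 f \<union> I1 f \<union> I2 f"

text \<open>
  \<open>E\<close> is a basis of \<open>W\<close> as a module over \<open>\<real>[x]/(m)\<close>, with \<open>x\<close> acting as \<open>\<sigma>\<close>;
  scalars are represented by polynomials, and they are zero iff they are divisible by \<open>m\<close>.
\<close>

definition quot_module_basis ::
  "('a::real_vector \<Rightarrow> 'a) \<Rightarrow> real poly \<Rightarrow> 'a set \<Rightarrow> 'a set \<Rightarrow> bool" where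
  "quot_module_basis \<sigma> m W E \<longleftrightarrow>
     finite E \<and> E \<subseteq> W \<and> (\<forall>w\<in>W. poly_act m \<sigma> w = 0) \<and>
     W = range (\<lambda>c. \<Sum>e\<in>E. poly_act (c e) \<sigma> e) \<and>
     (\<forall>c. (\<Sum>e\<in>E. poly_act (c e) \<sigma> e) = 0 \<longrightarrow> (\<forall>e\<in>E. m dvd c e))"

definition free_quot_module :: "('a::real_vector \<Rightarrow> 'a) \<Rightarrow> real poly \<Rightarrow> 'a set \<Rightarrow> bool" where
  "free_quot_module \<sigma> m W \<longleftrightarrow> (\<exists>E. quot_module_basis \<sigma> m W E)"

definition free_rank :: "('a::real_vector \<Rightarrow> 'a) \<Rightarrow> real poly \<Rightarrow> 'a set \<Rightarrow> nat" where
  "free_rank \<sigma> m W = (THE k. \<exists>E. quot_module_basis \<sigma> m W E \<and> card E = k)"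

definition internal_direct_sum ::
  "'i set \<Rightarrow> ('i \<Rightarrow> 'a::real_vector set) \<Rightarrow> 'a set \<Rightarrow> bool" where
  "internal_direct_sum J W U \<longleftrightarrow>
     (\<forall>j\<in>J. subspace (W j)) \<and> span (\<Union>j\<in>J. W j) = U \<and>
     (\<forall>F c. finite F \<and> F \<subseteq> J \<and> (\<forall>j\<in>F. c j \<in> W j) \<and> (\<Sum>j\<in>F. c j) = 0 \<longrightarrow> (\<forall>j\<in>F. c j = 0))"

definition primary_component :: "('a::real_vector \<Rightarrow> 'a) \<Rightarrow> real poly \<Rightarrow> 'a set" where
  "primary_component \<sigma> p = {v. \<exists>K. \<forall>k\<ge>K. (poly_act p \<sigma> ^^ k) v = 0}"

definition module_decomposition ::
  "('a::real_vector \<Rightarrow> 'a \<Rightarrow> real) \<Rightarrow> ('a \<Rightarrow> 'a) \<Rightarrow> (real poly \<times> nat \<Rightarrow> 'a set) \<Rightarrow> bool" where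
  "module_decomposition B \<sigma> W \<longleftrightarrow>
     (let I = I_all (endo_char_poly \<sigma>) in
       (\<forall>p\<in>I. \<forall>l\<ge>1. subspace (W (p, l)) \<and> \<sigma> ` W (p, l) \<subseteq> W (p, l) \<and>
          free_quot_module \<sigma> (p ^ l) (W (p, l))) \<and>
       internal_direct_sum (I \<times> {1..}) W UNIV \<and>
       (\<forall>p\<in>I. internal_direct_sum {1..} (\<lambda>l. W (p, l)) (primary_component \<sigma> p)) \<and>
       (\<forall>j\<in>I \<times> {1..}. \<forall>k\<in>I \<times> {1..}. j \<noteq> k \<longrightarrow> (\<forall>u\<in>W j. \<forall>v\<in>W k. B u v = 0)))"

definition I0_odd ::
  "('a::real_vector \<Rightarrow> 'a) \<Rightarrow> (real poly \<times> nat \<Rightarrow> 'a set) \<Rightarrow> (real poly \<times> nat) set" where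
  "I0_odd \<sigma> W = {(p, l). p \<in> I0 (endo_char_poly \<sigma>) \<and> odd l \<and> W (p, l) \<noteq> {0}}"

definition I1_odd ::
  "('a::real_vector \<Rightarrow> 'a) \<Rightarrow> (real poly \<times> nat \<Rightarrow> 'a set) \<Rightarrow> (real poly \<times> nat) set" where
  "I1_odd \<sigma> W = {(p, l). p \<in> I1 (endo_char_poly \<sigma>) \<and> odd l \<and> W (p, l) \<noteq> {0}}"

definition I1_ev ::
  "('a::real_vector \<Rightarrow> 'a) \<Rightarrow> (real poly \<times> nat \<Rightarrow> 'a set) \<Rightarrow> (real poly \<times> nat) set" where
  "I1_ev \<sigma> W = {(p, l). p \<in> I1 (endo_char_poly \<sigma>) \<and> l \<ge> 1 \<and> even l \<and> W (p, l) \<noteq> {0}}"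

fun eps ::
  "('a::real_vector \<Rightarrow> 'a) \<Rightarrow> (real poly \<times> nat \<Rightarrow> 'a set) \<Rightarrow> real poly \<times> nat \<Rightarrow> nat" where
  "eps \<sigma> W (p, l) = free_rank \<sigma> (p ^ l) (W (p, l))"

definition eps0 :: "('a::real_vector \<Rightarrow> 'a) \<Rightarrow> (real poly \<times> nat \<Rightarrow> 'a set) \<Rightarrow> nat" where
  "eps0 \<sigma> W = (\<Sum>j\<in>I0_odd \<sigma> W. eps \<sigma> W j)"

definition eps1 :: "('a::real_vector \<Rightarrow> 'a) \<Rightarrow> (real poly \<times> nat \<Rightarrow> 'a set) \<Rightarrow> nat" where
  "eps1 \<sigma> W = (\<Sum>j\<in>I1_odd \<sigma> W. eps \<sigma> W j)"

definition V_odd :: "('a::real_vector \<Rightarrow> 'a) \<Rightarrow> (real poly \<times> nat \<Rightarrow> 'a set) \<Rightarrow> 'a set" where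
  "V_odd \<sigma> W = span (\<Union>j\<in>I0_odd \<sigma> W \<union> I1_odd \<sigma> W. W j)"

text \<open>
  Needed because the spaces \<open>W/pW\<close> and their orthogonal sums depend on \<open>\<sigma>\<close> and on the chosen
  decomposition, and so are not types.
\<close>

record 'v quad_space =
  vecs :: "'v set"
  vplus :: "'v \<Rightarrow> 'v \<Rightarrow> 'v"
  vscale :: "real \<Rightarrow> 'v \<Rightarrow> 'v"
  vzero :: 'v
  vform :: "'v \<Rightarrow> 'v \<Rightarrow> real"

definition coord_space :: "nat \<Rightarrow> (nat \<Rightarrow> real) set" where
  "coord_space n = {x. \<forall>i\<ge>n. x i = 0}"

definition coordinates :: "'v quad_space \<Rightarrow> nat \<Rightarrow> ((nat \<Rightarrow> real) \<Rightarrow> 'v) \<Rightarrow> bool" where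
  "coordinates Q n \<phi> \<longleftrightarrow>
     bij_betw \<phi> (coord_space n) (vecs Q) \<and>
     (\<forall>x\<in>coord_space n. \<forall>y\<in>coord_space n. \<phi> (\<lambda>i. x i + y i) = vplus Q (\<phi> x) (\<phi> y)) \<and>
     (\<forall>a. \<forall>x\<in>coord_space n. \<phi> (\<lambda>i. a * x i) = vscale Q a (\<phi> x))"

definition has_dim :: "'v quad_space \<Rightarrow> nat \<Rightarrow> bool" where
  "has_dim Q n \<longleftrightarrow> (\<exists>\<phi>. coordinates Q n \<phi>)"

definition has_signature :: "'v quad_space \<Rightarrow> nat \<Rightarrow> nat \<Rightarrow> bool" where
  "has_signature Q r s \<longleftrightarrow>
     (\<exists>\<phi>. coordinates Q (r + s) \<phi> \<and>
        (\<forall>x\<in>coord_space (r + s). \<forall>y\<in>coord_space (r + s).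
           vform Q (\<phi> x) (\<phi> y) = (\<Sum>i<r. x i * y i) - (\<Sum>i=r..<r + s. x i * y i)))"

definition hyperbolic_plane :: "'v quad_space \<Rightarrow> bool" where
  "hyperbolic_plane Q \<longleftrightarrow> has_signature Q 1 1"

definition positive_definite :: "'v quad_space \<Rightarrow> bool" where
  "positive_definite Q \<longleftrightarrow> (\<forall>v\<in>vecs Q. v \<noteq> vzero Q \<longrightarrow> vform Q v v > 0)"

definition negative_definite :: "'v quad_space \<Rightarrow> bool" where
  "negative_definite Q \<longleftrightarrow> (\<forall>v\<in>vecs Q. v \<noteq> vzero Q \<longrightarrow> vform Q v v < 0)"

definition definite :: "'v quad_space \<Rightarrow> bool" where
  "definite Q \<longleftrightarrow> positive_definite Q \<or> negative_definite Q"

definition subspace_quad :: "('a::real_vector \<Rightarrow> 'a \<Rightarrow> real) \<Rightarrow> 'a set \<Rightarrow> 'a quad_space" where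
  "subspace_quad B U =
     \<lparr>vecs = U, vplus = (+), vscale = (*\<^sub>R), vzero = 0, vform = B\<rparr>"

text \<open>The quotient \<open>W/N\<close>, as a set of cosets, with a form given on cosets.\<close>

definition quotient_quad ::
  "'a::real_vector set \<Rightarrow> 'a set \<Rightarrow> ('a set \<Rightarrow> 'a set \<Rightarrow> real) \<Rightarrow> 'a set quad_space" where
  "quotient_quad W N \<beta> =
     \<lparr>vecs = (\<lambda>w. (+) w ` N) ` W,
      vplus = (\<lambda>X Y. {x + y | x y. x \<in> X \<and> y \<in> Y}),
      vscale = (\<lambda>a X. {a *\<^sub>R x + z | x z. x \<in> X \<and> z \<in> N}),
      vzero = N,
      vform = \<beta>\<rparr>"

text \<open>
  The value on a pair of cosets is the common value of \<open>\<beta>\<close> on all pairs of representatives.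
\<close>

definition induced_form :: "('a \<Rightarrow> 'a \<Rightarrow> real) \<Rightarrow> 'a set \<Rightarrow> 'a set \<Rightarrow> real" where
  "induced_form \<beta> X Y = the_elem ((\<lambda>(u, v). \<beta> u v) ` (X \<times> Y))"

definition scale_form :: "real \<Rightarrow> 'v quad_space \<Rightarrow> 'v quad_space" where
  "scale_form a Q = Q\<lparr>vform := (\<lambda>x y. a * vform Q x y)\<rparr>"

definition orth_sum :: "'i set \<Rightarrow> ('i \<Rightarrow> 'v quad_space) \<Rightarrow> ('i \<Rightarrow> 'v) quad_space" where
  "orth_sum J Q =
     \<lparr>vecs = (\<Pi>\<^sub>E j\<in>J. vecs (Q j)),
      vplus = (\<lambda>x y. \<lambda>j\<in>J. vplus (Q j) (x j) (y j)),
      vscale = (\<lambda>a x. \<lambda>j\<in>J. vscale (Q j) a (x j)),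
      vzero = (\<lambda>j\<in>J. vzero (Q j)),
      vform = (\<lambda>x y. \<Sum>j\<in>J. vform (Q j) (x j) (y j))\<rparr>"

definition orth_pair :: "'v quad_space \<Rightarrow> 'w quad_space \<Rightarrow> ('v \<times> 'w) quad_space" where
  "orth_pair Q R =
     \<lparr>vecs = vecs Q \<times> vecs R,
      vplus = (\<lambda>x y. (vplus Q (fst x) (fst y), vplus R (snd x) (snd y))),
      vscale = (\<lambda>a x. (vscale Q a (fst x), vscale R a (snd x))),
      vzero = (vzero Q, vzero R),
      vform = (\<lambda>x y. vform Q (fst x) (fst y) + vform R (snd x) (snd y))\<rparr>"

fun b_space ::
  "('a::real_vector \<Rightarrow> 'a \<Rightarrow> real) \<Rightarrow> ('a \<Rightarrow> 'a) \<Rightarrow> (real poly \<times> nat \<Rightarrow> 'a set) \<Rightarrow>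
   real poly \<times> nat \<Rightarrow> 'a set quad_space" where
  "b_space B \<sigma> W (t, l) = quotient_quad (W (t, l)) (poly_act t \<sigma> ` W (t, l))
     (induced_form (\<lambda>u v. B (((\<lambda>w. \<sigma> w - inv_into UNIV \<sigma> w) ^^ (l - 1)) u) v))"

text \<open>
  \<open>\<real>[x]/(p)\<close> is identified with \<open>\<complex>\<close> by sending \<open>x\<close> to the root of \<open>p\<close> in the upper
  half plane.
\<close>

definition upper_root :: "real poly \<Rightarrow> complex" where
  "upper_root p = (THE z. poly (map_poly complex_of_real p) z = 0 \<and> Im z > 0)"

text \<open>
  Hermitian forms on \<open>Q\<close>, where multiplication by \<open>\<zeta>\<close> on \<open>Q\<close> is given by \<open>J\<close> (and \<open>\<zeta>\<close> is
  not real); linear in the first argument.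
\<close>

definition hermitian_form ::
  "'v quad_space \<Rightarrow> complex \<Rightarrow> ('v \<Rightarrow> 'v) \<Rightarrow> ('v \<Rightarrow> 'v \<Rightarrow> complex) \<Rightarrow> bool" where
  "hermitian_form Q \<zeta> J h \<longleftrightarrow>
     (\<forall>x\<in>vecs Q. \<forall>y\<in>vecs Q. \<forall>z\<in>vecs Q. h (vplus Q x y) z = h x z + h y z) \<and>
     (\<forall>a. \<forall>x\<in>vecs Q. \<forall>y\<in>vecs Q. h (vscale Q a x) y = complex_of_real a * h x y) \<and>
     (\<forall>x\<in>vecs Q. \<forall>y\<in>vecs Q. h (J x) y = \<zeta> * h x y) \<and>
     (\<forall>x\<in>vecs Q. \<forall>y\<in>vecs Q. h y x = cnj (h x y))"

definition complex_trace :: "complex \<Rightarrow> real" where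
  "complex_trace z = Re (z + cnj z)"

text \<open>The quotient \<open>W/pW\<close> with the form that is to be the trace of \<open>h\<close>.\<close>

fun h_base ::
  "('a::real_vector \<Rightarrow> 'a \<Rightarrow> real) \<Rightarrow> ('a \<Rightarrow> 'a) \<Rightarrow> (real poly \<times> nat \<Rightarrow> 'a set) \<Rightarrow>
   real poly \<times> nat \<Rightarrow> 'a set quad_space" where
  "h_base B \<sigma> W (p, l) = quotient_quad (W (p, l)) (poly_act p \<sigma> ` W (p, l))
     (induced_form (\<lambda>u v. B (((inv_into UNIV \<sigma> \<circ> poly_act p \<sigma>) ^^ (l - 1)) u) v))"

text \<open>
  On \<open>W/pW\<close> multiplication by \<open>x\<close> sends a coset \<open>X\<close> to \<open>\<sigma> ` X\<close>. The conditions determine \<open>h\<close>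
  on pairs of cosets.
\<close>

definition h_form ::
  "('a::real_vector \<Rightarrow> 'a \<Rightarrow> real) \<Rightarrow> ('a \<Rightarrow> 'a) \<Rightarrow> (real poly \<times> nat \<Rightarrow> 'a set) \<Rightarrow>
   real poly \<times> nat \<Rightarrow> 'a set \<Rightarrow> 'a set \<Rightarrow> complex" where
  "h_form B \<sigma> W j = (SOME h.
     hermitian_form (h_base B \<sigma> W j) (upper_root (fst j)) ((`) \<sigma>) h \<and>
     (\<forall>X\<in>vecs (h_base B \<sigma> W j). \<forall>Y\<in>vecs (h_base B \<sigma> W j).
        complex_trace (h X Y) = vform (h_base B \<sigma> W j) X Y))"

definition trace_space ::
  "('a::real_vector \<Rightarrow> 'a \<Rightarrow> real) \<Rightarrow> ('a \<Rightarrow> 'a) \<Rightarrow> (real poly \<times> nat \<Rightarrow> 'a set) \<Rightarrow>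
   real poly \<times> nat \<Rightarrow> 'a set quad_space" where
  "trace_space B \<sigma> W j =
     (h_base B \<sigma> W j)\<lparr>vform := (\<lambda>X Y. complex_trace (h_form B \<sigma> W j X Y))\<rparr>"

definition q0 ::
  "('a::real_vector \<Rightarrow> 'a \<Rightarrow> real) \<Rightarrow> ('a \<Rightarrow> 'a) \<Rightarrow> (real poly \<times> nat \<Rightarrow> 'a set) \<Rightarrow>
   (real poly \<times> nat \<Rightarrow> 'a set) quad_space" where
  "q0 B \<sigma> W = orth_sum (I0_odd \<sigma> W)
     (\<lambda>(t, l). scale_form ((- 1) ^ ((l - 1) div 2)) (b_space B \<sigma> W (t, l)))"

definition q1 ::
  "('a::real_vector \<Rightarrow> 'a \<Rightarrow> real) \<Rightarrow> ('a \<Rightarrow> 'a) \<Rightarrow> (real poly \<times> nat \<Rightarrow> 'a set) \<Rightarrow>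
   (real poly \<times> nat \<Rightarrow> 'a set) quad_space" where
  "q1 B \<sigma> W = orth_sum (I1_odd \<sigma> W) (trace_space B \<sigma> W)"

definition q_total ::
  "('a::real_vector \<Rightarrow> 'a \<Rightarrow> real) \<Rightarrow> ('a \<Rightarrow> 'a) \<Rightarrow> (real poly \<times> nat \<Rightarrow> 'a set) \<Rightarrow>
   ((real poly \<times> nat \<Rightarrow> 'a set) \<times> (real poly \<times> nat \<Rightarrow> 'a set)) quad_space" where
  "q_total B \<sigma> W = orth_pair (q0 B \<sigma> W) (q1 B \<sigma> W)"

text \<open>The families are extensional, since otherwise no solution would be unique as a function.\<close>

definition star_solutions ::
  "('a::real_vector \<Rightarrow> 'a) \<Rightarrow> (real poly \<times> nat \<Rightarrow> 'a set) \<Rightarrow> nat \<Rightarrow> nat \<Rightarrow>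
   ((real poly \<times> nat \<Rightarrow> int) \<times> (real poly \<times> nat \<Rightarrow> int)) set" where
  "star_solutions \<sigma> W n r = {(w, z).
     w \<in> (\<Pi>\<^sub>E j\<in>I0_odd \<sigma> W. {0..int (eps \<sigma> W j)}) \<and>
     z \<in> (\<Pi>\<^sub>E j\<in>I1_odd \<sigma> W. {0..int (eps \<sigma> W j)}) \<and>
     real n / 2 - real (eps0 \<sigma> W) / 2 - real (eps1 \<sigma> W)
       + (\<Sum>j\<in>I0_odd \<sigma> W. real_of_int (w j)) + 2 * (\<Sum>j\<in>I1_odd \<sigma> W. real_of_int (z j))
       = real r}"

definition condition_i :: "('a::real_vector \<Rightarrow> 'a) \<Rightarrow> (real poly \<times> nat \<Rightarrow> 'a set) \<Rightarrow> bool" where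
  "condition_i \<sigma> W \<longleftrightarrow> card (I0_odd \<sigma> W) + card (I1_odd \<sigma> W) \<le> 1"

definition condition_ii ::
  "('a::real_vector \<Rightarrow> 'a \<Rightarrow> real) \<Rightarrow> ('a \<Rightarrow> 'a) \<Rightarrow> (real poly \<times> nat \<Rightarrow> 'a set) \<Rightarrow> bool" where
  "condition_ii B \<sigma> W \<longleftrightarrow> definite (q_total B \<sigma> W)"

definition condition_iii ::
  "('a::real_vector \<Rightarrow> 'a \<Rightarrow> real) \<Rightarrow> ('a \<Rightarrow> 'a) \<Rightarrow> (real poly \<times> nat \<Rightarrow> 'a set) \<Rightarrow> bool" where
  "condition_iii B \<sigma> W \<longleftrightarrow>
     card (I0_odd \<sigma> W) = 1 \<and> has_dim (q0 B \<sigma> W) 1 \<and>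
     (card (I1_odd \<sigma> W) = 1 \<or> definite (q1 B \<sigma> W))"

definition condition_iv ::
  "('a::real_vector \<Rightarrow> 'a \<Rightarrow> real) \<Rightarrow> ('a \<Rightarrow> 'a) \<Rightarrow> (real poly \<times> nat \<Rightarrow> 'a set) \<Rightarrow> bool" where
  "condition_iv B \<sigma> W \<longleftrightarrow>
     card (I0_odd \<sigma> W) = 1 \<and> hyperbolic_plane (q0 B \<sigma> W) \<and>
     (card (I1_odd \<sigma> W) = 1 \<or> definite (q1 B \<sigma> W))"

definition condition_v ::
  "('a::real_vector \<Rightarrow> 'a \<Rightarrow> real) \<Rightarrow> ('a \<Rightarrow> 'a) \<Rightarrow> (real poly \<times> nat \<Rightarrow> 'a set) \<Rightarrow> bool" where
  "condition_v B \<sigma> W \<longleftrightarrow>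
     card (I0_odd \<sigma> W) = 1 \<and>
     (\<exists>r0 s0. has_signature (q0 B \<sigma> W) r0 s0 \<and>
        (r0 \<ge> 2 \<and> s0 = 1 \<and> positive_definite (q1 B \<sigma> W) \<or>
         r0 = 1 \<and> s0 \<ge> 2 \<and> negative_definite (q1 B \<sigma> W)))"

end

theory Submission
  imports Defs "HOL-Computational_Algebra.Computational_Algebra" "HOL-Computational_Algebra.Field_as_Ring"
begin

text \<open>
  Let \<open>\<tau> = g \<circ> \<sigma> \<circ> inv g\<close> be an isometry.  The form \<open>B (g x) (g y)\<close> is \<open>\<sigma>\<close>-invariant, and up to the
  centraliser of \<open>\<sigma>\<close> it arises from \<open>B\<close> by changing the sign on a \<open>\<sigma>\<close>-stable non-degenerate
  subspace \<open>U\<close>.  As it has the same signature as \<open>B\<close>, the signature of \<open>U\<close> is zero.  So \<open>\<tau>\<close> is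
  conjugate to \<open>\<sigma>\<close> by an isometry as soon as \<open>U\<close> has an anti-isometry commuting with \<open>\<sigma>\<close>.
  For every irreducible reciprocal \<open>p\<close> and every \<open>l\<close> (odd, if \<open>p\<close> is linear) there is a local form
  on the kernel of \<open>p(\<sigma>)\<^sup>l\<close> in \<open>U\<close>, and such an anti-isometry exists iff all local signatures of \<open>U\<close>
  vanish.  Hence the conjugacy property says that every \<open>U\<close> of signature zero has vanishing local signatures.

  The signature of \<open>U\<close> is the sum of its local signatures with odd \<open>l\<close>, and the local
  signatures of the subspaces \<open>U\<close> take exactly the values allowed by the local indices of \<open>V\<close>.
  The local indices of \<open>V\<close> itself solve \<open>(\<ast>)\<close>, and the subspaces of signature zero
  yield the differences between this solution and the others.  A pair with \<open>p\<close> quadratic and \<open>l\<close> even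
  always admits such a subspace with non-zero local signature, as it does not contribute to the signature.
  Finally, the solution is unique iff it is impossible to move a unit between two
  unknowns \<open>w\<close>, between two unknowns \<open>z\<close>, or to exchange two units of \<open>w\<close> for one of \<open>z\<close>.
\<close>

section \<open>Finite-dimensional real vector spaces\<close>

text \<open>The indices \<open>pos\<close> and \<open>neg\<close> at (p, l) are taken on the full
  kernel of p(\<sigma>)^l in a stable subspace U, and not on a chosen free summand. The local form
  is then degenerate, but its radical counts for neither index, so the indices make sense for every
  U without a decomposition and are additive over orthogonal stable summands. Hence statements about
  a non-degenerate stable U can be proved by splitting off one small block, passing to its
  orthogonal complement and inducting on the dimension. Square roots are always taken inside
  polynomial rings, so that the resulting maps commute with \<sigma>. Modulo a power of x - 1 they
  straighten a map that reverses the form only to leading order; modulo an annihilator of A they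
  reduce the invariant form B (A x) y to a change of sign. Over the reals x is a square modulo an
  irreducible polynomial only up to sign, and this sign is the origin of the subspace U. In the
  converse direction Sylvester's law turns a subspace U of signature zero into an actual
  \<tau>.\<close>

locale fdim =
  fixes Bas :: "'a::real_vector set"
  assumes finite_Bas: "finite Bas" and independent_Bas: "independent Bas"
    and span_Bas: "span Bas = UNIV"

text \<open>The rewrites replace the constants of the generic vector space locale by those of
  \<open>real_vector\<close>, so that facts from both sources speak of the same \<open>span\<close>
  and \<open>dim\<close>.\<close>

sublocale fdim \<subseteq> fd: finite_dimensional_vector_space "scaleR :: real \<Rightarrow> 'a \<Rightarrow> 'a" Bas
  rewrites "module.dependent (*\<^sub>R) = (dependent :: 'a set \<Rightarrow> bool)"
    and "module.representation (*\<^sub>R) = (representation :: 'a set \<Rightarrow> _)"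
    and "module.subspace (*\<^sub>R) = (subspace :: 'a set \<Rightarrow> bool)"
    and "module.span (*\<^sub>R) = (span :: 'a set \<Rightarrow> _)"
    and "vector_space.dim (*\<^sub>R) = (dim :: 'a set \<Rightarrow> nat)"
    and "Vector_Spaces.linear (*\<^sub>R) (*\<^sub>R) = (linear :: ('a \<Rightarrow> 'a) \<Rightarrow> bool)"
proof -
  show "finite_dimensional_vector_space ((*\<^sub>R) :: real \<Rightarrow> 'a \<Rightarrow> 'a) Bas"
    by unfold_locales
      (use finite_Bas independent_Bas span_Bas in
        \<open>auto simp: dependent_raw_def[symmetric] span_raw_def[symmetric]\<close>)
qed (auto simp: dependent_raw_def representation_raw_def subspace_raw_def span_raw_def dim_raw_def
      linear_def[abs_def])

definition ssum :: "'a::real_vector set \<Rightarrow> 'a set \<Rightarrow> 'a set" where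
  "ssum S T = {x + y | x y. x \<in> S \<and> y \<in> T}"

lemma ssumI: "x \<in> S \<Longrightarrow> y \<in> T \<Longrightarrow> x + y \<in> ssum S T"
  by (auto simp: ssum_def)

lemma ssumE: assumes "z \<in> ssum S T" obtains x y where "x \<in> S" "y \<in> T" "z = x + y"
  using assms by (auto simp: ssum_def)

lemma subspace_ssum: "subspace S \<Longrightarrow> subspace T \<Longrightarrow> subspace (ssum S T)"
  unfolding ssum_def by (rule subspace_sums)

lemma ssum_subset: "subspace U \<Longrightarrow> S \<subseteq> U \<Longrightarrow> T \<subseteq> U \<Longrightarrow> ssum S T \<subseteq> U"
  by (auto simp: ssum_def subset_iff subspace_add)

lemma ssum_superset1: "subspace T \<Longrightarrow> S \<subseteq> ssum S T"
  using ssumI[of _ S 0 T] subspace_0[of T] by fastforce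

lemma ssum_superset2: "subspace S \<Longrightarrow> T \<subseteq> ssum S T"
  using ssumI[of 0 S _ T] subspace_0[of S] by fastforce

section \<open>Symmetric bilinear forms and their indices of inertia\<close>

definition symform :: "('a::real_vector \<Rightarrow> 'a \<Rightarrow> real) \<Rightarrow> bool" where
  "symform \<beta> \<longleftrightarrow> (\<forall>x. linear (\<beta> x)) \<and> (\<forall>x y. \<beta> x y = \<beta> y x)"

definition nondeg_on :: "('a::real_vector \<Rightarrow> 'a \<Rightarrow> real) \<Rightarrow> 'a set \<Rightarrow> bool" where
  "nondeg_on \<beta> U \<longleftrightarrow> (\<forall>x\<in>U. (\<forall>y\<in>U. \<beta> x y = 0) \<longrightarrow> x = 0)"

definition pos_def_on :: "('a::real_vector \<Rightarrow> 'a \<Rightarrow> real) \<Rightarrow> 'a set \<Rightarrow> bool" where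
  "pos_def_on \<beta> P \<longleftrightarrow> (\<forall>x\<in>P. x \<noteq> 0 \<longrightarrow> \<beta> x x > 0)"

definition orth :: "('a::real_vector \<Rightarrow> 'a \<Rightarrow> real) \<Rightarrow> 'a set \<Rightarrow> 'a set \<Rightarrow> bool" where
  "orth \<beta> S T \<longleftrightarrow> (\<forall>x\<in>S. \<forall>y\<in>T. \<beta> x y = 0)"

definition rad_on :: "('a::real_vector \<Rightarrow> 'a \<Rightarrow> real) \<Rightarrow> 'a set \<Rightarrow> 'a set" where
  "rad_on \<beta> U = {x\<in>U. \<forall>y\<in>U. \<beta> x y = 0}"

definition perp :: "('a::real_vector \<Rightarrow> 'a \<Rightarrow> real) \<Rightarrow> 'a set \<Rightarrow> 'a set \<Rightarrow> 'a set" where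
  "perp \<beta> U P = {x\<in>U. \<forall>y\<in>P. \<beta> y x = 0}"

text \<open>A maximal dimension involves neither a diagonalising basis nor non-degeneracy; this
  matters because the local forms are used on kernels, where they have a radical. The dimensions are
  bounded by that of the space (\<open>finite_dims\<close>), so the maximum is one over a finite
  set.\<close>

definition pidx :: "('a::real_vector \<Rightarrow> 'a \<Rightarrow> real) \<Rightarrow> 'a set \<Rightarrow> nat" where
  "pidx \<beta> U = Max (dim ` {P. subspace P \<and> P \<subseteq> U \<and> pos_def_on \<beta> P})"

definition nidx :: "('a::real_vector \<Rightarrow> 'a \<Rightarrow> real) \<Rightarrow> 'a set \<Rightarrow> nat" where
  "nidx \<beta> U = pidx (\<lambda>x y. - \<beta> x y) U"

lemma symform_minus: "symform \<beta> \<Longrightarrow> symform (\<lambda>x y. - \<beta> x y)"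
  by (auto simp: symform_def intro: linear_compose_neg)

lemma symform_rules:
  assumes "symform \<beta>"
  shows "\<beta> (x + y) z = \<beta> x z + \<beta> y z" "\<beta> z (x + y) = \<beta> z x + \<beta> z y"
    "\<beta> (c *\<^sub>R x) z = c * \<beta> x z" "\<beta> z (c *\<^sub>R x) = c * \<beta> z x"
    "\<beta> 0 z = 0" "\<beta> z 0 = 0" "\<beta> (- x) z = - \<beta> x z" "\<beta> z (- x) = - \<beta> z x"
    "\<beta> (x - y) z = \<beta> x z - \<beta> y z" "\<beta> z (x - y) = \<beta> z x - \<beta> z y"
proof -
  have l: "linear (\<beta> x)" for x using assms by (auto simp: symform_def)
  have s: "\<beta> x y = \<beta> y x" for x y using assms by (auto simp: symform_def)
  show r: "\<beta> z (x + y) = \<beta> z x + \<beta> z y" "\<beta> z (c *\<^sub>R x) = c * \<beta> z x"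
    "\<beta> z 0 = 0" "\<beta> z (- x) = - \<beta> z x" "\<beta> z (x - y) = \<beta> z x - \<beta> z y" for x y z c
    using l[of z] by (simp_all add: linear_add linear_scale linear_0 linear_neg linear_diff)
  show "\<beta> (x + y) z = \<beta> x z + \<beta> y z" "\<beta> (c *\<^sub>R x) z = c * \<beta> x z"
    "\<beta> 0 z = 0" "\<beta> (- x) z = - \<beta> x z" "\<beta> (x - y) z = \<beta> x z - \<beta> y z"
    using r[of z] s by metis+
qed

lemma symform_sym: "symform \<beta> \<Longrightarrow> \<beta> x y = \<beta> y x"
  by (auto simp: symform_def)

lemma symform_sum:
  assumes "symform \<beta>"
  shows "\<beta> z (sum f A) = (\<Sum>i\<in>A. \<beta> z (f i))" "\<beta> (sum f A) z = (\<Sum>i\<in>A. \<beta> (f i) z)"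
proof -
  show 1: "\<beta> z (sum f A) = (\<Sum>i\<in>A. \<beta> z (f i))" for z
    using assms by (auto simp: symform_def linear_sum)
  show "\<beta> (sum f A) z = (\<Sum>i\<in>A. \<beta> (f i) z)"
    using 1[of z] by (simp add: symform_sym[OF assms])
qed

lemma symform_linear_left: "symform \<beta> \<Longrightarrow> linear (\<lambda>x. \<beta> x y)"
  by (auto intro!: linearI simp: symform_rules)

lemma subspace_perp: "symform \<beta> \<Longrightarrow> subspace U \<Longrightarrow> subspace (perp \<beta> U P)"
  by (auto simp: perp_def subspace_def symform_rules)

lemma subspace_radical: "symform \<beta> \<Longrightarrow> subspace U \<Longrightarrow> subspace (rad_on \<beta> U)"
  by (auto simp: rad_on_def subspace_def symform_rules)

lemma orth_sym: "symform \<beta> \<Longrightarrow> orth \<beta> S T \<Longrightarrow> orth \<beta> T S"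
  unfolding orth_def using symform_sym by metis

lemma orth_perp: "orth \<beta> P (perp \<beta> U P)"
  by (auto simp: orth_def perp_def)

lemma nondeg_on_orth_disjoint:
  assumes "nondeg_on \<beta> U1" "orth \<beta> U1 U2" "symform \<beta>" shows "U1 \<inter> U2 \<subseteq> {0}"
proof
  fix x assume x: "x \<in> U1 \<inter> U2"
  then have "\<forall>y\<in>U1. \<beta> x y = 0" using assms(2) symform_sym[OF assms(3)] by (auto simp: orth_def)
  then show "x \<in> {0}" using assms(1) x by (auto simp: nondeg_on_def)
qed

lemma nondeg_on_ssum:
  assumes \<beta>: "symform \<beta>" and sub: "subspace U1" "subspace U2" and o: "orth \<beta> U1 U2"
  shows "nondeg_on \<beta> (ssum U1 U2) \<longleftrightarrow> nondeg_on \<beta> U1 \<and> nondeg_on \<beta> U2"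
proof
  note r = symform_rules[OF \<beta>]
  have o': "orth \<beta> U2 U1" using o orth_sym[OF \<beta>] by blast
  show "nondeg_on \<beta> U1 \<and> nondeg_on \<beta> U2" if n: "nondeg_on \<beta> (ssum U1 U2)"
  proof -
    have "x = 0" if "x \<in> U1" "\<forall>y\<in>U1. \<beta> x y = 0" for x
    proof -
      have "\<beta> x z = 0" if "z \<in> ssum U1 U2" for z
        using that \<open>x \<in> U1\<close> \<open>\<forall>y\<in>U1. _\<close> o by (auto simp: ssum_def r orth_def)
      then show ?thesis using n \<open>x \<in> U1\<close> ssum_superset1[OF sub(2), of U1] by (auto simp: nondeg_on_def)
    qed
    moreover have "x = 0" if "x \<in> U2" "\<forall>y\<in>U2. \<beta> x y = 0" for x
    proof -
      have "\<beta> x z = 0" if "z \<in> ssum U1 U2" for z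
        using that \<open>x \<in> U2\<close> \<open>\<forall>y\<in>U2. _\<close> o' by (auto simp: ssum_def r orth_def)
      then show ?thesis using n \<open>x \<in> U2\<close> ssum_superset2[OF sub(1), of U2] by (auto simp: nondeg_on_def)
    qed
    ultimately show ?thesis by (auto simp: nondeg_on_def)
  qed
  show "nondeg_on \<beta> (ssum U1 U2)" if n: "nondeg_on \<beta> U1 \<and> nondeg_on \<beta> U2"
    unfolding nondeg_on_def
  proof (intro ballI impI)
    fix x assume x: "x \<in> ssum U1 U2" and 0: "\<forall>y\<in>ssum U1 U2. \<beta> x y = 0"
    then obtain a b where ab: "a \<in> U1" "b \<in> U2" "x = a + b" by (auto elim: ssumE)
    have "\<beta> a y = 0" if "y \<in> U1" for y
    proof -
      have "\<beta> x y = 0" using 0 that ssum_superset1[OF sub(2), of U1] by auto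
      then show ?thesis using ab o' that by (auto simp: r orth_def)
    qed
    then have "a = 0" using n ab by (auto simp: nondeg_on_def)
    have "\<beta> b y = 0" if "y \<in> U2" for y
    proof -
      have "\<beta> x y = 0" using 0 that ssum_superset2[OF sub(1), of U2] by auto
      then show ?thesis using ab o that by (auto simp: r orth_def)
    qed
    then have "b = 0" using n ab by (auto simp: nondeg_on_def)
    then show "x = 0" using \<open>a = 0\<close> ab by simp
  qed
qed

lemma pos_def_on_nondeg: "pos_def_on \<beta> P \<Longrightarrow> nondeg_on \<beta> P"
  by (force simp: pos_def_on_def nondeg_on_def)

lemma nondeg_on_minus: "nondeg_on (\<lambda>x y. - \<beta> x y) U \<longleftrightarrow> nondeg_on \<beta> U"
  by (auto simp: nondeg_on_def)

context fdim begin

lemma dim_image_inj: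
  fixes f :: "'a \<Rightarrow> 'a"
  assumes "linear f" "subspace S" "\<And>x. x \<in> S \<Longrightarrow> f x = 0 \<Longrightarrow> x = 0"
  shows "dim (f ` S) = dim S"
proof -
  interpret fd1: finite_dimensional_vector_space_pair_1 "scaleR :: real \<Rightarrow> 'a \<Rightarrow> 'a" Bas
    "scaleR :: real \<Rightarrow> 'a \<Rightarrow> 'a" by unfold_locales
  have "inj_on f S"
    using assms by (auto simp: inj_on_def subspace_diff linear_diff)
      (metis eq_iff_diff_eq_0 linear_diff subspace_diff)
  then show ?thesis
    using fd1.dim_image_eq[of f S] assms
    by (simp add: dim_raw_def linear_def span_raw_def[symmetric] span_eq_iff[THEN iffD2])
qed

lemma image_eq_self:
  fixes f :: "'a \<Rightarrow> 'a"
  assumes "linear f" "subspace S" "f ` S \<subseteq> S" "\<And>x. x \<in> S \<Longrightarrow> f x = 0 \<Longrightarrow> x = 0"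
  shows "f ` S = S"
  using fd.subspace_dim_equal[of "f ` S" S] dim_image_inj[of f S] assms
  by (simp add: linear_subspace_image)

lemma dim_ssum_le:
  fixes S T :: "'a set"
  assumes "subspace S" "subspace T" shows "dim (ssum S T) \<le> dim S + dim T"
proof -
  obtain b where b: "b \<subseteq> S" "independent b" "S \<subseteq> span b" "card b = dim S" using basis_exists by blast
  obtain c where c: "c \<subseteq> T" "independent c" "T \<subseteq> span c" "card c = dim T" using basis_exists by blast
  have fin: "finite b" "finite c" using b c fd.finiteI_independent by auto
  have "S \<subseteq> span (b \<union> c)" "T \<subseteq> span (b \<union> c)" using b(3) c(3) span_mono[of b "b \<union> c"] span_mono[of c "b \<union> c"] by auto
  then have "ssum S T \<subseteq> span (b \<union> c)" by (intro ssum_subset subspace_span)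
  then have "dim (ssum S T) \<le> card (b \<union> c)" using fin by (intro fd.dim_le_card) auto
  also have "\<dots> \<le> dim S + dim T" using b(4) c(4) card_Un_le[of b c] by simp
  finally show ?thesis .
qed

lemma dim_ssum:
  fixes S T :: "'a set"
  assumes S: "subspace S" and T: "subspace T" and 0: "S \<inter> T \<subseteq> {0}"
  shows "dim (ssum S T) = dim S + dim T"
proof -
  obtain b where b: "b \<subseteq> S" "independent b" "S \<subseteq> span b" "card b = dim S" using basis_exists by blast
  obtain c where c: "c \<subseteq> T" "independent c" "T \<subseteq> span c" "card c = dim T" using basis_exists by blast
  have fin: "finite b" "finite c" using b c fd.finiteI_independent by auto
  have sb: "span b = S" "span c = T" using b c S T by (simp_all add: span_subspace)
  have "b \<inter> c \<subseteq> {0}" using b c 0 by blast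
  then have dis: "b \<inter> c = {}" using b(2) dependent_zero[of b] by auto
  have "independent (b \<union> c)"
  proof (rule independent_if_scalars_zero)
    show "finite (b \<union> c)" using fin by simp
    fix f v assume s: "(\<Sum>x\<in>b \<union> c. f x *\<^sub>R x) = 0" and v: "v \<in> b \<union> c"
    have s2: "(\<Sum>x\<in>b. f x *\<^sub>R x) + (\<Sum>x\<in>c. f x *\<^sub>R x) = 0"
      using s sum.union_disjoint[OF fin dis] by metis
    have m: "(\<Sum>x\<in>b. f x *\<^sub>R x) \<in> S" "(\<Sum>x\<in>c. f x *\<^sub>R x) \<in> T"
      using sb by (metis (no_types, lifting) span_base span_scale span_sum)+
    have "(\<Sum>x\<in>b. f x *\<^sub>R x) = - (\<Sum>x\<in>c. f x *\<^sub>R x)" using s2 by (simp add: add_eq_0_iff2)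
    then have "(\<Sum>x\<in>b. f x *\<^sub>R x) \<in> S \<inter> T" using m T subspace_neg by auto
    then have z: "(\<Sum>x\<in>b. f x *\<^sub>R x) = 0" using 0 by blast
    then have z2: "(\<Sum>x\<in>c. f x *\<^sub>R x) = 0" using s2 by simp
    show "f v = 0"
      using v independentD[OF b(2) fin(1) order_refl z, of v] independentD[OF c(2) fin(2) order_refl z2, of v] by blast
  qed
  then have "card (b \<union> c) \<le> dim (ssum S T)"
    using b(1) c(1) ssum_superset1[OF T, of S] ssum_superset2[OF S, of T]
    by (intro fd.independent_card_le_dim) auto
  then show ?thesis using dis b(4) c(4) fin dim_ssum_le[OF S T] by (simp add: card_Un_disjoint)
qed

lemma dim_disjoint_le:
  fixes S T U :: "'a set"
  assumes "subspace S" "subspace T" "S \<inter> T \<subseteq> {0}" "S \<subseteq> U" "T \<subseteq> U" "subspace U"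
  shows "dim S + dim T \<le> dim U"
  using dim_ssum[of S T] fd.dim_subset[of "ssum S T" U] ssum_subset[of U S T] assms by simp

text \<open>Testing against a basis \<open>b\<close> of \<open>U\<close> is encoded by the
  endomorphism \<open>T\<close>, which uses the values \<beta> u v as coefficients of the basis
  vectors themselves. Non-degeneracy makes \<open>T\<close> injective on \<open>U\<close>, hence
  onto by dimension, so every functional on \<open>U\<close> is represented. Uniqueness of the
  representing vectors makes them depend linearly on x.\<close>

lemma riesz:
  fixes \<beta> \<Phi> :: "'a \<Rightarrow> 'a \<Rightarrow> real"
  assumes U: "subspace U" and \<beta>: "symform \<beta>" and n: "nondeg_on \<beta> U"
    and \<Phi>: "\<And>x. linear (\<Phi> x)" "\<And>y. linear (\<lambda>x. \<Phi> x y)"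
  shows "\<exists>A. linear A \<and> (\<forall>x. A x \<in> U \<and> (\<forall>y\<in>U. \<beta> (A x) y = \<Phi> x y))"
proof -
  note r = symform_rules[OF \<beta>]
  obtain b where b: "b \<subseteq> U" "independent b" "U \<subseteq> span b" "card b = dim U" using basis_exists by blast
  have fin: "finite b" using b fd.finiteI_independent by auto
  define T where "T = (\<lambda>u. \<Sum>v\<in>b. \<beta> u v *\<^sub>R v)"
  have lT: "linear T"
    unfolding T_def by (intro linear_compose_sum ballI linearI) (auto simp: r scaleR_left_distrib)
  have eqb: "x = 0" if "x \<in> U" "\<forall>v\<in>b. \<beta> x v = 0" for x
  proof -
    have "linear (\<beta> x)" using \<beta> by (auto simp: symform_def)
    then have "\<beta> x y = 0" if "y \<in> span b" for y
      using linear_eq_on_span[of "\<beta> x" "\<lambda>_. 0" b y] that \<open>\<forall>v\<in>b. _\<close> linear_zero by auto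
    then show ?thesis using n b(3) \<open>x \<in> U\<close> by (auto simp: nondeg_on_def)
  qed
  have coef: "\<forall>v\<in>b. f v = g v" if "(\<Sum>v\<in>b. f v *\<^sub>R v) = (\<Sum>v\<in>b. g v *\<^sub>R v)" for f g :: "'a \<Rightarrow> real"
  proof -
    have "(\<Sum>v\<in>b. (f v - g v) *\<^sub>R v) = 0" using that by (simp add: scaleR_left_diff_distrib sum_subtractf)
    then show ?thesis using independentD[OF b(2) fin order_refl, of "\<lambda>v. f v - g v"] by auto
  qed
  have TU: "T ` U = U"
  proof (rule image_eq_self[OF lT U])
    show "T ` U \<subseteq> U" using b(1) U by (auto simp: T_def subset_iff intro!: subspace_sum subspace_scale)
    show "x = 0" if "x \<in> U" "T x = 0" for x
      using eqb[OF that(1)] coef[of "\<beta> x" "\<lambda>_. 0"] that(2) by (auto simp: T_def)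
  qed
  have ex: "\<exists>u. u \<in> U \<and> (\<forall>y\<in>U. \<beta> u y = \<Phi> x y)" for x
  proof -
    have "(\<Sum>v\<in>b. \<Phi> x v *\<^sub>R v) \<in> T ` U"
      unfolding TU using b(1) U by (auto simp: subset_iff intro!: subspace_sum subspace_scale)
    then obtain u where u: "u \<in> U" "T u = (\<Sum>v\<in>b. \<Phi> x v *\<^sub>R v)" by auto
    have "\<forall>v\<in>b. \<beta> u v = \<Phi> x v" using coef u(2) by (auto simp: T_def)
    then have "\<beta> u y = \<Phi> x y" if "y \<in> span b" for y
      using linear_eq_on_span[of "\<beta> u" "\<Phi> x" b y] that \<Phi>(1)[of x] \<beta> by (auto simp: symform_def)
    then show ?thesis using u(1) b(3) by auto
  qed
  then obtain A where A: "\<And>x. A x \<in> U" "\<And>x y. y \<in> U \<Longrightarrow> \<beta> (A x) y = \<Phi> x y" by metis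
  have uniq: "u = v" if "u \<in> U" "v \<in> U" "\<forall>y\<in>U. \<beta> u y = \<beta> v y" for u v
    using n that U subspace_diff[of U u v] by (auto simp: nondeg_on_def r)
  have "linear A"
  proof (rule linearI)
    show "A (x + y) = A x + A y" for x y
      using A U \<Phi>(2) by (intro uniq) (auto simp: r subspace_add linear_add[OF \<Phi>(2)])
    show "A (c *\<^sub>R x) = c *\<^sub>R A x" for c x
      using A U \<Phi>(2) by (intro uniq) (auto simp: r subspace_scale linear_scale[OF \<Phi>(2)])
  qed
  then show ?thesis using A by blast
qed

text \<open>This is \<open>riesz\<close> for \<beta> itself. As \<pi> is linear on the whole space,
  it later extends maps that are only given on \<open>U\<close> to linear maps of the whole
  type.\<close>

lemma orth_projection:
  fixes U :: "'a set"
  assumes "subspace U" "symform \<beta>" "nondeg_on \<beta> U"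
  obtains \<pi> :: "'a \<Rightarrow> 'a" where "linear \<pi>" "\<And>x. \<pi> x \<in> U" "\<And>x y. y \<in> U \<Longrightarrow> \<beta> (\<pi> x) y = \<beta> x y"
    "\<And>x. x \<in> U \<Longrightarrow> \<pi> x = x" "\<And>x. (\<forall>y\<in>U. \<beta> x y = 0) \<Longrightarrow> \<pi> x = 0"
proof -
  obtain \<pi> where p: "linear \<pi>" "\<And>x. \<pi> x \<in> U" "\<And>x y. y \<in> U \<Longrightarrow> \<beta> (\<pi> x) y = \<beta> x y"
    using riesz[of U \<beta> \<beta>] assms symform_linear_left[OF assms(2)] by (auto simp: symform_def)
  have "\<pi> x = x" if "x \<in> U" for x
  proof -
    have "\<pi> x - x \<in> U" "\<forall>y\<in>U. \<beta> (\<pi> x - x) y = 0"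
      using p that assms by (auto simp: subspace_diff symform_rules[OF assms(2)])
    then have "\<pi> x - x = 0" using assms by (auto simp: nondeg_on_def)
    then show ?thesis by simp
  qed
  moreover have "\<pi> x = 0" if "\<forall>y\<in>U. \<beta> x y = 0" for x
    using p that assms by (auto simp: nondeg_on_def)
  ultimately show ?thesis using p that by blast
qed

lemma ssum_perp:
  fixes U :: "'a set"
  assumes P: "subspace P" "P \<subseteq> U" and U: "subspace U" and "symform \<beta>" "nondeg_on \<beta> P"
  shows "U = ssum P (perp \<beta> U P)"
proof
  obtain \<pi> where p: "linear \<pi>" "\<And>x. \<pi> x \<in> P" "\<And>x y. y \<in> P \<Longrightarrow> \<beta> (\<pi> x) y = \<beta> x y"
    using orth_projection[of P \<beta>] assms by metis
  have "x \<in> ssum P (perp \<beta> U P)" if "x \<in> U" for x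
  proof -
    have "\<beta> y (x - \<pi> x) = 0" if "y \<in> P" for y
      using p(3)[of y x] that symform_sym[OF assms(4)] by (simp add: symform_rules[OF assms(4)])
    then have "x - \<pi> x \<in> perp \<beta> U P"
      using that p(2) P U by (auto simp: perp_def subset_iff subspace_diff)
    then show ?thesis using ssumI[OF p(2)[of x], of "x - \<pi> x"] by auto
  qed
  then show "U \<subseteq> ssum P (perp \<beta> U P)" by blast
  show "ssum P (perp \<beta> U P) \<subseteq> U" using P U by (intro ssum_subset) (auto simp: perp_def)
qed

lemma finite_dims: "finite (dim ` {P. subspace P \<and> P \<subseteq> (U :: 'a set) \<and> pos_def_on \<beta> P})"
  by (rule finite_subset[of _ "{..dim U}"]) (auto intro: fd.dim_subset)

lemma pidx_ge:
  fixes U :: "'a set"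
  assumes "subspace P" "P \<subseteq> U" "pos_def_on \<beta> P" shows "dim P \<le> pidx \<beta> U"
  unfolding pidx_def using assms by (intro Max_ge finite_dims) auto

lemma pidx_attained:
  fixes U :: "'a set"
  assumes "subspace U"
  obtains P where "subspace P" "P \<subseteq> U" "pos_def_on \<beta> P" "dim P = pidx \<beta> U"
proof -
  have "{0} \<in> {P. subspace P \<and> P \<subseteq> U \<and> pos_def_on \<beta> P}"
    using assms by (auto simp: pos_def_on_def subspace_0 subspace_single_0)
  then have "dim ` {P. subspace P \<and> P \<subseteq> U \<and> pos_def_on \<beta> P} \<noteq> {}" by blast
  from Max_in[OF finite_dims this] show ?thesis using that unfolding pidx_def by auto
qed

text \<open>A positive definite \<open>P\<close> of maximal dimension is non-degenerate and
  therefore splits off. A vector of positive square in its complement would give a larger positive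
  definite subspace.\<close>

lemma pidx_split:
  fixes U :: "'a set"
  assumes U: "subspace U" and \<beta>: "symform \<beta>"
  obtains P where "subspace P" "P \<subseteq> U" "pos_def_on \<beta> P" "dim P = pidx \<beta> U"
    "U = ssum P (perp \<beta> U P)" "\<And>z. z \<in> perp \<beta> U P \<Longrightarrow> \<beta> z z \<le> 0"
proof -
  note r = symform_rules[OF \<beta>]
  obtain P where P: "subspace P" "P \<subseteq> U" "pos_def_on \<beta> P" "dim P = pidx \<beta> U"
    using pidx_attained[OF U] by blast
  have "\<beta> z z \<le> 0" if z: "z \<in> perp \<beta> U P" for z
  proof (rule ccontr)
    assume "\<not> \<beta> z z \<le> 0"
    then have zz: "\<beta> z z > 0" by simp
    have zP: "\<beta> y z = 0" "\<beta> z y = 0" if "y \<in> P" for y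
      using z that symform_sym[OF \<beta>] by (auto simp: perp_def)
    let ?Q = "ssum P (span {z})"
    have "P \<inter> span {z} \<subseteq> {0}"
    proof
      fix y assume y: "y \<in> P \<inter> span {z}"
      then obtain c where "y = c *\<^sub>R z" by (auto simp: span_singleton)
      then have "c * \<beta> z z = 0" using zP[of y] y by (auto simp: r)
      then show "y \<in> {0}" using zz \<open>y = _\<close> by simp
    qed
    then have "dim ?Q = dim P + dim (span {z})" by (intro dim_ssum P subspace_span)
    also have "dim (span {z}) = 1" using zz by (auto simp: r(5))
    finally have "dim ?Q = pidx \<beta> U + 1" using P by simp
    moreover have "dim ?Q \<le> pidx \<beta> U"
    proof (intro pidx_ge)
      show "subspace ?Q" by (intro subspace_ssum P subspace_span)
      show "?Q \<subseteq> U" using z U by (intro ssum_subset P span_minimal) (auto simp: perp_def)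
      show "pos_def_on \<beta> ?Q" unfolding pos_def_on_def
      proof (intro ballI impI)
        fix x assume "x \<in> ?Q" "x \<noteq> 0"
        then obtain p c where x: "p \<in> P" "x = p + c *\<^sub>R z" by (auto simp: ssum_def span_singleton)
        have e: "\<beta> x x = \<beta> p p + c * c * \<beta> z z" using x zP[OF x(1)] by (simp add: r algebra_simps)
        have pp: "p = 0 \<or> \<beta> p p > 0" using P(3) x(1) by (auto simp: pos_def_on_def)
        have cz: "c = 0 \<or> c * c * \<beta> z z > 0" using zz by (auto simp: zero_less_mult_iff linorder_neq_iff)
        show "\<beta> x x > 0" unfolding e using pp cz x \<open>x \<noteq> 0\<close> by (auto simp: r)
      qed
    qed
    ultimately show False by simp
  qed
  then show ?thesis using that P ssum_perp[OF P(1,2) U \<beta>] pos_def_on_nondeg[OF P(3)] by blast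
qed

text \<open>The inequality behind Sylvester's law: a positive definite subspace meets a subspace
  without positive values only in 0. The upper bounds on indices below come from it.\<close>

lemma pidx_add_nonpos_le:
  fixes U :: "'a set"
  assumes "subspace Z" "Z \<subseteq> U" "subspace U" "\<And>z. z \<in> Z \<Longrightarrow> \<beta> z z \<le> 0"
  shows "pidx \<beta> U + dim Z \<le> dim U"
proof -
  obtain P where P: "subspace P" "P \<subseteq> U" "pos_def_on \<beta> P" "dim P = pidx \<beta> U"
    using pidx_attained[OF assms(3)] by blast
  have "P \<inter> Z \<subseteq> {0}" using P(3) assms(4) by (force simp: pos_def_on_def)
  then show ?thesis using dim_disjoint_le[of P Z U] P assms by simp
qed

lemma pidx_eqI:
  fixes U :: "'a set"
  assumes "subspace P" "subspace Z" "pos_def_on \<beta> P" "\<And>z. z \<in> Z \<Longrightarrow> \<beta> z z \<le> 0"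
    "U = ssum P Z"
  shows "pidx \<beta> U = dim P"
proof -
  have "P \<subseteq> U" "Z \<subseteq> U" "subspace U"
    using assms ssum_superset1[OF assms(2), of P] ssum_superset2[OF assms(1), of Z] subspace_ssum by auto
  then have "dim P \<le> pidx \<beta> U" "pidx \<beta> U + dim Z \<le> dim U" "dim U \<le> dim P + dim Z"
    using pidx_ge pidx_add_nonpos_le dim_ssum_le assms by auto
  then show ?thesis by simp
qed

text \<open>The positive parts of the two summands and their non-positive complements combine
  separately, and \<open>pidx_eqI\<close> applies to the regrouped sum.\<close>

lemma pidx_ssum:
  fixes U1 U2 :: "'a set"
  assumes sub: "subspace U1" "subspace U2" and \<beta>: "symform \<beta>" and o: "orth \<beta> U1 U2"
  shows "pidx \<beta> (ssum U1 U2) = pidx \<beta> U1 + pidx \<beta> U2"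
proof -
  note r = symform_rules[OF \<beta>]
  obtain P1 where P1: "subspace P1" "P1 \<subseteq> U1" "pos_def_on \<beta> P1" "dim P1 = pidx \<beta> U1"
    "U1 = ssum P1 (perp \<beta> U1 P1)" "\<And>z. z \<in> perp \<beta> U1 P1 \<Longrightarrow> \<beta> z z \<le> 0"
    using pidx_split[OF sub(1) \<beta>] by blast
  obtain P2 where P2: "subspace P2" "P2 \<subseteq> U2" "pos_def_on \<beta> P2" "dim P2 = pidx \<beta> U2"
    "U2 = ssum P2 (perp \<beta> U2 P2)" "\<And>z. z \<in> perp \<beta> U2 P2 \<Longrightarrow> \<beta> z z \<le> 0"
    using pidx_split[OF sub(2) \<beta>] by blast
  define Z1 where "Z1 = perp \<beta> U1 P1"
  define Z2 where "Z2 = perp \<beta> U2 P2"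
  have Z: "subspace Z1" "subspace Z2" "Z1 \<subseteq> U1" "Z2 \<subseteq> U2"
    using subspace_perp[OF \<beta>] sub by (auto simp: Z1_def Z2_def perp_def)
  have o12: "\<beta> x y = 0" "\<beta> y x = 0" if "x \<in> U1" "y \<in> U2" for x y
    using o that symform_sym[OF \<beta>] by (auto simp: orth_def)
  have pd: "pos_def_on \<beta> (ssum P1 P2)" unfolding pos_def_on_def
  proof (intro ballI impI)
    fix x assume "x \<in> ssum P1 P2" "x \<noteq> 0"
    then obtain a b where x: "a \<in> P1" "b \<in> P2" "x = a + b" by (auto elim: ssumE)
    have e: "\<beta> x x = \<beta> a a + \<beta> b b" using o12[of a b] subsetD[OF P1(2) x(1)] subsetD[OF P2(2) x(2)] x(3) by (simp add: r)
    have "a = 0 \<or> \<beta> a a > 0" "b = 0 \<or> \<beta> b b > 0" using x P1(3) P2(3) by (auto simp: pos_def_on_def)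
    then show "\<beta> x x > 0" unfolding e using x \<open>x \<noteq> 0\<close> by (auto simp: r)
  qed
  have zn: "\<beta> z z \<le> 0" if z: "z \<in> ssum Z1 Z2" for z
  proof -
    obtain a b where x: "a \<in> Z1" "b \<in> Z2" "z = a + b" using z by (rule ssumE)
    have e: "\<beta> z z = \<beta> a a + \<beta> b b" using o12[of a b] subsetD[OF Z(3) x(1)] subsetD[OF Z(4) x(2)] x(3) by (simp add: r)
    have "\<beta> a a \<le> 0" "\<beta> b b \<le> 0" using x P1(6) P2(6) unfolding Z1_def Z2_def by auto
    then show ?thesis using e by simp
  qed
  have s: "ssum U1 U2 = ssum (ssum P1 P2) (ssum Z1 Z2)"
  proof -
    have "ssum U1 U2 = ssum (ssum P1 Z1) (ssum P2 Z2)" using P1(5) P2(5) unfolding Z1_def Z2_def by simp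
    also have "\<dots> = ssum (ssum P1 P2) (ssum Z1 Z2)"
      unfolding ssum_def by (auto, (metis (no_types, opaque_lifting) add.assoc add.commute)+)
    finally show ?thesis .
  qed
  have "P1 \<inter> P2 \<subseteq> {0}" using P1(2,3) P2(2) o12 by (force simp: pos_def_on_def)
  then have "dim (ssum P1 P2) = dim P1 + dim P2" by (intro dim_ssum P1 P2)
  moreover have "pidx \<beta> (ssum U1 U2) = dim (ssum P1 P2)"
    using pd zn by (intro pidx_eqI[OF _ _ _ _ s]) (auto intro: subspace_ssum P1 P2 Z)
  ultimately show ?thesis using P1(4) P2(4) by simp
qed

lemma pidx_cong:
  fixes U :: "'a set"
  assumes "\<And>x. x \<in> U \<Longrightarrow> \<beta> x x = \<gamma> x x" shows "pidx \<beta> U = pidx \<gamma> U"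
proof -
  have "{P. subspace P \<and> P \<subseteq> U \<and> pos_def_on \<beta> P} = {P. subspace P \<and> P \<subseteq> U \<and> pos_def_on \<gamma> P}"
    using assms by (auto simp: pos_def_on_def subset_iff)
  then show ?thesis by (simp add: pidx_def)
qed

lemma pidx_image_le:
  fixes g :: "'a \<Rightarrow> 'a"
  assumes g: "linear g" and U: "subspace U" and e: "\<And>x. x \<in> U \<Longrightarrow> \<gamma> x x = \<beta> (g x) (g x)" and "\<beta> 0 0 = 0"
  shows "pidx \<gamma> U \<le> pidx \<beta> (g ` U)"
proof -
  obtain P where P: "subspace P" "P \<subseteq> U" "pos_def_on \<gamma> P" "dim P = pidx \<gamma> U"
    using pidx_attained[OF U] by blast
  have "x = 0" if "x \<in> P" "g x = 0" for x
    using P(2,3) e[of x] that assms(4) by (force simp: pos_def_on_def)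
  then have "dim (g ` P) = dim P" using dim_image_inj[OF g P(1)] by blast
  moreover have "dim (g ` P) \<le> pidx \<beta> (g ` U)"
    using P e linear_subspace_image[OF g P(1)]
    by (intro pidx_ge) (auto simp: pos_def_on_def linear_0[OF g] subset_iff)
  ultimately show ?thesis using P by simp
qed

text \<open>\<open>pidx_image_le\<close> gives one inequality; for the other, a positive definite
  subspace of the image is pulled back to \<open>U\<close>.\<close>

lemma pidx_image:
  fixes g :: "'a \<Rightarrow> 'a"
  assumes g: "linear g" and U: "subspace U" and e: "\<And>x. x \<in> U \<Longrightarrow> \<gamma> x x = \<beta> (g x) (g x)"
    and \<beta>: "symform \<beta>" and i: "\<And>x. x \<in> U \<Longrightarrow> g x = 0 \<Longrightarrow> x = 0"
  shows "pidx \<gamma> U = pidx \<beta> (g ` U)"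
proof (rule antisym)
  show "pidx \<gamma> U \<le> pidx \<beta> (g ` U)"
    by (rule pidx_image_le[OF g U]) (simp_all add: e symform_rules[OF \<beta>])
  obtain P where P: "subspace P" "P \<subseteq> g ` U" "pos_def_on \<beta> P" "dim P = pidx \<beta> (g ` U)"
    using pidx_attained[OF linear_subspace_image[OF g U]] by blast
  define P' where "P' = U \<inter> g -` P"
  have s: "subspace P'" unfolding P'_def
    by (intro subspace_inter U linear_subspace_vimage g P)
  have im: "g ` P' = P" using P(2) by (auto simp: P'_def)
  have "dim (g ` P') = dim P'" using dim_image_inj[OF g s] i by (auto simp: P'_def)
  moreover have "dim P' \<le> pidx \<gamma> U"
  proof (intro pidx_ge s)
    show "P' \<subseteq> U" by (auto simp: P'_def)
    show "pos_def_on \<gamma> P'" unfolding pos_def_on_def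
    proof (intro ballI impI)
      fix x assume "x \<in> P'" "x \<noteq> 0"
      then have "g x \<noteq> 0" "g x \<in> P" "x \<in> U" using i by (auto simp: P'_def)
      then show "\<gamma> x x > 0" using P(3) e by (auto simp: pos_def_on_def)
    qed
  qed
  ultimately show "pidx \<beta> (g ` U) \<le> pidx \<gamma> U" using im P by simp
qed

lemma nidx_ssum:
  fixes U1 U2 :: "'a set"
  assumes "subspace U1" "subspace U2" "symform \<beta>" "orth \<beta> U1 U2"
  shows "nidx \<beta> (ssum U1 U2) = nidx \<beta> U1 + nidx \<beta> U2"
  unfolding nidx_def using assms by (intro pidx_ssum symform_minus) (auto simp: orth_def)

lemma pidx_nonpos:
  fixes U :: "'a set"
  assumes "subspace U" "\<And>x. x \<in> U \<Longrightarrow> \<beta> x x \<le> 0" shows "pidx \<beta> U = 0"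
  using pidx_add_nonpos_le[of U U \<beta>] assms by simp

lemma pidx_pos_witness:
  fixes U :: "'a set"
  assumes "subspace U" "pidx \<beta> U > 0" obtains x where "x \<in> U" "\<beta> x x > 0"
proof -
  have "\<not> (\<forall>x\<in>U. \<beta> x x \<le> 0)" using pidx_nonpos[OF assms(1), of \<beta>] assms(2) by fastforce
  then show ?thesis using that by (auto simp: not_le)
qed

lemma pidx_pos:
  fixes U :: "'a set"
  assumes "subspace U" "symform \<beta>" "x \<in> U" "\<beta> x x > 0" shows "pidx \<beta> U > 0"
proof -
  have x0: "x \<noteq> 0" using assms symform_rules(5)[OF assms(2)] by (metis less_irrefl)
  have "dim (span {x}) \<le> pidx \<beta> U"
    using assms x0
    by (intro pidx_ge subspace_span span_minimal)
      (auto simp: pos_def_on_def span_singleton symform_rules[OF assms(2)] zero_less_mult_iff mult_less_0_iff linorder_neq_iff)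
  then show ?thesis using x0 by simp
qed

text \<open>Split off a maximal positive definite \<open>P\<close>, and from its complement a
  maximal negative definite \<open>N\<close>. On what remains the form is both non-positive and
  non-negative, so it vanishes there by polarisation, and the remainder is the radical.\<close>

lemma pidx_nidx_radical:
  fixes U :: "'a set"
  assumes U: "subspace U" and \<beta>: "symform \<beta>"
  shows "pidx \<beta> U + nidx \<beta> U + dim (rad_on \<beta> U) = dim U"
proof -
  note r = symform_rules[OF \<beta>]
  define \<gamma> where "\<gamma> = (\<lambda>x y. - \<beta> x y)"
  have \<gamma>: "symform \<gamma>" using symform_minus[OF \<beta>] by (simp add: \<gamma>_def)
  obtain P where P: "subspace P" "P \<subseteq> U" "pos_def_on \<beta> P" "dim P = pidx \<beta> U"
    "U = ssum P (perp \<beta> U P)" "\<And>z. z \<in> perp \<beta> U P \<Longrightarrow> \<beta> z z \<le> 0"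
    using pidx_split[OF U \<beta>] by blast
  define Z where "Z = perp \<beta> U P"
  have Z: "subspace Z" using subspace_perp[OF \<beta> U] by (simp add: Z_def)
  obtain N where N: "subspace N" "N \<subseteq> Z" "pos_def_on \<gamma> N" "dim N = pidx \<gamma> Z"
    "Z = ssum N (perp \<gamma> Z N)" "\<And>z. z \<in> perp \<gamma> Z N \<Longrightarrow> \<gamma> z z \<le> 0"
    using pidx_split[OF Z \<gamma>] by blast
  define R where "R = perp \<gamma> Z N"
  have R: "subspace R" "R \<subseteq> Z" using subspace_perp[OF \<gamma> Z] by (auto simp: R_def perp_def)
  have R0: "\<beta> x x = 0" if "x \<in> R" for x
    using N(6)[of x] P(6)[of x] that R by (force simp: R_def Z_def \<gamma>_def)
  have RR: "\<beta> x y = 0" if "x \<in> R" "y \<in> R" for x y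
  proof -
    have "\<beta> (x + y) (x + y) = 0" using R0 that R subspace_add by blast
    then show ?thesis using R0 that by (simp add: r symform_sym[OF \<beta>, of y x])
  qed
  have RN: "\<beta> x y = 0" if "x \<in> R" "y \<in> N" for x y
    using that symform_sym[OF \<beta>] by (auto simp: R_def perp_def \<gamma>_def)
  have ZP: "\<beta> x y = 0" if "x \<in> Z" "y \<in> P" for x y
    using that symform_sym[OF \<beta>] by (auto simp: Z_def perp_def)
  have ZU: "Z \<subseteq> U" by (auto simp: Z_def perp_def)
  have "R \<subseteq> rad_on \<beta> U"
  proof
    fix x assume x: "x \<in> R"
    have "\<beta> x y = 0" if "y \<in> U" for y
    proof -
      have "y \<in> ssum P Z" using that equalityD1[OF P(5)] unfolding Z_def by blast
      then obtain p z where "p \<in> P" "z \<in> Z" "y = p + z" by (rule ssumE)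
      moreover have "z \<in> ssum N R" using \<open>z \<in> Z\<close> equalityD1[OF N(5)] unfolding R_def by blast
      then obtain n q where "n \<in> N" "q \<in> R" "z = n + q" by (rule ssumE)
      ultimately show ?thesis using x RR RN ZP R(2) by (auto simp: r)
    qed
    then show "x \<in> rad_on \<beta> U" using x R ZU by (auto simp: rad_on_def)
  qed
  moreover have "rad_on \<beta> U \<subseteq> R"
  proof
    fix x assume x: "x \<in> rad_on \<beta> U"
    then have "x \<in> Z" using symform_sym[OF \<beta>] P(2) by (auto simp: rad_on_def Z_def perp_def)
    then show "x \<in> R" using x N(2) ZU symform_sym[OF \<beta>] by (auto simp: R_def perp_def rad_on_def \<gamma>_def)
  qed
  ultimately have rad: "rad_on \<beta> U = R" by blast
  have "P \<inter> Z \<subseteq> {0}" using P(3) P(6) by (force simp: pos_def_on_def Z_def)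
  then have "dim U = dim P + dim Z" using dim_ssum[OF P(1) Z] P(5) by (simp add: Z_def)
  moreover have "N \<inter> R \<subseteq> {0}" using N(3) N(6) by (force simp: pos_def_on_def R_def)
  then have "dim Z = dim N + dim R" using dim_ssum[OF N(1) R(1)] N(5) by (simp add: R_def)
  moreover have "nidx \<beta> U = dim N"
  proof -
    have "\<gamma> x x \<le> 0" if "x \<in> P" for x using P(3) that by (cases "x = 0") (auto simp: pos_def_on_def \<gamma>_def r intro: less_imp_le)
    then have "pidx \<gamma> P = 0" by (rule pidx_nonpos[OF P(1)])
    moreover have "orth \<gamma> P Z" by (auto simp: orth_def \<gamma>_def Z_def perp_def)
    ultimately have "pidx \<gamma> U = pidx \<gamma> Z" using pidx_ssum[OF P(1) Z \<gamma>] P(5) by (simp add: Z_def)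
    then show ?thesis using N(4) by (simp add: nidx_def \<gamma>_def)
  qed
  ultimately show ?thesis using P(4) rad by simp
qed

lemma nidx_minus: "nidx (\<lambda>x y. - \<beta> x y) U = pidx \<beta> U" "pidx (\<lambda>x y. - \<beta> x y) U = nidx \<beta> U"
  by (simp_all add: nidx_def)

lemma radical_nondeg: "nondeg_on \<beta> U \<Longrightarrow> subspace U \<Longrightarrow> symform \<beta> \<Longrightarrow> rad_on \<beta> U = {0}"
  using subspace_0[of U] by (auto simp: nondeg_on_def rad_on_def symform_rules)

lemma pidx_nidx_nondeg:
  fixes U :: "'a set"
  assumes "subspace U" "symform \<beta>" "nondeg_on \<beta> U"
  shows "pidx \<beta> U + nidx \<beta> U = dim U"
  using pidx_nidx_radical[OF assms(1,2)] radical_nondeg[OF assms(3,1,2)] by simp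

end

section \<open>Polynomials in an endomorphism and cyclic subspaces\<close>

lemma poly_act_altdef:
  assumes "degree p \<le> n" shows "poly_act p A v = (\<Sum>i\<le>n. coeff p i *\<^sub>R (A ^^ i) v)"
  unfolding poly_act_def using assms by (intro sum.mono_neutral_left) (auto simp: coeff_eq_0)

lemma linear_funpow: "linear (A :: 'a::real_vector \<Rightarrow> 'a) \<Longrightarrow> linear (A ^^ i)"
proof (induction i)
  case (Suc i)
  then show ?case using linear_compose[of "A ^^ i" A] by (simp add: comp_def)
qed (use linear_id in \<open>simp add: id_def\<close>)

lemma linear_poly_act: "linear A \<Longrightarrow> linear (poly_act p A)"
  unfolding poly_act_def[abs_def]
  by (intro linear_compose_sum ballI) (auto intro: linear_compose_scale_right linear_funpow)

lemma poly_act_0 [simp]: "poly_act 0 A v = 0"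
  by (simp add: poly_act_def)

lemma poly_act_add: "poly_act (p + q) A v = poly_act p A v + poly_act q A v"
proof -
  define n where "n = max (degree p) (degree q)"
  have "degree (p + q) \<le> n" "degree p \<le> n" "degree q \<le> n" by (auto simp: n_def degree_add_le_max)
  then show ?thesis by (simp add: poly_act_altdef scaleR_left_distrib sum.distrib)
qed

lemma poly_act_smult: "poly_act (Polynomial.smult c p) A v = c *\<^sub>R poly_act p A v"
  by (subst poly_act_altdef[of _ "degree p"]) (auto simp: poly_act_def scaleR_sum_right degree_smult_le)

lemma poly_act_uminus: "poly_act (- p) A v = - poly_act p A v"
  using poly_act_smult[of "-1" p A v] by simp

lemma poly_act_diff: "poly_act (p - q) A v = poly_act p A v - poly_act q A v"
  using poly_act_add[of p "- q" A v] by (simp add: poly_act_uminus)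

lemma poly_act_sum: "poly_act (sum f S) A v = (\<Sum>i\<in>S. poly_act (f i) A v)"
  by (induction S rule: infinite_finite_induct) (auto simp: poly_act_add)

lemma poly_act_pCons:
  assumes "linear A" shows "poly_act (pCons a p) A v = a *\<^sub>R v + A (poly_act p A v)"
proof -
  have "degree (pCons a p) \<le> Suc (degree p)" by (simp add: degree_pCons_le)
  then have "poly_act (pCons a p) A v = a *\<^sub>R v + (\<Sum>i\<le>degree p. coeff p i *\<^sub>R A ((A ^^ i) v))"
    by (subst poly_act_altdef, assumption, subst sum.atMost_Suc_shift) simp
  also have "(\<Sum>i\<le>degree p. coeff p i *\<^sub>R A ((A ^^ i) v)) = A (poly_act p A v)"
    by (simp add: poly_act_def linear_sum[OF assms] linear_scale[OF assms])
  finally show ?thesis .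
qed

lemma poly_act_mult:
  assumes "linear A" shows "poly_act (p * q) A v = poly_act p A (poly_act q A v)"
  by (induction p) (simp_all add: poly_act_pCons[OF assms] poly_act_add poly_act_smult)

lemma poly_act_const: "poly_act [:c:] A v = c *\<^sub>R v"
  by (simp add: poly_act_def)

lemma poly_act_1 [simp]: "poly_act 1 A v = v"
  by (simp add: poly_act_def)

lemma poly_act_X: "linear A \<Longrightarrow> poly_act [:0, 1:] A v = A v"
  by (simp add: poly_act_pCons linear_0)

lemma poly_act_monom: "linear A \<Longrightarrow> poly_act (Polynomial.monom c i) A v = c *\<^sub>R (A ^^ i) v"
  by (induction i) (simp_all add: monom_0 poly_act_const monom_Suc poly_act_pCons linear_scale)

lemma poly_act_commute_mult:
  assumes "linear A" shows "poly_act p A (poly_act q A v) = poly_act q A (poly_act p A v)"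
  using poly_act_mult[OF assms, of p q v] poly_act_mult[OF assms, of q p v] by (simp add: mult.commute)

lemma poly_act_dvd_0: "linear A \<Longrightarrow> p dvd q \<Longrightarrow> poly_act p A v = 0 \<Longrightarrow> poly_act q A v = 0"
  by (auto simp: dvd_def poly_act_commute_mult[of A p] poly_act_mult linear_0 linear_poly_act)

text \<open>Membership and intertwining are proved together, because the induction over
  \<open>p\<close> uses \<open>g (A x) = C (g x)\<close> at intermediate vectors, which must lie in
  \<open>U\<close>.\<close>

lemma poly_act_intertwine:
  assumes A: "linear A" "linear C" and g: "linear g" and U: "subspace U"
    and s: "\<And>x. x \<in> U \<Longrightarrow> A x \<in> U" "\<And>x. x \<in> U \<Longrightarrow> g (A x) = C (g x)"
  shows "x \<in> U \<Longrightarrow> poly_act p A x \<in> U \<and> g (poly_act p A x) = poly_act p C (g x)"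
  by (induction p)
    (simp_all add: poly_act_pCons A linear_0[OF g] linear_add[OF g] linear_scale[OF g] s
      subspace_0 subspace_add subspace_scale U)

lemma poly_act_in:
  assumes "linear A" "subspace U" "\<And>x. x \<in> U \<Longrightarrow> A x \<in> U" "x \<in> U"
  shows "poly_act p A x \<in> U"
  using poly_act_intertwine[OF assms(1,1) linear_id assms(2), of x p] assms by simp

lemma poly_act_commute:
  assumes "linear A" "linear g" "\<And>x. g (A x) = A (g x)"
  shows "g (poly_act p A x) = poly_act p A (g x)"
  using poly_act_intertwine[OF assms(1,1,2) subspace_UNIV, of x p] assms by simp

lemma bezout_coprime:
  fixes p q :: "real poly" assumes "coprime p q" obtains a b where "a * p + b * q = 1"
  using assms bezout_coefficients_fst_snd[of p q] by simp

lemma coprime_kernel: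
  assumes A: "linear A" and "coprime p q" "poly_act p A x = 0" "poly_act q A x = 0" shows "x = 0"
proof -
  obtain a b where "a * p + b * q = 1" using bezout_coprime assms by blast
  then have "x = poly_act (a * p + b * q) A x" by simp
  also have "\<dots> = 0" using assms by (simp add: poly_act_add poly_act_mult linear_0 linear_poly_act)
  finally show ?thesis .
qed

definition cyc :: "('a::real_vector \<Rightarrow> 'a) \<Rightarrow> 'a \<Rightarrow> 'a set" where
  "cyc A u = range (\<lambda>a. poly_act a A u)"

lemma subspace_cyc: "linear A \<Longrightarrow> subspace (cyc A u)"
  unfolding cyc_def subspace_def
  by (auto intro: rev_image_eqI[of 0] simp flip: poly_act_add poly_act_smult)

lemma cyc_stable: "linear A \<Longrightarrow> x \<in> cyc A u \<Longrightarrow> A x \<in> cyc A u"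
  unfolding cyc_def by (auto simp flip: poly_act_X poly_act_mult)

lemma cyc_base: "u \<in> cyc A u"
  unfolding cyc_def by (auto intro: rev_image_eqI[of 1])

text \<open>A vanishing combination of the powers is a polynomial of degree below \<open>d\<close>
  that kills \<open>w\<close>.\<close>

lemma independent_powers:
  assumes A: "linear A" and z: "\<And>a. degree a < d \<Longrightarrow> poly_act a A w = 0 \<Longrightarrow> a = 0"
  shows "inj_on (\<lambda>i. (A ^^ i) w) {..<d}" "independent ((\<lambda>i. (A ^^ i) w) ` {..<d})"
proof -
  have z': "\<forall>i<d. f i = 0" if "(\<Sum>i<d. f i *\<^sub>R (A ^^ i) w) = 0" for f
  proof -
    define a where "a = (\<Sum>i<d. Polynomial.monom (f i) i)"
    have c: "coeff a i = (if i < d then f i else 0)" for i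
      by (simp add: a_def coeff_sum)
    have "a = 0"
    proof (cases "d = 0")
      case False
      have "degree a \<le> d - 1" by (rule degree_le) (use c in auto)
      then show ?thesis using False that by (intro z) (auto simp: a_def poly_act_sum poly_act_monom[OF A])
    qed (simp add: a_def)
    then show ?thesis using c by (metis coeff_0)
  qed
  show inj: "inj_on (\<lambda>i. (A ^^ i) w) {..<d}"
  proof (rule inj_onI, rule ccontr)
    fix i j assume ij: "i \<in> {..<d}" "j \<in> {..<d}" "(A ^^ i) w = (A ^^ j) w" "i \<noteq> j"
    define f where "f = (\<lambda>k. if k = i then 1 else if k = j then -1 else (0::real))"
    have "(\<Sum>k<d. f k *\<^sub>R (A ^^ k) w) = (\<Sum>k<d. (if k = i then (A ^^ k) w else 0) - (if k = j then (A ^^ k) w else 0))"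
      using ij by (intro sum.cong) (auto simp: f_def)
    also have "\<dots> = 0" using ij by (simp add: sum_subtractf)
    finally show False using z'[of f] ij by (auto simp: f_def)
  qed
  show "independent ((\<lambda>i. (A ^^ i) w) ` {..<d})"
  proof (rule independent_if_scalars_zero)
    fix f x assume "(\<Sum>x\<in>(\<lambda>i. (A ^^ i) w) ` {..<d}. f x *\<^sub>R x) = 0" "x \<in> (\<lambda>i. (A ^^ i) w) ` {..<d}"
    then show "f x = 0" using z'[of "\<lambda>i. f ((A ^^ i) w)"] by (auto simp: sum.reindex[OF inj])
  qed simp
qed

context fdim begin

lemma ann_vector:
  fixes A :: "'a \<Rightarrow> 'a" assumes A: "linear A" obtains m where "m \<noteq> 0" "poly_act m A w = 0"
proof (cases "\<exists>m. m \<noteq> 0 \<and> poly_act m A w = 0")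
  case False
  \<comment> \<open>One power more than can be independent.\<close>
  let ?d = "Suc (card Bas)"
  let ?B = "(\<lambda>i. (A ^^ i) w) ` {..<?d}"
  have "inj_on (\<lambda>i. (A ^^ i) w) {..<?d}" "independent ?B"
    using independent_powers[OF A, of ?d w] False by auto
  moreover from this(2) have "card ?B \<le> dim (UNIV :: 'a set)" by (intro fd.independent_card_le_dim) auto
  ultimately show ?thesis by (simp add: card_image)
qed (use that in blast)

lemma ann_space:
  fixes A :: "'a \<Rightarrow> 'a" assumes A: "linear A" obtains m where "m \<noteq> 0" "\<And>x. poly_act m A x = 0"
proof -
  have "\<exists>m. m \<noteq> 0 \<and> (\<forall>w\<in>S. poly_act m A w = 0)" if "finite S" for S
    using that
  proof (induction S)
    case (insert w S)
    then obtain m k where "m \<noteq> 0" "\<forall>w\<in>S. poly_act m A w = 0" "k \<noteq> 0" "poly_act k A w = 0"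
      using ann_vector[OF A] by metis
    then have "\<forall>w\<in>insert w S. poly_act (m * k) A w = 0"
      using poly_act_dvd_0[OF A, of m "m * k"] poly_act_dvd_0[OF A, of k "m * k"] by auto
    then show ?case using \<open>m \<noteq> 0\<close> \<open>k \<noteq> 0\<close> by (intro exI[of _ "m * k"]) auto
  qed (auto intro: exI[of _ 1])
  from this[OF finite_Bas] obtain m where m: "m \<noteq> 0" "\<forall>w\<in>Bas. poly_act m A w = 0" by blast
  have "poly_act m A x = 0" for x
    using linear_eq_on_span[OF linear_poly_act[OF A, of m] linear_zero, of Bas x] m span_Bas by auto
  then show ?thesis using that m by blast
qed

text \<open>Division by \<open>m\<close> with remainder shows that the first \<open>degree m\<close>
  powers span; no nonzero polynomial of smaller degree kills \<open>w\<close>, so they are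
  independent.\<close>

lemma dim_cyc:
  fixes A :: "'a \<Rightarrow> 'a"
  assumes A: "linear A" and m: "m \<noteq> 0" "\<And>a. poly_act a A w = 0 \<longleftrightarrow> m dvd a"
  shows "dim (cyc A w) = degree m"
proof -
  let ?f = "\<lambda>i. (A ^^ i) w"
  let ?B = "?f ` {..<degree m}"
  have "inj_on ?f {..<degree m}" "independent ?B"
  proof -
    have *: "a = 0" if "degree a < degree m" "poly_act a A w = 0" for a
      using that m dvd_imp_degree_le[of m a] by auto
    show "inj_on ?f {..<degree m}" "independent ?B"
      using independent_powers[OF A, of "degree m" w] * by blast+
  qed
  moreover have "span ?B = cyc A w"
  proof (rule span_subspace)
    show "?B \<subseteq> cyc A w"
    proof clarify
      fix i show "(A ^^ i) w \<in> cyc A w"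
        unfolding cyc_def by (rule range_eqI[of _ _ "Polynomial.monom 1 i"]) (simp add: poly_act_monom[OF A])
    qed
    show "cyc A w \<subseteq> span ?B"
    proof
      fix x assume "x \<in> cyc A w"
      then obtain a where x: "x = poly_act a A w" by (auto simp: cyc_def)
      have "a = m * (a div m) + a mod m" by simp
      then have x': "x = poly_act (a mod m) A w"
        using x m(2)[of "m * (a div m)"] poly_act_add[of "m * (a div m)" "a mod m" A w] by simp
      show "x \<in> span ?B"
      proof (cases "a mod m = 0")
        case True then show ?thesis using x' by (simp add: span_zero)
      next
        case False
        then have "degree (a mod m) < degree m" using degree_mod_less m(1) by blast
        then show ?thesis unfolding x' poly_act_def
          by (intro span_sum span_scale span_base) auto
      qed
    qed
  qed (use subspace_cyc[OF A] in auto)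
  ultimately show ?thesis by (metis card_image card_lessThan dim_span_eq_card_independent)
qed

end

section \<open>Real polynomials\<close>

lemma map_poly_of_real_add:
  "map_poly complex_of_real (p + q) = map_poly complex_of_real p + map_poly complex_of_real q"
  by (rule poly_eqI) (simp add: coeff_map_poly)

lemma map_poly_of_real_mult:
  "map_poly complex_of_real (p * q) = map_poly complex_of_real p * map_poly complex_of_real q"
  by (rule poly_eqI) (simp add: coeff_map_poly coeff_mult)

lemma poly_map_poly_of_real: "poly (map_poly complex_of_real p) (of_real x) = of_real (poly p x)"
  by (induction p) (simp_all add: map_poly_pCons)

text \<open>A complex root z exists. If it is real, x - z divides q; otherwise q is divisible by the
  real quadratic with roots z and its conjugate. Irreducibility then determines q up to a
  constant.\<close>

lemma real_irreducible_cases: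
  fixes q :: "real poly" assumes q: "irreducible q"
  shows "degree q = 1 \<or> (degree q = 2 \<and> (coeff q 1)\<^sup>2 < 4 * coeff q 0 * coeff q 2)"
proof -
  have q0: "q \<noteq> 0" "\<not> is_unit q" using q by (auto simp: irreducible_def)
  then have dq: "degree q > 0" by (simp add: is_unit_iff_degree)
  let ?Q = "map_poly complex_of_real q"
  have "\<not> constant (poly ?Q)" using dq by (simp add: constant_degree degree_map_poly)
  then obtain z where z: "poly ?Q z = 0" using fundamental_theorem_of_algebra by blast
  define a where "a = Re z"
  define b where "b = (Im z)\<^sup>2"
  have dvd_case: "degree q = degree d" "\<exists>c. c \<noteq> 0 \<and> q = Polynomial.smult c d" if d: "d dvd q" "degree d > 0" for d
  proof -
    obtain e where e: "q = d * e" using d by auto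
    have "d \<noteq> 0" using d(2) by auto
    then have "\<not> is_unit d" using d(2) by (simp add: is_unit_iff_degree)
    then have "is_unit e" using q e irreducibleD by blast
    then have "e \<noteq> 0" "degree e = 0" by (auto simp: is_unit_iff_degree)
    then obtain c where c: "e = [:c:]" "c \<noteq> 0" by (auto elim: degree_eq_zeroE)
    then show "degree q = degree d" "\<exists>c. c \<noteq> 0 \<and> q = Polynomial.smult c d" using e by auto
  qed
  show ?thesis
  proof (cases "Im z = 0")
    case True
    then have "z = complex_of_real a" by (simp add: a_def complex_eq_iff)
    then have "poly q a = 0" using z by (simp add: poly_map_poly_of_real)
    then have "[:-a, 1:] dvd q" by (simp add: poly_eq_0_iff_dvd)
    then have "degree q = degree [:-a, 1:]" by (rule dvd_case) simp
    then show ?thesis by simp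
  next
    case False
    define d where "d = [:a\<^sup>2 + b, - 2 * a, 1:]"
    have bpos: "b > 0" using False by (simp add: b_def)
    have degd: "degree d = 2" by (simp add: d_def)
    have dz: "poly (map_poly complex_of_real d) z = 0"
      by (simp add: d_def a_def b_def complex_eq_iff map_poly_pCons power2_eq_square algebra_simps)
    \<comment> \<open>The remainder has the form r0 + r1 x and vanishes at the non-real z, so r0 =
      r1 = 0.\<close>
    define r where "r = q mod d"
    have "q = d * (q div d) + r" by (simp add: r_def)
    then have "?Q = map_poly complex_of_real d * map_poly complex_of_real (q div d) + map_poly complex_of_real r"
      by (metis map_poly_of_real_add map_poly_of_real_mult)
    then have rz: "poly (map_poly complex_of_real r) z = 0" using z dz by simp
    have "r = 0 \<or> degree r < 2" unfolding r_def using degree_mod_less[of d q] degd by (cases "d = 0") auto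
    define r0 where "r0 = coeff r 0"
    define r1 where "r1 = coeff r 1"
    have r: "r = [:r0, r1:]"
      by (rule poly_eqI)
        (use \<open>r = 0 \<or> degree r < 2\<close> in \<open>auto simp: r0_def r1_def coeff_pCons coeff_eq_0 split: nat.splits\<close>)
    have "of_real r0 + z * of_real r1 = 0"
      using rz by (cases "r1 = 0"; cases "r0 = 0") (simp_all add: r map_poly_pCons)
    then have "Im (of_real r0 + z * of_real r1) = 0" "Re (of_real r0 + z * of_real r1) = 0" by simp_all
    then have "r1 = 0" "r0 = 0" using False by auto
    then have "d dvd q" using r r_def by (simp add: dvd_eq_mod_eq_0)
    then have "degree q = 2" "\<exists>c. c \<noteq> 0 \<and> q = Polynomial.smult c d" using dvd_case degd by auto
    then obtain c where c: "c \<noteq> 0" "q = Polynomial.smult c d" by blast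
    have "b * (c * c) > 0" using c bpos by (auto simp: zero_less_mult_iff linorder_neq_iff)
    then have "(coeff q 1)\<^sup>2 < 4 * coeff q 0 * coeff q 2"
      using c by (simp add: d_def coeff_pCons numeral_2_eq_2 power2_eq_square algebra_simps)
    then show ?thesis using \<open>degree q = 2\<close> by blast
  qed
qed

section \<open>Square roots of x up to sign modulo a polynomial\<close>

lemma sqrt_mod_irreducible:
  fixes q :: "real poly" assumes q: "irreducible q" "\<not> q dvd [:0, 1:]"
  obtains f s where "s = 1 \<or> s = (- 1 :: real)" "q dvd f\<^sup>2 - [:0, s:]"
  using real_irreducible_cases[OF q(1)]
proof
  \<comment> \<open>Modulo x - t the residue of x is the real number t, which is a square up to its
    sign \<open>s\<close>.\<close>
  assume d: "degree q = 1"
  then obtain a b where ab: "q = [:b, a:]" "a \<noteq> 0"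
    using degree1_coeffs[of q] by (metis One_nat_def)
  define t where "t = - b / a"
  define s where "s = (if t \<ge> 0 then 1 else - 1 :: real)"
  define f where "f = [: sqrt \<bar>t\<bar> :]"
  have "poly (f\<^sup>2 - [:0, s:]) t = 0"
    by (simp add: f_def s_def power2_eq_square)
  then have "[:- t, 1:] dvd f\<^sup>2 - [:0, s:]" unfolding poly_eq_0_iff_dvd .
  moreover have "q = Polynomial.smult a [:-t, 1:]" using ab by (simp add: t_def)
  ultimately have "q dvd f\<^sup>2 - [:0, s:]" using ab(2) smult_dvd_iff[of a "[:-t, 1:]"] by metis
  then show ?thesis using that[of s f] by (simp add: s_def)
next
  assume d: "degree q = 2 \<and> (coeff q 1)\<^sup>2 < 4 * coeff q 0 * coeff q 2"
  define A where "A = coeff q 2"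
  have A: "A \<noteq> 0" using d leading_coeff_0_iff[of q] unfolding A_def by force
  define b where "b = coeff q 1 / A"
  define c where "c = coeff q 0 / A"
  have qe: "q = Polynomial.smult A [:c, b, 1:]"
  proof (rule poly_eqI)
    fix n :: nat
    consider "n = 0" | "n = 1" | "n = 2" | "n > 2" by linarith
    then show "coeff q n = coeff (Polynomial.smult A [:c, b, 1:]) n"
      using A d by cases (simp_all add: b_def c_def A_def numeral_2_eq_2 coeff_eq_0 coeff_pCons split: nat.splits)
  qed
  have "b\<^sup>2 < 4 * c"
  proof -
    have "A\<^sup>2 > 0" using A by simp
    moreover have "A\<^sup>2 * b\<^sup>2 < A\<^sup>2 * (4 * c)"
      using d A by (simp add: b_def c_def A_def power2_eq_square field_simps)
    ultimately show ?thesis by (simp add: mult_less_cancel_left_pos)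
  qed
  then have c: "c > 0" by (smt (verit) zero_le_power2)
  have bc: "\<bar>b\<bar> < 2 * sqrt c"
    using \<open>b\<^sup>2 < 4 * c\<close> c real_sqrt_less_mono[of "b\<^sup>2" "4 * c"] by (simp add: real_sqrt_mult)
  \<comment> \<open>The residue field is \<complex> here, so no sign appears. Comparing (\<alpha> x
    + \<alpha> sqrt c)^2 - x with \<alpha>^2 (x^2 + b x + c) leaves only the linear coefficient,
    which requires \<alpha>^2 (2 sqrt c - b) = 1. This is solvable as the discriminant is
    negative.\<close>
  define \<alpha> where "\<alpha> = 1 / sqrt (2 * sqrt c - b)"
  have \<alpha>: "\<alpha>\<^sup>2 * (2 * sqrt c - b) = 1" using bc by (simp add: \<alpha>_def power_divide)
  have "[:\<alpha> * sqrt c, \<alpha>:]\<^sup>2 - [:0, 1:] = Polynomial.smult (\<alpha>\<^sup>2) [:c, b, 1:]"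
    using \<alpha> c by (simp add: power2_eq_square algebra_simps)
  then have "q dvd [:\<alpha> * sqrt c, \<alpha>:]\<^sup>2 - [:0, 1:]" using A qe smult_dvd_iff[of A "[:c, b, 1:]"] dvd_smult[OF dvd_refl] by metis
  then show ?thesis using that[of 1 "[:\<alpha> * sqrt c, \<alpha>:]"] by simp
qed

text \<open>Newton iteration: as q does not divide g, an approximate root f is a unit modulo q, and
  the error q^k h is removed modulo q^(k + 1) by a correction of order q^k.\<close>

lemma hensel_sqrt:
  fixes q :: "real poly" assumes q: "irreducible q" and f0: "q dvd f0\<^sup>2 - g" "\<not> q dvd g"
  obtains f where "q ^ k dvd f\<^sup>2 - g"
proof -
  have "\<exists>f. q ^ Suc k dvd f\<^sup>2 - g" for k
  proof (induction k)
    case 0 then show ?case using f0 by auto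
  next
    case (Suc k)
    then obtain f h where f: "f\<^sup>2 - g = q ^ Suc k * h" by (auto simp: dvd_def)
    have "\<not> q dvd f"
    proof
      assume "q dvd f"
      then have "q dvd f\<^sup>2" by (simp add: power2_eq_square)
      moreover have "q dvd q ^ Suc k * h" by simp
      ultimately have "q dvd f\<^sup>2 - (f\<^sup>2 - g)" unfolding f by (rule dvd_diff)
      then show False using f0 by simp
    qed
    then have "coprime q f" using q 
      by (intro prime_elem_imp_coprime irreducible_imp_prime_elem)
    then obtain a b where ab: "a * q + b * f = 1" using bezout_coprime by blast
    \<comment> \<open>\<open>t\<close> solves h + 2 f t = 0 modulo q; \<open>b\<close> is the
      inverse of \<open>f\<close>, and -1/2 comes from linearising the square.\<close>
    define t where "t = Polynomial.smult (- 1/2) (h * b)"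
    have t2: "2 * t = - (h * b)" unfolding t_def mult_2 smult_add_left[symmetric] by simp
    have "h + 2 * f * t = h + f * (2 * t)" by (simp only: mult.assoc mult.left_commute)
    also have "\<dots> = h - h * (b * f)" unfolding t2 by (simp add: algebra_simps)
    also have "b * f = 1 - a * q" using ab by (simp add: algebra_simps)
    finally have ht: "h + 2 * f * t = q * (h * a)" by (simp add: algebra_simps)
    have "(f + q ^ Suc k * t)\<^sup>2 - g = (f\<^sup>2 - g) + q ^ Suc k * (2 * f * t) + q ^ Suc k * (q ^ Suc k * t\<^sup>2)"
      by (simp add: power2_eq_square algebra_simps)
    also have "\<dots> = q ^ Suc k * (h + 2 * f * t) + q ^ Suc k * (q ^ Suc k * t\<^sup>2)"
      unfolding f by (simp add: algebra_simps)
    also have "\<dots> = q ^ Suc (Suc k) * (h * a + q ^ k * t\<^sup>2)"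
      unfolding ht by (simp add: algebra_simps)
    finally show ?case by (metis dvd_triv_left)
  qed
  then obtain f where "q ^ Suc k dvd f\<^sup>2 - g" by blast
  then have "q ^ k dvd f\<^sup>2 - g" by (rule dvd_trans[rotated]) (simp add: le_imp_power_dvd)
  then show ?thesis using that by blast
qed

text \<open>On each primary factor of m, x is a square or minus a square by
  \<open>sqrt_mod_irreducible\<close>, and \<open>hensel_sqrt\<close> lifts this to prime powers;
  that m is coprime to x puts every prime factor within the reach of Hensel lifting. The Chinese
  remainder theorem glues the roots into f and the signs into e.\<close>

lemma signed_sqrt_mod:
  fixes m :: "real poly" assumes "m \<noteq> 0" "coprime m [:0, 1:]"
  shows "\<exists>f e. m dvd f\<^sup>2 * e - [:0, 1:] \<and> m dvd e\<^sup>2 - 1"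
  using assms
proof (induction "degree m" arbitrary: m rule: less_induct)
  case less
  show ?case
  proof (cases "is_unit m")
    case True then show ?thesis by (metis unit_imp_dvd)
  next
    case False
    then obtain q where q: "prime_elem q" "q dvd m"
      using less.prems prime_divisor_exists[of m] by auto
    then have qi: "irreducible q" using prime_elem_imp_irreducible by blast
    define k where "k = multiplicity q m"
    obtain n where n: "m = q ^ k * n" "\<not> q dvd n"
      using multiplicity_decompose'[of m q] less.prems(1) q by (auto simp: k_def prime_elem_def)
    have "k \<noteq> 0" using n q by (metis mult_1 power_0)
    have qX: "\<not> q dvd [:0, 1:]"
      using coprime_common_divisor[OF less.prems(2) q(2)] prime_elem_not_unit[OF q(1)] by blast
    have degq: "degree q > 0" using qi is_unit_iff_degree[of q] unfolding irreducible_def by blast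
    have n0: "n \<noteq> 0" using n less.prems(1) by auto
    have "degree n < degree m"
      using n n0 less.prems(1) degq \<open>k \<noteq> 0\<close> qi by (simp add: degree_mult_eq degree_power_eq irreducible_def)
    moreover have "coprime n [:0, 1:]" using less.prems(2) n(1) by simp
    ultimately obtain f1 e1 where 1: "n dvd f1\<^sup>2 * e1 - [:0, 1:]" "n dvd e1\<^sup>2 - 1"
      using less.hyps n0 by blast
    obtain f0 s where s: "s = 1 \<or> s = (-1 :: real)" "q dvd f0\<^sup>2 - [:0, s:]"
      using sqrt_mod_irreducible[OF qi qX] by blast
    have "\<not> q dvd [:0, s:]"
    proof
      assume "q dvd [:0, s:]"
      then have "q dvd Polynomial.smult s [:0, s:]" by (rule dvd_smult)
      moreover have "Polynomial.smult s [:0, s:] = [:0, 1:]" using s(1) by auto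
      ultimately show False using qX by simp
    qed
    from hensel_sqrt[OF qi s(2) this, of k] obtain f2 where f2: "q ^ k dvd f2\<^sup>2 - [:0, s:]" by blast
    define e2 where "e2 = [:s:]"
    have 2: "q ^ k dvd f2\<^sup>2 * e2 - [:0, 1:]" "q ^ k dvd e2\<^sup>2 - 1"
    proof -
      have "f2\<^sup>2 * e2 - [:0, 1:] = Polynomial.smult s (f2\<^sup>2 - [:0, s:])"
        using s(1) by (auto simp: e2_def smult_diff_right)
      then show "q ^ k dvd f2\<^sup>2 * e2 - [:0, 1:]" using f2 by (simp add: dvd_smult)
      have "e2\<^sup>2 = 1" using s(1) by (auto simp: e2_def power2_eq_square one_pCons)
      then show "q ^ k dvd e2\<^sup>2 - 1" by simp
    qed
    have "coprime (q ^ k) n"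
      using prime_elem_imp_coprime[OF q(1) n(2)] by simp
    then obtain a b where ab: "a * q ^ k + b * n = 1" using bezout_coprime by blast
    \<comment> \<open>Chinese remainders: \<open>a * q ^ k\<close> is 1 modulo \<open>n\<close> and
      0 modulo \<open>q ^ k\<close>, and \<open>b * n\<close> is the other way round.\<close>
    define f where "f = f1 * (a * q ^ k) + f2 * (b * n)"
    define e where "e = e1 * (a * q ^ k) + e2 * (b * n)"
    have c1: "n dvd f - f1" "n dvd e - e1"
    proof -
      have "f - f1 = f1 * (a * q ^ k - 1) + f2 * (b * n)" "e - e1 = e1 * (a * q ^ k - 1) + e2 * (b * n)"
        by (simp_all add: f_def e_def algebra_simps)
      moreover have "a * q ^ k - 1 = - (b * n)" using ab by (simp add: algebra_simps)
      ultimately show "n dvd f - f1" "n dvd e - e1" by simp_all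
    qed
    have c2: "q ^ k dvd f - f2" "q ^ k dvd e - e2"
    proof -
      have "f - f2 = f1 * (a * q ^ k) + f2 * (b * n - 1)" "e - e2 = e1 * (a * q ^ k) + e2 * (b * n - 1)"
        by (simp_all add: f_def e_def algebra_simps)
      moreover have "b * n - 1 = - (a * q ^ k)" using ab by (simp add: algebra_simps)
      ultimately show "q ^ k dvd f - f2" "q ^ k dvd e - e2" by simp_all
    qed
    have key: "d dvd f\<^sup>2 * e - [:0, 1:]" "d dvd e\<^sup>2 - 1"
      if "d dvd f - f'" "d dvd e - e'" "d dvd f'\<^sup>2 * e' - [:0, 1:]" "d dvd e'\<^sup>2 - 1" for d f' e' :: "real poly"
    proof -
      have "f\<^sup>2 * e - [:0, 1:] = (f - f') * ((f + f') * e) + (e - e') * f'\<^sup>2 + (f'\<^sup>2 * e' - [:0, 1:])"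
        by (simp add: power2_eq_square algebra_simps)
      then show "d dvd f\<^sup>2 * e - [:0, 1:]" using that by (metis dvd_add dvd_mult2)
      have "e\<^sup>2 - 1 = (e - e') * (e + e') + (e'\<^sup>2 - 1)" by (simp add: power2_eq_square algebra_simps)
      then show "d dvd e\<^sup>2 - 1" using that by (metis dvd_add dvd_mult2)
    qed
    have "m dvd f\<^sup>2 * e - [:0, 1:]" "m dvd e\<^sup>2 - 1"
      unfolding n(1) using \<open>coprime (q ^ k) n\<close> key[OF c1 1] key[OF c2 2] by (auto intro: divides_mult)
    then show ?thesis by blast
  qed
qed

section \<open>Local signatures of an isometry\<close>

definition stable :: "('a::real_vector \<Rightarrow> 'a) \<Rightarrow> 'a set \<Rightarrow> bool" where
  "stable A U \<longleftrightarrow> subspace U \<and> (\<forall>x\<in>U. A x \<in> U)"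

definition self_dual :: "real poly \<Rightarrow> bool" where
  "self_dual p \<longleftrightarrow> irreducible p \<and> reciprocal p"

text \<open>
  The pairs \<open>(p, l)\<close> that carry a signature: for \<open>p\<close> linear and \<open>l\<close> even the local form is alternating.
\<close>

definition admissible :: "real poly \<times> nat \<Rightarrow> bool" where
  "admissible = (\<lambda>(p, l). self_dual p \<and> l \<ge> 1 \<and> (degree p = 1 \<longrightarrow> odd l))"

text \<open>In general p(\<sigma>) is not selfadjoint. For self-dual p, \<open>Nop\<close> differs
  from it by a factor that commutes with \<sigma> and is injective on the kernels of the powers of p
  (\<open>N_eta\<close>, \<open>eta_inj\<close>), but it is skew-adjoint for p linear and
  selfadjoint for p quadratic (\<open>N_adj\<close>). These are the operators in
  \<open>b_space\<close> and \<open>h_base\<close>.\<close>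

definition Nop :: "('a::real_vector \<Rightarrow> 'a) \<Rightarrow> real poly \<Rightarrow> 'a \<Rightarrow> 'a" where
  "Nop \<sigma> p x = (if degree p = 1 then \<sigma> x - inv_into UNIV \<sigma> x else inv_into UNIV \<sigma> (poly_act p \<sigma> x))"

definition csgn :: "real poly \<Rightarrow> nat \<Rightarrow> real" where
  "csgn p l = (if degree p = 1 then (- 1) ^ ((l - 1) div 2) else 1)"

text \<open>
  Modulo \<open>p\<close>, this is the form \<open>(- 1)^((l - 1) div 2) b\<^bsub>t,l\<^esub>\<close> (\<open>p = t\<close> linear) or the trace of \<open>h\<^bsub>p,l\<^esub>\<close>
  (\<open>p\<close> quadratic); without the sign, the local signatures would not sum up to the signature.
\<close>

definition bform :: "('a::real_vector \<Rightarrow> 'a \<Rightarrow> real) \<Rightarrow> ('a \<Rightarrow> 'a) \<Rightarrow> real poly \<times> nat \<Rightarrow> 'a \<Rightarrow> 'a \<Rightarrow> real" where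
  "bform B \<sigma> = (\<lambda>(p, l) x y. csgn p l * B ((Nop \<sigma> p ^^ (l - 1)) x) y)"

definition kerp :: "('a::real_vector \<Rightarrow> 'a) \<Rightarrow> real poly \<times> nat \<Rightarrow> 'a set" where
  "kerp \<sigma> = (\<lambda>(p, l). {x. poly_act (p ^ l) \<sigma> x = 0})"

text \<open>The whole kernel in \<open>U\<close> is available for every stable \<open>U\<close>. On
  a free summand of an exponent other than \<open>l\<close> the form vanishes on this kernel
  (\<open>free_bform_vanish\<close>); on a non-degenerate free summand of exponent \<open>l\<close>
  the radical is the image of p(\<sigma>) (\<open>radical_free\<close>), so the index is that of a
  form modulo p.\<close>

definition pos :: "('a::real_vector \<Rightarrow> 'a \<Rightarrow> real) \<Rightarrow> ('a \<Rightarrow> 'a) \<Rightarrow> real poly \<times> nat \<Rightarrow> 'a set \<Rightarrow> nat" where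
  "pos B \<sigma> j U = pidx (bform B \<sigma> j) (U \<inter> kerp \<sigma> j)"

definition neg :: "('a::real_vector \<Rightarrow> 'a \<Rightarrow> real) \<Rightarrow> ('a \<Rightarrow> 'a) \<Rightarrow> real poly \<times> nat \<Rightarrow> 'a set \<Rightarrow> nat" where
  "neg B \<sigma> j U = nidx (bform B \<sigma> j) (U \<inter> kerp \<sigma> j)"

lemma csgn_square [simp]: "csgn p l * csgn p l = 1" "csgn p l \<noteq> 0"
  by (auto simp: csgn_def simp flip: power_mult_distrib)

text \<open>Equality with \<open>star_poly p\<close> makes the coefficients symmetric up to the
  factor p(0). Hence the leading coefficient is 1 and p(0)^2 = 1; in degree 2 the negative
  discriminant forces p(0) = 1.\<close>

lemma self_dual_cases:
  assumes "self_dual p"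
  obtains c where "p = [:c, 1:]" "c = 1 \<or> c = - 1" | b where "p = [:1, b, 1:]" "b\<^sup>2 < 4"
proof -
  have irr: "irreducible p" and r: "coeff p 0 \<noteq> 0" "p = star_poly p"
    using assms by (auto simp: self_dual_def reciprocal_def)
  have sc: "coeff p i = coeff p (degree p - i) / coeff p 0" if "i \<le> degree p" for i
    using arg_cong[OF r(2), of "\<lambda>q. coeff q i"] that by (simp add: star_poly_def coeff_reflect_poly divide_inverse mult.commute)
  from real_irreducible_cases[OF irr] show ?thesis
  proof
    assume d: "degree p = 1"
    have p: "p = [:coeff p 0, coeff p 1:]"
      by (rule poly_eqI) (use d in \<open>auto simp: coeff_pCons coeff_eq_0 split: nat.splits\<close>)
    have "coeff p 1 = 1" using sc[of 1] d r(1) by simp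
    moreover from this have "coeff p 0 * coeff p 0 = 1" using sc[of 0] d r(1) by (simp add: field_simps)
    then have "coeff p 0 = 1 \<or> coeff p 0 = - 1" by (simp add: square_eq_1_iff)
    ultimately show ?thesis using that(1)[of "coeff p 0"] p by simp
  next
    assume d: "degree p = 2 \<and> (coeff p 1)\<^sup>2 < 4 * coeff p 0 * coeff p 2"
    have p: "p = [:coeff p 0, coeff p 1, coeff p 2:]"
      by (rule poly_eqI) (use d in \<open>auto simp: coeff_pCons coeff_eq_0 numeral_2_eq_2 split: nat.splits\<close>)
    have 2: "coeff p 2 = 1" using sc[of 2] d r(1) by simp
    moreover from this have "coeff p 0 * coeff p 0 = 1" using sc[of 0] d r(1) by (simp add: field_simps)
    then have "coeff p 0 = 1 \<or> coeff p 0 = - 1" by (simp add: square_eq_1_iff)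
    moreover have "(coeff p 1)\<^sup>2 < 4 * coeff p 0" using d 2 by simp
    then have "coeff p 0 > 0" using zero_le_power2[of "coeff p 1"] by linarith
    ultimately show ?thesis using that(2)[of "coeff p 1"] p d by auto
  qed
qed

lemma self_dual_degree: "self_dual p \<Longrightarrow> degree p = 1 \<or> degree p = 2"
  by (erule self_dual_cases) auto

lemma self_dual_reflect: "self_dual p \<Longrightarrow> \<exists>c. c \<noteq> 0 \<and> reflect_poly p = Polynomial.smult c p"
  unfolding self_dual_def reciprocal_def star_poly_def
  by (metis smult_smult right_inverse smult_1_left)

lemma self_dual_nz: "self_dual p \<Longrightarrow> p \<noteq> 0" and self_dual_degree_pos: "self_dual p \<Longrightarrow> degree p > 0"
  using self_dual_degree[of p] by force+

lemma self_dual_not_dvd_coprime: "self_dual p \<Longrightarrow> \<not> p dvd c \<Longrightarrow> coprime p c"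
  unfolding self_dual_def by (intro prime_elem_imp_coprime irreducible_imp_prime_elem) auto

lemma self_dual_eq_or_coprime:
  assumes "self_dual p" "self_dual q" "p \<noteq> q" shows "coprime p q"
proof (rule self_dual_not_dvd_coprime[OF assms(1)])
  show "\<not> p dvd q"
  proof
    assume "p dvd q"
    then obtain c where c: "q = p * c" by auto
    have "\<not> is_unit p" using assms(1) by (auto simp: self_dual_def irreducible_def)
    then have "is_unit c" using assms(2) c irreducibleD unfolding self_dual_def by blast
    then have "degree c = 0" by (simp add: is_unit_iff_degree split: if_splits)
    then obtain k where k: "c = [:k:]" by (auto elim: degree_eq_zeroE)
    have m: "lead_coeff p = 1" "lead_coeff q = 1" using assms(1,2) by (auto elim!: self_dual_cases)
    have "k = 1" using m c k by (metis lead_coeff_mult lead_coeff_pCons(2) mult_1)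
    then show False using c k assms(3) by (simp add: one_pCons[symmetric])
  qed
qed

section \<open>Adjoints under an isometry and the operators \<open>N\<close>\<close>

locale isom = fdim Bas for Bas :: "'a::real_vector set" +
  fixes B :: "'a \<Rightarrow> 'a \<Rightarrow> real" and \<sigma> :: "'a \<Rightarrow> 'a"
  assumes nondegenerate_B: "nondegenerate_form B" and sigma_O: "\<sigma> \<in> O_group B"
begin

abbreviation "act a \<equiv> poly_act a \<sigma>"
abbreviation "\<sigma>i \<equiv> inv_into UNIV \<sigma>"
abbreviation "\<beta> \<equiv> bform B \<sigma>"
abbreviation "N \<equiv> Nop \<sigma>"

lemma lin: "linear \<sigma>" and bij_sigma: "bij \<sigma>" and B_sigma: "B (\<sigma> x) (\<sigma> y) = B x y"
  using sigma_O by (auto simp: O_group_def GL_def)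

lemma symB: "symform B" and ndB: "nondeg_on B UNIV"
  using nondegenerate_B by (auto simp: nondegenerate_form_def symform_def nondeg_on_def)

lemmas Br = symform_rules[OF symB]

lemma sigma_inv [simp]: "\<sigma> (\<sigma>i x) = x" "\<sigma>i (\<sigma> x) = x"
  using bij_sigma by (auto simp: bij_is_inj bij_is_surj f_inv_into_f)

lemma lin_inv: "linear \<sigma>i"
  by (rule linearI; rule injD[OF bij_is_inj[OF bij_sigma]])
    (simp_all add: linear_add[OF lin] linear_scale[OF lin])

lemmas lin_act = linear_poly_act[OF lin]

lemma adj: "B (\<sigma> x) y = B x (\<sigma>i y)" "B (\<sigma>i x) y = B x (\<sigma> y)"
  using B_sigma[of x "\<sigma>i y"] B_sigma[of "\<sigma>i x" y] by simp_all

lemma adj_funpow: "B ((\<sigma> ^^ i) x) y = B x ((\<sigma>i ^^ i) y)"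
  by (induction i arbitrary: x y) (simp_all add: adj funpow_swap1)

lemma adj_act: "B (act a x) y = B x (poly_act a \<sigma>i y)"
  unfolding poly_act_def by (simp add: symform_sum[OF symB] Br adj_funpow)

text \<open>\<sigma> maps U injectively into itself, hence onto itself by dimension.\<close>

lemma stable_inv: assumes "stable \<sigma> U" "x \<in> U" shows "\<sigma>i x \<in> U"
proof -
  have "\<sigma> ` U = U"
    using assms by (intro image_eq_self[OF lin]) (auto simp: stable_def, metis lin linear_0 sigma_inv(2))
  then obtain y where "y \<in> U" "\<sigma> y = x" using assms(2) by (metis imageE)
  then show ?thesis by auto
qed

lemma stable_act: "stable \<sigma> U \<Longrightarrow> x \<in> U \<Longrightarrow> act a x \<in> U"
  by (rule poly_act_in[OF lin]) (auto simp: stable_def)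

lemma stable_subspace: "stable \<sigma> U \<Longrightarrow> subspace U"
  by (simp add: stable_def)

lemma stable_cyc: "stable \<sigma> (cyc \<sigma> u)"
  using subspace_cyc[OF lin] cyc_stable[OF lin] by (auto simp: stable_def)

lemma stable_perp:
  assumes "stable \<sigma> U" "stable \<sigma> P" shows "stable \<sigma> (perp B U P)"
  unfolding stable_def
proof (intro conjI ballI)
  show "subspace (perp B U P)" using assms subspace_perp[OF symB] by (auto simp: stable_def)
  fix x assume x: "x \<in> perp B U P"
  have "B y (\<sigma> x) = 0" if "y \<in> P" for y
    using x stable_inv[OF assms(2) that] by (simp add: perp_def flip: adj(2))
  then show "\<sigma> x \<in> perp B U P" using x assms(1) by (auto simp: perp_def stable_def)
qed

lemma stable_ssum: "stable \<sigma> U \<Longrightarrow> stable \<sigma> V \<Longrightarrow> stable \<sigma> (ssum U V)"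
  by (auto simp: stable_def subspace_ssum linear_add[OF lin] intro!: ssumI elim!: ssumE)

lemma inv_act: "\<sigma>i (act a x) = act a (\<sigma>i x)"
  using poly_act_commute[OF lin lin_inv, of a x] by simp

lemma sigma_act: "\<sigma> (act a x) = act a (\<sigma> x)"
  using poly_act_commute[OF lin lin, of a x] by simp

lemma inv_funpow: assumes "i \<le> d" shows "(\<sigma>i ^^ d) ((\<sigma> ^^ (d - i)) y) = (\<sigma>i ^^ i) y"
proof -
  have "(\<sigma>i ^^ (i + k)) ((\<sigma> ^^ k) y) = (\<sigma>i ^^ i) y" for k
    by (induction k) (simp_all add: funpow_swap1[of \<sigma>i])
  then show ?thesis using assms by (metis le_add_diff_inverse)
qed

text \<open>The left side is the adjoint of a(\<sigma>) by \<open>adj_act\<close>. Clearing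
  denominators expresses it by the reflected polynomial; this is how reciprocity enters.\<close>

lemma act_inv: "poly_act a \<sigma>i y = (\<sigma>i ^^ degree a) (act (reflect_poly a) y)"
proof -
  let ?d = "degree a"
  have "act (reflect_poly a) y = (\<Sum>i\<le>?d. coeff (reflect_poly a) i *\<^sub>R (\<sigma> ^^ i) y)"
    by (rule poly_act_altdef) (rule degree_reflect_poly_le)
  also have "\<dots> = (\<Sum>i\<le>?d. coeff a (?d - i) *\<^sub>R (\<sigma> ^^ i) y)"
    by (intro sum.cong) (auto simp: coeff_reflect_poly)
  also have "\<dots> = (\<Sum>i\<le>?d. coeff a i *\<^sub>R (\<sigma> ^^ (?d - i)) y)"
    by (rule sum.reindex_bij_witness[of _ "\<lambda>i. ?d - i" "\<lambda>i. ?d - i"]) auto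
  finally have "(\<sigma>i ^^ ?d) (act (reflect_poly a) y) = (\<Sum>i\<le>?d. coeff a i *\<^sub>R (\<sigma>i ^^ ?d) ((\<sigma> ^^ (?d - i)) y))"
    using linear_funpow[OF lin_inv, of ?d] by (simp add: linear_sum linear_scale)
  also have "\<dots> = poly_act a \<sigma>i y" unfolding poly_act_def by (intro sum.cong) (auto simp: inv_funpow)
  finally show ?thesis by simp
qed

text \<open>Moving a(\<sigma>) to the other argument turns it, up to a power of \<sigma>, into the
  reflected polynomial. For self-dual polynomials this makes kernels of powers orthogonal to images;
  for a non-reciprocal q it makes the kernels in \<open>split\<close> isotropic.\<close>

lemma act_reflect_0: "act (reflect_poly a) w = 0 \<Longrightarrow> B w (act a y) = 0"
proof -
  assume "act (reflect_poly a) w = 0"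
  then have "poly_act a \<sigma>i w = 0"
    using linear_0[OF linear_funpow[OF lin_inv]] by (simp add: act_inv)
  then show ?thesis using adj_act[of a y w] symform_sym[OF symB] by (simp add: Br)
qed

lemma self_dual_adj_0:
  assumes "self_dual p" "act (p ^ k) w = 0" shows "B w (act (p ^ k) y) = 0"
proof -
  obtain c where "reflect_poly p = Polynomial.smult c p" using self_dual_reflect[OF assms(1)] by blast
  then have "reflect_poly (p ^ k) = Polynomial.smult (c ^ k) (p ^ k)"
    by (simp add: reflect_poly_power smult_power)
  then show ?thesis using assms(2) by (intro act_reflect_0) (simp add: poly_act_smult)
qed

text \<open>For p = x + c with c^2 = 1 the cofactor x - c completes p to x^2 - 1, and \<sigma> -
  \<sigma>^-1 = \<sigma>^-1 (\<sigma>^2 - 1). So this is what remains of \<open>N p\<close> once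
  p(\<sigma>) is taken out.\<close>

definition eta :: "real poly \<Rightarrow> 'a \<Rightarrow> 'a" where
  "eta p x = \<sigma>i (if degree p = 1 then act [:- coeff p 0, 1:] x else x)"

lemma eta_linear: "linear (eta p)"
proof -
  have "linear (\<lambda>x. \<sigma>i (act q x))" for q
    using linear_compose[OF lin_act lin_inv] by (simp add: comp_def)
  then show ?thesis using lin_inv by (cases "degree p = 1") (simp_all add: eta_def[abs_def])
qed

lemma eta_act: "eta p (act a x) = act a (eta p x)"
  by (simp add: eta_def inv_act poly_act_commute_mult[OF lin])

lemma eta_stable: "stable \<sigma> U \<Longrightarrow> x \<in> U \<Longrightarrow> eta p x \<in> U"
  by (simp add: eta_def stable_inv stable_act)

lemma N_eta:
  assumes "self_dual p" shows "N p x = eta p (act p x)"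
  using assms
proof (cases p rule: self_dual_cases)
  case (1 c)
  have "act [:- c, 1:] (act p x) = act [:- 1, 0, 1:] x"
    using 1 by (auto simp flip: poly_act_mult[OF lin])
  also have "\<dots> = \<sigma> (\<sigma> x) - x" by (simp add: poly_act_pCons[OF lin] linear_0[OF lin])
  finally show ?thesis using 1 by (simp add: eta_def Nop_def linear_diff[OF lin_inv])
qed (simp add: eta_def Nop_def)

text \<open>The polynomials x - c and x + c are coprime, so x - c acts injectively on the kernel of
  a power of x + c. For p quadratic only \<sigma>^-1 is left.\<close>

lemma eta_inj:
  assumes "self_dual p" "act (p ^ l) x = 0" "eta p x = 0" shows "x = 0"
  using assms(1)
proof (cases p rule: self_dual_cases)
  case (1 c)
  have "act [:- c, 1:] x = 0"
    using assms(3) 1 linear_0[OF lin] by (simp add: eta_def) (metis sigma_inv(1))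
  moreover have "coprime ([:- c, 1:]) (p ^ l)"
  proof -
    have "Polynomial.smult (1 / (2 * c)) p - Polynomial.smult (1 / (2 * c)) [:- c, 1:] = 1"
      using 1 by (auto simp: one_pCons)
    then have "coprime [:- c, 1:] p"
      by (metis coprimeI dvd_diff dvd_smult)
    then show ?thesis by simp
  qed
  ultimately show ?thesis using coprime_kernel[OF lin] assms(2) by blast
next
  case (2 b)
  then show ?thesis using assms(3) linear_0[OF lin] by (simp add: eta_def) (metis sigma_inv(1))
qed

lemma eta_power_linear: "linear (eta p ^^ k)"
  by (rule linear_funpow[OF eta_linear])

lemma eta_power_act: "(eta p ^^ k) (act a x) = act a ((eta p ^^ k) x)"
  by (induction k) (simp_all add: eta_act)

lemma eta_power_stable: "stable \<sigma> U \<Longrightarrow> x \<in> U \<Longrightarrow> (eta p ^^ k) x \<in> U"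
  by (induction k) (simp_all add: eta_stable)

lemma eta_power_inj:
  assumes "self_dual p" "act (p ^ l) x = 0" shows "(eta p ^^ k) x = 0 \<Longrightarrow> x = 0"
proof (induction k)
  case (Suc k)
  have "act (p ^ l) ((eta p ^^ k) x) = 0"
    using assms(2) linear_0[OF eta_power_linear] by (simp flip: eta_power_act)
  then show ?case using Suc eta_inj[OF assms(1)] by simp
qed simp

lemma N_power:
  assumes "self_dual p" shows "(N p ^^ k) x = (eta p ^^ k) (act (p ^ k) x)"
  by (induction k)
    (simp_all add: N_eta[OF assms] poly_act_mult[OF lin] eta_power_act poly_act_commute_mult[OF lin])

lemma N_linear: "self_dual p \<Longrightarrow> linear (N p ^^ k)"
proof -
  assume "self_dual p"
  then have "N p ^^ k = (eta p ^^ k) \<circ> act (p ^ k)" by (intro ext) (simp add: N_power)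
  then show ?thesis using linear_compose[OF lin_act eta_power_linear] by simp
qed

lemma N_act: "self_dual p \<Longrightarrow> (N p ^^ k) (act a x) = act a ((N p ^^ k) x)"
  by (simp add: N_power eta_power_act poly_act_commute_mult[OF lin, of a])

lemma N_sigma: "self_dual p \<Longrightarrow> (N p ^^ k) (\<sigma> x) = \<sigma> ((N p ^^ k) x)"
  using N_act[of p k "[:0, 1:]" x] by (simp add: poly_act_X[OF lin])

lemma N_stable: "self_dual p \<Longrightarrow> stable \<sigma> U \<Longrightarrow> x \<in> U \<Longrightarrow> (N p ^^ k) x \<in> U"
  by (simp add: N_power eta_power_stable stable_act)

lemma N_0: "self_dual p \<Longrightarrow> act (p ^ k) x = 0 \<Longrightarrow> (N p ^^ k) x = 0"
  by (simp add: N_power linear_0[OF eta_power_linear])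

lemma N_0D:
  assumes p: "self_dual p" and "(N p ^^ k) x = 0" "act (p ^ l) x = 0" shows "act (p ^ k) x = 0"
proof (rule eta_power_inj[OF p])
  show "act (p ^ l) (act (p ^ k) x) = 0"
    using assms(3) by (simp add: poly_act_commute_mult[OF lin, of "p ^ l"] linear_0[OF lin_act])
  show "(eta p ^^ k) (act (p ^ k) x) = 0" using assms(2) by (simp add: N_power[OF p])
qed

lemma act_power_mono: "act (p ^ k) x = 0 \<Longrightarrow> k \<le> l \<Longrightarrow> act (p ^ l) x = 0"
  using poly_act_dvd_0[OF lin le_imp_power_dvd] by blast

text \<open>For p = x^2 + b x + 1 one has \<sigma>^-1 p(\<sigma>) = \<sigma> + b + \<sigma>^-1.
  Adjoints exchange \<sigma> and \<sigma>^-1, which fixes this sum and changes the sign of \<sigma>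
  - \<sigma>^-1.\<close>

lemma N_adj: 
  assumes "self_dual p"
  shows "B (N p x) y = (if degree p = 1 then - 1 else 1) * B x (N p y)"
  using assms
proof (cases p rule: self_dual_cases)
  case (1 c)
  then show ?thesis by (simp add: Nop_def Br adj)
next
  case (2 b)
  have e: "N p z = \<sigma> z + b *\<^sub>R z + \<sigma>i z" for z
    using 2 by (simp add: Nop_def poly_act_pCons[OF lin] linear_0[OF lin] linear_add[OF lin_inv]
        linear_add[OF lin] linear_scale[OF lin_inv] linear_scale[OF lin] add.commute)
  have "degree p \<noteq> 1" using 2 by simp
  then show ?thesis by (simp add: e Br adj)
qed

lemma N_adj_power: 
  assumes "self_dual p"
  shows "B ((N p ^^ k) x) y = (if degree p = 1 then - 1 else 1) ^ k * B x ((N p ^^ k) y)"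
proof (induction k arbitrary: x y)
  case (Suc k)
  show ?case using N_adj[OF assms, of x "(N p ^^ k) y"] Suc[of "N p x" y] by (simp add: funpow_swap1 del: funpow.simps(2)) (simp add: funpow_swap1)
qed simp

text \<open>Admissibility enters here: for p linear, moving N^(l - 1) across costs the sign (-1)^(l
  - 1), which is 1 as l is odd.\<close>

lemma symform_bform: assumes "admissible j" shows "symform (\<beta> j)"
proof -
  obtain p l where j: "j = (p, l)" by (cases j)
  have p: "self_dual p" "l \<ge> 1" "degree p = 1 \<Longrightarrow> odd l" using assms by (auto simp: admissible_def j)
  have s: "\<beta> j x y = \<beta> j y x" for x y
  proof -
    have "(if degree p = 1 then - 1 else 1 :: real) ^ (l - 1) = 1" using p(2,3) by auto
    then show ?thesis using N_adj_power[OF p(1), of "l - 1" x y] symform_sym[OF symB] by (simp add: bform_def j)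
  qed
  have "linear (\<beta> j x)" for x by (auto intro!: linearI simp: bform_def j Br algebra_simps)
  then show ?thesis using s by (auto simp: symform_def)
qed

lemma bform_sigma: "self_dual (fst j) \<Longrightarrow> \<beta> j (\<sigma> x) (\<sigma> y) = \<beta> j x y"
  by (cases j) (simp add: bform_def N_sigma B_sigma)

lemma subspace_kerp: "subspace (kerp \<sigma> j)"
  by (cases j) (auto simp: kerp_def subspace_def linear_add[OF lin_act] linear_scale[OF lin_act] linear_0[OF lin_act])

lemma stable_kerp: "stable \<sigma> (kerp \<sigma> j)"
  using subspace_kerp by (cases j) (auto simp: stable_def kerp_def linear_0[OF lin] simp flip: sigma_act)

lemma stable_inter: "stable \<sigma> U \<Longrightarrow> stable \<sigma> V \<Longrightarrow> stable \<sigma> (U \<inter> V)"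
  by (auto simp: stable_def subspace_inter)

section \<open>Non-degenerate free summands on one or two generators\<close>

lemma free_block:
  assumes p: "self_dual p" and E: "finite E" "\<And>e. e \<in> E \<Longrightarrow> act (p ^ l) e = 0"
    and U: "U = range (\<lambda>c. \<Sum>e\<in>E. act (c e) e)"
    and H: "\<And>c. \<forall>y\<in>U. B (act (p ^ (l - 1)) (\<Sum>e\<in>E. act (c e) e)) y = 0 \<Longrightarrow> \<forall>e\<in>E. p dvd c e"
  shows "stable \<sigma> U" "quot_module_basis \<sigma> (p ^ l) U E" "nondeg_on B U"
proof -
  have sub: "subspace U" unfolding subspace_def
  proof (intro conjI ballI allI)
    show "0 \<in> U" unfolding U by (rule range_eqI[of _ _ "\<lambda>_. 0"]) simp
    fix x y c assume "x \<in> U" 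
    then obtain a where a: "x = (\<Sum>e\<in>E. act (a e) e)" unfolding U by blast
    then show "c *\<^sub>R x \<in> U" unfolding U
      by (intro range_eqI[of _ _ "\<lambda>e. Polynomial.smult c (a e)"]) (simp add: poly_act_smult scaleR_sum_right)
    assume "y \<in> U"
    then obtain b where b: "y = (\<Sum>e\<in>E. act (b e) e)" unfolding U by blast
    show "x + y \<in> U" unfolding U
      by (intro range_eqI[of _ _ "\<lambda>e. a e + b e"]) (simp add: a b poly_act_add sum.distrib)
  qed
  have actU: "act q (\<Sum>e\<in>E. act (c e) e) = (\<Sum>e\<in>E. act (q * c e) e)" for q c
    by (simp add: linear_sum[OF lin_act] poly_act_mult[OF lin])
  show st: "stable \<sigma> U" unfolding stable_def
  proof (intro conjI ballI sub)
    fix x assume "x \<in> U"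
    then obtain a where a: "x = (\<Sum>e\<in>E. act (a e) e)" unfolding U by blast
    then show "\<sigma> x \<in> U" unfolding U using actU[of "[:0, 1:]" a] by (auto simp: poly_act_X[OF lin])
  qed
  \<comment> \<open>If p^k divides the coefficients of a vector orthogonal to \<open>U\<close>, then
    the quotients \<open>d\<close> give, after multiplication by p^(l - 1), again a vector
    orthogonal to \<open>U\<close>, and \<open>H\<close> supplies one more factor p. So freeness and
    non-degeneracy both reduce to the condition \<open>H\<close> modulo p.\<close>
  have key: "\<forall>e\<in>E. p ^ k dvd c e" if "\<forall>y\<in>U. B (\<Sum>e\<in>E. act (c e) e) y = 0" "k \<le> l" for c k
    using that(2)
  proof (induction k)
    case (Suc k)
    then have "\<forall>e\<in>E. p ^ k dvd c e" by simp
    then obtain d where d: "\<And>e. e \<in> E \<Longrightarrow> c e = p ^ k * d e" unfolding dvd_def by metis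
    have "(\<Sum>e\<in>E. act (c e) e) = act (p ^ k) (\<Sum>e\<in>E. act (d e) e)"
      using d by (simp add: actU cong: sum.cong)
    moreover have "act (p ^ (l - 1)) z = act (p ^ (l - 1 - k)) (act (p ^ k) z)" for z
      using Suc.prems by (simp flip: poly_act_mult[OF lin] power_add)
    ultimately have e: "act (p ^ (l - 1)) (\<Sum>e\<in>E. act (d e) e) = act (p ^ (l - 1 - k)) (\<Sum>e\<in>E. act (c e) e)"
      by simp
    have "\<forall>x\<in>U. act q x \<in> U" for q using stable_act[OF st] by blast
    have "(\<Sum>e\<in>E. act (c e) e) \<in> perp B UNIV U" using that(1) symform_sym[OF symB] by (auto simp: perp_def)
    moreover have "stable \<sigma> (perp B UNIV U)" by (intro stable_perp st) (auto simp: stable_def)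
    ultimately have "act (p ^ (l - 1 - k)) (\<Sum>e\<in>E. act (c e) e) \<in> perp B UNIV U" using stable_act by blast
    then have "\<forall>y\<in>U. B (act (p ^ (l - 1)) (\<Sum>e\<in>E. act (d e) e)) y = 0"
      using symform_sym[OF symB] unfolding e by (auto simp: perp_def)
    then have "\<forall>e\<in>E. p dvd d e" by (rule H)
    then show ?case using d by (auto simp: mult.commute)
  qed simp
  have zero: "(\<Sum>e\<in>E. act (c e) e) = 0" if "\<forall>e\<in>E. p ^ l dvd c e" for c
    using that poly_act_dvd_0[OF lin _ E(2)] by (intro sum.neutral) blast
  show "nondeg_on B U" unfolding nondeg_on_def
  proof (intro ballI impI)
    fix x assume "x \<in> U" "\<forall>y\<in>U. B x y = 0"
    moreover obtain c where "x = (\<Sum>e\<in>E. act (c e) e)" using \<open>x \<in> U\<close> unfolding U by blast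
    ultimately show "x = 0" using key[of c l] zero[of c] by simp
  qed
  have "E \<subseteq> U"
  proof
    fix f assume f: "f \<in> E"
    have "(\<Sum>e\<in>E. act (if e = f then 1 else 0) e) = (\<Sum>e\<in>E. if e = f then e else 0)"
      by (intro sum.cong) auto
    then have "f = (\<Sum>e\<in>E. act (if e = f then 1 else 0) e)" using f E(1) by simp
    then show "f \<in> U" unfolding U by (rule range_eqI[where x = "\<lambda>e. if e = f then 1 else 0"])
  qed
  moreover have "\<forall>w\<in>U. act (p ^ l) w = 0" unfolding U by (auto simp: actU intro!: zero)
  moreover have "\<forall>c. (\<Sum>e\<in>E. act (c e) e) = 0 \<longrightarrow> (\<forall>e\<in>E. p ^ l dvd c e)"
    using key[of _ l] by (simp add: Br)
  ultimately show "quot_module_basis \<sigma> (p ^ l) U E" using E(1) U by (auto simp: quot_module_basis_def)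
qed

lemma perp_N:
  assumes p: "self_dual p" and "stable \<sigma> U" "\<forall>y\<in>U. B (act (p ^ k) z) y = 0" "y \<in> U"
  shows "B ((N p ^^ k) z) y = 0"
proof -
  have "act (p ^ k) z \<in> perp B UNIV U" using assms(3) symform_sym[OF symB] by (auto simp: perp_def)
  moreover have "stable \<sigma> (perp B UNIV U)" by (intro stable_perp assms) (auto simp: stable_def)
  ultimately have "(N p ^^ k) z \<in> perp B UNIV U" by (simp add: N_power[OF p] eta_power_stable)
  then show ?thesis using assms(4) symform_sym[OF symB] by (auto simp: perp_def)
qed

text \<open>If p does not divide the coefficient c of u, then c is invertible modulo p, and the
  orthogonality of p^(l - 1) c u to the cyclic subspace passes on to p^(l - 1) u. This contradicts
  the last hypothesis.\<close>

lemma cyc_block: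
  assumes p: "self_dual p" "act (p ^ l) u = 0" "l \<ge> 1" "B ((N p ^^ (l - 1)) u) u \<noteq> 0"
  shows "quot_module_basis \<sigma> (p ^ l) (cyc \<sigma> u) {u}" "nondeg_on B (cyc \<sigma> u)"
proof -
  have U: "cyc \<sigma> u = range (\<lambda>c. \<Sum>e\<in>{u}. act (c e) e)"
    unfolding cyc_def by (auto intro: range_eqI[of _ _ "\<lambda>_. _"])
  have H: "\<forall>e\<in>{u}. p dvd c e"
    if z: "\<forall>y\<in>cyc \<sigma> u. B (act (p ^ (l - 1)) (\<Sum>e\<in>{u}. act (c e) e)) y = 0" for c
  proof (rule ccontr)
    assume "\<not> (\<forall>e\<in>{u}. p dvd c e)"
    then have "coprime p (c u)" using self_dual_not_dvd_coprime[OF p(1)] by simp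
    then obtain a b where ab: "a * p + b * c u = 1" using bezout_coprime by blast
    let ?P = "perp B UNIV (cyc \<sigma> u)"
    have "stable \<sigma> ?P" by (intro stable_perp stable_cyc) (auto simp: stable_def)
    moreover have "act (p ^ (l - 1)) (act (c u) u) \<in> ?P"
      using z symform_sym[OF symB] by (auto simp: perp_def)
    ultimately have "act b (act (p ^ (l - 1)) (act (c u) u)) \<in> ?P" using stable_act by blast
    also have "act b (act (p ^ (l - 1)) (act (c u) u)) = act (p ^ (l - 1) * (b * c u)) u"
      by (simp flip: poly_act_mult[OF lin] add: mult_ac)
    \<comment> \<open>Bezout replaces \<open>b * c u\<close> by 1; the error term contains p^l and
      kills u.\<close>
    also have "p ^ (l - 1) * (b * c u) = p ^ (l - 1) * (a * p + b * c u) - a * (p * p ^ (l - 1))"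
      by (simp add: algebra_simps)
    also have "\<dots> = p ^ (l - 1) - a * p ^ l" unfolding ab using p(3) by (simp flip: power_Suc)
    also have "act \<dots> u = act (p ^ (l - 1)) u"
      using p(2) by (simp add: poly_act_diff poly_act_mult[OF lin] linear_0[OF lin_act])
    finally have "\<forall>y\<in>cyc \<sigma> u. B (act (p ^ (l - 1)) u) y = 0"
      using symform_sym[OF symB] by (auto simp: perp_def)
    then show False using perp_N[OF p(1) stable_cyc _ cyc_base] p(4) by blast
  qed
  show "quot_module_basis \<sigma> (p ^ l) (cyc \<sigma> u) {u}" "nondeg_on B (cyc \<sigma> u)"
    using free_block(2,3)[OF p(1) _ _ U H] p(2) by auto
qed

text \<open>Modulo p = x + c a polynomial equals its value at -c, and multiples of p disappear
  because p^l annihilates u.\<close>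

lemma N_act_linear:
  assumes p: "p = [:c, 1:]" "self_dual p" and u: "act (p ^ l) u = 0" "l \<ge> 1"
  shows "(N p ^^ (l - 1)) (act a u) = poly a (- c) *\<^sub>R (N p ^^ (l - 1)) u"
proof -
  obtain q where q: "a = p * q + [:poly a (- c):]"
  proof -
    have "[:- (- c), 1:] dvd a - [:poly a (- c):]" unfolding poly_eq_0_iff_dvd[symmetric] by simp
    then obtain q where "a - [:poly a (- c):] = p * q" using p(1) by (auto simp: dvd_def)
    then show ?thesis using that[of q] by (simp add: algebra_simps)
  qed
  have "(N p ^^ (l - 1)) (act (p * q) u) = 0"
  proof (rule N_0[OF p(2)])
    have "act (p ^ (l - 1)) (act (p * q) u) = act q (act (p ^ l) u)"
      using u(2) by (simp flip: poly_act_mult[OF lin] power_Suc add: mult_ac) (simp add: power_eq_if mult_ac)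
    then show "act (p ^ (l - 1)) (act (p * q) u) = 0" using u(1) by (simp add: linear_0[OF lin_act])
  qed
  moreover have "act a u = act (p * q) u + poly a (- c) *\<^sub>R u"
    by (subst q) (simp add: poly_act_add poly_act_const)
  ultimately show ?thesis
    using N_linear[OF p(2), of "l - 1"] by (simp add: linear_add linear_scale)
qed

text \<open>For p linear and l even the form B (N^(l - 1) x) y is alternating, so
  \<open>cyc_block\<close> never applies; two vectors with non-zero pairing take the place of one.
  Evaluating a combination at v and at u shows that both coefficients vanish at -c.\<close>

lemma pair_block:
  assumes p: "self_dual p" "degree p = 1" and l: "even l" "l \<ge> 1"
    and uv: "act (p ^ l) u = 0" "act (p ^ l) v = 0" "B ((N p ^^ (l - 1)) u) v \<noteq> 0"
    and U: "U = range (\<lambda>c. \<Sum>e\<in>{u, v}. act (c e) e)"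
  shows "u \<noteq> v" "stable \<sigma> U" "quot_module_basis \<sigma> (p ^ l) U {u, v}" "nondeg_on B U"
    "\<And>x. B ((N p ^^ (l - 1)) x) x = 0"
proof -
  obtain c where c: "p = [:c, 1:]" using p self_dual_cases by (metis degree_pCons_eq_if One_nat_def numeral_2_eq_2 nat.inject one_neq_zero pCons_eq_0_iff zero_neq_one)
  have sk: "B ((N p ^^ (l - 1)) x) y = - B ((N p ^^ (l - 1)) y) x" for x y
  proof -
    have "(- 1 :: real) ^ (l - 1) = - 1" using l by simp
    then show ?thesis using N_adj_power[OF p(1), of "l - 1" x y] p(2) symform_sym[OF symB] by simp
  qed
  show s0: "B ((N p ^^ (l - 1)) x) x = 0" for x using sk[of x x] by simp
  then show ne: "u \<noteq> v" using uv(3) by auto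
  have in_U: "u \<in> U" "v \<in> U"
  proof -
    show "u \<in> U" unfolding U by (rule range_eqI[where x = "\<lambda>e. if e = u then 1 else 0"]) (use ne in auto)
    show "v \<in> U" unfolding U by (rule range_eqI[where x = "\<lambda>e. if e = v then 1 else 0"]) (use ne in auto)
  qed
  have stU: "stable \<sigma> U"
  proof -
    have "U = ssum (cyc \<sigma> u) (cyc \<sigma> v)"
    proof
      show "U \<subseteq> ssum (cyc \<sigma> u) (cyc \<sigma> v)" unfolding U ssum_def cyc_def using ne by auto
      show "ssum (cyc \<sigma> u) (cyc \<sigma> v) \<subseteq> U"
      proof
        fix x assume "x \<in> ssum (cyc \<sigma> u) (cyc \<sigma> v)"
        then obtain a b where "x = act a u + act b v" by (auto simp: ssum_def cyc_def)
        then have "x = (\<Sum>e\<in>{u, v}. act ((\<lambda>e. if e = u then a else b) e) e)" using ne by auto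
        then show "x \<in> U" unfolding U by (rule range_eqI[where x = "\<lambda>e. if e = u then a else b"])
      qed
    qed
    then show ?thesis by (simp add: stable_ssum stable_cyc)
  qed
  have H: "\<forall>e\<in>{u, v}. p dvd d e"
    if z: "\<forall>y\<in>U. B (act (p ^ (l - 1)) (\<Sum>e\<in>{u, v}. act (d e) e)) y = 0" for d
  proof -
    have n: "B ((N p ^^ (l - 1)) (\<Sum>e\<in>{u, v}. act (d e) e)) y = 0" if "y \<in> U" for y
      using perp_N[OF p(1) stU z that] .
    have "(N p ^^ (l - 1)) (\<Sum>e\<in>{u, v}. act (d e) e)
        = poly (d u) (- c) *\<^sub>R (N p ^^ (l - 1)) u + poly (d v) (- c) *\<^sub>R (N p ^^ (l - 1)) v"
      using ne N_linear[OF p(1), of "l - 1"] N_act_linear[OF c p(1) uv(1) l(2)] N_act_linear[OF c p(1) uv(2) l(2)]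
      by (simp add: linear_add)
    then have "poly (d u) (- c) = 0" "poly (d v) (- c) = 0"
      using n[OF in_U(2)] n[OF in_U(1)] uv(3) s0 sk[of v u] by (simp_all add: Br)
    then show ?thesis using c by (simp add: poly_eq_0_iff_dvd)
  qed
  show "stable \<sigma> U" "quot_module_basis \<sigma> (p ^ l) U {u, v}" "nondeg_on B U"
    using free_block[OF p(1) _ _ U H] uv by auto
qed

end

lemma bform_minus: "bform (\<lambda>x y. - B x y) \<sigma> j = (\<lambda>x y. - bform B \<sigma> j x y)"
  by (cases j) (simp add: bform_def)

lemma pos_minus: "pos (\<lambda>x y. - B x y) \<sigma> j U = neg B \<sigma> j U"
  and neg_minus: "neg (\<lambda>x y. - B x y) \<sigma> j U = pos B \<sigma> j U"
  by (simp_all add: pos_def neg_def bform_minus nidx_def)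

context isom begin

text \<open>Reversing the sign of the form exchanges \<open>pos\<close> and \<open>neg\<close>.
  Statements on negative blocks and negative indices follow by interpreting the locale for
  -B.\<close>

lemma isom_minus: "isom Bas (\<lambda>x y. - B x y) \<sigma>"
proof unfold_locales
  show "nondegenerate_form (\<lambda>x y. - B x y)"
    using nondegenerate_B by (auto simp: nondegenerate_form_def intro: linear_compose_neg)
  show "\<sigma> \<in> O_group (\<lambda>x y. - B x y)" using sigma_O by (auto simp: O_group_def)
qed

section \<open>Local indices of free and of cyclic summands\<close>

lemma free_independent:
  "quot_module_basis \<sigma> m U E \<Longrightarrow> (\<Sum>e\<in>E. act (c e) e) = 0 \<Longrightarrow> e \<in> E \<Longrightarrow> m dvd c e"
  by (simp add: quot_module_basis_def)

lemma free_ker: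
  assumes E: "quot_module_basis \<sigma> (p ^ i) U E" and "p \<noteq> 0" "x \<in> U" "act (p ^ l) x = 0" "l \<le> i"
  shows "\<exists>y\<in>U. x = act (p ^ (i - l)) y"
proof -
  obtain c where c: "x = (\<Sum>e\<in>E. act (c e) e)" using assms by (auto simp: quot_module_basis_def)
  have "(\<Sum>e\<in>E. act (p ^ l * c e) e) = 0"
    using assms(4) unfolding c by (simp add: linear_sum[OF lin_act] poly_act_mult[OF lin])
  then have d: "\<forall>e\<in>E. p ^ i dvd p ^ l * c e" using free_independent[OF E, of "\<lambda>e. p ^ l * c e"] by blast
  have "p ^ i = p ^ l * p ^ (i - l)" using assms(5) by (simp flip: power_add)
  then have "\<forall>e\<in>E. p ^ (i - l) dvd c e" using d assms(2) by simp
  then obtain d where d: "\<And>e. e \<in> E \<Longrightarrow> c e = p ^ (i - l) * d e" unfolding dvd_def by metis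
  have "x = act (p ^ (i - l)) (\<Sum>e\<in>E. act (d e) e)"
    using d unfolding c by (simp add: linear_sum[OF lin_act] poly_act_mult[OF lin] cong: sum.cong)
  moreover have "(\<Sum>e\<in>E. act (d e) e) \<in> U" using E by (auto simp: quot_module_basis_def)
  ultimately show ?thesis by blast
qed

text \<open>Each new generator e adds the cyclic subspace of q(\<sigma>) e, whose annihilator is m'
  = m / q; freeness of the family makes the sum direct.\<close>

lemma dim_free_family:
  assumes "finite E" "\<forall>c. (\<Sum>e\<in>E. act (c e) e) = 0 \<longrightarrow> (\<forall>e\<in>E. m dvd c e)"
    "\<forall>e\<in>E. act m e = 0" "m = q * m'" "m \<noteq> 0"
  shows "subspace (range (\<lambda>c. \<Sum>e\<in>E. act (q * c e) e)) \<and>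
    dim (range (\<lambda>c. \<Sum>e\<in>E. act (q * c e) e)) = degree m' * card E"
  using assms(1-3)
proof (induction E)
  case empty
  have "range (\<lambda>c. \<Sum>e\<in>{}. act (q * c e) e) = {0}" by auto
  then show ?case by (simp add: subspace_single_0)
next
  case (insert e E)
  let ?S = "range (\<lambda>c. \<Sum>e\<in>E. act (q * c e) e)"
  have ind: "\<forall>c. (\<Sum>e\<in>E. act (c e) e) = 0 \<longrightarrow> (\<forall>e\<in>E. m dvd c e)"
  proof (intro allI impI)
    fix c assume "(\<Sum>e\<in>E. act (c e) e) = 0"
    moreover define d where "d = c(e := 0)"
    moreover have "(\<Sum>f\<in>E. act (d f) f) = (\<Sum>f\<in>E. act (c f) f)"
      using insert.hyps by (intro sum.cong) (auto simp: d_def)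
    ultimately have "(\<Sum>f\<in>insert e E. act (d f) f) = 0" using insert.hyps by (simp add: d_def)
    then have "\<forall>f\<in>insert e E. m dvd d f" using insert.prems(1) by blast
    then show "\<forall>e\<in>E. m dvd c e" using insert.hyps(2) by (auto simp: d_def split: if_splits)
  qed
  then have IH: "subspace ?S" "dim ?S = degree m' * card E" using insert by auto
  have eq: "range (\<lambda>c. \<Sum>e\<in>insert e E. act (q * c e) e) = ssum (cyc \<sigma> (act q e)) ?S"
  proof
    show "range (\<lambda>c. \<Sum>e\<in>insert e E. act (q * c e) e) \<subseteq> ssum (cyc \<sigma> (act q e)) ?S"
      using insert.hyps by (auto simp: cyc_def poly_act_mult[OF lin] poly_act_commute_mult[OF lin, of q] intro!: ssumI)
    show "ssum (cyc \<sigma> (act q e)) ?S \<subseteq> range (\<lambda>c. \<Sum>e\<in>insert e E. act (q * c e) e)"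
    proof
      fix x assume "x \<in> ssum (cyc \<sigma> (act q e)) ?S"
      then obtain a c where "x = act a (act q e) + (\<Sum>e\<in>E. act (q * c e) e)"
        by (auto simp: cyc_def elim!: ssumE)
      moreover have "(\<Sum>f\<in>E. act (q * c f) f) = (\<Sum>f\<in>E. act (q * (c(e := a)) f) f)"
        using insert.hyps(2) by (intro sum.cong) auto
      ultimately have "x = (\<Sum>f\<in>insert e E. act (q * (c(e := a)) f) f)"
        using insert.hyps by (simp add: poly_act_mult[OF lin] poly_act_commute_mult[OF lin, of q])
      then show "x \<in> range (\<lambda>c. \<Sum>e\<in>insert e E. act (q * c e) e)"
        by (rule range_eqI[where x = "c(e := a)"])
    qed
  qed
  have relation: "m dvd a" if "act a e = (\<Sum>f\<in>E. act (c f) f)" for a c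
  proof -
    define d where "d = (\<lambda>f. if f = e then a else - c f)"
    have "(\<Sum>f\<in>E. act (d f) f) = (\<Sum>f\<in>E. - act (c f) f)"
      using insert.hyps(2) by (intro sum.cong) (auto simp: poly_act_uminus d_def)
    then have "(\<Sum>f\<in>insert e E. act (d f) f) = 0"
      using insert.hyps that by (simp add: sum_negf d_def)
    then have "m dvd d e" using insert.prems(1) by blast
    then show ?thesis by (simp add: d_def)
  qed
  have q0: "q \<noteq> 0" "m' \<noteq> 0" using assms(4,5) by auto
  have ann: "act a (act q e) = 0 \<longleftrightarrow> m' dvd a" for a
  proof
    assume "act a (act q e) = 0"
    then have "m dvd a * q" using relation[of "a * q" "\<lambda>_. 0"] by (simp add: poly_act_mult[OF lin])
    then show "m' dvd a" using assms(4) q0 by (simp add: mult.commute)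
  next
    assume "m' dvd a"
    then have "m dvd a * q" using assms(4) by (simp add: mult.commute)
    then show "act a (act q e) = 0" using insert.prems(2) poly_act_dvd_0[OF lin, of m "a * q" e] by (simp add: poly_act_mult[OF lin])
  qed
  have "cyc \<sigma> (act q e) \<inter> ?S \<subseteq> {0}"
  proof
    fix x assume "x \<in> cyc \<sigma> (act q e) \<inter> ?S"
    moreover from this obtain a where x: "x = act (a * q) e" by (auto simp: cyc_def poly_act_mult[OF lin])
    ultimately obtain c where "x = (\<Sum>e\<in>E. act (q * c e) e)" by blast
    then have "m dvd a * q" using relation[of "a * q" "\<lambda>e. q * c e"] x by simp
    then show "x \<in> {0}" using x insert.prems(2) poly_act_dvd_0[OF lin, of m "a * q" e] by simp
  qed
  then have "dim (ssum (cyc \<sigma> (act q e)) ?S) = dim (cyc \<sigma> (act q e)) + dim ?S"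
    by (intro dim_ssum IH subspace_cyc[OF lin])
  also have "dim (cyc \<sigma> (act q e)) = degree m'" by (rule dim_cyc[OF lin q0(2) ann])
  finally show ?case unfolding eq using IH insert.hyps subspace_ssum[OF subspace_cyc[OF lin]] by simp
qed

lemma dim_free_mult:
  assumes E: "quot_module_basis \<sigma> m U E" and m: "m = q * m'" "m \<noteq> 0"
  shows "dim (act q ` U) = degree m' * card E"
proof -
  have "act q ` U = range (\<lambda>c. \<Sum>e\<in>E. act (q * c e) e)"
    using E by (auto simp: quot_module_basis_def linear_sum[OF lin_act] poly_act_mult[OF lin] image_iff)
  moreover have "finite E" "\<forall>c. (\<Sum>e\<in>E. act (c e) e) = 0 \<longrightarrow> (\<forall>e\<in>E. m dvd c e)" "\<forall>e\<in>E. act m e = 0"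
    using E by (auto simp: quot_module_basis_def)
  ultimately show ?thesis using dim_free_family[OF _ _ _ m] by simp
qed

lemma free_stable:
  assumes E: "quot_module_basis \<sigma> m U E" shows "stable \<sigma> U"
proof -
  have U: "U = range (\<lambda>c. \<Sum>e\<in>E. act (c e) e)" using E by (simp add: quot_module_basis_def)
  have "\<sigma> x \<in> U" if x: "x \<in> U" for x
  proof -
    obtain a where "x = (\<Sum>e\<in>E. act (a e) e)" using x unfolding U by blast
    then have "\<sigma> x = (\<Sum>e\<in>E. act ([:0, 1:] * a e) e)"
      by (simp only: linear_sum[OF lin] poly_act_mult[OF lin] poly_act_X[OF lin])
    then show ?thesis unfolding U by (rule range_eqI[where x = "\<lambda>e. [:0, 1:] * a e"])
  qed
  moreover have "subspace U" unfolding subspace_def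
  proof (intro conjI ballI allI)
    show "0 \<in> U" unfolding U by (rule range_eqI[of _ _ "\<lambda>_. 0"]) simp
    fix x y c assume "x \<in> U" 
    then obtain a where a: "x = (\<Sum>e\<in>E. act (a e) e)" unfolding U by blast
    then show "c *\<^sub>R x \<in> U" unfolding U
      by (intro range_eqI[of _ _ "\<lambda>e. Polynomial.smult c (a e)"]) (simp add: poly_act_smult scaleR_sum_right)
    assume "y \<in> U"
    then obtain b where b: "y = (\<Sum>e\<in>E. act (b e) e)" unfolding U by blast
    show "x + y \<in> U" unfolding U
      by (intro range_eqI[of _ _ "\<lambda>e. a e + b e"]) (simp add: a b poly_act_add sum.distrib)
  qed
  ultimately show ?thesis by (simp add: stable_def)
qed

lemma free_annihilated: "quot_module_basis \<sigma> m U E \<Longrightarrow> x \<in> U \<Longrightarrow> act m x = 0"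
  by (simp add: quot_module_basis_def)

lemma admissibleD: "admissible (p, l) \<Longrightarrow> self_dual p" "admissible (p, l) \<Longrightarrow> l \<ge> 1"
  "admissible (p, l) \<Longrightarrow> degree p = 1 \<Longrightarrow> odd l"
  by (auto simp: admissible_def)

text \<open>For i < l the operator N^(l - 1) already vanishes on U. For i > l both arguments lie in
  the image of p^(i - l); moving this factor from y over to x brings the total exponent to (l - 1) +
  2 (i - l), which is at least i.\<close>

lemma free_bform_vanish:
  assumes j: "admissible (p, l)" and E: "quot_module_basis \<sigma> (p ^ i) U E" and "i \<noteq> l"
    and xy: "x \<in> U \<inter> kerp \<sigma> (p, l)" "y \<in> U \<inter> kerp \<sigma> (p, l)"
  shows "\<beta> (p, l) x y = 0"
proof -
  note p = admissibleD(1)[OF j]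
  show ?thesis
  proof (cases "i < l")
    case True
    then have "act (p ^ (l - 1)) x = 0" using free_annihilated[OF E, of x] xy(1) act_power_mono[of p i x "l - 1"] by simp
    then show ?thesis using N_0[OF p] by (simp add: bform_def Br)
  next
    case False
    then have il: "l < i" using assms(3) by simp
    then obtain x' y' where x': "x = act (p ^ (i - l)) x'" "x' \<in> U" and y': "y = act (p ^ (i - l)) y'"
      using free_ker[OF E self_dual_nz[OF p], of x l] free_ker[OF E self_dual_nz[OF p], of y l] xy
      by (auto simp: kerp_def)
    have "act (p ^ (i - l)) ((N p ^^ (l - 1)) x) = (eta p ^^ (l - 1)) (act (p ^ ((i - l) + ((l - 1) + (i - l)))) x')"
      unfolding N_power[OF p] x'(1) by (simp only: power_add poly_act_mult[OF lin] eta_power_act)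
    also have "act (p ^ ((i - l) + ((l - 1) + (i - l)))) x' = 0"
      using free_annihilated[OF E x'(2)] by (rule act_power_mono) (use il admissibleD(2)[OF j] in linarith)
    finally have "act (p ^ (i - l)) ((N p ^^ (l - 1)) x) = 0" by (simp add: linear_0[OF eta_power_linear])
    then have "B ((N p ^^ (l - 1)) x) y = 0" unfolding y' by (rule self_dual_adj_0[OF p])
    then show ?thesis by (simp add: bform_def)
  qed
qed

lemma subspace_Int_kerp: "stable \<sigma> U \<Longrightarrow> subspace (U \<inter> kerp \<sigma> j)"
  by (simp add: stable_def subspace_inter subspace_kerp)

lemma pos_neg_vanish:
  assumes "stable \<sigma> U" "\<And>x. x \<in> U \<inter> kerp \<sigma> j \<Longrightarrow> \<beta> j x x = 0"
  shows "pos B \<sigma> j U = 0" "neg B \<sigma> j U = 0"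
  unfolding pos_def neg_def nidx_def using assms by (auto intro!: pidx_nonpos subspace_Int_kerp)

lemma pos_neg_free_other:
  assumes "admissible (p, l)" "quot_module_basis \<sigma> (p ^ i) U E" "i \<noteq> l"
  shows "pos B \<sigma> (p, l) U = 0" "neg B \<sigma> (p, l) U = 0"
  using pos_neg_vanish[OF free_stable[OF assms(2)]] free_bform_vanish[OF assms] by auto

lemma pos_neg_coprime:
  assumes j: "admissible (p, l)" and U: "stable \<sigma> U" "\<And>x. x \<in> U \<Longrightarrow> act m x = 0" and "coprime m p"
  shows "pos B \<sigma> (p, l) U = 0" "neg B \<sigma> (p, l) U = 0"
proof -
  have "\<beta> (p, l) x x = 0" if "x \<in> U \<inter> kerp \<sigma> (p, l)" for x
  proof -
    have "x = 0" using that U(2) assms(4) coprime_kernel[OF lin, of m "p ^ l" x] by (auto simp: kerp_def)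
    then show ?thesis using symform_rules[OF symform_bform[OF j]] by simp
  qed
  then show "pos B \<sigma> (p, l) U = 0" "neg B \<sigma> (p, l) U = 0" using pos_neg_vanish[OF U(1)] by auto
qed

text \<open>If x is in the radical, then N^(l - 1) x is orthogonal to U and so vanishes; in a free
  module this makes x divisible by p. Thus the local form is really one on U modulo p(\<sigma>)
  U.\<close>

lemma radical_free:
  assumes j: "admissible (p, l)" and E: "quot_module_basis \<sigma> (p ^ l) U E" and n: "nondeg_on B U"
  shows "rad_on (\<beta> (p, l)) U = act p ` U"
proof -
  note p = admissibleD(1)[OF j] and l = admissibleD(2)[OF j]
  have st: "stable \<sigma> U" by (rule free_stable[OF E])
  show ?thesis
  proof
    show "rad_on (\<beta> (p, l)) U \<subseteq> act p ` U"
    proof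
      fix x assume "x \<in> rad_on (\<beta> (p, l)) U"
      then have x: "x \<in> U" "\<forall>y\<in>U. B ((N p ^^ (l - 1)) x) y = 0" by (auto simp: rad_on_def bform_def)
      then have "(N p ^^ (l - 1)) x = 0" using n N_stable[OF p st x(1)] by (auto simp: nondeg_on_def)
      then have "act (p ^ (l - 1)) x = 0" using N_0D[OF p] free_annihilated[OF E x(1)] by blast
      then obtain y where "y \<in> U" "x = act (p ^ (l - (l - 1))) y"
        using free_ker[OF E self_dual_nz[OF p] x(1)] by force
      then show "x \<in> act p ` U" using l by simp
    qed
    show "act p ` U \<subseteq> rad_on (\<beta> (p, l)) U"
    proof clarify
      fix y assume y: "y \<in> U"
      have "act (p ^ (l - 1)) (act p y) = act (p ^ l) y"
        using l by (simp flip: poly_act_mult[OF lin] power_Suc2)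
      then have "(N p ^^ (l - 1)) (act p y) = 0" using N_0[OF p] free_annihilated[OF E y] by simp
      then show "act p y \<in> rad_on (\<beta> (p, l)) U"
        using y stable_act[OF st] by (auto simp: rad_on_def bform_def Br)
    qed
  qed
qed

lemma free_Int_kerp: "quot_module_basis \<sigma> (p ^ l) U E \<Longrightarrow> U \<inter> kerp \<sigma> (p, l) = U"
  by (auto simp: kerp_def free_annihilated)

text \<open>By \<open>radical_free\<close> the two indices add up to the codimension of p(\<sigma>)
  U in U, to which every basis element contributes \<open>degree p\<close>.\<close>

lemma pos_neg_free:
  assumes j: "admissible (p, l)" and E: "quot_module_basis \<sigma> (p ^ l) U E" and n: "nondeg_on B U"
  shows "pos B \<sigma> (p, l) U + neg B \<sigma> (p, l) U = degree p * card E"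
proof -
  note p = admissibleD(1)[OF j] and l = admissibleD(2)[OF j]
  have p0: "p ^ l \<noteq> 0" using self_dual_nz[OF p] by simp
  have e: "p ^ l = p * p ^ (l - 1)" using l by (simp flip: power_Suc)
  have "dim (act p ` U) = degree (p ^ (l - 1)) * card E" by (rule dim_free_mult[OF E e p0])
  moreover have "dim (act 1 ` U) = degree (p ^ l) * card E" by (rule dim_free_mult[OF E _ p0]) simp
  moreover have "degree (p ^ l) = degree p + degree (p ^ (l - 1))"
    unfolding e using p0 e self_dual_nz[OF p] by (intro degree_mult_eq) auto
  moreover have "pos B \<sigma> (p, l) U + neg B \<sigma> (p, l) U + dim (act p ` U) = dim U"
    using pidx_nidx_radical[OF stable_subspace[OF free_stable[OF E]] symform_bform[OF j]] radical_free[OF j E n]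
    by (simp add: pos_def neg_def free_Int_kerp[OF E])
  ultimately show ?thesis by (simp add: algebra_simps)
qed

text \<open>If p^l kills a + b, then p^l a = - p^l b lies in both summands and is 0.\<close>

lemma kerp_ssum:
  assumes st: "stable \<sigma> U1" "stable \<sigma> U2" and 0: "U1 \<inter> U2 \<subseteq> {0}"
  shows "ssum U1 U2 \<inter> kerp \<sigma> j = ssum (U1 \<inter> kerp \<sigma> j) (U2 \<inter> kerp \<sigma> j)"
proof
  obtain p l where j: "j = (p, l)" by (cases j)
  show "ssum (U1 \<inter> kerp \<sigma> j) (U2 \<inter> kerp \<sigma> j) \<subseteq> ssum U1 U2 \<inter> kerp \<sigma> j"
    by (auto simp: ssum_def intro: subspace_add[OF subspace_kerp])
  show "ssum U1 U2 \<inter> kerp \<sigma> j \<subseteq> ssum (U1 \<inter> kerp \<sigma> j) (U2 \<inter> kerp \<sigma> j)"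
  proof
    fix x assume x: "x \<in> ssum U1 U2 \<inter> kerp \<sigma> j"
    then obtain a b where ab: "a \<in> U1" "b \<in> U2" "x = a + b" by (auto elim: ssumE)
    have "act (p ^ l) a + act (p ^ l) b = 0" using x ab by (simp add: j kerp_def linear_add[OF lin_act])
    then have e: "act (p ^ l) a = - act (p ^ l) b" by (simp add: add_eq_0_iff2)
    moreover have "act (p ^ l) a \<in> U1" "- act (p ^ l) b \<in> U2"
      using ab st stable_act by (auto simp: stable_def intro: subspace_neg)
    ultimately have "act (p ^ l) a = 0" using 0 by auto
    then show "x \<in> ssum (U1 \<inter> kerp \<sigma> j) (U2 \<inter> kerp \<sigma> j)"
      using ab e by (auto simp: j kerp_def intro!: ssumI)
  qed
qed

lemma pos_neg_ssum:
  assumes j: "admissible j" and st: "stable \<sigma> U1" "stable \<sigma> U2" and 0: "U1 \<inter> U2 \<subseteq> {0}" and o: "orth B U1 U2"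
  shows "pos B \<sigma> j (ssum U1 U2) = pos B \<sigma> j U1 + pos B \<sigma> j U2"
    "neg B \<sigma> j (ssum U1 U2) = neg B \<sigma> j U1 + neg B \<sigma> j U2"
proof -
  have "orth (\<beta> j) (U1 \<inter> kerp \<sigma> j) (U2 \<inter> kerp \<sigma> j)"
    using o N_stable[OF _ st(1)] j by (cases j) (auto simp: orth_def bform_def admissible_def)
  then show "pos B \<sigma> j (ssum U1 U2) = pos B \<sigma> j U1 + pos B \<sigma> j U2"
    "neg B \<sigma> j (ssum U1 U2) = neg B \<sigma> j U1 + neg B \<sigma> j U2"
    unfolding pos_def neg_def kerp_ssum[OF st 0]
    by (simp_all add: pidx_ssum nidx_ssum subspace_Int_kerp st symform_bform j)
qed

text \<open>The factor \<gamma> is the same for all u, so cyclic blocks at (p, l) are distinguished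
  by the sign of \<beta> u u alone. For a root \<zeta> of p, the number \<gamma> a a is
  |a(\<zeta>)|^2, hence not negative.\<close>

lemma bform_cyc:
  assumes j: "admissible (p, l)"
  obtains \<gamma> where "\<And>u a b. act (p ^ l) u = 0 \<Longrightarrow> \<beta> (p, l) (act a u) (act b u) = \<gamma> a b * \<beta> (p, l) u u"
    "\<And>a. \<gamma> a a \<ge> (0::real)"
  using admissibleD(1)[OF j]
proof (cases p rule: self_dual_cases)
  case (1 c)
  note r = symform_rules[OF symform_bform[OF j]]
  have e: "\<beta> (p, l) (act a u) y = poly a (- c) * \<beta> (p, l) u y" if "act (p ^ l) u = 0" for a u y
    using N_act_linear[OF 1(1) admissibleD(1)[OF j] that admissibleD(2)[OF j], of a] by (simp add: bform_def Br)
  show ?thesis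
  proof (rule that[of "\<lambda>a b. poly a (- c) * poly b (- c)"])
    show "\<beta> (p, l) (act a u) (act b u) = poly a (- c) * poly b (- c) * \<beta> (p, l) u u" if "act (p ^ l) u = 0" for u a b
      using e[OF that, of a "act b u"] e[OF that, of b u] symform_sym[OF symform_bform[OF j]] by simp
  qed simp
next
  case (2 b)
  note r = symform_rules[OF symform_bform[OF j]] and p = admissibleD(1)[OF j]
  note sym = symform_sym[OF symform_bform[OF j]]
  have degp: "degree p = 2" and p0: "p \<noteq> 0" using 2 by auto
  define a0 where "a0 = (\<lambda>a. coeff (a mod p) 0)"
  define a1 where "a1 = (\<lambda>a. coeff (a mod p) 1)"
  have kill: "\<beta> (p, l) (act (p * q) u) y = 0" if u: "act (p ^ l) u = 0" for q u y
  proof -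
    have "act (p ^ (l - 1)) (act (p * q) u) = act (p ^ l * q) u"
      using admissibleD(2)[OF j] by (simp flip: poly_act_mult[OF lin] power_Suc2 mult.assoc)
    then have "(N p ^^ (l - 1)) (act (p * q) u) = 0"
      using u N_0[OF p] poly_act_commute_mult[OF lin, of "p ^ l" q u] linear_0[OF lin_act] by (simp add: poly_act_mult[OF lin])
    then show ?thesis by (simp add: bform_def Br)
  qed
  have red: "\<beta> (p, l) (act a u) y = a0 a * \<beta> (p, l) u y + a1 a * \<beta> (p, l) (\<sigma> u) y" if u: "act (p ^ l) u = 0" for a u y
  proof -
    have "degree (a mod p) < 2" using degree_mod_less[OF p0, of a] degp by auto
    then have m: "a mod p = [:a0 a, a1 a:]"
      by (intro poly_eqI) (auto simp: a0_def a1_def coeff_pCons coeff_eq_0 split: nat.splits)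
    have "a = p * (a div p) + [:a0 a, a1 a:]" using m by (metis mult_div_mod_eq)
    then have "act a u = act (p * (a div p)) u + act [:a0 a, a1 a:] u" by (metis poly_act_add)
    also have "act [:a0 a, a1 a:] u = a0 a *\<^sub>R u + a1 a *\<^sub>R \<sigma> u"
      by (simp add: poly_act_pCons[OF lin] linear_scale[OF lin] linear_0[OF lin])
    finally show ?thesis using kill[OF u] by (simp add: r)
  qed
  \<comment> \<open>The vector u + b \<sigma> u + \<sigma>^2 u is orthogonal to everything for the
    local form, and \<sigma> preserves this form; pairing with \<sigma> u gives the value.\<close>
  have s1: "\<beta> (p, l) (\<sigma> u) u = - b / 2 * \<beta> (p, l) u u" if u: "act (p ^ l) u = 0" for u
  proof -
    have "act p u = u + b *\<^sub>R \<sigma> u + \<sigma> (\<sigma> u)"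
      using 2 by (simp add: poly_act_pCons[OF lin] linear_0[OF lin] linear_add[OF lin] linear_scale[OF lin])
    then have "\<beta> (p, l) (u + b *\<^sub>R \<sigma> u + \<sigma> (\<sigma> u)) (\<sigma> u) = 0" using kill[OF u, of 1 "\<sigma> u"] by simp
    then have "\<beta> (p, l) u (\<sigma> u) + b * \<beta> (p, l) u u + \<beta> (p, l) (\<sigma> u) u = 0"
      using bform_sigma[of "(p, l)"] p by (simp add: r)
    then show ?thesis using sym[of u "\<sigma> u"] by simp
  qed
  define \<gamma> where "\<gamma> = (\<lambda>c d. a0 c * a0 d + a1 c * a1 d - b / 2 * (a0 c * a1 d + a1 c * a0 d))"
  show ?thesis
  proof (rule that[of \<gamma>])
    fix u c d assume u: "act (p ^ l) u = 0"
    have "\<beta> (p, l) (act c u) (act d u) = a0 c * \<beta> (p, l) u (act d u) + a1 c * \<beta> (p, l) (\<sigma> u) (act d u)"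
      by (rule red[OF u])
    also have "\<beta> (p, l) u (act d u) = a0 d * \<beta> (p, l) u u + a1 d * \<beta> (p, l) (\<sigma> u) u"
      using red[OF u, of d u] sym by simp
    also have "\<beta> (p, l) (\<sigma> u) (act d u) = a0 d * \<beta> (p, l) (\<sigma> u) u + a1 d * \<beta> (p, l) u u"
      using red[OF u, of d "\<sigma> u"] sym bform_sigma[of "(p, l)" u u] p by simp
    finally show "\<beta> (p, l) (act c u) (act d u) = \<gamma> c d * \<beta> (p, l) u u"
      unfolding s1[OF u] \<gamma>_def by (simp add: algebra_simps)
  next
    fix a
    have "\<gamma> a a = (a0 a - b / 2 * a1 a)\<^sup>2 + (1 - b\<^sup>2 / 4) * (a1 a)\<^sup>2"
      by (simp add: \<gamma>_def power2_eq_square algebra_simps)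
    moreover have "(1 - b\<^sup>2 / 4) * (a1 a)\<^sup>2 \<ge> 0" using 2(2) by (intro mult_nonneg_nonneg) auto
    ultimately show "\<gamma> a a \<ge> 0" by simp
  qed
qed

lemma dim_N_image:
  assumes p: "self_dual p" and E: "quot_module_basis \<sigma> (p ^ l) U E" and "k \<le> l"
  shows "dim ((N p ^^ k) ` U) = degree p * (l - k) * card E"
proof -
  have "(N p ^^ k) ` U = (eta p ^^ k) ` (act (p ^ k) ` U)" by (auto simp: N_power[OF p] image_image)
  moreover have "dim ((eta p ^^ k) ` (act (p ^ k) ` U)) = dim (act (p ^ k) ` U)"
  proof (rule dim_image_inj[OF eta_power_linear])
    show "subspace (act (p ^ k) ` U)"
      by (rule linear_subspace_image[OF lin_act stable_subspace[OF free_stable[OF E]]])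
    fix x assume "x \<in> act (p ^ k) ` U" "(eta p ^^ k) x = 0"
    moreover from this(1) have "x \<in> U" using stable_act[OF free_stable[OF E]] by auto
    ultimately show "x = 0" using eta_power_inj[OF p] free_annihilated[OF E] by blast
  qed
  moreover have "dim (act (p ^ k) ` U) = degree (p ^ (l - k)) * card E"
    by (rule dim_free_mult[OF E]) (use assms(3) self_dual_nz[OF p] in \<open>auto simp flip: power_add\<close>)
  moreover have "degree (p ^ (l - k)) = degree p * (l - k)" by (simp add: degree_power_eq self_dual_nz[OF p] mult.commute)
  ultimately show ?thesis by simp
qed

lemma N_image_isotropic:
  assumes p: "self_dual p" and E: "quot_module_basis \<sigma> (p ^ l) U E" and "l \<le> 2 * k"
    and "x \<in> (N p ^^ k) ` U"
  shows "B x x = 0"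
proof -
  obtain y where y: "y \<in> U" "x = (N p ^^ k) y" using assms(4) by auto
  have "(N p ^^ k) ((N p ^^ k) y) = (N p ^^ (2 * k)) y" by (simp add: mult_2 funpow_add)
  also have "\<dots> = 0" using free_annihilated[OF E y(1)] assms(3) act_power_mono N_0[OF p] by blast
  finally show ?thesis using N_adj_power[OF p, of k y x] y(2) by (simp add: Br)
qed

text \<open>The images of powers of N provide subspaces on which B has one sign. Let d be
  \<open>degree p\<close>. For l = 2 k + 1 the image of N^(k + 1) is isotropic of dimension d k, and
  on the image of N^k, of dimension d (k + 1), B is non-negative. The two resulting bounds on the
  indices add up to the dimension of U, so both are attained. For l even there is an isotropic
  subspace of half the dimension.\<close>

lemma cyc_positive:
  assumes j: "admissible (p, l)" and u: "act (p ^ l) u = 0" "\<beta> (p, l) u u > 0"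
  defines "U \<equiv> cyc \<sigma> u"
  shows "quot_module_basis \<sigma> (p ^ l) U {u}" "nondeg_on B U"
    "pos B \<sigma> (p, l) U = degree p" "neg B \<sigma> (p, l) U = 0"
    "\<And>k. admissible k \<Longrightarrow> k \<noteq> (p, l) \<Longrightarrow> pos B \<sigma> k U = 0 \<and> neg B \<sigma> k U = 0"
    "pidx B U = nidx B U + (if odd l then degree p else 0)"
proof -
  note p = admissibleD(1)[OF j] and l = admissibleD(2)[OF j]
  have "B ((N p ^^ (l - 1)) u) u \<noteq> 0" using u(2) by (auto simp: bform_def)
  note cb = cyc_block[OF p u(1) l this]
  show E: "quot_module_basis \<sigma> (p ^ l) U {u}" and n: "nondeg_on B U" using cb by (simp_all add: U_def)
  have st: "stable \<sigma> U" using stable_cyc by (simp add: U_def)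
  have sub: "subspace U" using st by (simp add: stable_def)
  obtain \<gamma> where g: "\<And>u a b. act (p ^ l) u = 0 \<Longrightarrow> \<beta> (p, l) (act a u) (act b u) = \<gamma> a b * \<beta> (p, l) u u"
    "\<And>a. \<gamma> a a \<ge> (0::real)" using bform_cyc[OF j] by blast
  have nn: "\<beta> (p, l) x x \<ge> 0" if "x \<in> U" for x
    using that g(1)[OF u(1)] g(2) u(2) by (auto simp: U_def cyc_def)
  show 0: "neg B \<sigma> (p, l) U = 0"
    unfolding neg_def nidx_def by (rule pidx_nonpos) (use subspace_Int_kerp[OF st] nn in auto)
  then show "pos B \<sigma> (p, l) U = degree p" using pos_neg_free[OF j E n] by simp
  show "pos B \<sigma> k U = 0 \<and> neg B \<sigma> k U = 0" if k: "admissible k" "k \<noteq> (p, l)" for k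
  proof -
    obtain p' l' where kk: "k = (p', l')" by (cases k)
    show ?thesis
    proof (cases "p' = p")
      case True
      then show ?thesis using pos_neg_free_other[of p l' l U "{u}"] E k by (auto simp: kk)
    next
      case False
      then have "coprime p p'" using self_dual_eq_or_coprime p k(1) by (auto simp: kk admissible_def)
      then have "coprime (p ^ l) p'" by simp
      then show ?thesis
        using pos_neg_coprime[OF k(1)[unfolded kk] st free_annihilated[OF E]] by (simp add: kk)
    qed
  qed
  have dU: "pidx B U + nidx B U = degree p * l"
    using pidx_nidx_nondeg[OF sub symB n] dim_N_image[OF p E, of 0] by simp
  show "pidx B U = nidx B U + (if odd l then degree p else 0)"
  proof (cases "odd l")
    case True
    then obtain k where k: "l = 2 * k + 1" by (elim oddE)
    define L where "L = (N p ^^ (k + 1)) ` U"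
    define Z where "Z = (N p ^^ k) ` U"
    have sLZ: "subspace L" "subspace Z" "L \<subseteq> U" "Z \<subseteq> U"
      unfolding L_def Z_def using N_stable[OF p st] by (auto intro!: linear_subspace_image N_linear p sub simp del: funpow.simps)
    have dl: "dim L = degree p * k" "dim Z = degree p * (k + 1)"
      unfolding L_def Z_def using dim_N_image[OF p E, of "k + 1"] dim_N_image[OF p E, of k] k by simp_all
    have "B x x \<le> 0" if "x \<in> L" for x
      using N_image_isotropic[OF p E, of "k + 1" x] that k by (simp add: L_def)
    then have 1: "pidx B U + dim L \<le> dim U" by (intro pidx_add_nonpos_le sLZ sub)
    have "- B x x \<le> 0" if x: "x \<in> Z" for x
    proof -
      obtain y where y: "y \<in> U" "x = (N p ^^ k) y" using x unfolding Z_def by auto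
      \<comment> \<open>B (N^k y) (N^k y) equals \<beta> y y: the sign from moving N^k across is
        exactly \<open>csgn\<close>.\<close>
      have "B x x = (if degree p = 1 then - 1 else 1) ^ k * B ((N p ^^ k) x) y"
        using N_adj_power[OF p, of k y x] symform_sym[OF symB, of y] unfolding y(2) by simp
      also have "(N p ^^ k) x = (N p ^^ (l - 1)) y" using k y by (simp add: mult_2 funpow_add)
      also have "(if degree p = 1 then - 1 else 1) ^ k * B ((N p ^^ (l - 1)) y) y = \<beta> (p, l) y y"
        using k by (simp add: bform_def csgn_def)
      finally show ?thesis using nn[OF y(1)] by simp
    qed
    then have 2: "nidx B U + dim Z \<le> dim U" unfolding nidx_def by (intro pidx_add_nonpos_le sLZ sub)
    have "dim U = degree p * l" using dim_N_image[OF p E, of 0] by simp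
    then show ?thesis using 1 2 dU dl k True by (simp add: algebra_simps)
  next
    case False
    then obtain k where k: "l = 2 * k" by auto
    define L where "L = (N p ^^ k) ` U"
    have sL: "subspace L" "L \<subseteq> U"
      unfolding L_def using N_stable[OF p st] by (auto intro!: linear_subspace_image N_linear p sub)
    have dl: "dim L = degree p * k" unfolding L_def using dim_N_image[OF p E] k by simp
    have z: "B x x = 0" if "x \<in> L" for x
      using N_image_isotropic[OF p E, of k x] that k by (simp add: L_def)
    have 1: "pidx B U + dim L \<le> dim U" by (intro pidx_add_nonpos_le sL sub) (simp add: z)
    have 2: "nidx B U + dim L \<le> dim U" unfolding nidx_def by (intro pidx_add_nonpos_le sL sub) (simp add: z)
    have "dim U = degree p * l" using dim_N_image[OF p E, of 0] by simp
    then show ?thesis using 1 2 dU dl k False by (simp add: algebra_simps)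
  qed
qed

lemma cyc_negative:
  assumes j: "admissible (p, l)" and u: "act (p ^ l) u = 0" "\<beta> (p, l) u u < 0"
  defines "U \<equiv> cyc \<sigma> u"
  shows "quot_module_basis \<sigma> (p ^ l) U {u}" "nondeg_on B U"
    "neg B \<sigma> (p, l) U = degree p" "pos B \<sigma> (p, l) U = 0"
    "\<And>k. admissible k \<Longrightarrow> k \<noteq> (p, l) \<Longrightarrow> pos B \<sigma> k U = 0 \<and> neg B \<sigma> k U = 0"
    "nidx B U = pidx B U + (if odd l then degree p else 0)"
proof -
  interpret m: isom Bas "\<lambda>x y. - B x y" \<sigma> by (rule isom_minus)
  have "bform (\<lambda>x y. - B x y) \<sigma> (p, l) u u > 0" using u(2) by (simp add: bform_minus)
  note c = m.cyc_positive[OF j u(1) this, unfolded pos_minus neg_minus nondeg_on_minus nidx_minus, folded U_def nidx_def]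
  show "quot_module_basis \<sigma> (p ^ l) U {u}" "nondeg_on B U"
    "neg B \<sigma> (p, l) U = degree p" "pos B \<sigma> (p, l) U = 0"
    "\<And>k. admissible k \<Longrightarrow> k \<noteq> (p, l) \<Longrightarrow> pos B \<sigma> k U = 0 \<and> neg B \<sigma> k U = 0"
    "nidx B U = pidx B U + (if odd l then degree p else 0)"
    using c by auto
qed


section \<open>Anti-isometries commuting with the isometry\<close>

text \<open>The map is linear on the whole space but otherwise constrained on \<open>U1\<close>
  only, which avoids linear maps between subspaces. If \<open>B\<close> is non-degenerate on
  \<open>U1\<close>, the last condition makes the map injective there.\<close>

definition anti :: "'a set \<Rightarrow> 'a set \<Rightarrow> bool" where
  "anti U1 U2 \<longleftrightarrow> (\<exists>g. linear g \<and> g ` U1 = U2 \<and> (\<forall>x\<in>U1. g (\<sigma> x) = \<sigma> (g x)) \<and>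
     (\<forall>x\<in>U1. \<forall>y\<in>U1. B (g x) (g y) = - B x y))"

lemma antiE:
  assumes "anti U1 U2"
  obtains g where "linear g" "g ` U1 = U2" "\<And>x. x \<in> U1 \<Longrightarrow> g (\<sigma> x) = \<sigma> (g x)"
     "\<And>x y. x \<in> U1 \<Longrightarrow> y \<in> U1 \<Longrightarrow> B (g x) (g y) = - B x y"
proof -
  from assms obtain g where "linear g \<and> g ` U1 = U2 \<and> (\<forall>x\<in>U1. g (\<sigma> x) = \<sigma> (g x)) \<and>
     (\<forall>x\<in>U1. \<forall>y\<in>U1. B (g x) (g y) = - B x y)" unfolding anti_def by (elim exE)
  then show ?thesis by (intro that[of g]) simp_all
qed

lemma anti_zero: "anti {0} {0}"
  unfolding anti_def by (rule exI[of _ "\<lambda>x. x"]) (simp add: linear_id[unfolded id_def] Br linear_0[OF lin])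

lemma intertwine_inv:
  assumes "stable \<sigma> U" "\<And>x. x \<in> U \<Longrightarrow> g (\<sigma> x) = \<sigma> (g x)" "x \<in> U"
  shows "g (\<sigma>i x) = \<sigma>i (g x)"
  using assms(2)[of "\<sigma>i x"] stable_inv[OF assms(1,3)] by (metis sigma_inv)

lemma intertwine_act:
  assumes "stable \<sigma> U" "linear g" "\<And>x. x \<in> U \<Longrightarrow> g (\<sigma> x) = \<sigma> (g x)" "x \<in> U"
  shows "g (act a x) = act a (g x)"
  using poly_act_intertwine[OF lin lin assms(2), of U x a] assms by (auto simp: stable_def)

lemma intertwine_N:
  assumes U: "stable \<sigma> U" and g: "linear g" "\<And>x. x \<in> U \<Longrightarrow> g (\<sigma> x) = \<sigma> (g x)"
    and p: "self_dual p" and x: "x \<in> U"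
  shows "g ((N p ^^ k) x) = (N p ^^ k) (g x)"
proof (induction k)
  case (Suc k)
  let ?y = "(N p ^^ k) x"
  have y: "?y \<in> U" by (rule N_stable[OF p U x])
  have "g (N p ?y) = N p (g ?y)"
    using y stable_act[OF U y] intertwine_inv[where g = g, OF U] intertwine_act[where g = g, OF U g(1)]
    by (simp add: Nop_def linear_diff[OF g(1)] g(2))
  then show ?case using Suc by simp
qed simp

text \<open>A map that commutes with \<sigma> also commutes with N and preserves the kernels. So it
  reverses B and every local form at once, and exchanges their positive and negative
  subspaces.\<close>

lemma anti_invariants:
  assumes "anti U U" "stable \<sigma> U" "nondeg_on B U" "admissible j"
  shows "pidx B U = nidx B U" "pos B \<sigma> j U = neg B \<sigma> j U"
proof -
  obtain g where g: "linear g" "g ` U = U" "\<And>x. x \<in> U \<Longrightarrow> g (\<sigma> x) = \<sigma> (g x)"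
     "\<And>x y. x \<in> U \<Longrightarrow> y \<in> U \<Longrightarrow> B (g x) (g y) = - B x y"
    by (rule antiE[OF assms(1)]) simp
  have inj: "x = 0" if "x \<in> U" "g x = 0" for x
    using assms(3) that g(4)[OF that(1)] by (auto simp: nondeg_on_def Br)
  have sub: "subspace U" using assms(2) by (simp add: stable_def)
  show "pidx B U = nidx B U"
  proof -
    have "pidx B U = pidx (\<lambda>x y. - B x y) (g ` U)"
      using g(4) inj by (intro pidx_image[OF g(1) sub] symform_minus[OF symB]) auto
    then show ?thesis unfolding g(2) nidx_def .
  qed
  obtain p l where j: "j = (p, l)" by (cases j)
  have p: "self_dual p" using assms(4) by (simp add: j admissible_def)
  let ?K = "U \<inter> kerp \<sigma> j"
  have K: "subspace ?K" by (rule subspace_Int_kerp[OF assms(2)])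
  have gK: "g ` ?K = ?K"
  proof (rule image_eq_self[OF g(1) K])
    show "g ` ?K \<subseteq> ?K"
    proof clarify
      fix x assume x: "x \<in> U" "x \<in> kerp \<sigma> j"
      have "act (p ^ l) (g x) = g (act (p ^ l) x)"
        using intertwine_act[where g = g, OF assms(2) g(1) _ x(1)] g(3) by simp
      then show "g x \<in> U \<inter> kerp \<sigma> j" using x g(2) by (auto simp: j kerp_def linear_0[OF g(1)])
    qed
  qed (use inj in auto)
  have "bform B \<sigma> j x x = - bform B \<sigma> j (g x) (g x)" if x: "x \<in> ?K" for x
    using g(4)[OF N_stable[OF p assms(2)], of x x "l - 1"] x intertwine_N[where g = g, OF assms(2) g(1) _ p, of x "l - 1"] g(3)
    by (simp add: bform_def j)
  then have "pidx (\<beta> j) ?K = pidx (\<lambda>x y. - \<beta> j x y) (g ` ?K)"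
    using inj by (intro pidx_image[OF g(1) K] symform_minus[OF symform_bform[OF assms(4)]]) auto
  then show "pos B \<sigma> j U = neg B \<sigma> j U" unfolding gK by (simp add: pos_def neg_def nidx_def)
qed

text \<open>The two maps are combined by means of the orthogonal projections onto \<open>U1\<close>
  and \<open>U2\<close>, which are linear everywhere and vanish on the respective other
  summand.\<close>

lemma anti_ssum:
  assumes sub: "subspace U1" "subspace U2" and n: "nondeg_on B U1" "nondeg_on B U2"
    and o: "orth B U1 U2" "orth B V1 V2" and st: "stable \<sigma> U1" "stable \<sigma> U2"
    and a: "anti U1 V1" "anti U2 V2"
  shows "anti (ssum U1 U2) (ssum V1 V2)"
proof -
  obtain g where g: "linear g" "g ` U1 = V1" "\<And>x. x \<in> U1 \<Longrightarrow> g (\<sigma> x) = \<sigma> (g x)"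
     "\<And>x y. x \<in> U1 \<Longrightarrow> y \<in> U1 \<Longrightarrow> B (g x) (g y) = - B x y"
    by (rule antiE[OF a(1)]) blast
  obtain h where h: "linear h" "h ` U2 = V2" "\<And>x. x \<in> U2 \<Longrightarrow> h (\<sigma> x) = \<sigma> (h x)"
     "\<And>x y. x \<in> U2 \<Longrightarrow> y \<in> U2 \<Longrightarrow> B (h x) (h y) = - B x y"
    by (rule antiE[OF a(2)]) blast
  obtain \<pi> where p: "linear \<pi>" "\<And>x. x \<in> U1 \<Longrightarrow> \<pi> x = x" "\<And>x. (\<forall>y\<in>U1. B x y = 0) \<Longrightarrow> \<pi> x = 0"
    using orth_projection[OF sub(1) symB n(1)] by metis
  obtain \<rho> where r: "linear \<rho>" "\<And>x. x \<in> U2 \<Longrightarrow> \<rho> x = x" "\<And>x. (\<forall>y\<in>U2. B x y = 0) \<Longrightarrow> \<rho> x = 0"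
    using orth_projection[OF sub(2) symB n(2)] by metis
  define k where "k = (\<lambda>x. g (\<pi> x) + h (\<rho> x))"
  have lk: "linear k" unfolding k_def
    using linear_compose[OF p(1) g(1)] linear_compose[OF r(1) h(1)] by (intro linear_compose_add) (simp_all add: comp_def)
  have o21: "orth B U2 U1" using o(1) orth_sym[OF symB] by blast
  have z: "\<pi> b = 0" "\<rho> a = 0" if "a \<in> U1" "b \<in> U2" for a b
    using that o(1) o21 p(3)[of b] r(3)[of a] by (auto simp: orth_def)
  have k: "k (a + b) = g a + h b" if "a \<in> U1" "b \<in> U2" for a b
    using z[OF that] p(2) r(2) that
    by (simp add: k_def linear_add[OF p(1)] linear_add[OF r(1)])
  have oV: "B (g a) (h b) = 0" "B (h b) (g a) = 0" if "a \<in> U1" "b \<in> U2" for a b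
    using o(2) g(2) h(2) that symform_sym[OF symB, of "h b"] by (auto simp: orth_def)
  have oU: "B a b = 0" "B b a = 0" if "a \<in> U1" "b \<in> U2" for a b
    using o(1) o21 that by (auto simp: orth_def)
  show ?thesis unfolding anti_def
  proof (intro exI conjI ballI)
    show "linear k" by (rule lk)
    show "k ` ssum U1 U2 = ssum V1 V2"
      unfolding g(2)[symmetric] h(2)[symmetric] by (auto simp: k image_iff elim!: ssumE intro!: ssumI)
        (metis k ssumI)
    fix x assume "x \<in> ssum U1 U2"
    then obtain a b where ab: "a \<in> U1" "b \<in> U2" "x = a + b" by (rule ssumE)
    have "\<sigma> a \<in> U1" "\<sigma> b \<in> U2" using ab st by (auto simp: stable_def)
    then show "k (\<sigma> x) = \<sigma> (k x)" using ab g(3) h(3) by (simp add: linear_add[OF lin] k)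
    fix y assume "y \<in> ssum U1 U2"
    then obtain c d where cd: "c \<in> U1" "d \<in> U2" "y = c + d" by (rule ssumE)
    show "B (k x) (k y) = - B x y"
      using ab cd by (simp add: k Br g(4) h(4) oV oU)
  qed
qed

text \<open>A relation between the elements of E has coefficients divisible by m, and m kills the
  prescribed images, so the map is well defined on U. Composition with the projection onto U makes
  it linear on the whole space.\<close>

lemma module_hom:
  assumes E: "quot_module_basis \<sigma> m U E" and n: "nondeg_on B U" and \<theta>: "\<And>e. e \<in> E \<Longrightarrow> act m (\<theta> e) = 0"
  obtains g where "linear g" "\<And>c. g (\<Sum>e\<in>E. act (c e) e) = (\<Sum>e\<in>E. act (c e) (\<theta> e))"
    "\<And>x. x \<in> U \<Longrightarrow> g (\<sigma> x) = \<sigma> (g x)"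
proof -
  have st: "stable \<sigma> U" by (rule free_stable[OF E])
  have U: "U = range (\<lambda>c. \<Sum>e\<in>E. act (c e) e)" using E by (simp add: quot_module_basis_def)
  have wd: "(\<Sum>e\<in>E. act (c e) (\<theta> e)) = (\<Sum>e\<in>E. act (d e) (\<theta> e))"
    if "(\<Sum>e\<in>E. act (c e) e) = (\<Sum>e\<in>E. act (d e) e)" for c d
  proof -
    have "(\<Sum>e\<in>E. act (c e - d e) e) = 0" using that by (simp add: poly_act_diff sum_subtractf)
    then have "\<And>e. e \<in> E \<Longrightarrow> m dvd c e - d e" using free_independent[OF E, of "\<lambda>e. c e - d e"] by blast
    then have "\<And>e. e \<in> E \<Longrightarrow> act (c e - d e) (\<theta> e) = 0" using \<theta> poly_act_dvd_0[OF lin] by blast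
    then have "(\<Sum>e\<in>E. act (c e - d e) (\<theta> e)) = 0" by (intro sum.neutral) blast
    then show ?thesis by (simp add: poly_act_diff sum_subtractf)
  qed
  define C where "C = (\<lambda>x. SOME c. x = (\<Sum>e\<in>E. act (c e) e))"
  have C: "x = (\<Sum>e\<in>E. act (C x e) e)" if "x \<in> U" for x
  proof -
    have "\<exists>c. x = (\<Sum>e\<in>E. act (c e) e)" using that[unfolded U] by blast
    then show ?thesis unfolding C_def by (rule someI_ex)
  qed
  define G where "G = (\<lambda>x. \<Sum>e\<in>E. act (C x e) (\<theta> e))"
  have G: "G (\<Sum>e\<in>E. act (c e) e) = (\<Sum>e\<in>E. act (c e) (\<theta> e))" for c
    unfolding G_def by (rule wd) (rule C[symmetric], use U in auto)
  have Gadd: "G (x + y) = G x + G y" if x: "x \<in> U" and y: "y \<in> U" for x y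
  proof -
    obtain c where c: "x = (\<Sum>e\<in>E. act (c e) e)" using x[unfolded U] by blast
    obtain d where d: "y = (\<Sum>e\<in>E. act (d e) e)" using y[unfolded U] by blast
    note cd = c d
    have "x + y = (\<Sum>e\<in>E. act (c e + d e) e)" by (simp add: cd poly_act_add sum.distrib)
    then show ?thesis using G[of "\<lambda>e. c e + d e"] by (simp add: cd G poly_act_add sum.distrib)
  qed
  have Gscale: "G (k *\<^sub>R x) = k *\<^sub>R G x" if x: "x \<in> U" for x k
  proof -
    obtain c where c: "x = (\<Sum>e\<in>E. act (c e) e)" using x[unfolded U] by blast
    have "k *\<^sub>R x = (\<Sum>e\<in>E. act (Polynomial.smult k (c e)) e)" by (simp add: c poly_act_smult scaleR_sum_right)
    then show ?thesis using G[of "\<lambda>e. Polynomial.smult k (c e)"] by (simp add: c G poly_act_smult scaleR_sum_right)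
  qed
  have Gsigma: "G (\<sigma> x) = \<sigma> (G x)" if x: "x \<in> U" for x
  proof -
    obtain c where c: "x = (\<Sum>e\<in>E. act (c e) e)" using x[unfolded U] by blast
    have "\<sigma> x = (\<Sum>e\<in>E. act ([:0, 1:] * c e) e)"
      by (simp only: c linear_sum[OF lin] poly_act_mult[OF lin] poly_act_X[OF lin])
    then show ?thesis using G[of "\<lambda>e. [:0, 1:] * c e"]
      by (simp only: c G linear_sum[OF lin] poly_act_mult[OF lin] poly_act_X[OF lin])
  qed
  obtain \<pi> where p: "linear \<pi>" "\<And>x. x \<in> U \<Longrightarrow> \<pi> x = x" "\<And>x. \<pi> x \<in> U"
    using orth_projection[OF stable_subspace[OF st] symB n] by metis
  show ?thesis
  proof (rule that[of "\<lambda>x. G (\<pi> x)"])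
    show "linear (\<lambda>x. G (\<pi> x))"
      by (rule linearI) (simp_all add: linear_add[OF p(1)] linear_scale[OF p(1)] Gadd Gscale p(3))
    show "G (\<pi> (\<Sum>e\<in>E. act (c e) e)) = (\<Sum>e\<in>E. act (c e) (\<theta> e))" for c
      using p(2) G U by auto
    show "G (\<pi> (\<sigma> x)) = \<sigma> (G (\<pi> x))" if "x \<in> U" for x
      using p(2) Gsigma that st by (simp add: stable_def)
  qed
qed

lemma sqrt_selfadjoint:
  assumes A: "linear A" and U: "subspace U" "\<And>x. x \<in> U \<Longrightarrow> A x \<in> U"
    and s: "\<And>x y. x \<in> U \<Longrightarrow> y \<in> U \<Longrightarrow> B (A x) y = B x (A y)"
    and xy: "x \<in> U" "y \<in> U"
  shows "B (poly_act f A x) y = B x (poly_act f A y)"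
  using xy
proof (induction f arbitrary: x y)
  case (pCons a f)
  have "poly_act f A x \<in> U" by (rule poly_act_in[OF A U pCons.prems(1)])
  then have "B (A (poly_act f A x)) y = B x (poly_act f A (A y))"
    using s pCons U(2) by simp
  also have "poly_act f A (A y) = A (poly_act f A y)"
    using poly_act_commute[OF A A, of f y] by simp
  finally show ?case by (simp add: poly_act_pCons[OF A] Br)
qed (simp add: Br)

text \<open>
  Writing \<open>- B (g x) (g y) = B (A x) y\<close>, the hypothesis says that \<open>A - 1\<close> maps into \<open>p(\<sigma>)U\<close>.
  Hence \<open>A\<close> is unipotent and has a square root which is a polynomial in \<open>A\<close>, and this
  square root corrects \<open>g\<close>.
\<close>

lemma anti_from_hom:
  assumes p: "self_dual p" and E: "quot_module_basis \<sigma> (p ^ l) U E" and l: "l \<ge> 1" and n: "nondeg_on B U"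
    and g: "linear g" "g ` U = V" "\<And>x. x \<in> U \<Longrightarrow> g (\<sigma> x) = \<sigma> (g x)"
    and H: "\<And>x y. x \<in> U \<Longrightarrow> y \<in> U \<Longrightarrow> B ((N p ^^ (l - 1)) (g x)) (g y) = - B ((N p ^^ (l - 1)) x) y"
  shows "anti U V"
proof -
  have st: "stable \<sigma> U" by (rule free_stable[OF E])
  have sub: "subspace U" using st by (simp add: stable_def)
  have lB: "linear (B x)" "linear (\<lambda>x. B x y)" for x y
    using symB symform_linear_left[OF symB] unfolding symform_def by blast+
  have l1: "linear (\<lambda>y. - B (g x) (g y))" for x
    using linear_compose[OF g(1) lB(1)[of "g x"]] by (intro linear_compose_neg) (simp add: comp_def)
  have l2: "linear (\<lambda>x. - B (g x) (g y))" for y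
    using linear_compose[OF g(1) lB(2)[of "g y"]] by (intro linear_compose_neg) (simp add: comp_def)
  obtain A where A: "linear A" "\<And>x. A x \<in> U" "\<And>x y. y \<in> U \<Longrightarrow> B (A x) y = - B (g x) (g y)"
    using riesz[OF sub symB n, of "\<lambda>x y. - B (g x) (g y)"] l1 l2 by metis
  have uniq: "a = b" if "a \<in> U" "b \<in> U" "\<And>y. y \<in> U \<Longrightarrow> B a y = B b y" for a b
  proof -
    have "a - b \<in> U" "\<forall>y\<in>U. B (a - b) y = 0" using that sub by (auto simp: subspace_diff Br)
    then show ?thesis using n by (auto simp: nondeg_on_def)
  qed
  have As: "A (\<sigma> x) = \<sigma> (A x)" if x: "x \<in> U" for x
  proof (rule uniq)
    show "A (\<sigma> x) \<in> U" by (rule A(2))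
    show "\<sigma> (A x) \<in> U" using A(2) st by (simp add: stable_def)
    fix y assume y: "y \<in> U"
    show "B (A (\<sigma> x)) y = B (\<sigma> (A x)) y"
      using A(3)[OF y] A(3)[OF stable_inv[OF st y]] g(3)[OF x] intertwine_inv[where g = g, OF st g(3) y] by (simp add: adj)
  qed
  have Aadj: "B (A x) y = B x (A y)" if "x \<in> U" "y \<in> U" for x y
    using A(3)[OF that(2)] A(3)[OF that(1)] symform_sym[OF symB] by metis
  define D where "D = [:- 1, 1:: real:]"
  have D: "poly_act D A x = A x - x" for x
    by (simp add: D_def poly_act_pCons[OF A(1)] linear_0[OF A(1)])
  have step: "\<exists>z\<in>U. A x - x = act p z" if x: "x \<in> U" for x
  proof -
    have "(N p ^^ (l - 1)) (A x) = (N p ^^ (l - 1)) x"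
    proof (rule uniq)
      show "(N p ^^ (l - 1)) (A x) \<in> U" "(N p ^^ (l - 1)) x \<in> U"
        using N_stable[OF p st] A(2) x by auto
      fix y assume y: "y \<in> U"
      have "B ((N p ^^ (l - 1)) (A x)) y = - B (g ((N p ^^ (l - 1)) x)) (g y)"
        using A(3)[OF y] intertwine_N[where g = A, OF st A(1) As p x] by metis
      also have "\<dots> = B ((N p ^^ (l - 1)) x) y" using H[OF x y] intertwine_N[where g = g, OF st g(1,3) p x] by simp
      finally show "B ((N p ^^ (l - 1)) (A x)) y = B ((N p ^^ (l - 1)) x) y" .
    qed
    then have "(N p ^^ (l - 1)) (A x - x) = 0" by (simp add: linear_diff[OF N_linear[OF p]])
    moreover have inU: "A x - x \<in> U" using A(2) x sub by (simp add: subspace_diff)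
    ultimately have "act (p ^ (l - 1)) (A x - x) = 0" using N_0D[OF p] free_annihilated[OF E] by blast
    then have "\<exists>z\<in>U. A x - x = act (p ^ (l - (l - 1))) z"
      by (intro free_ker[OF E self_dual_nz[OF p] inU]) auto
    then show ?thesis using l by simp
  qed
  have nil: "\<exists>z\<in>U. poly_act (D ^ i) A x = act (p ^ i) z" if x: "x \<in> U" for x i
  proof (induction i)
    case (Suc i)
    then obtain z where z: "z \<in> U" "poly_act (D ^ i) A x = act (p ^ i) z" by blast
    obtain w where w: "w \<in> U" "A z - z = act p w" using step[OF z(1)] by blast
    have "poly_act (D ^ Suc i) A x = act (p ^ i) (A z - z)"
      using z intertwine_act[where g = A, OF st A(1) As z(1)] by (simp add: poly_act_mult[OF A(1)] D linear_diff[OF lin_act])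
    also have "\<dots> = act (p ^ Suc i) w" using w by (simp flip: poly_act_mult[OF lin] add: mult.commute)
    finally show ?case using w by blast
  qed (use x in auto)
  have Dl: "poly_act (D ^ l) A x = 0" if "x \<in> U" for x
    using nil[OF that, of l] free_annihilated[OF E] by auto
  have irr: "irreducible D" unfolding D_def by (rule irreducible_linear_field_poly) simp
  have nd: "\<not> D dvd [:0, 1:]"
  proof
    assume "D dvd [:0, 1:]"
    then have "poly [:0, 1:] (1 :: real) = 0" unfolding D_def poly_eq_0_iff_dvd by simp
    then show False by simp
  qed
  have "D dvd 1\<^sup>2 - [:0, 1:]"
  proof -
    have "1\<^sup>2 - [:0, 1:] = - D" by (simp add: D_def one_pCons power2_eq_square)
    then show ?thesis by simp
  qed
  from hensel_sqrt[OF irr this nd, of l] obtain f where f: "D ^ l dvd f\<^sup>2 - [:0, 1:]" by blast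
  have "coprime D [:0, 1:]" by (rule prime_elem_imp_coprime[OF irreducible_imp_prime_elem[OF irr] nd])
  then have "coprime (D ^ l) [:0, 1:]" by simp
  then obtain a b where ab: "a * D ^ l + b * [:0, 1:] = 1" by (rule bezout_coprime)
  define h where "h = poly_act f A"
  \<comment> \<open>\<open>b\<close> inverts x modulo D^l, so \<open>k\<close> is h A^-1, the
    inverse of \<open>h\<close> on U.\<close>
  define k where "k = poly_act (f * b) A"
  have pU: "poly_act q A x \<in> U" if "x \<in> U" for q x by (rule poly_act_in[OF A(1) sub A(2) that])
  have hh: "h (h x) = A x" if "x \<in> U" for x
  proof -
    have "poly_act (f\<^sup>2 - [:0, 1:]) A x = 0" by (rule poly_act_dvd_0[OF A(1) f Dl[OF that]])
    then show ?thesis by (simp add: h_def poly_act_diff power2_eq_square poly_act_mult[OF A(1)] poly_act_X[OF A(1)])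
  qed
  have hk: "h (k x) = x" if "x \<in> U" for x
  proof -
    have "h (k x) = poly_act b A (h (h x))"
      by (simp add: h_def k_def flip: poly_act_mult[OF A(1)]) (simp add: mult_ac)
    also have "\<dots> = poly_act (b * [:0, 1:]) A x" by (simp only: hh[OF that] poly_act_mult[OF A(1)] poly_act_X[OF A(1)])
    also have "\<dots> = poly_act (a * D ^ l + b * [:0, 1:]) A x"
      by (simp only: poly_act_add poly_act_mult[OF A(1)] Dl[OF that] linear_0[OF linear_poly_act[OF A(1)]] add_0)
    finally show ?thesis unfolding ab by simp
  qed
  have kU: "k ` U = U"
  proof -
    have "k x \<in> U" if "x \<in> U" for x using pU that by (simp add: k_def)
    moreover have "x \<in> k ` U" if x: "x \<in> U" for x
    proof (rule image_eqI)
      show "x = k (h x)" using hk[OF x] by (simp add: h_def k_def poly_act_commute_mult[OF A(1), of f])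
      show "h x \<in> U" using pU x by (simp add: h_def)
    qed
    ultimately show ?thesis by blast
  qed
  have lk: "linear k" unfolding k_def by (rule linear_poly_act[OF A(1)])
  show ?thesis unfolding anti_def
  proof (intro exI conjI ballI)
    show "linear (g \<circ> k)" by (rule linear_compose[OF lk g(1)])
    show "(g \<circ> k) ` U = V" using kU g(2) by (metis image_comp)
    fix x assume x: "x \<in> U"
    have ks: "k (\<sigma> x) = \<sigma> (k x)"
      using poly_act_intertwine[OF A(1) A(1) lin sub, of x "f * b"] A(2) As x by (simp add: k_def)
    have kx: "k x \<in> U" using kU x by blast
    show "(g \<circ> k) (\<sigma> x) = \<sigma> ((g \<circ> k) x)" using ks g(3)[OF kx] by simp
    fix y assume y: "y \<in> U"
    then have ky: "k y \<in> U" using kU by blast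
    have "B ((g \<circ> k) x) ((g \<circ> k) y) = - B (h (h (k x))) (k y)" using A(3)[OF ky] hh[OF kx] by simp
    also have "\<dots> = - B x (h (k y))"
      using hk[OF x] sqrt_selfadjoint[OF A(1) sub A(2) Aadj x ky, of f] by (simp add: h_def)
    finally show "B ((g \<circ> k) x) ((g \<circ> k) y) = - B x y" using hk[OF y] by simp
  qed
qed

text \<open>After scaling, u and v have opposite values of \<beta>. By \<open>bform_cyc\<close>
  sending u to v then reverses the local form, that is, the form modulo p, and
  \<open>anti_from_hom\<close> corrects the map.\<close>

lemma anti_cyc:
  assumes j: "admissible (p, l)" and uv: "act (p ^ l) u = 0" "act (p ^ l) v = 0"
    and s: "\<beta> (p, l) u u * \<beta> (p, l) v v < 0"
  shows "anti (cyc \<sigma> u) (cyc \<sigma> v)"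
proof -
  note p = admissibleD(1)[OF j] and l = admissibleD(2)[OF j] and r = symform_rules[OF symform_bform[OF j]]
  have "B ((N p ^^ (l - 1)) u) u \<noteq> 0" using s by (auto simp: bform_def)
  note cb = cyc_block[OF p uv(1) l this]
  \<comment> \<open>The scale for which \<beta> (t v) (t v) = - \<beta> u u; the radicand is
    positive as the two values have opposite signs.\<close>
  define t where "t = sqrt (- (\<beta> (p, l) u u / \<beta> (p, l) v v))"
  have q: "- (\<beta> (p, l) u u / \<beta> (p, l) v v) > 0" using s by (auto simp: mult_less_0_iff divide_less_0_iff)
  have t: "t * t = - (\<beta> (p, l) u u / \<beta> (p, l) v v)"
    by (simp only: t_def real_sqrt_mult_self abs_of_pos[OF q])
  then have "t \<noteq> 0" using q by auto
  note t = this t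
  define w where "w = t *\<^sub>R v"
  have w: "act (p ^ l) w = 0" using uv by (simp add: w_def linear_scale[OF lin_act])
  have "\<beta> (p, l) w w = t * t * \<beta> (p, l) v v" by (simp add: w_def r)
  also have "\<dots> = - \<beta> (p, l) u u" using s unfolding t(2) by auto
  finally have ww: "\<beta> (p, l) w w = - \<beta> (p, l) u u" .
  obtain g where g: "linear g" "\<And>c. g (\<Sum>e\<in>{u}. act (c e) e) = (\<Sum>e\<in>{u}. act (c e) w)"
    "\<And>x. x \<in> cyc \<sigma> u \<Longrightarrow> g (\<sigma> x) = \<sigma> (g x)"
    by (rule module_hom[OF cb, of "\<lambda>_. w"]) (use w in auto)
  have ga: "g (act a u) = act a w" for a using g(2)[of "\<lambda>_. a"] by simp
  have "g ` cyc \<sigma> u = cyc \<sigma> w" by (auto simp: cyc_def ga image_iff)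
  also have "\<dots> = cyc \<sigma> v"
  proof -
    have "act a w = act (Polynomial.smult t a) v" "act a v = act (Polynomial.smult (1 / t) a) w" for a
      using t(1) by (simp_all add: w_def poly_act_smult linear_scale[OF lin_act])
    then show ?thesis unfolding cyc_def by blast
  qed
  finally have im: "g ` cyc \<sigma> u = cyc \<sigma> v" .
  obtain \<gamma> where ga2: "\<And>u a b. act (p ^ l) u = 0 \<Longrightarrow> \<beta> (p, l) (act a u) (act b u) = \<gamma> a b * \<beta> (p, l) u u"
    using bform_cyc[OF j] by metis
  have "B ((N p ^^ (l - 1)) (g x)) (g y) = - B ((N p ^^ (l - 1)) x) y" if x: "x \<in> cyc \<sigma> u" and y: "y \<in> cyc \<sigma> u" for x y
  proof -
    obtain a where a: "x = act a u" using x by (auto simp: cyc_def)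
    obtain b where b: "y = act b u" using y by (auto simp: cyc_def)
    note ab = a b
    have "\<beta> (p, l) (g x) (g y) = - \<beta> (p, l) x y"
      using ga2[OF uv(1), of a b] ga2[OF w, of a b] ww by (simp add: ab ga)
    then have "csgn p l * B ((N p ^^ (l - 1)) (g x)) (g y) = csgn p l * (- B ((N p ^^ (l - 1)) x) y)"
      by (simp add: bform_def)
    then show ?thesis using mult_left_cancel[OF csgn_square(2)[of p l]] by metis
  qed
  note H = this
  show ?thesis by (rule anti_from_hom[where g = g, OF p cb(1) l cb(2) g(1) im g(3) H])
qed

text \<open>Fixing u and negating v reverses an alternating form on the plane of u and v modulo p.
  So a pair is balanced against itself.\<close>

lemma anti_pair:
  assumes p: "self_dual p" "degree p = 1" and l: "even l" "l \<ge> 1"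
    and uv: "act (p ^ l) u = 0" "act (p ^ l) v = 0" "B ((N p ^^ (l - 1)) u) v \<noteq> 0"
    and U: "U = range (\<lambda>c. \<Sum>e\<in>{u, v}. act (c e) e)"
  shows "anti U U"
proof -
  note pb = pair_block[OF assms]
  obtain c where c: "p = [:c, 1:]" using p by (auto elim: self_dual_cases)
  define \<theta> where "\<theta> = (\<lambda>e. if e = u then u else - v)"
  have "act (p ^ l) (\<theta> e) = 0" if "e \<in> {u, v}" for e
    using uv by (simp add: \<theta>_def linear_neg[OF lin_act])
  then obtain g where g: "linear g" "\<And>c. g (\<Sum>e\<in>{u, v}. act (c e) e) = (\<Sum>e\<in>{u, v}. act (c e) (\<theta> e))"
    "\<And>x. x \<in> U \<Longrightarrow> g (\<sigma> x) = \<sigma> (g x)"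
    by (rule module_hom[OF pb(3,4), of \<theta>]) blast+
  have el: "\<exists>a b. x = act a u + act b v" if "x \<in> U" for x
    using that pb(1) unfolding U by auto
  have elU: "act a u + act b v \<in> U" for a b
    unfolding U by (rule range_eqI[where x = "\<lambda>e. if e = u then a else b"]) (use pb(1) in auto)
  have ge: "g (act a u + act b v) = act a u - act b v" for a b
    using g(2)[of "\<lambda>e. if e = u then a else b"] pb(1) by (simp add: \<theta>_def linear_neg[OF lin_act])
  have im: "g ` U = U"
  proof
    show "g ` U \<subseteq> U"
    proof clarify
      fix x assume "x \<in> U"
      then obtain a b where "x = act a u + act b v" using el by blast
      then have "g x = act a u + act (- b) v" by (simp add: ge poly_act_uminus)
      then show "g x \<in> U" using elU by simp
    qed
    show "U \<subseteq> g ` U"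
    proof
      fix x assume "x \<in> U"
      then obtain a b where "x = act a u + act b v" using el by blast
      then have "x = g (act a u + act (- b) v)" using ge[of a "- b"] by (simp add: poly_act_uminus)
      then show "x \<in> g ` U" using elU by blast
    qed
  qed
  have Nl: "(N p ^^ (l - 1)) (act a u + s *\<^sub>R act b v)
      = poly a (- c) *\<^sub>R (N p ^^ (l - 1)) u + (s * poly b (- c)) *\<^sub>R (N p ^^ (l - 1)) v" for a b s
    using N_act_linear[OF c p(1) uv(1) l(2)] N_act_linear[OF c p(1) uv(2) l(2)]
    by (simp add: linear_add[OF N_linear[OF p(1)]] linear_scale[OF N_linear[OF p(1)]])
  have sk: "B ((N p ^^ (l - 1)) x) y = - B ((N p ^^ (l - 1)) y) x" for x y
  proof -
    have "B ((N p ^^ (l - 1)) (x + y)) (x + y) = 0" by (rule pb(5))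
    then show ?thesis using pb(5)[of x] pb(5)[of y] by (simp add: linear_add[OF N_linear[OF p(1)]] Br)
  qed
  have val: "B ((N p ^^ (l - 1)) (act a u + s *\<^sub>R act b v)) (act a' u + s *\<^sub>R act b' v)
      = s * (poly a (- c) * poly b' (- c) - poly b (- c) * poly a' (- c)) * B ((N p ^^ (l - 1)) u) v" for a b a' b' s
  proof -
    have 1: "B ((N p ^^ (l - 1)) u) (act a' u + s *\<^sub>R act b' v) = s * poly b' (- c) * B ((N p ^^ (l - 1)) u) v"
      using sk[of u "act a' u + s *\<^sub>R act b' v"] sk[of v u] pb(5)[of u] unfolding Nl by (simp add: Br)
    have 2: "B ((N p ^^ (l - 1)) v) (act a' u + s *\<^sub>R act b' v) = - poly a' (- c) * B ((N p ^^ (l - 1)) u) v"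
      using sk[of v "act a' u + s *\<^sub>R act b' v"] pb(5)[of v] unfolding Nl by (simp add: Br)
    show ?thesis unfolding Nl by (simp only: Br(1) Br(3) 1 2) (simp add: algebra_simps)
  qed
  have "B ((N p ^^ (l - 1)) (g x)) (g y) = - B ((N p ^^ (l - 1)) x) y" if xy: "x \<in> U" "y \<in> U" for x y
  proof -
    obtain a b where x: "x = act a u + act b v" using el xy by blast
    obtain a' b' where y: "y = act a' u + act b' v" using el xy by blast
    show ?thesis using val[of a "-1" b a' b'] val[of a 1 b a' b'] unfolding x y ge by (simp add: algebra_simps)
  qed
  note H = this
  show ?thesis by (rule anti_from_hom[where g = g, OF p(1) pb(3) l(2) pb(4) g(1) im g(3) H])
qed

end

section \<open>Splitting off a block\<close>

lemma coprime_part: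
  fixes m s :: "real poly" assumes "m \<noteq> 0" shows "\<exists>n m'. m dvd s ^ n * m' \<and> coprime s m'"
  using assms
proof (induction "degree m" arbitrary: m rule: less_induct)
  case less
  show ?case
  proof (cases "coprime s m")
    case True
    then show ?thesis by (intro exI[of _ 0] exI[of _ m]) simp
  next
    case False
    \<comment> \<open>A common factor d is moved from m into one more power of s.\<close>
    then obtain d where d: "d dvd s" "d dvd m" "\<not> is_unit d" using not_coprimeE by blast
    obtain m1 where m1: "m = d * m1" using d by auto
    then have nz: "d \<noteq> 0" "m1 \<noteq> 0" using less.prems by auto
    have "degree d > 0" using d(3) nz(1) by (auto simp: is_unit_iff_degree)
    then have "degree m1 < degree m" using nz by (simp add: m1 degree_mult_eq)
    then obtain n m' where n: "m1 dvd s ^ n * m'" "coprime s m'" using less.hyps nz by blast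
    then have "m dvd s ^ Suc n * m'" using mult_dvd_mono[OF d(1) n(1)] by (simp add: m1 mult.assoc)
    then show ?thesis using n(2) by blast
  qed
qed

context isom begin

text \<open>Fitting's lemma: for large n, U is the sum of the kernel and the image of s(\<sigma>)^n.
  The hypothesis on s makes the two orthogonal, so the kernel inherits non-degeneracy.\<close>

lemma fitting:
  assumes U: "stable \<sigma> U" "nondeg_on B U"
    and s: "\<And>k w y. act (s ^ k) w = 0 \<Longrightarrow> B w (act (s ^ k) y) = 0"
  obtains n where "n \<ge> 1" "nondeg_on B (U \<inter> {x. act (s ^ n) x = 0})"
proof -
  obtain m where m: "m \<noteq> 0" "\<And>x. act m x = 0" by (rule ann_space[OF lin]) blast
  obtain n0 m' where 0: "m dvd s ^ n0 * m'" "coprime s m'" using coprime_part[OF m(1)] by blast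
  define n where "n = Suc n0"
  have k: "act (s ^ n * m') x = 0" for x
  proof (rule poly_act_dvd_0[OF lin])
    have "s ^ n0 * m' dvd s * (s ^ n0 * m')" by (rule dvd_triv_right)
    then show "m dvd s ^ n * m'" using 0(1) by (simp add: n_def mult.assoc)
    show "act m x = 0" by (rule m)
  qed
  have "coprime (s ^ n) m'" using 0(2) by simp
  then obtain a b where ab: "a * s ^ n + b * m' = 1" by (rule bezout_coprime)
  have "nondeg_on B (U \<inter> {x. act (s ^ n) x = 0})" unfolding nondeg_on_def
  proof (intro ballI impI)
    fix x assume x: "x \<in> U \<inter> {x. act (s ^ n) x = 0}" and z: "\<forall>y\<in>U \<inter> {x. act (s ^ n) x = 0}. B x y = 0"
    have "B x y = 0" if y: "y \<in> U" for y
    proof -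
      have "act (s ^ n) (act (b * m') y) = act b (act (s ^ n * m') y)"
        by (simp flip: poly_act_mult[OF lin] add: mult_ac)
      then have "act (b * m') y \<in> U \<inter> {x. act (s ^ n) x = 0}"
        using stable_act[OF U(1) y] by (simp add: k linear_0[OF lin_act])
      then have "B x (act (b * m') y) = 0" using z by blast
      moreover have "B x (act (s ^ n) (act a y)) = 0" using x by (intro s) auto
      moreover have "act (a * s ^ n + b * m') y = y" unfolding ab by simp
      then have "act (s ^ n) (act a y) + act (b * m') y = y"
        by (simp add: poly_act_add poly_act_mult[OF lin] poly_act_commute_mult[OF lin, of a])
      ultimately show ?thesis using Br(2)[of x "act (s ^ n) (act a y)" "act (b * m') y"] by simp
    qed
    then show "x = 0" using U(2) x by (auto simp: nondeg_on_def)
  qed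
  then show ?thesis using that[of n] by (simp add: n_def)
qed

text \<open>Take a nonzero polynomial of least degree that kills some nonzero vector w of U. If it
  is a b, then b kills w or a kills b(\<sigma>) w, so one factor has full degree. The constant term
  is nonzero because \<sigma> is injective.\<close>

lemma exists_irreducible:
  assumes U: "stable \<sigma> U" "U \<noteq> {0}"
  obtains q w where "irreducible q" "lead_coeff q = 1" "w \<in> U" "w \<noteq> 0" "act q w = 0" "coeff q 0 \<noteq> 0"
proof -
  define P where "P = (\<lambda>d. \<exists>m w. m \<noteq> 0 \<and> w \<in> U \<and> w \<noteq> 0 \<and> act m w = 0 \<and> degree m = d)"
  have "0 \<in> U" using U(1) by (simp add: stable_def subspace_0)
  then obtain w0 where "w0 \<in> U" "w0 \<noteq> 0" using U(2) by blast
  moreover obtain m0 where "m0 \<noteq> 0" "act m0 w0 = 0" by (rule ann_vector[OF lin])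
  ultimately have "P (degree m0)" unfolding P_def by blast
  then have "P (LEAST d. P d)" by (rule LeastI)
  then obtain m w where m: "m \<noteq> 0" "w \<in> U" "w \<noteq> 0" "act m w = 0" "degree m = (LEAST d. P d)"
    unfolding P_def by blast
  have min: "degree m \<le> degree m'" if "m' \<noteq> 0" "w' \<in> U" "w' \<noteq> 0" "act m' w' = 0" for m' w'
    using that Least_le[of P "degree m'"] m(5) unfolding P_def by auto
  have "irreducible m"
  proof (rule irreducibleI)
    show "m \<noteq> 0" by (rule m)
    show "\<not> is_unit m"
    proof
      assume "is_unit m"
      then obtain c where "1 = m * c" by (auto simp: dvd_def)
      then have "w = act c (act m w)" by (simp flip: poly_act_mult[OF lin] add: mult.commute)
      then show False using m by (simp add: linear_0[OF lin_act])
    qed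
    fix a b assume ab: "m = a * b"
    then have nz: "a \<noteq> 0" "b \<noteq> 0" using m(1) by auto
    have deg: "degree m = degree a + degree b" using nz by (simp add: ab degree_mult_eq)
    show "is_unit a \<or> is_unit b"
    proof (cases "act b w = 0")
      case True
      then have "degree m \<le> degree b" using min nz m by blast
      then show ?thesis using deg nz by (simp add: is_unit_iff_degree)
    next
      case False
      have "act a (act b w) = 0" using m(4) by (simp add: ab poly_act_mult[OF lin])
      then have "degree m \<le> degree a" using min[of a "act b w"] nz False stable_act[OF U(1) m(2)] by blast
      then show ?thesis using deg nz by (simp add: is_unit_iff_degree)
    qed
  qed
  moreover define q where "q = Polynomial.smult (inverse (lead_coeff m)) m"
  have lc: "lead_coeff m \<noteq> 0" using m(1) by simp
  ultimately have irr: "irreducible q"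
    using irreducible_mult_unit_left[of "[:inverse (lead_coeff m):]" m] by (simp add: q_def is_unit_pCons_iff)
  have q: "lead_coeff q = 1" using lc by (simp add: q_def)
  have qw: "act q w = 0" using m(4) by (simp add: q_def poly_act_smult)
  have "coeff q 0 \<noteq> 0"
  proof
    assume c0: "coeff q 0 = 0"
    obtain a q' where e: "q = pCons a q'" by (cases q)
    then have e: "q = [:0, 1:] * q'" using c0 by simp
    moreover have "\<not> is_unit [:0, 1 :: real:]" by (simp add: is_unit_iff_degree)
    ultimately have "is_unit q'" using irr irreducibleD by blast
    then have "degree q' = 0" by (auto simp: is_unit_iff_degree)
    then obtain c where "q' = [:c:]" by (auto elim: degree_eq_zeroE)
    then have "q = [:0, c:]" using e by simp
    moreover from this have "c = 1" using q by (auto split: if_splits)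
    ultimately have "\<sigma> w = 0" using qw by (simp add: poly_act_pCons[OF lin] linear_0[OF lin])
    then show False using m(3) linear_0[OF lin] sigma_inv(2)[of w] sigma_inv(2)[of 0] by metis
  qed
  then show ?thesis using that irr q m(2,3) qw by blast
qed

text \<open>There are three kinds of blocks. A non-reciprocal q yields the sum of the kernels of
  powers of q and of its reflection, on which a map with eigenvalues 1 and -1 is an anti-isometry.
  For self-dual q the highest power N^(l - 1) on the primary component gives a non-zero form:
  alternating for q linear and l even, which yields a pair, and symmetric otherwise, which yields a
  vector with \<beta> u u \<noteq> 0.\<close>

lemma split:
  assumes U: "stable \<sigma> U" "nondeg_on B U" "U \<noteq> {0}"
  shows "(\<exists>H. H \<subseteq> U \<and> stable \<sigma> H \<and> nondeg_on B H \<and> H \<noteq> {0} \<and> anti H H) \<or>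
    (\<exists>p l u. admissible (p, l) \<and> u \<in> U \<and> act (p ^ l) u = 0 \<and> \<beta> (p, l) u u \<noteq> 0)"
proof -
  obtain q w where q: "irreducible q" "lead_coeff q = 1" "w \<in> U" "w \<noteq> 0" "act q w = 0" "coeff q 0 \<noteq> 0"
    by (rule exists_irreducible[OF U(1,3)])
  have sk: "stable \<sigma> (U \<inter> {x. act (s ^ n) x = 0})" for s n
    using stable_inter[OF U(1) stable_kerp[of "(s, n)"]] by (simp add: kerp_def)
  show ?thesis
  proof (cases "reciprocal q")
    case True
    then have p: "self_dual q" using q(1) by (simp add: self_dual_def)
    obtain n where n: "n \<ge> 1" "nondeg_on B (U \<inter> {x. act (q ^ n) x = 0})"
      using fitting[OF U(1,2), of q] self_dual_adj_0[OF p] by blast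
    define H where "H = U \<inter> {x. act (q ^ n) x = 0}"
    have stH: "stable \<sigma> H" by (simp add: H_def sk)
    have wH: "w \<in> H" using q(3,5) act_power_mono[of q 1 w n] n(1) by (simp add: H_def)
    \<comment> \<open>The exponent of the component: q^l kills \<open>H\<close>, but N^(l - 1) does
      not.\<close>
    define l where "l = (LEAST l. \<forall>x\<in>H. act (q ^ l) x = 0)"
    have l: "\<forall>x\<in>H. act (q ^ l) x = 0" unfolding l_def by (rule LeastI[of _ n]) (simp add: H_def)
    have l1: "l \<ge> 1"
    proof (rule ccontr)
      assume "\<not> l \<ge> 1"
      then show False using l wH q(4) by (auto simp: not_le)
    qed
    have "\<not> (\<forall>x\<in>H. act (q ^ (l - 1)) x = 0)"
      using not_less_Least[of "l - 1" "\<lambda>l. \<forall>x\<in>H. act (q ^ l) x = 0"] l1 unfolding l_def[symmetric] by simp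
    then obtain x where x: "x \<in> H" "act (q ^ (l - 1)) x \<noteq> 0" by blast
    then have "(N q ^^ (l - 1)) x \<noteq> 0" using N_0D[OF p] l by blast
    then obtain y where y: "y \<in> H" "B ((N q ^^ (l - 1)) x) y \<noteq> 0"
      using n(2) N_stable[OF p stH x(1)] unfolding H_def[symmetric] nondeg_on_def by blast
    have 0: "act (q ^ l) x = 0" "act (q ^ l) y = 0" using l x y by auto
    show ?thesis
    proof (cases "degree q = 1 \<and> even l")
      case True
      define K where "K = range (\<lambda>c. \<Sum>e\<in>{x, y}. act (c e) e)"
      note pb = pair_block[OF p _ _ l1 0 y(2) K_def]
      have "K \<subseteq> U"
      proof -
        have "act a x \<in> U" "act a y \<in> U" for a using stable_act[OF U(1)] x y by (auto simp: H_def)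
        then show ?thesis using U(1) unfolding K_def by (auto simp: stable_def intro!: subspace_sum)
      qed
      moreover have "K \<noteq> {0}"
      proof -
        have "{x, y} \<subseteq> K" using pb(3) True unfolding quot_module_basis_def by blast
        then show ?thesis using pb(1) True by auto
      qed
      ultimately show ?thesis using pb(2,4) anti_pair[OF p _ _ l1 0 y(2) K_def] True by blast
    next
      case False
      then have j: "admissible (q, l)" using p l1 by (auto simp: admissible_def)
      note r = symform_rules[OF symform_bform[OF j]]
      have bxy: "\<beta> (q, l) x y \<noteq> 0" using y(2) by (simp add: bform_def)
      \<comment> \<open>Polarisation: one of x, y and x + y has a nonzero value.\<close>
      have "\<beta> (q, l) (x + y) (x + y) = \<beta> (q, l) x x + 2 * \<beta> (q, l) x y + \<beta> (q, l) y y"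
        using symform_sym[OF symform_bform[OF j], of y x] by (simp add: r)
      then have "\<beta> (q, l) x x \<noteq> 0 \<or> \<beta> (q, l) y y \<noteq> 0 \<or> \<beta> (q, l) (x + y) (x + y) \<noteq> 0" using bxy by auto
      moreover have "x + y \<in> H" using x y stH by (simp add: stable_def subspace_add)
      ultimately have "\<exists>u\<in>H. \<beta> (q, l) u u \<noteq> 0" using x y by blast
      then show ?thesis using j l by (auto simp: H_def)
    qed
  next
    case False
    define r where "r = reflect_poly q"
    have refl: "reflect_poly r = q" using q(6) by (simp add: r_def)
    have deg: "degree r = degree q" unfolding r_def using q(6) by simp
    \<comment> \<open>The degrees agree, so divisibility would make r a constant multiple of q and
      hence q reciprocal.\<close>
    have "\<not> q dvd r"
    proof
      assume "q dvd r"
      then obtain c where c: "r = q * c" by auto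
      moreover have "r \<noteq> 0" using refl q(6) by auto
      ultimately have "degree c = 0" using deg by (auto simp: degree_mult_eq)
      then obtain k where k: "c = [:k:]" by (auto elim: degree_eq_zeroE)
      have "coeff r (degree q) = coeff q 0" by (simp add: r_def coeff_reflect_poly)
      then have "k = coeff q 0" using q(2) by (simp add: c k)
      then have "star_poly q = q" using q(6) c k by (simp add: star_poly_def r_def)
      then show False using False q(6) by (simp add: reciprocal_def)
    qed
    then have cop: "coprime q r" by (rule prime_elem_imp_coprime[OF irreducible_imp_prime_elem[OF q(1)]])
    have rs: "reflect_poly ((q * r) ^ k) = (q * r) ^ k" for k
      using refl by (simp add: reflect_poly_power reflect_poly_mult r_def[symmetric] mult.commute)
    obtain n where n: "n \<ge> 1" "nondeg_on B (U \<inter> {x. act ((q * r) ^ n) x = 0})"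
      using fitting[OF U(1,2), of "q * r"] act_reflect_0[of "(q * r) ^ _"] rs by metis
    define H where "H = U \<inter> {x. act ((q * r) ^ n) x = 0}"
    have stH: "stable \<sigma> H" by (simp add: H_def sk)
    have "act (q * r) w = 0" using q(5) poly_act_dvd_0[OF lin, of q "q * r"] by simp
    then have wH: "w \<in> H" using q(3) act_power_mono[of "q * r" 1 w n] n(1) by (simp add: H_def)
    have "coprime (q ^ n) (r ^ n)" using cop by simp
    then obtain a b where ab: "a * q ^ n + b * r ^ n = 1" by (rule bezout_coprime)
    \<comment> \<open>In \<open>H\<close> this is 1 on the kernel of r^n and -1 on that of q^n. Both
      kernels are isotropic, so only the mixed terms of B survive, and they change sign.\<close>
    define g where "g = act (a * q ^ n - b * r ^ n)"
    have dec: "x = act (a * q ^ n) x + act (b * r ^ n) x" for x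
      using ab by (simp flip: poly_act_add)
    have gx: "g x = act (a * q ^ n) x - act (b * r ^ n) x" for x by (simp add: g_def poly_act_diff)
    have kil: "act (r ^ n) (act (a * q ^ n) x) = 0" "act (q ^ n) (act (b * r ^ n) x) = 0" if "x \<in> H" for x
    proof -
      have "act (r ^ n) (act (a * q ^ n) x) = act a (act ((q * r) ^ n) x)"
        by (simp flip: poly_act_mult[OF lin] add: power_mult_distrib mult_ac)
      then show "act (r ^ n) (act (a * q ^ n) x) = 0" using that by (simp add: H_def linear_0[OF lin_act])
      have "act (q ^ n) (act (b * r ^ n) x) = act b (act ((q * r) ^ n) x)"
        by (simp flip: poly_act_mult[OF lin] add: power_mult_distrib mult_ac)
      then show "act (q ^ n) (act (b * r ^ n) x) = 0" using that by (simp add: H_def linear_0[OF lin_act])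
    qed
    have iso: "B (act (a * q ^ n) x) (act (a * q ^ n) y) = 0" "B (act (b * r ^ n) x) (act (b * r ^ n) y) = 0"
      if "x \<in> H" "y \<in> H" for x y
    proof -
      have "B (act (a * q ^ n) x) (act (q ^ n) (act a y)) = 0"
        using kil(1)[OF that(1)] by (intro act_reflect_0) (simp add: reflect_poly_power r_def[symmetric])
      then show "B (act (a * q ^ n) x) (act (a * q ^ n) y) = 0"
        by (simp add: poly_act_mult[OF lin] poly_act_commute_mult[OF lin, of "q ^ n" a])
      have "B (act (b * r ^ n) x) (act (r ^ n) (act b y)) = 0"
        using kil(2)[OF that(1)] by (intro act_reflect_0) (simp add: reflect_poly_power refl)
      then show "B (act (b * r ^ n) x) (act (b * r ^ n) y) = 0"
        by (simp add: poly_act_mult[OF lin] poly_act_commute_mult[OF lin, of "r ^ n" b])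
    qed
    have "anti H H" unfolding anti_def
    proof (intro exI conjI ballI)
      show "linear g" unfolding g_def by (rule lin_act)
      have gH: "g x \<in> H" if "x \<in> H" for x unfolding g_def by (rule stable_act[OF stH that])
      have gg: "g (g x) = x" if x: "x \<in> H" for x
      proof -
        have "act (a * q ^ n) x = x - act (b * r ^ n) x" using dec[of x] by (metis add_diff_cancel_right')
        then have "g x = x - 2 *\<^sub>R act (b * r ^ n) x" unfolding gx by (simp add: scaleR_2)
        then have "act (a * q ^ n) (g x) = act (a * q ^ n) (x - 2 *\<^sub>R act (b * r ^ n) x)" by simp
        also have "\<dots> = act (a * q ^ n) x"
          using kil(2)[OF x] by (simp add: linear_diff[OF lin_act] linear_scale[OF lin_act] poly_act_mult[OF lin, of a] linear_0[OF lin_act])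
        finally have 1: "act (a * q ^ n) (g x) = act (a * q ^ n) x" .
        have "act (b * r ^ n) x = x - act (a * q ^ n) x" using dec[of x] by (metis add_diff_cancel_left')
        then have "g x = 2 *\<^sub>R act (a * q ^ n) x - x" unfolding gx by (simp add: scaleR_2)
        then have "act (b * r ^ n) (g x) = act (b * r ^ n) (2 *\<^sub>R act (a * q ^ n) x - x)" by simp
        also have "\<dots> = - act (b * r ^ n) x"
          using kil(1)[OF x] by (simp add: linear_diff[OF lin_act] linear_scale[OF lin_act] poly_act_mult[OF lin, of b] linear_0[OF lin_act])
        finally show ?thesis using 1 dec[of x] by (simp add: gx[of "g x"])
      qed
      have "x \<in> g ` H" if "x \<in> H" for x using image_eqI[of x g "g x" H] gg[OF that] gH[OF that] by simp
      then show "g ` H = H" using gH by blast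
      show "g (\<sigma> x) = \<sigma> (g x)" if "x \<in> H" for x by (simp add: g_def sigma_act)
      show "B (g x) (g y) = - B x y" if "x \<in> H" "y \<in> H" for x y
      proof -
        have "B x y = B (act (a * q ^ n) x + act (b * r ^ n) x) (act (a * q ^ n) y + act (b * r ^ n) y)"
          using dec by metis
        then show ?thesis using iso[OF that] by (simp add: gx Br)
      qed
    qed
    then show ?thesis using stH n(2) wH q(4) by (intro disjI1 exI[of _ H]) (auto simp: H_def)
  qed
qed


text \<open>The bookkeeping shared by the inductions on the dimension: every invariant splits over C
  and its orthogonal complement in U.\<close>

lemma decompose:
  assumes U: "stable \<sigma> U" "nondeg_on B U" and C: "stable \<sigma> C" "nondeg_on B C" "C \<subseteq> U"
  defines "R \<equiv> perp B U C"
  shows "stable \<sigma> R" "nondeg_on B R" "R \<subseteq> U" "orth B C R" "C \<inter> R \<subseteq> {0}" "U = ssum C R"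
    "dim U = dim C + dim R" "pidx B U = pidx B C + pidx B R" "nidx B U = nidx B C + nidx B R"
    "\<And>j. admissible j \<Longrightarrow> pos B \<sigma> j U = pos B \<sigma> j C + pos B \<sigma> j R"
    "\<And>j. admissible j \<Longrightarrow> neg B \<sigma> j U = neg B \<sigma> j C + neg B \<sigma> j R"
proof -
  note sC = stable_subspace[OF C(1)] and sU = stable_subspace[OF U(1)]
  show R: "stable \<sigma> R" unfolding R_def by (rule stable_perp[OF U(1) C(1)])
  note sR = stable_subspace[OF R]
  show "R \<subseteq> U" by (auto simp: R_def perp_def)
  show o: "orth B C R" unfolding R_def by (rule orth_perp)
  show 0: "C \<inter> R \<subseteq> {0}" by (rule nondeg_on_orth_disjoint[OF C(2) o symB])
  show e: "U = ssum C R" unfolding R_def by (rule ssum_perp[OF sC C(3) sU symB C(2)])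
  show "nondeg_on B R" using U(2) nondeg_on_ssum[OF symB sC sR o] by (simp add: e[symmetric])
  show "dim U = dim C + dim R" using dim_ssum[OF sC sR 0] by (simp add: e[symmetric])
  show "pidx B U = pidx B C + pidx B R" using pidx_ssum[OF sC sR symB o] by (simp add: e[symmetric])
  show "nidx B U = nidx B C + nidx B R" using nidx_ssum[OF sC sR symB o] by (simp add: e[symmetric])
  show "pos B \<sigma> j U = pos B \<sigma> j C + pos B \<sigma> j R" "neg B \<sigma> j U = neg B \<sigma> j C + neg B \<sigma> j R"
    if "admissible j" for j
    using pos_neg_ssum[OF that C(1) R 0 o] by (simp_all add: e[symmetric])
qed

lemma cyc_atom:
  assumes j: "admissible (p, l)" and u: "act (p ^ l) u = 0" "\<beta> (p, l) u u \<noteq> 0"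
  shows "nondeg_on B (cyc \<sigma> u)"
    "pos B \<sigma> (p, l) (cyc \<sigma> u) = (if \<beta> (p, l) u u > 0 then degree p else 0)"
    "neg B \<sigma> (p, l) (cyc \<sigma> u) = (if \<beta> (p, l) u u < 0 then degree p else 0)"
    "\<And>k. admissible k \<Longrightarrow> k \<noteq> (p, l) \<Longrightarrow> pos B \<sigma> k (cyc \<sigma> u) = 0 \<and> neg B \<sigma> k (cyc \<sigma> u) = 0"
    "int (pidx B (cyc \<sigma> u)) - int (nidx B (cyc \<sigma> u))
      = (if odd l then int (pos B \<sigma> (p, l) (cyc \<sigma> u)) - int (neg B \<sigma> (p, l) (cyc \<sigma> u)) else 0)"
proof -
  have "nondeg_on B (cyc \<sigma> u) \<and>
    pos B \<sigma> (p, l) (cyc \<sigma> u) = (if \<beta> (p, l) u u > 0 then degree p else 0) \<and>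
    neg B \<sigma> (p, l) (cyc \<sigma> u) = (if \<beta> (p, l) u u < 0 then degree p else 0) \<and>
    (\<forall>k. admissible k \<longrightarrow> k \<noteq> (p, l) \<longrightarrow> pos B \<sigma> k (cyc \<sigma> u) = 0 \<and> neg B \<sigma> k (cyc \<sigma> u) = 0) \<and>
    int (pidx B (cyc \<sigma> u)) - int (nidx B (cyc \<sigma> u))
      = (if odd l then int (pos B \<sigma> (p, l) (cyc \<sigma> u)) - int (neg B \<sigma> (p, l) (cyc \<sigma> u)) else 0)"
  proof (cases "\<beta> (p, l) u u > 0")
    case True
    from cyc_positive(2-6)[OF j u(1) True] True show ?thesis by simp
  next
    case False
    then have n: "\<beta> (p, l) u u < 0" using u(2) by simp
    from cyc_negative(2-6)[OF j u(1) n] n show ?thesis by simp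
  qed
  then show "nondeg_on B (cyc \<sigma> u)"
    "pos B \<sigma> (p, l) (cyc \<sigma> u) = (if \<beta> (p, l) u u > 0 then degree p else 0)"
    "neg B \<sigma> (p, l) (cyc \<sigma> u) = (if \<beta> (p, l) u u < 0 then degree p else 0)"
    "\<And>k. admissible k \<Longrightarrow> k \<noteq> (p, l) \<Longrightarrow> pos B \<sigma> k (cyc \<sigma> u) = 0 \<and> neg B \<sigma> k (cyc \<sigma> u) = 0"
    "int (pidx B (cyc \<sigma> u)) - int (nidx B (cyc \<sigma> u))
      = (if odd l then int (pos B \<sigma> (p, l) (cyc \<sigma> u)) - int (neg B \<sigma> (p, l) (cyc \<sigma> u)) else 0)"
    by blast+
qed

section \<open>Inductions that remove one block at a time\<close>

lemma cyc_subset_stable: "stable \<sigma> U \<Longrightarrow> u \<in> U \<Longrightarrow> cyc \<sigma> u \<subseteq> U"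
  using stable_act by (auto simp: cyc_def)

lemma dim_cyc_pos: "\<beta> j u u \<noteq> 0 \<Longrightarrow> admissible j \<Longrightarrow> dim (cyc \<sigma> u) > 0"
proof (rule ccontr)
  assume a: "\<beta> j u u \<noteq> 0" "admissible j" "\<not> dim (cyc \<sigma> u) > 0"
  then have "cyc \<sigma> u \<subseteq> {0}" by (simp add: fd.dim_eq_0)
  then have "u = 0" using cyc_base by blast
  then show False using a symform_rules[OF symform_bform[OF a(2)]] by simp
qed

lemma dim_pos_subspace:
  fixes U :: "'a set"
  assumes "subspace U" "U \<noteq> {0}" shows "dim U > 0"
proof (rule ccontr)
  assume "\<not> dim U > 0"
  then have "U \<subseteq> {0}" by (simp add: fd.dim_eq_0)
  then show False using assms subspace_0 by blast
qed

lemma zero_invariants: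
  "pidx B {0} = 0" "nidx B {0} = 0"
  "admissible j \<Longrightarrow> pos B \<sigma> j {0} = 0" "admissible j \<Longrightarrow> neg B \<sigma> j {0} = 0"
proof -
  show "pidx B {0} = 0" "nidx B {0} = 0"
    unfolding nidx_def by (auto intro!: pidx_nonpos simp: subspace_single_0 Br)
  have st: "stable \<sigma> {0}" by (simp add: stable_def subspace_single_0 linear_0[OF lin])
  show "pos B \<sigma> j {0} = 0" "neg B \<sigma> j {0} = 0" if j: "admissible j"
  proof -
    have "\<And>x. x \<in> {0} \<inter> kerp \<sigma> j \<Longrightarrow> \<beta> j x x = 0" by (simp add: symform_rules[OF symform_bform[OF j]])
    from pos_neg_vanish[OF st this] show "pos B \<sigma> j {0} = 0" "neg B \<sigma> j {0} = 0" by blast+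
  qed
qed

text \<open>Both sides are additive over orthogonal stable summands, vanish on summands with an
  anti-isometry, and agree on a cyclic block, which contributes only for odd l. The set J is fixed
  in advance; the condition that it contains all odd pairs that occur passes to complements, whose
  indices are no larger.\<close>

lemma signature_formula:
  assumes "stable \<sigma> U" "nondeg_on B U" and J: "finite J" "\<And>j. j \<in> J \<Longrightarrow> admissible j \<and> odd (snd j)"
    "\<And>j. admissible j \<Longrightarrow> odd (snd j) \<Longrightarrow> pos B \<sigma> j U + neg B \<sigma> j U > 0 \<Longrightarrow> j \<in> J"
  shows "int (pidx B U) - int (nidx B U) = (\<Sum>j\<in>J. int (pos B \<sigma> j U) - int (neg B \<sigma> j U))"
  using assms(1,2,5)
proof (induction "dim U" arbitrary: U rule: less_induct)
  case less
  show ?case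
  proof (cases "U = {0}")
    case True
    then show ?thesis using J(2) by (simp add: zero_invariants cong: sum.cong)
  next
    case False
    have step: ?thesis if C: "stable \<sigma> C" "nondeg_on B C" "C \<subseteq> U" "dim C > 0"
      and sC: "int (pidx B C) - int (nidx B C) = (\<Sum>j\<in>J. int (pos B \<sigma> j C) - int (neg B \<sigma> j C))" for C
    proof -
      define R where "R = perp B U C"
      note d = decompose[OF less.prems(1,2) C(1-3), folded R_def]
      have "int (pidx B R) - int (nidx B R) = (\<Sum>j\<in>J. int (pos B \<sigma> j R) - int (neg B \<sigma> j R))"
      proof (rule less.hyps[OF _ d(1,2)])
        show "dim R < dim U" using d(7) C(4) by simp
        fix j assume "admissible j" "odd (snd j)" "pos B \<sigma> j R + neg B \<sigma> j R > 0"
        then show "j \<in> J" using less.prems(3)[of j] d(10,11)[of j] by auto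
      qed
      moreover have "(\<Sum>j\<in>J. int (pos B \<sigma> j U) - int (neg B \<sigma> j U))
        = (\<Sum>j\<in>J. int (pos B \<sigma> j C) - int (neg B \<sigma> j C)) + (\<Sum>j\<in>J. int (pos B \<sigma> j R) - int (neg B \<sigma> j R))"
        unfolding sum.distrib[symmetric] using J(2) d(10,11) by (intro sum.cong) auto
      ultimately show ?thesis using sC d(8,9) by simp
    qed
    from split[OF less.prems(1,2) False] show ?thesis
    proof (elim disjE exE conjE)
      fix H assume H: "H \<subseteq> U" "stable \<sigma> H" "nondeg_on B H" "H \<noteq> {0}" "anti H H"
      have "int (pos B \<sigma> j H) - int (neg B \<sigma> j H) = 0" if "j \<in> J" for j
        using anti_invariants(2)[OF H(5,2,3)] J(2)[OF that] by simp
      moreover have "pidx B H = nidx B H"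
      proof -
        obtain g where g: "linear g" "g ` H = H" "\<And>x y. x \<in> H \<Longrightarrow> y \<in> H \<Longrightarrow> B (g x) (g y) = - B x y"
          by (rule antiE[OF H(5)]) simp
        have inj: "x = 0" if "x \<in> H" "g x = 0" for x
          using H(3) that g(3)[OF that(1)] by (auto simp: nondeg_on_def Br)
        have "pidx B H = pidx (\<lambda>x y. - B x y) (g ` H)"
          using g(3) inj by (intro pidx_image[OF g(1) stable_subspace[OF H(2)]] symform_minus[OF symB]) auto
        then show ?thesis unfolding g(2) nidx_def .
      qed
      ultimately show ?thesis
        using step[OF H(2,3,1) dim_pos_subspace[OF stable_subspace[OF H(2)] H(4)]] by simp
    next
      fix p l u assume u: "admissible (p, l)" "u \<in> U" "act (p ^ l) u = 0" "\<beta> (p, l) u u \<noteq> 0"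
      note c = cyc_atom[OF u(1,3,4)]
      have "(\<Sum>j\<in>J. int (pos B \<sigma> j (cyc \<sigma> u)) - int (neg B \<sigma> j (cyc \<sigma> u)))
        = (\<Sum>j\<in>J. if j = (p, l) then int (pos B \<sigma> (p, l) (cyc \<sigma> u)) - int (neg B \<sigma> (p, l) (cyc \<sigma> u)) else 0)"
        using c(4) J(2) by (intro sum.cong) auto
      also have "\<dots> = (if (p, l) \<in> J then int (pos B \<sigma> (p, l) (cyc \<sigma> u)) - int (neg B \<sigma> (p, l) (cyc \<sigma> u)) else 0)"
        using J(1) by simp
      also have "(p, l) \<in> J \<longleftrightarrow> odd l"
      proof
        assume "(p, l) \<in> J" then show "odd l" using J(2) by fastforce
      next
        assume l: "odd l"
        have "pos B \<sigma> (p, l) (cyc \<sigma> u) + neg B \<sigma> (p, l) (cyc \<sigma> u) > 0"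
          using c(2,3) u(4) self_dual_degree_pos[OF admissibleD(1)[OF u(1)]] by auto
        then have "pos B \<sigma> (p, l) U + neg B \<sigma> (p, l) U > 0"
          using decompose(10,11)[OF less.prems(1,2) stable_cyc c(1) cyc_subset_stable[OF less.prems(1) u(2)] u(1)] by linarith
        then show "(p, l) \<in> J" using less.prems(3) u(1) l by simp
      qed
      finally show ?thesis
        using c(5) by (intro step[OF stable_cyc c(1) cyc_subset_stable[OF less.prems(1) u(2)] dim_cyc_pos[OF u(4,1)]]) simp
    qed
  qed
qed

lemma neg_witness:
  assumes "stable \<sigma> U" "neg B \<sigma> (p, l) U > 0"
  obtains v where "v \<in> U" "act (p ^ l) v = 0" "\<beta> (p, l) v v < 0"
proof -
  obtain v where "v \<in> U \<inter> kerp \<sigma> (p, l)" "- \<beta> (p, l) v v > 0"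
    using pidx_pos_witness[OF subspace_Int_kerp[OF assms(1)]] assms(2) unfolding neg_def nidx_def by blast
  then show ?thesis using that[of v] by (simp add: kerp_def)
qed

lemma pos_witness:
  assumes "stable \<sigma> U" "pos B \<sigma> (p, l) U > 0"
  obtains v where "v \<in> U" "act (p ^ l) v = 0" "\<beta> (p, l) v v > 0"
proof -
  obtain v where "v \<in> U \<inter> kerp \<sigma> (p, l)" "\<beta> (p, l) v v > 0"
    using pidx_pos_witness[OF subspace_Int_kerp[OF assms(1)]] assms(2) unfolding pos_def by blast
  then show ?thesis using that[of v] by (simp add: kerp_def)
qed

lemma ssum_commute: "ssum S T = ssum T (S :: 'a set)"
  unfolding ssum_def by (auto, (metis add.commute)+)

text \<open>A cyclic block with \<beta> u u of one sign leaves an excess of the other sign in its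
  complement, where a partner v is found. Their cyclic subspaces are exchanged by an anti-isometry,
  and removing both leaves a balanced complement.\<close>

lemma balanced_anti:
  assumes "stable \<sigma> U" "nondeg_on B U" "\<And>j. admissible j \<Longrightarrow> pos B \<sigma> j U = neg B \<sigma> j U"
  shows "anti U U"
  using assms
proof (induction "dim U" arbitrary: U rule: less_induct)
  case less
  show ?case
  proof (cases "U = {0}")
    case True then show ?thesis using anti_zero by simp
  next
    case False
    have step: ?thesis if C: "stable \<sigma> C" "nondeg_on B C" "C \<subseteq> U" "dim C > 0" "anti C C" 
      and sC: "\<And>j. admissible j \<Longrightarrow> pos B \<sigma> j C = neg B \<sigma> j C" for C
    proof -
      define R where "R = perp B U C"
      note d = decompose[OF less.prems(1,2) C(1-3), folded R_def]
      have "anti R R"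
      proof (rule less.hyps[OF _ d(1,2)])
        show "dim R < dim U" using d(7) C(4) by simp
        show "\<And>j. admissible j \<Longrightarrow> pos B \<sigma> j R = neg B \<sigma> j R"
          using less.prems(3) sC d(10,11) by fastforce
      qed
      then have "anti (ssum C R) (ssum C R)"
        by (intro anti_ssum C(2,5) d(1,2,4) C(1) stable_subspace)
      then show ?thesis unfolding d(6)[symmetric] .
    qed
    from split[OF less.prems(1,2) False] show ?thesis
    proof (elim disjE exE conjE)
      fix H assume H: "H \<subseteq> U" "stable \<sigma> H" "nondeg_on B H" "H \<noteq> {0}" "anti H H"
      show ?thesis
        by (rule step[OF H(2,3,1) dim_pos_subspace[OF stable_subspace[OF H(2)] H(4)] H(5)])
          (rule anti_invariants(2)[OF H(5,2,3)])
    next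
      fix p l u assume u: "admissible (p, l)" "u \<in> U" "act (p ^ l) u = 0" "\<beta> (p, l) u u \<noteq> 0"
      define C where "C = cyc \<sigma> u"
      define R where "R = perp B U C"
      note c = cyc_atom[OF u(1,3,4), folded C_def]
      have C: "stable \<sigma> C" "C \<subseteq> U" using stable_cyc cyc_subset_stable[OF less.prems(1) u(2)] by (simp_all add: C_def)
      note d = decompose[OF less.prems(1,2) C(1) c(1) C(2), folded R_def]
      have dp: "degree p > 0" by (rule self_dual_degree_pos[OF admissibleD(1)[OF u(1)]])
      have "\<exists>v\<in>R. act (p ^ l) v = 0 \<and> \<beta> (p, l) u u * \<beta> (p, l) v v < 0"
      proof (cases "\<beta> (p, l) u u > 0")
        case True
        then have "neg B \<sigma> (p, l) R > 0" using d(10,11)[OF u(1)] less.prems(3)[OF u(1)] c(2,3) dp by simp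
        from neg_witness[OF d(1) this] show ?thesis using True by (metis mult_pos_neg)
      next
        case False
        then have "pos B \<sigma> (p, l) R > 0" using d(10,11)[OF u(1)] less.prems(3)[OF u(1)] c(2,3) dp u(4) by simp
        from pos_witness[OF d(1) this] show ?thesis using False u(4) by (metis linorder_neqE_linordered_idom mult_neg_pos)
      qed
      then obtain v where v: "v \<in> R" "act (p ^ l) v = 0" "\<beta> (p, l) u u * \<beta> (p, l) v v < 0" by blast
      then have v0: "\<beta> (p, l) v v \<noteq> 0" by auto
      define D where "D = cyc \<sigma> v"
      note c2 = cyc_atom[OF u(1) v(2) v0, folded D_def]
      have D: "stable \<sigma> D" "D \<subseteq> R" using stable_cyc cyc_subset_stable[OF d(1) v(1)] by (simp_all add: D_def)
      have a: "anti C D" "anti D C"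
        unfolding C_def D_def using v u by (auto intro!: anti_cyc[OF u(1)] simp: mult.commute)
      have o: "orth B C D" "orth B D C" using d(4) D(2) orth_sym[OF symB] by (auto simp: orth_def symform_sym[OF symB])
      have 0: "C \<inter> D \<subseteq> {0}" using d(5) D(2) by blast
      define K where "K = ssum C D"
      have K: "stable \<sigma> K" unfolding K_def by (rule stable_ssum[OF C(1) D(1)])
      have "anti K (ssum D C)" unfolding K_def
        by (rule anti_ssum[OF stable_subspace[OF C(1)] stable_subspace[OF D(1)] c(1) c2(1) o C(1) D(1) a])
      then have aK: "anti K K" unfolding K_def by (simp add: ssum_commute)
      have nK: "nondeg_on B K" unfolding K_def
        using nondeg_on_ssum[OF symB stable_subspace[OF C(1)] stable_subspace[OF D(1)] o(1)] c(1) c2(1) by blast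
      have KU: "K \<subseteq> U" unfolding K_def
        using C(2) D(2) d(3) by (intro ssum_subset stable_subspace[OF less.prems(1)]) auto
      have "dim K > 0"
        using dim_ssum[OF stable_subspace[OF C(1)] stable_subspace[OF D(1)] 0] dim_cyc_pos[OF u(4,1)] by (simp add: K_def C_def)
      then show ?thesis by (rule step[OF K nK KU _ aK]) (rule anti_invariants(2)[OF aK K nK])
    qed
  qed
qed

text \<open>Removing a positive cyclic block lowers \<open>pos\<close> by
  \<open>degree p\<close>.\<close>

lemma degree_dvd_pos:
  assumes "stable \<sigma> U" "nondeg_on B U" and j: "admissible (p, l)"
  shows "degree p dvd pos B \<sigma> (p, l) U"
  using assms(1,2)
proof (induction "dim U" arbitrary: U rule: less_induct)
  case less
  show ?case
  proof (cases "pos B \<sigma> (p, l) U = 0")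
    case False
    then obtain u where u: "u \<in> U" "act (p ^ l) u = 0" "\<beta> (p, l) u u > 0"
      using pos_witness[OF less.prems(1)] by (metis neq0_conv)
    then have u0: "\<beta> (p, l) u u \<noteq> 0" by simp
    note c = cyc_atom[OF j u(2) u0]
    note d = decompose[OF less.prems stable_cyc c(1) cyc_subset_stable[OF less.prems(1) u(1)]]
    have "degree p dvd pos B \<sigma> (p, l) (perp B U (cyc \<sigma> u))"
      using d(7) dim_cyc_pos[OF u0 j] by (intro less.hyps d(1,2)) simp
    then show ?thesis using d(10)[OF j] c(2) u(3) by simp
  qed simp
qed

text \<open>T is assembled from |s j| cyclic blocks of the sign of s j, one at a time. The bounds
  ensure that the complement of the blocks already taken still contains a vector of the required
  sign.\<close>

lemma exists_with_signs:
  assumes F: "finite F" "\<And>j. j \<in> F \<Longrightarrow> admissible j" "\<And>j. j \<notin> F \<Longrightarrow> s j = (0 :: int)"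
    and U: "stable \<sigma> U" "nondeg_on B U"
    and b: "\<And>j. j \<in> F \<Longrightarrow> int (degree (fst j)) * s j \<le> int (pos B \<sigma> j U)"
      "\<And>j. j \<in> F \<Longrightarrow> - (int (degree (fst j)) * s j) \<le> int (neg B \<sigma> j U)"
  shows "\<exists>T. T \<subseteq> U \<and> stable \<sigma> T \<and> nondeg_on B T \<and>
    (\<forall>j. admissible j \<longrightarrow> int (pos B \<sigma> j T) - int (neg B \<sigma> j T) = int (degree (fst j)) * s j)"
  using F(3) U b
proof (induction "nat (\<Sum>j\<in>F. \<bar>s j\<bar>)" arbitrary: s U rule: less_induct)
  case less
  show ?case
  proof (cases "\<exists>j\<in>F. s j \<noteq> 0")
    case False
    then have "s j = 0" for j using less.prems(1) by blast
    moreover have "{0} \<subseteq> U" "stable \<sigma> {0}"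
      using subspace_0[OF stable_subspace[OF less.prems(2)]] by (auto simp: stable_def subspace_single_0 linear_0[OF lin])
    moreover have "nondeg_on B {0}" by (simp add: nondeg_on_def)
    ultimately show ?thesis by (intro exI[of _ "{0}"]) (simp add: zero_invariants)
  next
    case True
    then obtain p l where pl: "(p, l) \<in> F" "s (p, l) \<noteq> 0" by auto
    note j = F(2)[OF pl(1)]
    have dp: "degree p > 0" by (rule self_dual_degree_pos[OF admissibleD(1)[OF j]])
    define \<delta> where "\<delta> = (if s (p, l) > 0 then 1 else - 1 :: int)"
    have "\<exists>u\<in>U. act (p ^ l) u = 0 \<and> \<beta> (p, l) u u \<noteq> 0 \<and> (\<beta> (p, l) u u > 0 \<longleftrightarrow> s (p, l) > 0)"
    proof (cases "s (p, l) > 0")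
      case pos: True
      then have "int (degree p) * s (p, l) > 0" using dp by simp
      then have "pos B \<sigma> (p, l) U > 0" using less.prems(4)[OF pl(1)] by simp
      from pos_witness[OF less.prems(2) this] show ?thesis using pos by (metis less_irrefl)
    next
      case neg: False
      then have "- (int (degree p) * s (p, l)) > 0" using dp pl(2) by (simp add: mult_less_0_iff)
      then have "neg B \<sigma> (p, l) U > 0" using less.prems(5)[OF pl(1)] by simp
      from neg_witness[OF less.prems(2) this] show ?thesis using neg by (metis less_irrefl less_asym)
    qed
    then obtain u where u: "u \<in> U" "act (p ^ l) u = 0" "\<beta> (p, l) u u \<noteq> 0"
      "\<beta> (p, l) u u > 0 \<longleftrightarrow> s (p, l) > 0" by blast
    define C where "C = cyc \<sigma> u"
    define R where "R = perp B U C"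
    note c = cyc_atom[OF j u(2,3), folded C_def]
    have C: "stable \<sigma> C" "C \<subseteq> U" using stable_cyc cyc_subset_stable[OF less.prems(2) u(1)] by (simp_all add: C_def)
    note d = decompose[OF less.prems(2,3) C(1) c(1) C(2), folded R_def]
    \<comment> \<open>One block of sign \<delta> at (p, l) has been used up.\<close>
    define s' where "s' = s((p, l) := s (p, l) - \<delta>)"
    have "\<exists>T. T \<subseteq> R \<and> stable \<sigma> T \<and> nondeg_on B T \<and>
      (\<forall>j. admissible j \<longrightarrow> int (pos B \<sigma> j T) - int (neg B \<sigma> j T) = int (degree (fst j)) * s' j)"
    proof (rule less.hyps)
      have abs: "\<bar>s' (p, l)\<bar> = \<bar>s (p, l)\<bar> - 1" using pl(2) by (auto simp: s'_def \<delta>_def)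
      have "(\<Sum>j\<in>F. \<bar>s' j\<bar>) = \<bar>s' (p, l)\<bar> + (\<Sum>j\<in>F - {(p, l)}. \<bar>s' j\<bar>)"
        by (rule sum.remove[OF F(1) pl(1)])
      also have "(\<Sum>j\<in>F - {(p, l)}. \<bar>s' j\<bar>) = (\<Sum>j\<in>F - {(p, l)}. \<bar>s j\<bar>)"
        by (intro sum.cong) (auto simp: s'_def)
      also have "\<bar>s' (p, l)\<bar> + (\<Sum>j\<in>F - {(p, l)}. \<bar>s j\<bar>) = (\<Sum>j\<in>F. \<bar>s j\<bar>) - 1"
        unfolding abs using sum.remove[OF F(1) pl(1), of "\<lambda>j. \<bar>s j\<bar>"] by simp
      finally have e: "(\<Sum>j\<in>F. \<bar>s' j\<bar>) = (\<Sum>j\<in>F. \<bar>s j\<bar>) - 1" .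
      have "(\<Sum>j\<in>F. \<bar>s' j\<bar>) \<ge> 0" by (intro sum_nonneg) simp
      then show "nat (\<Sum>j\<in>F. \<bar>s' j\<bar>) < nat (\<Sum>j\<in>F. \<bar>s j\<bar>)" using e by linarith
      show "\<And>j. j \<notin> F \<Longrightarrow> s' j = 0" using less.prems(1) pl(1) by (auto simp: s'_def)
      show "stable \<sigma> R" "nondeg_on B R" by (rule d)+
      fix k assume k: "k \<in> F"
      note ka = F(2)[OF k]
      show "int (degree (fst k)) * s' k \<le> int (pos B \<sigma> k R)"
      proof (cases "k = (p, l)")
        case True
        have "int (degree p) * (s (p, l) + 1) \<le> 0" if "\<not> s (p, l) > 0"
          using that pl(2) by (intro mult_nonneg_nonpos) auto
        then show ?thesis using True less.prems(4)[OF pl(1)] d(10)[OF j] c(2) u pl(2)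
          by (auto simp: s'_def \<delta>_def algebra_simps mult_le_0_iff)
      next
        case False
        then show ?thesis using less.prems(4)[OF k] d(10)[OF ka] c(4)[OF ka] by (simp add: s'_def)
      qed
      show "- (int (degree (fst k)) * s' k) \<le> int (neg B \<sigma> k R)"
      proof (cases "k = (p, l)")
        case True
        have "int (degree p) * (s (p, l) - 1) \<ge> 0" if "s (p, l) > 0" using that by simp
        then show ?thesis using less.prems(5)[OF pl(1)] d(11)[OF j] c(3) u pl(2) True
          by (auto simp: s'_def \<delta>_def algebra_simps)
      next
        case False
        then show ?thesis using less.prems(5)[OF k] d(11)[OF ka] c(4)[OF ka] by (simp add: s'_def)
      qed
    qed
    then obtain T where T: "T \<subseteq> R" "stable \<sigma> T" "nondeg_on B T"
      "\<And>j. admissible j \<Longrightarrow> int (pos B \<sigma> j T) - int (neg B \<sigma> j T) = int (degree (fst j)) * s' j" by blast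
    have o: "orth B C T" using d(4) T(1) by (auto simp: orth_def)
    have 0: "C \<inter> T \<subseteq> {0}" using d(5) T(1) by blast
    show ?thesis
    proof (intro exI conjI allI impI)
      show "ssum C T \<subseteq> U" using C(2) T(1) d(3) by (intro ssum_subset stable_subspace[OF less.prems(2)]) auto
      show "stable \<sigma> (ssum C T)" by (rule stable_ssum[OF C(1) T(2)])
      show "nondeg_on B (ssum C T)"
        using nondeg_on_ssum[OF symB stable_subspace[OF C(1)] stable_subspace[OF T(2)] o] c(1) T(3) by blast
      fix k assume k: "admissible k"
      note pn = pos_neg_ssum[OF k C(1) T(2) 0 o]
      show "int (pos B \<sigma> k (ssum C T)) - int (neg B \<sigma> k (ssum C T)) = int (degree (fst k)) * s k"
      proof (cases "k = (p, l)")
        case True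
        then show ?thesis using pn T(4)[OF k] c(2,3) u by (auto simp: s'_def \<delta>_def algebra_simps)
      next
        case False
        then show ?thesis using pn T(4)[OF k] c(4)[OF k] by (simp add: s'_def)
      qed
    qed
  qed
qed

end

section \<open>Conjugacy\<close>

definition sg :: "nat \<Rightarrow> nat \<Rightarrow> real" where
  "sg r i = (if i < r then 1 else - 1)"

lemma sg_simps [simp]: "sg r i * sg r i = 1" "sg r i \<noteq> 0"
  by (auto simp: sg_def)

text \<open>An orthonormal basis in the indefinite sense, with the positive vectors first. The
  prescribed values of \<beta> imply independence.\<close>

definition signed_basis ::
  "('a::real_vector \<Rightarrow> 'a \<Rightarrow> real) \<Rightarrow> 'a set \<Rightarrow> nat \<Rightarrow> nat \<Rightarrow> (nat \<Rightarrow> 'a) \<Rightarrow> bool" where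
  "signed_basis \<beta> D r s e \<longleftrightarrow> (\<forall>i<r + s. e i \<in> D) \<and>
     (\<forall>i<r + s. \<forall>k<r + s. \<beta> (e i) (e k) = (if i = k then sg r i else 0)) \<and>
     span (e ` {..<r + s}) = D"

lemma signed_expand:
  assumes \<beta>: "symform \<beta>" and e: "signed_basis \<beta> D r s e" and x: "x \<in> D"
  shows "x = (\<Sum>i<r + s. (sg r i * \<beta> x (e i)) *\<^sub>R e i)"
proof -
  note R = symform_rules[OF \<beta>]
  have l: "linear (\<lambda>x. \<Sum>i<r + s. (sg r i * \<beta> x (e i)) *\<^sub>R e i)"
    by (intro linear_compose_sum ballI linearI) (simp_all add: R algebra_simps)
  have "e k = (\<Sum>i<r + s. (sg r i * \<beta> (e k) (e i)) *\<^sub>R e i)" if k: "k < r + s" for k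
  proof -
    have "(\<Sum>i<r + s. (sg r i * \<beta> (e k) (e i)) *\<^sub>R e i) = (\<Sum>i<r + s. if i = k then e k else 0)"
      using e k by (intro sum.cong) (auto simp: signed_basis_def)
    then show ?thesis using k by simp
  qed
  then have "\<And>y. y \<in> e ` {..<r + s} \<Longrightarrow> id y = (\<Sum>i<r + s. (sg r i * \<beta> y (e i)) *\<^sub>R e i)" by auto
  moreover have "x \<in> span (e ` {..<r + s})" using e x by (simp add: signed_basis_def)
  ultimately have "id x = (\<Sum>i<r + s. (sg r i * \<beta> x (e i)) *\<^sub>R e i)"
    by (rule linear_eq_on_span[OF linear_id l])
  then show ?thesis by simp
qed

lemma signed_basis_subspace: "signed_basis \<beta> D r s e \<Longrightarrow> subspace D"
  unfolding signed_basis_def by (metis subspace_span)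

lemma signed_form:
  assumes \<beta>: "symform \<beta>" and e: "signed_basis \<beta> D r s e" and x: "x \<in> D"
  shows "\<beta> x y = (\<Sum>i<r + s. sg r i * \<beta> x (e i) * \<beta> y (e i))"
proof -
  have "\<beta> x y = \<beta> (\<Sum>i<r + s. (sg r i * \<beta> x (e i)) *\<^sub>R e i) y"
    using signed_expand[OF assms] by simp
  also have "\<dots> = (\<Sum>i<r + s. sg r i * \<beta> x (e i) * \<beta> y (e i))"
    by (simp add: symform_sum[OF \<beta>] symform_rules[OF \<beta>] symform_sym[OF \<beta>, of "e _"])
  finally show ?thesis .
qed

lemma signed_basis_nondeg:
  assumes \<beta>: "symform \<beta>" and e: "signed_basis \<beta> D r s e" shows "nondeg_on \<beta> D"
  unfolding nondeg_on_def
proof (intro ballI impI)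
  fix x assume "x \<in> D" "\<forall>y\<in>D. \<beta> x y = 0"
  moreover from this(2) have "\<forall>i<r + s. \<beta> x (e i) = 0" using e by (auto simp: signed_basis_def)
  ultimately show "x = 0" using signed_expand[OF \<beta> e, of x] by simp
qed

context fdim begin

text \<open>On the span of the first r vectors the form is a sum of squares, on the span of the
  others minus a sum of squares; \<open>pidx_eqI\<close> reads off the positive index.\<close>

lemma signed_basis_dims:
  fixes e :: "nat \<Rightarrow> 'a"
  assumes \<beta>: "symform \<beta>" and e: "signed_basis \<beta> D r s e"
  shows "pidx \<beta> D = r" "nidx \<beta> D = s" "dim D = r + s"
proof -
  note R = symform_rules[OF \<beta>]
  have ee: "\<beta> (e i) (e k) = (if i = k then sg r i else 0)" if "i < r + s" "k < r + s" for i k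
    using e that by (simp add: signed_basis_def)
  have inj: "inj_on e {..<r + s}"
  proof (rule inj_onI, rule ccontr)
    fix i k assume ik: "i \<in> {..<r + s}" "k \<in> {..<r + s}" "e i = e k" "i \<noteq> k"
    have "sg r i = \<beta> (e i) (e i)" using ee[of i i] ik(1) by simp
    also have "\<dots> = \<beta> (e i) (e k)" using arg_cong[OF ik(3), of "\<beta> (e i)"] .
    also have "\<dots> = 0" using ee[of i k] ik by simp
    finally show False by simp
  qed
  have ind: "independent (e ` {..<r + s})"
  proof (rule independent_if_scalars_zero)
    fix f x assume z: "(\<Sum>x\<in>e ` {..<r + s}. f x *\<^sub>R x) = 0" and x: "x \<in> e ` {..<r + s}"
    then obtain k where k: "k < r + s" "x = e k" by auto
    have "0 = \<beta> (\<Sum>i<r + s. f (e i) *\<^sub>R e i) (e k)" using z inj by (simp add: sum.reindex R)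
    also have "\<dots> = (\<Sum>i<r + s. if i = k then f (e k) * sg r k else 0)"
      unfolding symform_sum[OF \<beta>] using ee k(1) by (intro sum.cong) (auto simp: R)
    also have "\<dots> = f x * sg r k" using k by simp
    finally show "f x = 0" by simp
  qed simp
  show dD: "dim D = r + s"
    using e dim_span_eq_card_independent[OF ind] card_image[OF inj] by (simp add: signed_basis_def)
  have IP: "independent (e ` {..<r})" "card (e ` {..<r}) = r"
    by (rule independent_mono[OF ind], intro image_mono, auto simp: card_image[OF inj_on_subset[OF inj]])
  have IZ: "independent (e ` {r..<r + s})" "card (e ` {r..<r + s}) = s"
  proof -
    have "{r..<r + s} \<subseteq> {..<r + s}" by auto
    then show "independent (e ` {r..<r + s})" "card (e ` {r..<r + s}) = s"
      using independent_mono[OF ind image_mono] card_image[OF inj_on_subset[OF inj]] by simp_all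
  qed
  define P where "P = span (e ` {..<r})"
  define Z where "Z = span (e ` {r..<r + s})"
  have sub: "subspace P" "subspace Z" by (simp_all add: P_def Z_def)
  have dP: "dim P = r"
    unfolding P_def using dim_span_eq_card_independent[OF IP(1)] IP(2) by simp
  have dZ: "dim Z = s"
    unfolding Z_def using dim_span_eq_card_independent[OF IZ(1)] IZ(2) by simp
  have D: "D = ssum P Z"
  proof -
    have "{..<r + s} = {..<r} \<union> {r..<r + s}" by auto
    then have "D = span (e ` {..<r} \<union> e ` {r..<r + s})" using e by (simp add: signed_basis_def image_Un)
    then show ?thesis by (simp add: span_Un ssum_def P_def Z_def)
  qed
  have PZ: "P \<subseteq> D" "Z \<subseteq> D" using D ssum_superset1[OF sub(2)] ssum_superset2[OF sub(1)] by auto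
  have z: "\<beta> x (e k) = 0" if "x \<in> span (e ` I)" "k < r + s" "I \<subseteq> {..<r + s}" "k \<notin> I" for x k I
  proof -
    have "\<beta> y (e k) = 0" if "y \<in> e ` I" for y using that \<open>k < r + s\<close> \<open>I \<subseteq> _\<close> \<open>k \<notin> I\<close> ee by auto
    then show ?thesis
      using linear_eq_on_span[OF symform_linear_left[OF \<beta>, of "e k"] linear_zero, of "e ` I" x] that(1) by auto
  qed
  have Pf: "\<beta> x x = (\<Sum>i<r. (\<beta> x (e i))\<^sup>2)" if x: "x \<in> P" for x
  proof -
    have "\<beta> x x = (\<Sum>i<r + s. sg r i * \<beta> x (e i) * \<beta> x (e i))" using signed_form[OF \<beta> e] PZ x by blast
    also have "\<dots> = (\<Sum>i<r. sg r i * \<beta> x (e i) * \<beta> x (e i))"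
      using z[of x "{..<r}"] x by (intro sum.mono_neutral_right) (auto simp: P_def)
    finally show ?thesis by (simp add: sg_def power2_eq_square)
  qed
  have Zf: "\<beta> x x = - (\<Sum>i\<in>{r..<r + s}. (\<beta> x (e i))\<^sup>2)" if x: "x \<in> Z" for x
  proof -
    have "\<beta> x x = (\<Sum>i<r + s. sg r i * \<beta> x (e i) * \<beta> x (e i))" using signed_form[OF \<beta> e] PZ x by blast
    also have "\<dots> = (\<Sum>i\<in>{r..<r + s}. sg r i * \<beta> x (e i) * \<beta> x (e i))"
    proof (intro sum.mono_neutral_right ballI)
      show s: "{r..<r + s} \<subseteq> {..<r + s}" by auto
      fix i assume "i \<in> {..<r + s} - {r..<r + s}"
      then show "sg r i * \<beta> x (e i) * \<beta> x (e i) = 0" using z[of x "{r..<r + s}" i] x s by (auto simp: Z_def)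
    qed simp
    finally show ?thesis by (simp add: sg_def power2_eq_square sum_negf)
  qed
  have "pos_def_on \<beta> P" unfolding pos_def_on_def
  proof (intro ballI impI)
    fix x assume x: "x \<in> P" "x \<noteq> 0"
    have "\<beta> x x \<noteq> 0"
    proof
      assume "\<beta> x x = 0"
      then have "\<forall>i<r. \<beta> x (e i) = 0" using Pf[OF x(1)] by (simp add: sum_nonneg_eq_0_iff)
      moreover have "\<forall>i<r + s. r \<le> i \<longrightarrow> \<beta> x (e i) = 0" using z[of x "{..<r}"] x(1) by (auto simp: P_def)
      ultimately have "\<forall>i<r + s. \<beta> x (e i) = 0" by (meson not_le)
      then show False using signed_expand[OF \<beta> e, of x] PZ x by auto
    qed
    then show "\<beta> x x > 0" using Pf[OF x(1)] sum_nonneg[of "{..<r}" "\<lambda>i. (\<beta> x (e i))\<^sup>2"] by simp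
  qed
  moreover have "\<beta> x x \<le> 0" if "x \<in> Z" for x using Zf[OF that] by (simp add: sum_nonneg)
  ultimately show p: "pidx \<beta> D = r" using pidx_eqI[OF sub _ _ D, of \<beta>] dP by simp
  show "nidx \<beta> D = s"
    using pidx_nidx_nondeg[OF signed_basis_subspace[OF e] \<beta> signed_basis_nondeg[OF \<beta> e]] p dD by simp
qed

text \<open>Gram-Schmidt: normalise one vector and continue in its orthogonal complement.\<close>

lemma orthonormal_exists:
  fixes P :: "'a set"
  assumes "subspace P" "symform \<beta>" "pos_def_on \<beta> P"
  shows "\<exists>e. (\<forall>i<dim P. e i \<in> P) \<and> (\<forall>i<dim P. \<forall>k<dim P. \<beta> (e i) (e k) = (if i = k then 1 else 0)) \<and>
    span (e ` {..<dim P}) = P"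
  using assms(1,3)
proof (induction "dim P" arbitrary: P)
  case 0
  then have "P \<subseteq> {0}" by (simp add: fd.dim_eq_0)
  then have "P = {0}" using 0 subspace_0 by blast
  then show ?case by simp
next
  case (Suc n)
  note R = symform_rules[OF assms(2)]
  have "\<not> P \<subseteq> {0}"
  proof
    assume "P \<subseteq> {0}"
    then have "dim P = 0" by (simp add: fd.dim_eq_0)
    then show False using Suc(2) by linarith
  qed
  then obtain x where x: "x \<in> P" "x \<noteq> 0" by blast
  define u where "u = (1 / sqrt (\<beta> x x)) *\<^sub>R x"
  have xx: "\<beta> x x > 0" using Suc(4) x by (simp add: pos_def_on_def)
  have u: "u \<in> P" "\<beta> u u = 1" "u \<noteq> 0"
    using xx x Suc(3) by (simp_all add: u_def R subspace_scale)
  let ?S = "span {u}"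
  have S: "subspace ?S" "?S \<subseteq> P" using u(1) Suc(3) by (simp_all add: span_minimal)
  have "nondeg_on \<beta> ?S" using Suc(4) S(2) by (intro pos_def_on_nondeg) (auto simp: pos_def_on_def)
  note sp = ssum_perp[OF S Suc(3) assms(2) this]
  define Q where "Q = perp \<beta> P ?S"
  have Q: "subspace Q" "Q \<subseteq> P" using subspace_perp[OF assms(2) Suc(3)] by (auto simp: Q_def perp_def)
  have uQ: "\<beta> u y = 0" "\<beta> y u = 0" if "y \<in> Q" for y
    using that symform_sym[OF assms(2)] span_base[of u "{u}"] by (auto simp: Q_def perp_def)
  have "?S \<inter> Q \<subseteq> {0}"
  proof
    fix y assume y: "y \<in> ?S \<inter> Q"
    then obtain c where "y = c *\<^sub>R u" by (auto simp: span_singleton)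
    then have "c = \<beta> u y" using u(2) by (simp add: R)
    then show "y \<in> {0}" using uQ y \<open>y = _\<close> by simp
  qed
  then have "dim P = dim ?S + dim Q" using dim_ssum[OF S(1) Q(1)] sp by (simp add: Q_def)
  then have dQ: "n = dim Q" using Suc(2) u(3) by simp
  have "pos_def_on \<beta> Q" using Suc(4) Q(2) by (auto simp: pos_def_on_def)
  then obtain e where e: "\<forall>i<n. e i \<in> Q" "\<forall>i<n. \<forall>k<n. \<beta> (e i) (e k) = (if i = k then 1 else 0)"
    "span (e ` {..<n}) = Q" using Suc(1)[OF dQ Q(1)] dQ by auto
  define e' where "e' = e(n := u)"
  have "span (e' ` {..<Suc n}) = span (insert u (e ` {..<n}))"
  proof -
    have "e' ` {..<n} = e ` {..<n}" by (intro image_cong) (auto simp: e'_def)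
    moreover have "e' n = u" by (simp add: e'_def)
    ultimately show ?thesis by (simp add: lessThan_Suc)
  qed
  also have "\<dots> = span ({u} \<union> e ` {..<n})" by simp
  also have "\<dots> = ssum ?S Q" unfolding span_Un ssum_def e(3) ..
  also have "\<dots> = P" using sp by (simp add: Q_def)
  finally have "span (e' ` {..<Suc n}) = P" .
  moreover have "\<forall>i<Suc n. e' i \<in> P" using e(1) Q(2) u(1) by (auto simp: e'_def less_Suc_eq)
  moreover have "\<forall>i<Suc n. \<forall>k<Suc n. \<beta> (e' i) (e' k) = (if i = k then 1 else 0)"
    using e(1,2) uQ u(2) by (auto simp: e'_def less_Suc_eq)
  ultimately show ?case using Suc(2) by (intro exI[of _ e']) simp
qed

text \<open>The complement Z of a maximal positive definite P has positive index 0. Being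
  non-degenerate, it has its full dimension as negative index and so is negative definite, and
  orthonormal bases of P and Z combine.\<close>

lemma signed_basis_exists:
  fixes D :: "'a set"
  assumes D: "subspace D" and \<beta>: "symform \<beta>" and n: "nondeg_on \<beta> D"
  obtains e where "signed_basis \<beta> D (pidx \<beta> D) (nidx \<beta> D) e"
proof -
  obtain P where P: "subspace P" "P \<subseteq> D" "pos_def_on \<beta> P" "dim P = pidx \<beta> D"
    "D = ssum P (perp \<beta> D P)" "\<And>z. z \<in> perp \<beta> D P \<Longrightarrow> \<beta> z z \<le> 0"
    using pidx_split[OF D \<beta>] by blast
  define Z where "Z = perp \<beta> D P"
  define \<gamma> where "\<gamma> = (\<lambda>x y. - \<beta> x y)"
  have \<gamma>: "symform \<gamma>" using symform_minus[OF \<beta>] by (simp add: \<gamma>_def)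
  have Z: "subspace Z" using subspace_perp[OF \<beta> D] by (simp add: Z_def)
  have o: "orth \<beta> P Z" unfolding Z_def by (rule orth_perp)
  have DPZ: "D = ssum P Z" using P(5) by (simp add: Z_def)
  have nZ: "nondeg_on \<beta> Z" using nondeg_on_ssum[OF \<beta> P(1) Z o] n DPZ by simp
  have "pidx \<beta> Z = 0" using P(6) by (intro pidx_nonpos Z) (simp add: Z_def)
  then have nZd: "nidx \<beta> Z = dim Z" using pidx_nidx_nondeg[OF Z \<beta> nZ] by simp
  obtain M where M: "subspace M" "M \<subseteq> Z" "pos_def_on \<gamma> M" "dim M = dim Z"
    using pidx_attained[OF Z, of \<gamma>] nZd by (auto simp: nidx_def \<gamma>_def)
  then have "M = Z" using fd.subspace_dim_equal[OF M(1) Z M(2)] by simp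
  then have pZ: "pos_def_on \<gamma> Z" using M(3) by simp
  have nD: "nidx \<beta> D = dim Z"
  proof -
    have "- \<beta> x x \<le> 0" if "x \<in> P" for x
      using P(3) that by (cases "x = 0") (auto simp: pos_def_on_def symform_rules[OF \<beta>] intro: less_imp_le)
    then have "nidx \<beta> P = 0" unfolding nidx_def by (rule pidx_nonpos[OF P(1)])
    then show ?thesis using nidx_ssum[OF P(1) Z \<beta> o] nZd by (simp add: DPZ[symmetric])
  qed
  obtain e where e: "\<forall>i<dim P. e i \<in> P" "\<forall>i<dim P. \<forall>k<dim P. \<beta> (e i) (e k) = (if i = k then 1 else 0)"
    "span (e ` {..<dim P}) = P" using orthonormal_exists[OF P(1) \<beta> P(3)] by blast
  obtain f where f: "\<forall>i<dim Z. f i \<in> Z" "\<forall>i<dim Z. \<forall>k<dim Z. \<gamma> (f i) (f k) = (if i = k then 1 else 0)"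
    "span (f ` {..<dim Z}) = Z" using orthonormal_exists[OF Z \<gamma> pZ] by blast
  define r where "r = dim P"
  define s where "s = dim Z"
  define b where "b = (\<lambda>i. if i < r then e i else f (i - r))"
  have bP: "b i \<in> P" if "i < r" for i using e(1) that by (simp add: b_def r_def)
  have bZ: "b i \<in> Z" if "\<not> i < r" "i < r + s" for i using f(1) that by (simp add: b_def s_def)
  have PD: "P \<subseteq> D" "Z \<subseteq> D" using P(2) by (auto simp: Z_def perp_def)
  have "signed_basis \<beta> D r s b"
    unfolding signed_basis_def
  proof (intro conjI allI impI)
    show "b i \<in> D" if "i < r + s" for i using bP[of i] bZ[of i] that PD by blast
    show "\<beta> (b i) (b k) = (if i = k then sg r i else 0)" if ik: "i < r + s" "k < r + s" for i k
    proof (cases "i < r"; cases "k < r")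
      assume "i < r" "k < r" then show ?thesis using e(2) by (simp add: b_def r_def sg_def)
    next
      assume "i < r" "\<not> k < r" then show ?thesis using o bP[of i] bZ[of k] ik by (auto simp: orth_def)
    next
      assume "\<not> i < r" "k < r"
      then show ?thesis using o bP[of k] bZ[of i] ik symform_sym[OF \<beta>, of "b i"] by (auto simp: orth_def)
    next
      assume a: "\<not> i < r" "\<not> k < r"
      then have "\<gamma> (f (i - r)) (f (k - r)) = (if i - r = k - r then 1 else 0)" using f(2) ik by (simp add: s_def)
      then show ?thesis using a by (auto simp: b_def sg_def \<gamma>_def split: if_splits)
    qed
    have "{..<r + s} = {..<r} \<union> {r..<r + s}" by auto
    also have "{r..<r + s} = (\<lambda>i. r + i) ` {..<s}"
      by (simp add: lessThan_atLeast0 add.commute)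
    finally have "b ` {..<r + s} = b ` {..<r} \<union> (\<lambda>i. b (r + i)) ` {..<s}" by (simp add: image_Un image_image)
    also have "b ` {..<r} = e ` {..<r}" by (intro image_cong) (auto simp: b_def)
    also have "(\<lambda>i. b (r + i)) ` {..<s} = f ` {..<s}" by (intro image_cong) (auto simp: b_def)
    finally have "span (b ` {..<r + s}) = ssum (span (e ` {..<r})) (span (f ` {..<s}))"
      by (simp only: span_Un ssum_def)
    then show "span (b ` {..<r + s}) = D"
      unfolding r_def s_def e(3) f(3) DPZ .
  qed
  then show ?thesis using that P(4) nD by (simp add: r_def s_def)
qed

text \<open>Both forms have signed bases of the same type, and \<open>g\<close> sends the one for
  \<gamma> to the one for \<beta>.\<close>

lemma isometry_exists:
  fixes \<beta> \<gamma> :: "'a \<Rightarrow> 'a \<Rightarrow> real"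
  assumes \<beta>: "symform \<beta>" "nondeg_on \<beta> UNIV" and \<gamma>: "symform \<gamma>" "nondeg_on \<gamma> UNIV"
    and e: "pidx \<beta> UNIV = pidx \<gamma> UNIV"
  obtains g :: "'a \<Rightarrow> 'a" where "linear g" "\<And>x y. \<gamma> x y = \<beta> (g x) (g y)"
proof -
  have n: "nidx \<beta> UNIV = nidx \<gamma> UNIV"
    using pidx_nidx_nondeg[OF subspace_UNIV \<beta>] pidx_nidx_nondeg[OF subspace_UNIV \<gamma>] e by simp
  define r where "r = pidx \<beta> UNIV"
  define s where "s = nidx \<beta> UNIV"
  obtain b where b: "signed_basis \<beta> UNIV r s b"
    using signed_basis_exists[OF subspace_UNIV \<beta>] by (auto simp: r_def s_def)
  obtain c where c: "signed_basis \<gamma> UNIV r s c"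
    using signed_basis_exists[OF subspace_UNIV \<gamma>] e n by (auto simp: r_def s_def)
  define g where "g = (\<lambda>x. \<Sum>i<r + s. (sg r i * \<gamma> x (c i)) *\<^sub>R b i)"
  have "linear g" unfolding g_def
    by (intro linear_compose_sum ballI linearI) (simp_all add: symform_rules[OF \<gamma>(1)] algebra_simps)
  moreover have gb: "\<beta> (g x) (b k) = \<gamma> x (c k)" if "k < r + s" for x k
  proof -
    have "\<beta> (g x) (b k) = (\<Sum>i<r + s. if i = k then \<gamma> x (c k) else 0)"
      unfolding g_def symform_sum[OF \<beta>(1)] using b that
      by (intro sum.cong) (auto simp: symform_rules[OF \<beta>(1)] signed_basis_def)
    then show ?thesis using that by simp
  qed
  have "\<gamma> x y = \<beta> (g x) (g y)" for x y
    using signed_form[OF \<beta>(1) b UNIV_I, of "g x" "g y"] signed_form[OF \<gamma>(1) c UNIV_I, of x y] gb by simp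
  ultimately show ?thesis using that by blast
qed

end

section \<open>Invariant forms and conjugate isometries\<close>

context isom begin

lemma stable_UNIV: "stable \<sigma> UNIV"
  by (simp add: stable_def)

text \<open>
  If \<open>B' x y = B (A x) y\<close>, then \<open>A\<close> is of the form \<open>f(A)\<^sup>2 e(A)\<close> with \<open>e(A)\<^sup>2 = 1\<close>, where \<open>e(A)\<close> is \<open>- 1\<close>
  exactly on the generalised eigenspaces of negative real eigenvalues of \<open>A\<close>.  So up to the centraliser of \<open>\<sigma>\<close>
  every invariant form arises from \<open>B\<close> by a change of sign on a \<open>\<sigma>\<close>-stable orthogonal summand.
\<close>

lemma invariant_form_flip:
  assumes B': "symform B'" "nondeg_on B' UNIV" "\<And>x y. B' (\<sigma> x) (\<sigma> y) = B' x y"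
  obtains h E where "linear h" "\<And>x. h x = 0 \<Longrightarrow> x = 0" "\<And>x. h (\<sigma> x) = \<sigma> (h x)"
    "linear E" "\<And>x. E (E x) = x" "\<And>x. E (\<sigma> x) = \<sigma> (E x)" "\<And>x y. B (E x) y = B x (E y)"
    "\<And>x y. B' x y = B (E (h x)) (h y)"
proof -
  obtain A where A: "linear A" "\<And>x y. B (A x) y = B' x y"
    using riesz[OF subspace_UNIV symB ndB, of B'] B'(1) symform_linear_left[OF B'(1)] by (auto simp: symform_def)
  have uniq: "a = b" if "\<And>y. B a y = B b y" for a b
  proof -
    have "\<forall>y. B (a - b) y = 0" using that by (simp add: Br)
    then have "a - b = 0" using ndB unfolding nondeg_on_def by blast
    then show ?thesis by simp
  qed
  have As: "A (\<sigma> x) = \<sigma> (A x)" for x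
  proof (rule uniq)
    fix y show "B (A (\<sigma> x)) y = B (\<sigma> (A x)) y"
      using B'(3)[of x "\<sigma>i y"] by (simp add: A(2) adj)
  qed
  have Aadj: "B (A x) y = B x (A y)" for x y
    using A(2)[of x y] A(2)[of y x] symform_sym[OF symB, of x "A y"] symform_sym[OF B'(1), of x y] by simp
  have Ainj: "x = 0" if "A x = 0" for x
    using B'(2) A(2)[of x] that by (simp add: nondeg_on_def Br)
  obtain m where m: "m \<noteq> 0" "\<And>x. poly_act m A x = 0" by (rule ann_space[OF A(1)]) blast
  let ?X = "[:0, 1 :: real:]"
  obtain n m' where nm: "m dvd ?X ^ n * m'" "coprime ?X m'" using coprime_part[OF m(1)] by blast
  have "m' \<noteq> 0"
  proof
    assume "m' = 0"
    then have "is_unit ?X" using nm(2) by simp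
    then show False by (simp add: is_unit_iff_degree)
  qed
  moreover have "coprime m' ?X" using nm(2) by (simp add: coprime_commute)
  ultimately obtain f e where fe: "m' dvd f\<^sup>2 * e - ?X" "m' dvd e\<^sup>2 - 1" using signed_sqrt_mod by blast
  have m'0: "poly_act m' A x = 0" for x
  proof -
    have "poly_act (?X ^ n * m') A x = 0" by (rule poly_act_dvd_0[OF A(1) nm(1) m(2)])
    then have "(A ^^ n) (poly_act m' A x) = 0"
    proof (induction n)
      case (Suc n)
      have "A (poly_act (?X ^ n * m') A x) = 0"
        using Suc.prems by (simp only: power_Suc mult.assoc poly_act_mult[OF A(1), of ?X] poly_act_X[OF A(1)])
      then show ?case using Suc.IH Ainj by (simp add: linear_0[OF A(1)])
    qed simp
    then show ?thesis
    proof (induction n)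
      case (Suc n) then show ?case using Ainj by simp
    qed simp
  qed
  define h where "h = poly_act f A"
  define E where "E = poly_act e A"
  have lh: "linear h" "linear E" by (simp_all add: h_def E_def linear_poly_act[OF A(1)])
  have EE: "E (E x) = x" for x
  proof -
    have "poly_act (e\<^sup>2 - 1) A x = 0" by (rule poly_act_dvd_0[OF A(1) fe(2) m'0])
    then show ?thesis by (simp add: E_def poly_act_diff power2_eq_square poly_act_mult[OF A(1)])
  qed
  have Ehh: "E (h (h x)) = A x" for x
  proof -
    have "poly_act (f\<^sup>2 * e - ?X) A x = 0" by (rule poly_act_dvd_0[OF A(1) fe(1) m'0])
    then have "poly_act (f\<^sup>2 * e) A x = A x" by (simp add: poly_act_diff poly_act_X[OF A(1)])
    moreover have "poly_act (f\<^sup>2 * e) A x = E (h (h x))"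
      unfolding h_def E_def by (simp flip: poly_act_mult[OF A(1)] add: power2_eq_square mult_ac)
    ultimately show ?thesis by simp
  qed
  have comm: "poly_act q A (\<sigma> x) = \<sigma> (poly_act q A x)" for q x
    using poly_act_commute[OF A(1) lin, of q x] As by simp
  have sa: "B (poly_act q A x) y = B x (poly_act q A y)" for q x y
    using sqrt_selfadjoint[OF A(1) subspace_UNIV _ Aadj] by simp
  have Eh: "E (h x) = h (E x)" for x by (simp add: E_def h_def poly_act_commute_mult[OF A(1)])
  show ?thesis
  proof (rule that[of h E])
    show "x = 0" if "h x = 0" for x
      using Ehh[of x] that Ainj lh by (simp add: linear_0)
    show "B' x y = B (E (h x)) (h y)" for x y
      using sa[of f "E (h x)" y] Ehh[of x] Eh A(2)[of x y] by (simp add: h_def[symmetric])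
  qed (use lh EE comm sa in \<open>simp_all add: h_def E_def\<close>)
qed

lemma pidx_flip:
  assumes U: "subspace U" "subspace V" "orth B U V" and g: "symform \<gamma>"
    and v: "\<And>x y. x \<in> U \<Longrightarrow> \<gamma> x y = - B x y" "\<And>x y. x \<in> V \<Longrightarrow> \<gamma> x y = B x y"
  shows "pidx \<gamma> (ssum U V) = nidx B U + pidx B V"
proof -
  have "orth \<gamma> U V" using U(3) v(1) by (auto simp: orth_def)
  then have "pidx \<gamma> (ssum U V) = pidx \<gamma> U + pidx \<gamma> V" by (rule pidx_ssum[OF U(1,2) g])
  also have "pidx \<gamma> U = nidx B U" unfolding nidx_def by (rule pidx_cong) (simp add: v)
  also have "pidx \<gamma> V = pidx B V" by (rule pidx_cong) (simp add: v)
  finally show ?thesis .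
qed

lemma linear_inj_bij:
  fixes g :: "'a \<Rightarrow> 'a" assumes "linear g" "\<And>x. g x = 0 \<Longrightarrow> x = 0" shows "bij g"
proof -
  have "inj g" using linear_injective_0[OF assms(1)] assms(2) by blast
  moreover have "g ` UNIV = UNIV" by (rule image_eq_self[OF assms(1) subspace_UNIV]) (use assms(2) in auto)
  ultimately show ?thesis by (simp add: bij_def)
qed

lemma conjugate_in_iff:
  assumes "G \<subseteq> GL"
  shows "conjugate_in G \<sigma> \<tau> \<longleftrightarrow> (\<exists>g\<in>G. \<forall>x. \<tau> (g x) = g (\<sigma> x))"
proof -
  have "\<tau> = g \<circ> \<sigma> \<circ> inv_into UNIV g \<longleftrightarrow> (\<forall>x. \<tau> (g x) = g (\<sigma> x))" if "g \<in> G" for g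
  proof -
    have "bij g" using that assms by (auto simp: GL_def)
    then show ?thesis by (auto simp: fun_eq_iff bij_is_inj) (metis bij_inv_eq_iff)
  qed
  then show ?thesis by (auto simp: conjugate_in_def)
qed

text \<open>Let B' be the pull-back of B along g. The map h turns it into B (E x) y, where E is -1
  on U and 1 on V, and k undoes the change of sign by an anti-isometry of U. Then g h^-1 k is an
  isometry that conjugates \<sigma> into \<tau>. U has signature zero because B' and B have the same
  positive index.\<close>

lemma conjugacy_if_balanced:
  assumes bal: "\<And>U j. stable \<sigma> U \<Longrightarrow> nondeg_on B U \<Longrightarrow> pidx B U = nidx B U \<Longrightarrow> admissible j \<Longrightarrow>
      pos B \<sigma> j U = neg B \<sigma> j U"
    and \<tau>: "\<tau> \<in> O_group B" "conjugate_in GL \<sigma> \<tau>"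
  shows "conjugate_in (O_group B) \<sigma> \<tau>"
proof -
  obtain g where g: "g \<in> GL" "\<And>x. \<tau> (g x) = g (\<sigma> x)" using \<tau>(2) conjugate_in_iff[of GL] by auto
  have lg: "linear g" "bij g" using g(1) by (auto simp: GL_def)
  have g0: "x = 0" if "g x = 0" for x
    using that linear_injective_0[OF lg(1)] bij_is_inj[OF lg(2)] by blast
  define B' where "B' = (\<lambda>x y. B (g x) (g y))"
  have B': "symform B'" unfolding symform_def
  proof (intro conjI allI)
    show "linear (B' x)" for x
      by (auto intro!: linearI simp: B'_def linear_add[OF lg(1)] linear_scale[OF lg(1)] Br)
    show "B' x y = B' y x" for x y unfolding B'_def by (rule symform_sym[OF symB])
  qed
  have nB': "nondeg_on B' UNIV" unfolding nondeg_on_def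
  proof (intro ballI impI)
    fix x assume "\<forall>y\<in>UNIV. B' x y = 0"
    then have "\<forall>z. B (g x) z = 0" unfolding B'_def by (metis UNIV_I bij_is_surj[OF lg(2)] surjD)
    then show "x = 0" using ndB g0 by (simp add: nondeg_on_def)
  qed
  have \<tau>B: "B (\<tau> x) (\<tau> y) = B x y" for x y using \<tau>(1) by (simp add: O_group_def)
  have inv: "B' (\<sigma> x) (\<sigma> y) = B' x y" for x y by (simp add: B'_def \<tau>B flip: g(2))
  obtain h E where hE: "linear h" "\<And>x. h x = 0 \<Longrightarrow> x = 0" "\<And>x. h (\<sigma> x) = \<sigma> (h x)"
    "linear E" "\<And>x. E (E x) = x" "\<And>x. E (\<sigma> x) = \<sigma> (E x)" "\<And>x y. B (E x) y = B x (E y)"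
    "\<And>x y. B' x y = B (E (h x)) (h y)"
    by (rule invariant_form_flip[OF B' nB' inv]) blast
  define U where "U = {x. E x = - x}"
  define V where "V = {x. E x = x}"
  have st: "stable \<sigma> U" "stable \<sigma> V"
    by (auto simp: stable_def subspace_def U_def V_def linear_0[OF hE(4)] linear_add[OF hE(4)]
        linear_scale[OF hE(4)] hE(6) linear_neg[OF lin])
  have o: "orth B U V"
    unfolding orth_def
  proof (intro ballI)
    fix x y assume "x \<in> U" "y \<in> V"
    then have "- B x y = B x y" using hE(7)[of x y] by (simp add: U_def V_def Br)
    then show "B x y = 0" by simp
  qed
  have s: "ssum U V = UNIV"
  proof -
    have "x \<in> ssum U V" for x
    proof -
      have "(1/2) *\<^sub>R (x - E x) \<in> U" "(1/2) *\<^sub>R (x + E x) \<in> V"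
        by (simp_all add: U_def V_def linear_scale[OF hE(4)] linear_diff[OF hE(4)] linear_add[OF hE(4)]
            hE(5) add.commute flip: scaleR_minus_right)
      from ssumI[OF this] show ?thesis by (simp flip: scaleR_add_right add: scaleR_2[symmetric])
    qed
    then show ?thesis by blast
  qed
  have sub: "subspace U" "subspace V" using st by (simp_all add: stable_def)
  have nU: "nondeg_on B U" using nondeg_on_ssum[OF symB sub o] ndB by (simp add: s)
  have "pidx B U = nidx B U"
  proof -
    define \<gamma> where "\<gamma> = (\<lambda>x y. B (E x) y)"
    have \<gamma>: "symform \<gamma>" unfolding symform_def \<gamma>_def
      using symB symform_sym[OF symB] hE(7) by (metis symform_def)
    have "pidx B UNIV = pidx B' UNIV"
      using pidx_image[OF lg(1) subspace_UNIV _ symB, of B'] g0 lg(2) by (simp add: B'_def bij_is_surj)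
    also have "\<dots> = pidx \<gamma> (h ` UNIV)"
      by (rule pidx_image[OF hE(1) subspace_UNIV _ \<gamma>]) (auto simp: hE(8) \<gamma>_def hE(2))
    also have "h ` UNIV = UNIV" using linear_inj_bij[OF hE(1,2)] by (simp add: bij_is_surj)
    also have "pidx \<gamma> UNIV = nidx B U + pidx B V"
    proof -
      have "\<gamma> x y = - B x y" if "x \<in> U" for x y using that by (simp add: \<gamma>_def U_def Br)
      moreover have "\<gamma> x y = B x y" if "x \<in> V" for x y using that by (simp add: \<gamma>_def V_def)
      ultimately show ?thesis using pidx_flip[OF sub o \<gamma>] unfolding s by blast
    qed
    finally show ?thesis using pidx_ssum[OF sub symB o] by (simp add: s)
  qed
  then have "anti U U" using bal[OF st(1) nU] by (intro balanced_anti st nU)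
  then obtain k0 where k0: "linear k0" "k0 ` U = U" "\<And>x. x \<in> U \<Longrightarrow> k0 (\<sigma> x) = \<sigma> (k0 x)"
     "\<And>x y. x \<in> U \<Longrightarrow> y \<in> U \<Longrightarrow> B (k0 x) (k0 y) = - B x y"
    by (rule antiE) simp
  obtain \<pi> where p: "linear \<pi>" "\<And>x. \<pi> x \<in> U" "\<And>x. x \<in> U \<Longrightarrow> \<pi> x = x" "\<And>x. (\<forall>y\<in>U. B x y = 0) \<Longrightarrow> \<pi> x = 0"
    using orth_projection[OF sub(1) symB nU] by metis
  define k where "k = (\<lambda>x. k0 (\<pi> x) + (x - \<pi> x))"
  have lk: "linear k"
    by (rule linearI) (simp_all add: k_def linear_add[OF p(1)] linear_add[OF k0(1)] linear_scale[OF p(1)]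
        linear_scale[OF k0(1)] algebra_simps)
  have oVU: "B b y = 0" "B y b = 0" if "b \<in> V" "y \<in> U" for b y
    using o that symform_sym[OF symB, of b y] by (auto simp: orth_def)
  have kab: "k (a + b) = k0 a + b" if "a \<in> U" "b \<in> V" for a b
    using that p(3) p(4)[of b] oVU by (simp add: k_def linear_add[OF p(1)])
  have dec: "\<exists>a b. a \<in> U \<and> b \<in> V \<and> x = a + b" for x
    using s by (metis UNIV_I ssumE)
  have k0U: "k0 a \<in> U" if "a \<in> U" for a using k0(2) that by blast
  have kE: "B (E (k x)) (k y) = B x y" for x y
  proof -
    obtain a b where x: "a \<in> U" "b \<in> V" "x = a + b" using dec by blast
    obtain c d where y: "c \<in> U" "d \<in> V" "y = c + d" using dec by blast
    have "E (k x) = - k0 a + b" using x k0U[OF x(1)] by (simp add: kab linear_add[OF hE(4)] U_def V_def)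
    then show ?thesis using x y k0U by (simp add: kab Br k0(4) oVU)
  qed
  have ks: "k (\<sigma> x) = \<sigma> (k x)" for x
  proof -
    obtain a b where x: "a \<in> U" "b \<in> V" "x = a + b" using dec by blast
    then have "\<sigma> a \<in> U" "\<sigma> b \<in> V" using st by (auto simp: stable_def)
    then show ?thesis using x k0(3) by (simp add: linear_add[OF lin] kab)
  qed
  have bh: "bij h" by (rule linear_inj_bij[OF hE(1,2)])
  define hi where "hi = inv_into UNIV h"
  have hi: "h (hi x) = x" "hi (h x) = x" for x
    using bh by (simp_all add: hi_def bij_is_surj bij_is_inj surj_f_inv_f)
  have lhi: "linear hi"
    by (rule linearI; rule injD[OF bij_is_inj[OF bh]]) (simp_all add: hi linear_add[OF hE(1)] linear_scale[OF hE(1)])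
  define G where "G = g \<circ> hi \<circ> k"
  have lG: "linear G" unfolding G_def by (intro linear_compose lk lhi lg)
  have GB: "B (G x) (G y) = B x y" for x y
    using hE(8)[of "hi (k x)" "hi (k y)"] kE by (simp add: G_def B'_def hi)
  have "x = 0" if "G x = 0" for x
    using GB[of x] that ndB by (simp add: nondeg_on_def Br)
  then have "bij G" by (rule linear_inj_bij[OF lG])
  then have GO: "G \<in> O_group B" using lG GB by (simp add: O_group_def GL_def)
  have "hi (\<sigma> x) = \<sigma> (hi x)" for x using hE(3)[of "hi x"] hi by metis
  then have "\<tau> (G x) = G (\<sigma> x)" for x by (simp add: G_def g(2) ks)
  then show ?thesis using GO conjugate_in_iff[of "O_group B"] by (auto simp: O_group_def)
qed

text \<open>Changing the sign of B on U gives an invariant form \<gamma> with the same positive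
  index, so some g is an isometry from \<gamma> to B. Then \<tau> = g \<sigma> g^-1 lies in O, and
  by assumption some G in O also conjugates \<sigma> into \<tau>. The map h = G^-1 g commutes with
  \<sigma> and carries \<gamma> to B, so both have the same local positive indices. With V the
  complement of U this says that neg U + pos V = pos U + pos V.\<close>

lemma balanced_if_conjugacy:
  assumes conj: "\<And>\<tau>. \<tau> \<in> O_group B \<Longrightarrow> conjugate_in GL \<sigma> \<tau> \<Longrightarrow> conjugate_in (O_group B) \<sigma> \<tau>"
    and U: "stable \<sigma> U" "nondeg_on B U" "pidx B U = nidx B U" and j: "admissible j"
  shows "pos B \<sigma> j U = neg B \<sigma> j U"
proof -
  note d = decompose[OF stable_UNIV ndB U(1,2) subset_UNIV]
  define V where "V = perp B UNIV U"
  note d = d[folded V_def]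
  have sub: "subspace U" "subspace V" using U(1) d(1) by (simp_all add: stable_def)
  obtain \<pi> where p: "linear \<pi>" "\<And>x. \<pi> x \<in> U" "\<And>x y. y \<in> U \<Longrightarrow> B (\<pi> x) y = B x y"
    "\<And>x. x \<in> U \<Longrightarrow> \<pi> x = x" "\<And>x. (\<forall>y\<in>U. B x y = 0) \<Longrightarrow> \<pi> x = 0"
    using orth_projection[OF sub(1) symB U(2)] by metis
  define E where "E = (\<lambda>x. x - 2 *\<^sub>R \<pi> x)"
  have lE: "linear E" by (rule linearI) (simp_all add: E_def linear_add[OF p(1)] linear_scale[OF p(1)] algebra_simps)
  have oVU: "B b y = 0" "B y b = 0" if "b \<in> V" "y \<in> U" for b y
    using d(4) that symform_sym[OF symB, of b y] by (auto simp: orth_def)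
  have EU: "E x = - x" if "x \<in> U" for x using p(4)[OF that] by (simp add: E_def scaleR_2)
  have EV: "E x = x" if "x \<in> V" for x using p(5)[of x] oVU that by (simp add: E_def)
  have dec: "\<exists>a b. a \<in> U \<and> b \<in> V \<and> x = a + b" for x
    using d(6) by (metis UNIV_I ssumE)
  have Es: "E (\<sigma> x) = \<sigma> (E x)" for x
  proof -
    obtain a b where x: "a \<in> U" "b \<in> V" "x = a + b" using dec by blast
    then have "\<sigma> a \<in> U" "\<sigma> b \<in> V" using U(1) d(1) by (auto simp: stable_def)
    then show ?thesis using x EU EV by (simp add: linear_add[OF lin] linear_add[OF lE] linear_neg[OF lin] linear_diff[OF lin])
  qed
  have Esym: "B (E x) y = B x (E y)" for x y
    using p(3)[OF p(2), of x y] p(3)[OF p(2), of y x] symform_sym[OF symB, of "\<pi> x"] symform_sym[OF symB, of x]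
    by (simp add: E_def Br)
  have EE: "E (E x) = x" for x
  proof -
    obtain a b where x: "a \<in> U" "b \<in> V" "x = a + b" using dec by blast
    then show ?thesis using EU EV by (simp add: linear_add[OF lE] linear_neg[OF lE] linear_diff[OF lE])
  qed
  define \<gamma> where "\<gamma> = (\<lambda>x y. B (E x) y)"
  have \<gamma>: "symform \<gamma>" unfolding symform_def \<gamma>_def
    using symB symform_sym[OF symB] Esym by (metis symform_def)
  have n\<gamma>: "nondeg_on \<gamma> UNIV" unfolding nondeg_on_def
  proof (intro ballI impI)
    fix x assume "\<forall>y\<in>UNIV. \<gamma> x y = 0"
    then have "E x = 0" using ndB by (simp add: \<gamma>_def nondeg_on_def)
    then show "x = 0" using EE[of x] linear_0[OF lE] by simp
  qed
  have "pidx B UNIV = pidx \<gamma> UNIV"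
    using pidx_flip[OF sub d(4) \<gamma>] d(8) U(3) by (simp add: d(6)[symmetric] \<gamma>_def EU EV Br)
  from isometry_exists[OF symB ndB \<gamma> n\<gamma> this]
  obtain g where g: "linear g" "\<And>x y. \<gamma> x y = B (g x) (g y)" by blast
  have g0: "x = 0" if "g x = 0" for x
    using n\<gamma> g(2)[of x] that by (simp add: nondeg_on_def Br)
  have bg: "bij g" by (rule linear_inj_bij[OF g(1) g0])
  define gi where "gi = inv_into UNIV g"
  have gi: "g (gi x) = x" "gi (g x) = x" for x
    using bg by (simp_all add: gi_def bij_is_surj bij_is_inj surj_f_inv_f)
  have lgi: "linear gi"
    by (rule linearI; rule injD[OF bij_is_inj[OF bg]]) (simp_all add: gi linear_add[OF g(1)] linear_scale[OF g(1)])
  define \<tau> where "\<tau> = g \<circ> \<sigma> \<circ> gi"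
  have lt: "linear \<tau>" unfolding \<tau>_def by (intro linear_compose lin g(1) lgi)
  have tB: "B (\<tau> x) (\<tau> y) = B x y" for x y
  proof -
    have "B (\<tau> x) (\<tau> y) = \<gamma> (\<sigma> (gi x)) (\<sigma> (gi y))" by (simp add: \<tau>_def g(2))
    also have "\<dots> = \<gamma> (gi x) (gi y)" by (simp add: \<gamma>_def Es B_sigma)
    finally show ?thesis by (simp add: g(2) gi)
  qed
  have "x = 0" if "\<tau> x = 0" for x using tB[of x] that ndB by (simp add: nondeg_on_def Br)
  then have "\<tau> \<in> O_group B" using lt tB linear_inj_bij[OF lt] by (simp add: O_group_def GL_def)
  moreover have "conjugate_in GL \<sigma> \<tau>"
    using conjugate_in_iff[of GL \<tau>] g(1) bg gi by (auto simp: GL_def \<tau>_def)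
  ultimately have "conjugate_in (O_group B) \<sigma> \<tau>" by (rule conj)
  then obtain G where G: "G \<in> O_group B" "\<And>x. \<tau> (G x) = G (\<sigma> x)"
    using conjugate_in_iff[of "O_group B"] by (auto simp: O_group_def)
  have lG: "linear G" "bij G" "\<And>x y. B (G x) (G y) = B x y" using G(1) by (auto simp: O_group_def GL_def)
  define Gi where "Gi = inv_into UNIV G"
  have Gi: "G (Gi x) = x" "Gi (G x) = x" for x
    using lG(2) by (simp_all add: Gi_def bij_is_surj bij_is_inj surj_f_inv_f)
  have lGi: "linear Gi"
    by (rule linearI; rule injD[OF bij_is_inj[OF lG(2)]]) (simp_all add: Gi linear_add[OF lG(1)] linear_scale[OF lG(1)])
  define h where "h = Gi \<circ> g"
  have lh: "linear h" unfolding h_def by (intro linear_compose g(1) lGi)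
  have hB: "B (h x) (h y) = \<gamma> x y" for x y using lG(3)[of "h x" "h y"] by (simp add: h_def Gi g(2))
  have hs: "h (\<sigma> x) = \<sigma> (h x)" for x
  proof -
    have "G (h (\<sigma> x)) = g (\<sigma> x)" by (simp add: h_def Gi)
    also have "\<dots> = \<tau> (g x)" by (simp add: \<tau>_def gi)
    also have "\<dots> = G (\<sigma> (h x))" using G(2)[of "h x"] by (simp add: h_def Gi)
    finally show ?thesis using Gi(2) by metis
  qed
  have h0: "x = 0" if "h x = 0" for x
    using hB[of x] that n\<gamma> by (simp add: nondeg_on_def Br)
  obtain p l where pl: "j = (p, l)" by (cases j)
  have sd: "self_dual p" using j by (simp add: pl admissible_def)
  note bs = symform_bform[OF j]
  let ?K = "kerp \<sigma> j"
  \<comment> \<open>The local form of \<gamma>, written as the pull-back of the local form of B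
    along h: it is -\<beta> on U and \<beta> on V.\<close>
  define \<delta> where "\<delta> = (\<lambda>x y. \<beta> j (h x) (h y))"
  have \<delta>: "symform \<delta>" unfolding symform_def \<delta>_def
  proof (intro conjI allI)
    show "linear (\<lambda>y. \<beta> j (h x) (h y))" for x
      by (auto intro!: linearI simp: linear_add[OF lh] linear_scale[OF lh] symform_rules[OF bs])
    show "\<beta> j (h x) (h y) = \<beta> j (h y) (h x)" for x y by (rule symform_sym[OF bs])
  qed
  have \<delta>e: "\<delta> x y = csgn p l * B (E ((N p ^^ (l - 1)) x)) y" for x y
  proof -
    have "h ((N p ^^ (l - 1)) x) = (N p ^^ (l - 1)) (h x)"
      by (rule intertwine_N[where g = h, OF stable_UNIV lh hs sd UNIV_I])
    then show ?thesis using hB[of "(N p ^^ (l - 1)) x" y] by (simp add: \<delta>_def bform_def pl \<gamma>_def)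
  qed
  have sK: "subspace (U \<inter> ?K)" "subspace (V \<inter> ?K)" by (rule subspace_Int_kerp[OF U(1)], rule subspace_Int_kerp[OF d(1)])
  have \<delta>U: "\<delta> x y = - \<beta> j x y" if "x \<in> U" for x y
    using EU[OF N_stable[OF sd U(1) that]] by (simp add: \<delta>e bform_def pl Br)
  have \<delta>V: "\<delta> x y = \<beta> j x y" if "x \<in> V" for x y
    using EV[OF N_stable[OF sd d(1) that]] by (simp add: \<delta>e bform_def pl)
  have hK: "h ` ?K = ?K"
  proof (rule image_eq_self[OF lh subspace_kerp])
    show "h ` ?K \<subseteq> ?K"
    proof clarify
      fix x assume "x \<in> ?K"
      then show "h x \<in> ?K"
        using intertwine_act[where g = h, OF stable_UNIV lh hs UNIV_I, of "p ^ l" x]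
        by (simp add: pl kerp_def linear_0[OF lh])
    qed
  qed (rule h0)
  have K: "?K = ssum (U \<inter> ?K) (V \<inter> ?K)" using kerp_ssum[OF U(1) d(1,5), of j] by (simp add: d(6)[symmetric])
  have oK: "orth \<delta> (U \<inter> ?K) (V \<inter> ?K)" unfolding orth_def
  proof (intro ballI)
    fix x y assume "x \<in> U \<inter> ?K" "y \<in> V \<inter> ?K"
    then show "\<delta> x y = 0" using \<delta>U[of x y] oVU(2)[of y "(N p ^^ (l - 1)) x"] N_stable[OF sd U(1), of x]
      by (simp add: bform_def pl)
  qed
  have "pos B \<sigma> j UNIV = pidx (\<beta> j) (h ` ?K)" unfolding hK by (simp add: pos_def)
  also have "\<dots> = pidx \<delta> ?K"
    by (rule pidx_image[symmetric, OF lh subspace_kerp _ bs h0]) (simp_all add: \<delta>_def)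
  also have "\<dots> = pidx \<delta> (U \<inter> ?K) + pidx \<delta> (V \<inter> ?K)"
    using pidx_ssum[OF sK \<delta> oK] by (simp add: K[symmetric])
  also have "pidx \<delta> (U \<inter> ?K) = neg B \<sigma> j U"
    unfolding neg_def nidx_def by (rule pidx_cong) (simp add: \<delta>U)
  also have "pidx \<delta> (V \<inter> ?K) = pos B \<sigma> j V"
    unfolding pos_def by (rule pidx_cong) (simp add: \<delta>V)
  finally show ?thesis using d(10)[OF j] by simp
qed

theorem conjugacy_iff_balanced:
  "(\<forall>\<tau>\<in>O_group B. conjugate_in GL \<sigma> \<tau> \<longrightarrow> conjugate_in (O_group B) \<sigma> \<tau>) \<longleftrightarrow>
   (\<forall>U. stable \<sigma> U \<and> nondeg_on B U \<and> pidx B U = nidx B U \<longrightarrow>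
      (\<forall>j. admissible j \<longrightarrow> pos B \<sigma> j U = neg B \<sigma> j U))"
  using conjugacy_if_balanced balanced_if_conjugacy by blast

end

section \<open>The solutions of the equation\<close>

lemma self_dual_monic: "self_dual p \<Longrightarrow> lead_coeff p = 1"
  by (auto elim!: self_dual_cases)

lemma self_dual_dvd_irreducible:
  assumes "self_dual p" "irreducible q" "p dvd q" obtains k where "q = Polynomial.smult k p"
proof -
  obtain c where c: "q = p * c" using assms(3) by auto
  have "\<not> is_unit p" using assms(1) by (auto simp: self_dual_def irreducible_def)
  then have "is_unit c" using assms(2) c irreducibleD by blast
  then have "degree c = 0" by (auto simp: is_unit_iff_degree)
  then obtain k where "c = [:k:]" by (auto elim: degree_eq_zeroE)
  then show ?thesis using that c by simp
qed

text \<open>A self-dual factor of q would be q itself, as both are monic, and a factor of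
  \<open>star_poly q\<close> reflects to one of q. The condition \<open>p' \<noteq> 0\<close>
  excludes q = x, whose \<open>star_poly\<close> is 0 because \<open>inverse 0 = 0\<close>.\<close>

lemma self_dual_coprime_I2:
  assumes p: "self_dual p" and q: "p' \<in> I2 f" "p' \<noteq> 0" shows "coprime p' p"
proof -
  obtain q where q: "p' = q * star_poly q" "lead_coeff q = 1" "irreducible q" "\<not> reciprocal q" "p' \<noteq> 0"
    using q by (auto simp: I2_def)
  then have q0: "coeff q 0 \<noteq> 0" by (auto simp: star_poly_def)
  have 1: "\<not> p dvd q"
  proof
    assume "p dvd q"
    then obtain k where k: "q = Polynomial.smult k p" using self_dual_dvd_irreducible[OF p q(3)] by blast
    then have "k = 1" using q(2) self_dual_monic[OF p] by (cases "k = 0") auto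
    then show False using k q(4) p by (simp add: self_dual_def)
  qed
  have "\<not> p dvd star_poly q"
  proof
    assume "p dvd star_poly q"
    then have "p dvd reflect_poly q" using q0 by (simp add: star_poly_def dvd_smult_iff)
    then obtain c where "reflect_poly q = p * c" by auto
    then have "reflect_poly (reflect_poly q) = reflect_poly p * reflect_poly c" by (simp add: reflect_poly_mult)
    moreover obtain d where "d \<noteq> 0" "reflect_poly p = Polynomial.smult d p" using self_dual_reflect[OF p] by blast
    ultimately have "q = p * Polynomial.smult d (reflect_poly c)" using q0 by simp
    then have "q = p * Polynomial.smult d (reflect_poly c)" by simp
    then show False using 1 by (metis dvd_triv_left)
  qed
  then have "coprime p q" "coprime p (star_poly q)" using 1 self_dual_not_dvd_coprime[OF p] by blast+
  then show ?thesis by (simp add: q(1) coprime_commute)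
qed

lemma I0_self_dual: "p \<in> I0 f \<Longrightarrow> self_dual p \<and> degree p = 1"
proof -
  assume p: "p \<in> I0 f"
  then have d: "degree p = 1" "reciprocal p" by (auto simp: I0_def)
  from d(1) obtain a b where "p = [:b, a:]" "a \<noteq> 0"
    using degree1_coeffs[of p] by (metis One_nat_def)
  then have "irreducible p" using irreducible_linear_field_poly by simp
  then show ?thesis using d by (simp add: self_dual_def)
qed

lemma I1_self_dual: "p \<in> I1 f \<Longrightarrow> self_dual p \<and> degree p = 2"
  by (auto simp: I1_def self_dual_def)

section \<open>Local indices of the given decomposition\<close>

locale decomp = isom Bas B \<sigma> for Bas :: "'a::real_vector set" and B \<sigma> +
  fixes W :: "real poly \<times> nat \<Rightarrow> 'a set"
  assumes decomposition: "module_decomposition B \<sigma> W"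
begin

abbreviation "ff \<equiv> endo_char_poly \<sigma>"
definition Idx :: "(real poly \<times> nat) set" where "Idx = I_all ff \<times> {1..}"
definition Kst :: "(real poly \<times> nat) set" where "Kst = {k \<in> Idx. W k \<noteq> {0}}"
abbreviation "J0 \<equiv> I0_odd \<sigma> W"
abbreviation "J1 \<equiv> I1_odd \<sigma> W"
abbreviation "ep \<equiv> eps \<sigma> W"

lemma W_free: assumes "(p, l) \<in> Idx" obtains E where "quot_module_basis \<sigma> (p ^ l) (W (p, l)) E"
proof -
  have "free_quot_module \<sigma> (p ^ l) (W (p, l))"
    using decomposition assms by (auto simp: module_decomposition_def Let_def Idx_def)
  then show ?thesis using that unfolding free_quot_module_def by blast
qed

lemma W_stable: "k \<in> Idx \<Longrightarrow> stable \<sigma> (W k)"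
  using decomposition by (cases k) (auto simp: module_decomposition_def Let_def Idx_def stable_def)

lemma W_direct: "internal_direct_sum Idx W UNIV"
  using decomposition by (simp add: module_decomposition_def Let_def Idx_def)

lemma W_span: "span (\<Union>k\<in>Idx. W k) = UNIV"
  using W_direct by (simp add: internal_direct_sum_def)

lemma W_independent:
  assumes "finite F" "F \<subseteq> Idx" "\<And>j. j \<in> F \<Longrightarrow> c j \<in> W j" "(\<Sum>j\<in>F. c j) = 0" "j \<in> F" shows "c j = 0"
proof -
  from W_direct have "\<forall>F c. finite F \<and> F \<subseteq> Idx \<and> (\<forall>j\<in>F. c j \<in> W j) \<and> (\<Sum>j\<in>F. c j) = 0 \<longrightarrow> (\<forall>j\<in>F. c j = 0)"
    unfolding internal_direct_sum_def by (elim conjE)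
  then have "finite F \<and> F \<subseteq> Idx \<and> (\<forall>j\<in>F. c j \<in> W j) \<and> (\<Sum>j\<in>F. c j) = 0 \<longrightarrow> (\<forall>j\<in>F. c j = 0)"
    by (elim allE)
  then show ?thesis using assms by simp
qed

lemma W_orth: "j \<in> Idx \<Longrightarrow> k \<in> Idx \<Longrightarrow> j \<noteq> k \<Longrightarrow> u \<in> W j \<Longrightarrow> v \<in> W k \<Longrightarrow> B u v = 0"
  using decomposition unfolding module_decomposition_def Let_def Idx_def by blast

definition UK :: "(real poly \<times> nat) set \<Rightarrow> 'a set" where "UK K = span (\<Union>k\<in>K. W k)"

lemma UK_stable: assumes "K \<subseteq> Idx" shows "stable \<sigma> (UK K)"
  unfolding stable_def UK_def
proof (intro conjI ballI)
  fix x assume "x \<in> span (\<Union>k\<in>K. W k)"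
  then have "\<sigma> x \<in> \<sigma> ` span (\<Union>k\<in>K. W k)" by simp
  also have "\<dots> = span (\<sigma> ` (\<Union>k\<in>K. W k))" by (rule linear_span_image[OF lin, symmetric])
  also have "\<dots> \<subseteq> span (\<Union>k\<in>K. W k)"
    using W_stable assms by (intro span_mono) (auto simp: stable_def)
  finally show "\<sigma> x \<in> span (\<Union>k\<in>K. W k)" .
qed simp

lemma UK_orth: assumes "K \<subseteq> Idx" "L \<subseteq> Idx" "K \<inter> L = {}" shows "orth B (UK K) (UK L)"
proof -
  have "B x y = 0" if x: "x \<in> W k" "k \<in> K" and y: "y \<in> UK L" for x y k
  proof -
    have "linear (B x)" using symB by (simp add: symform_def)
    moreover have "B x v = 0" if "v \<in> (\<Union>l\<in>L. W l)" for v using that x assms W_orth by blast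
    ultimately show ?thesis using linear_eq_on_span[OF _ linear_zero, of "B x" "\<Union>l\<in>L. W l" y] y by (simp add: UK_def)
  qed
  note gen = this
  have "B x y = 0" if "x \<in> UK K" "y \<in> UK L" for x y
  proof -
    have "B v y = 0" if "v \<in> (\<Union>k\<in>K. W k)" for v using that gen \<open>y \<in> UK L\<close> by blast
    then show ?thesis
      using linear_eq_on_span[OF symform_linear_left[OF symB, of y] linear_zero, of "\<Union>k\<in>K. W k" x] that(1)
      by (simp add: UK_def)
  qed
  then show ?thesis by (simp add: orth_def)
qed

lemma UK_union: "UK (K \<union> L) = ssum (UK K) (UK L)"
  by (simp add: UK_def ssum_def span_Un)

lemma UK_single: "k \<in> Idx \<Longrightarrow> UK {k} = W k"
  using W_stable by (simp add: UK_def stable_def span_eq_iff[THEN iffD2])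

text \<open>The remaining summands form an orthogonal complement in the whole space, which is
  non-degenerate.\<close>

lemma UK_nondeg: assumes "K \<subseteq> Idx" shows "nondeg_on B (UK K)"
proof -
  have d: "Idx - K \<subseteq> Idx" "K \<inter> (Idx - K) = {}" by auto
  have "UK Idx = UNIV" using W_span by (simp add: UK_def)
  moreover have "K \<union> (Idx - K) = Idx" using assms by auto
  ultimately have "ssum (UK K) (UK (Idx - K)) = UNIV" using UK_union[of K "Idx - K"] by simp
  then show ?thesis
    using nondeg_on_ssum[OF symB stable_subspace[OF UK_stable[OF assms]] stable_subspace[OF UK_stable[OF d(1)]]
      UK_orth[OF assms d]] ndB by simp
qed

lemma W_nondeg: "k \<in> Idx \<Longrightarrow> nondeg_on B (W k)"
  using UK_nondeg[of "{k}"] by (simp add: UK_single)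

lemma Idx_cases: "(p, l) \<in> Idx \<Longrightarrow> l \<ge> 1 \<and> (p \<in> I0 ff \<or> p \<in> I1 ff \<or> p \<in> I2 ff)"
  by (auto simp: Idx_def I_all_def)

text \<open>A free summand for p'^i contributes at p' only to the exponent i, by
  \<open>pos_neg_free_other\<close>, and not at all to polynomials coprime to p', by
  \<open>pos_neg_coprime\<close>.\<close>

lemma pos_neg_W_other:
  assumes k: "k \<in> Idx" and j: "admissible j" "j \<noteq> k"
  shows "pos B \<sigma> j (W k) = 0 \<and> neg B \<sigma> j (W k) = 0"
proof -
  obtain p l where jj: "j = (p, l)" by (cases j)
  obtain p' i where kk: "k = (p', i)" by (cases k)
  obtain E where E: "quot_module_basis \<sigma> (p' ^ i) (W (p', i)) E" using W_free k kk by blast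
  have sd: "self_dual p" using j by (simp add: jj admissible_def)
  note ic = Idx_cases[OF k[unfolded kk]]
  consider "p' = p" | "p' \<noteq> p" "p' \<noteq> 0" | "p' = 0" by blast
  then show ?thesis
  proof cases
    case 1
    then show ?thesis using pos_neg_free_other[of p l i "W k" E] j E by (simp add: jj kk)
  next
    case 2
    have "coprime p' p"
      using ic I0_self_dual I1_self_dual self_dual_eq_or_coprime[OF _ sd 2(1)] self_dual_coprime_I2[OF sd _ 2(2)] by blast
    then have "coprime (p' ^ i) p" by simp
    then show ?thesis
      using pos_neg_coprime[OF j(1)[unfolded jj] W_stable[OF k] free_annihilated[OF E[folded kk]]] by (simp add: jj)
  next
    \<comment> \<open>p' = 0 could only come from q = x in \<open>I2\<close>. A module that is free
      over \<real>[x]/(0) is zero here, since every vector has a nonzero annihilator.\<close>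
    case 3
    have "E = {}"
    proof (rule ccontr)
      assume "E \<noteq> {}"
      then obtain e where e: "e \<in> E" by blast
      obtain m where m: "m \<noteq> 0" "act m e = 0" by (rule ann_vector[OF lin])
      have "(\<Sum>x\<in>E. act (if x = e then m else 0) x) = 0" using m by (intro sum.neutral) auto
      from free_independent[where c = "\<lambda>x. if x = e then m else 0", OF E this e] have "p' ^ i dvd m" by simp
      then show False using 3 ic m by (simp add: power_0_left)
    qed
    then have "W k = {0}" using E by (simp add: quot_module_basis_def kk)
    then show ?thesis using zero_invariants(3,4)[OF j(1)] by simp
  qed
qed

text \<open>Nonzero vectors from distinct summands are independent, so the dimension bounds the
  number of nonzero summands.\<close>

lemma finite_Kst: "finite Kst"
proof (rule ccontr)
  assume "infinite Kst"
  then obtain F where F: "finite F" "card F = Suc (dim (UNIV :: 'a set))" "F \<subseteq> Kst"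
    by (meson infinite_arbitrarily_large)
  have "\<exists>w. w \<in> W k \<and> w \<noteq> 0" if "k \<in> F" for k
  proof -
    have k: "k \<in> Idx" "W k \<noteq> {0}" using that F(3) by (auto simp: Kst_def)
    then show ?thesis using subspace_0[OF stable_subspace[OF W_stable[OF k(1)]]] by blast
  qed
  then obtain w where w: "\<And>k. k \<in> F \<Longrightarrow> w k \<in> W k" "\<And>k. k \<in> F \<Longrightarrow> w k \<noteq> 0" by metis
  have FI: "F \<subseteq> Idx" using F(3) by (auto simp: Kst_def)
  have z: "f k = 0" if "(\<Sum>k\<in>F. f k *\<^sub>R w k) = 0" "k \<in> F" for f k
  proof -
    have "f j *\<^sub>R w j \<in> W j" if "j \<in> F" for j
      using w(1)[OF that] W_stable[of j] FI that by (auto simp: stable_def intro: subspace_scale)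
    then have "f k *\<^sub>R w k = 0" using W_independent[OF F(1) FI _ that(1,2)] by blast
    then show ?thesis using w(2) that by simp
  qed
  have inj: "inj_on w F"
  proof (rule inj_onI, rule ccontr)
    fix i k assume ik: "i \<in> F" "k \<in> F" "w i = w k" "i \<noteq> k"
    have "(\<Sum>m\<in>F. (if m = i then 1 else if m = k then - 1 else 0) *\<^sub>R w m)
        = (\<Sum>m\<in>F. (if m = i then w m else 0) - (if m = k then w m else 0))"
      using ik by (intro sum.cong) auto
    also have "\<dots> = 0" using ik F(1) by (simp add: sum_subtractf)
    finally show False using z[of "\<lambda>m. if m = i then 1 else if m = k then - 1 else 0" i] ik by simp
  qed
  have "independent (w ` F)"
  proof (rule independent_if_scalars_zero)
    fix f x assume "(\<Sum>x\<in>w ` F. f x *\<^sub>R x) = 0" "x \<in> w ` F"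
    then show "f x = 0" using z[of "\<lambda>k. f (w k)"] by (auto simp: sum.reindex[OF inj])
  qed (use F in simp)
  then have "card (w ` F) \<le> dim (UNIV :: 'a set)" by (intro fd.independent_card_le_dim) auto
  then show False using F(2) card_image[OF inj] by simp
qed

lemma pos_neg_UK:
  assumes "finite K" "K \<subseteq> Idx" and j: "admissible j"
  shows "pos B \<sigma> j (UK K) = (if j \<in> K then pos B \<sigma> j (W j) else 0) \<and>
    neg B \<sigma> j (UK K) = (if j \<in> K then neg B \<sigma> j (W j) else 0)"
  using assms(1,2)
proof (induction K)
  case empty
  have "UK {} = {0}" by (simp add: UK_def)
  then show ?case using zero_invariants(3,4)[OF j] by simp
next
  case (insert k K)
  have k: "k \<in> Idx" and K: "K \<subseteq> Idx" using insert.prems by auto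
  have o: "orth B (W k) (UK K)"
    using UK_orth[of "{k}" K] k K insert.hyps by (simp add: UK_single)
  have 0: "W k \<inter> UK K \<subseteq> {0}" by (rule nondeg_on_orth_disjoint[OF W_nondeg[OF k] o symB])
  have u: "UK (insert k K) = ssum (W k) (UK K)" using UK_union[of "{k}" K] UK_single[OF k] by simp
  show ?case
    using pos_neg_ssum[OF j W_stable[OF k] UK_stable[OF K] 0 o] insert.IH[OF K] pos_neg_W_other[OF k j] insert.hyps
    unfolding u by (cases "j = k") auto
qed

lemma UK_Kst: "UK Kst = UNIV"
proof -
  have "(\<Union>k\<in>Idx. W k) \<subseteq> insert 0 (\<Union>k\<in>Kst. W k)" by (auto simp: Kst_def)
  then have "span (\<Union>k\<in>Idx. W k) \<subseteq> span (insert 0 (\<Union>k\<in>Kst. W k))" by (rule span_mono)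
  then show ?thesis using W_span by (simp add: UK_def span_insert_0 top.extremum_unique)
qed

lemma pos_neg_UNIV:
  assumes "admissible j"
  shows "pos B \<sigma> j UNIV = (if j \<in> Kst then pos B \<sigma> j (W j) else 0)"
    "neg B \<sigma> j UNIV = (if j \<in> Kst then neg B \<sigma> j (W j) else 0)"
  using pos_neg_UK[OF finite_Kst _ assms] UK_Kst by (auto simp: Kst_def)

lemma J_admissible: "j \<in> J0 \<union> J1 \<Longrightarrow> admissible j \<and> odd (snd j)"
  using I0_self_dual I1_self_dual by (auto simp: I0_odd_def I1_odd_def admissible_def elim: oddE)

lemma J0_degree: "j \<in> J0 \<Longrightarrow> degree (fst j) = 1" and J1_degree: "j \<in> J1 \<Longrightarrow> degree (fst j) = 2"
  using I0_self_dual I1_self_dual by (auto simp: I0_odd_def I1_odd_def)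

lemma ev_admissible: "j \<in> I1_ev \<sigma> W \<Longrightarrow> admissible j \<and> even (snd j) \<and> degree (fst j) = 2 \<and> j \<in> Kst"
  using I1_self_dual by (auto simp: I1_ev_def admissible_def Kst_def Idx_def I_all_def)

lemma J_Kst: "J0 \<union> J1 \<subseteq> Kst"
  by (auto simp: I0_odd_def I1_odd_def Kst_def Idx_def I_all_def elim: oddE)

lemma J_disjoint: "J0 \<inter> J1 = {}"
  using J0_degree J1_degree by fastforce

lemma finite_J: "finite J0" "finite J1"
  using finite_subset[OF J_Kst finite_Kst] by auto

lemma Kst_admissible:
  assumes "j \<in> Kst" "admissible j" shows "j \<in> J0 \<union> J1 \<union> I1_ev \<sigma> W"
proof -
  obtain p l where j: "j = (p, l)" by (cases j)
  have sd: "self_dual p" "l \<ge> 1" "degree p = 1 \<Longrightarrow> odd l" using assms(2) by (auto simp: j admissible_def)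
  have k: "(p, l) \<in> Idx" "W (p, l) \<noteq> {0}" using assms(1) by (auto simp: Kst_def j)
  have "p \<notin> I2 ff"
  proof
    assume "p \<in> I2 ff"
    then have "coprime p p" using self_dual_coprime_I2[OF sd(1)] self_dual_nz[OF sd(1)] by blast
    then show False using sd(1) by (simp add: self_dual_def irreducible_def)
  qed
  then show ?thesis using Idx_cases[OF k(1)] k(2) sd(3) I0_self_dual
    by (auto simp: j I0_odd_def I1_odd_def I1_ev_def)
qed

text \<open>\<open>free_rank\<close> is a definite description, so it can be evaluated only once all
  bases have the same cardinality; the dimension of U fixes it.\<close>

lemma free_rank_eq:
  assumes "self_dual p" "l \<ge> 1" and E: "quot_module_basis \<sigma> (p ^ l) U E" shows "free_rank \<sigma> (p ^ l) U = card E"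
  unfolding free_rank_def
proof (rule the_equality)
  show "\<exists>E'. quot_module_basis \<sigma> (p ^ l) U E' \<and> card E' = card E" using E by blast
  fix k assume "\<exists>E'. quot_module_basis \<sigma> (p ^ l) U E' \<and> card E' = k"
  then obtain E' where E': "quot_module_basis \<sigma> (p ^ l) U E'" "card E' = k" by blast
  have p0: "p ^ l \<noteq> 0" using self_dual_nz[OF assms(1)] by simp
  have "degree (p ^ l) * card E = degree (p ^ l) * card E'"
    using dim_free_mult[OF E _ p0, of 1 "p ^ l"] dim_free_mult[OF E'(1) _ p0, of 1 "p ^ l"] by simp
  moreover have "degree (p ^ l) > 0"
    using self_dual_degree_pos[OF assms(1)] assms(2) by (simp add: degree_power_eq self_dual_nz[OF assms(1)])
  ultimately show "k = card E" using E'(2) by simp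
qed

lemma pos_neg_eps:
  assumes j: "j \<in> Kst" "admissible j"
  shows "pos B \<sigma> j UNIV + neg B \<sigma> j UNIV = degree (fst j) * ep j" "ep j \<ge> 1"
proof -
  obtain p l where jj: "j = (p, l)" by (cases j)
  have k: "(p, l) \<in> Idx" "W (p, l) \<noteq> {0}" using j(1) by (auto simp: Kst_def jj)
  obtain E where E: "quot_module_basis \<sigma> (p ^ l) (W (p, l)) E" using W_free[OF k(1)] .
  have e: "ep j = card E" using free_rank_eq[OF admissibleD(1,2) E] j(2) by (simp add: jj)
  show "pos B \<sigma> j UNIV + neg B \<sigma> j UNIV = degree (fst j) * ep j"
    using pos_neg_free[OF j(2)[unfolded jj] E W_nondeg[OF k(1)]] pos_neg_UNIV[OF j(2)] j(1) e by (simp add: jj)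
  have "E \<noteq> {}" using E k(2) by (auto simp: quot_module_basis_def)
  moreover have "finite E" using E by (simp add: quot_module_basis_def)
  ultimately show "ep j \<ge> 1" using e by (simp add: Suc_le_eq card_gt_0_iff)
qed

text \<open>The local indices of the whole space serve as the reference solution of the equation.
  For p quadratic the index is even (\<open>pos_even\<close>), and half of it counts complex
  dimensions.\<close>

definition w0 :: "real poly \<times> nat \<Rightarrow> int" where "w0 j = int (pos B \<sigma> j UNIV)"
definition z0 :: "real poly \<times> nat \<Rightarrow> int" where "z0 j = int (pos B \<sigma> j UNIV div 2)"

lemma pos_even: "admissible j \<Longrightarrow> degree (fst j) = 2 \<Longrightarrow> stable \<sigma> U \<Longrightarrow> nondeg_on B U \<Longrightarrow> even (pos B \<sigma> j U)"
  using degree_dvd_pos[of U "fst j" "snd j"] by simp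

lemma neg_even:
  assumes "admissible j" "degree (fst j) = 2" "stable \<sigma> U" "nondeg_on B U" shows "even (neg B \<sigma> j U)"
proof -
  interpret m: isom Bas "\<lambda>x y. - B x y" \<sigma> by (rule isom_minus)
  show ?thesis
    using m.degree_dvd_pos[of U "fst j" "snd j"] assms by (simp add: pos_minus nondeg_on_minus)
qed

lemma J0_values:
  assumes "j \<in> J0"
  shows "0 \<le> w0 j" "w0 j \<le> int (ep j)" "int (neg B \<sigma> j UNIV) = int (ep j) - w0 j" "ep j \<ge> 1"
  using pos_neg_eps[of j] J_Kst J_admissible[of j] J0_degree[OF assms] assms by (auto simp: w0_def)

lemma J1_values:
  assumes "j \<in> J1"
  shows "0 \<le> z0 j" "z0 j \<le> int (ep j)" "int (pos B \<sigma> j UNIV) = 2 * z0 j"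
    "int (neg B \<sigma> j UNIV) = 2 * int (ep j) - 2 * z0 j" "ep j \<ge> 1"
proof -
  have j: "admissible j" "j \<in> Kst" "degree (fst j) = 2" using J_admissible J_Kst J1_degree assms by auto
  have e: "even (pos B \<sigma> j UNIV)" by (rule pos_even[OF j(1,3) stable_UNIV ndB])
  show 1: "int (pos B \<sigma> j UNIV) = 2 * z0 j" using e by (auto simp: z0_def)
  note pe = pos_neg_eps[OF j(2,1)]
  show "ep j \<ge> 1" by (rule pe)
  show "int (neg B \<sigma> j UNIV) = 2 * int (ep j) - 2 * z0 j" "0 \<le> z0 j" "z0 j \<le> int (ep j)"
    using pe(1) 1 j(3) by (auto simp: z0_def)
qed

lemma pos_neg_le_UNIV:
  assumes "stable \<sigma> U" "nondeg_on B U" "admissible j"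
  shows "pos B \<sigma> j U \<le> pos B \<sigma> j UNIV" "neg B \<sigma> j U \<le> neg B \<sigma> j UNIV"
  using decompose(10,11)[OF stable_UNIV ndB assms(1,2) subset_UNIV assms(3)] by simp_all

lemma signature_sum:
  assumes "stable \<sigma> U" "nondeg_on B U"
  shows "int (pidx B U) - int (nidx B U) = (\<Sum>j\<in>J0 \<union> J1. int (pos B \<sigma> j U) - int (neg B \<sigma> j U))"
proof (rule signature_formula[OF assms])
  show "finite (J0 \<union> J1)" using finite_J by simp
  show "\<And>j. j \<in> J0 \<union> J1 \<Longrightarrow> admissible j \<and> odd (snd j)" by (rule J_admissible)
  fix j assume j: "admissible j" "odd (snd j)" "pos B \<sigma> j U + neg B \<sigma> j U > 0"
  then have "j \<in> Kst" using pos_neg_le_UNIV[OF assms j(1)] pos_neg_UNIV[OF j(1)] by (cases "j \<in> Kst") auto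
  then show "j \<in> J0 \<union> J1" using Kst_admissible[OF _ j(1)] j(2) ev_admissible by blast
qed

text \<open>The equation freed of its real constants: as \<open>w0\<close> and \<open>z0\<close>
  solve it, the other solutions are those with the same weighted sum
  (\<open>star_solutions_eq\<close>).\<close>

definition Sol :: "((real poly \<times> nat \<Rightarrow> int) \<times> (real poly \<times> nat \<Rightarrow> int)) set" where
  "Sol = {(w, z). w \<in> (\<Pi>\<^sub>E j\<in>J0. {0..int (ep j)}) \<and> z \<in> (\<Pi>\<^sub>E j\<in>J1. {0..int (ep j)}) \<and>
     (\<Sum>j\<in>J0. w j) + 2 * (\<Sum>j\<in>J1. z j) = (\<Sum>j\<in>J0. w0 j) + 2 * (\<Sum>j\<in>J1. z0 j)}"

definition base :: "(real poly \<times> nat \<Rightarrow> int) \<times> (real poly \<times> nat \<Rightarrow> int)" where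
  "base = (restrict w0 J0, restrict z0 J1)"

lemma base_Sol: "base \<in> Sol"
  using J0_values J1_values by (auto simp: base_def Sol_def)

lemma sum_J: "(\<Sum>j\<in>J0 \<union> J1. g j) = (\<Sum>j\<in>J0. g j) + (\<Sum>j\<in>J1. g j)" for g :: "real poly \<times> nat \<Rightarrow> int"
  using finite_J J_disjoint by (rule sum.union_disjoint)

text \<open>Solutions and subspaces correspond by differences. For a solution (w, z), the values w0
  - w and z0 - z satisfy the bounds of \<open>exists_with_signs\<close>, and the equation says that
  the resulting T has signature zero. Conversely, a U of signature zero shifts the reference
  solution by its local signatures, halved for p quadratic; the shifted values stay in range because
  the indices of U are at most those of the whole space.\<close>

lemma balanced_iff_unique:
  "(\<forall>U. stable \<sigma> U \<and> nondeg_on B U \<and> pidx B U = nidx B U \<longrightarrow>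
      (\<forall>j. admissible j \<longrightarrow> pos B \<sigma> j U = neg B \<sigma> j U)) \<longleftrightarrow> I1_ev \<sigma> W = {} \<and> Sol = {base}"
  (is "?L \<longleftrightarrow> _")
proof
  assume L: ?L
  have ev: "I1_ev \<sigma> W = {}"
  proof (rule ccontr)
    assume "I1_ev \<sigma> W \<noteq> {}"
    then obtain j where jev: "j \<in> I1_ev \<sigma> W" by blast
    note j = ev_admissible[OF jev]
    have adm: "admissible j" and dj: "degree (fst j) = 2" using j by auto
    have e: "even (pos B \<sigma> j UNIV)" "even (neg B \<sigma> j UNIV)"
      using pos_even[OF adm dj stable_UNIV ndB] neg_even[OF adm dj stable_UNIV ndB] .
    have "pos B \<sigma> j UNIV + neg B \<sigma> j UNIV > 0" using pos_neg_eps[of j] j by simp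
    then have pn: "pos B \<sigma> j UNIV \<ge> 2 \<or> neg B \<sigma> j UNIV \<ge> 2" 
    proof -
      have "pos B \<sigma> j UNIV \<noteq> 1" "neg B \<sigma> j UNIV \<noteq> 1" using e by auto
      then show ?thesis using \<open>pos B \<sigma> j UNIV + neg B \<sigma> j UNIV > 0\<close> by linarith
    qed
    \<comment> \<open>A single block at the even pair j, of a sign that is available there. It has
      no odd local signature, so T has signature zero, while its local signature at j is 2 or
      -2.\<close>
    define s where "s = (\<lambda>k. if k = j then (if pos B \<sigma> j UNIV \<ge> 2 then 1 else - 1 :: int) else 0)"
    have "\<exists>T. T \<subseteq> UNIV \<and> stable \<sigma> T \<and> nondeg_on B T \<and>
      (\<forall>k. admissible k \<longrightarrow> int (pos B \<sigma> k T) - int (neg B \<sigma> k T) = int (degree (fst k)) * s k)"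
      by (rule exists_with_signs[of "{j}"]) (use adm dj pn stable_UNIV ndB in \<open>auto simp: s_def\<close>)
    then obtain T where T: "stable \<sigma> T" "nondeg_on B T"
      "\<And>k. admissible k \<Longrightarrow> int (pos B \<sigma> k T) - int (neg B \<sigma> k T) = int (degree (fst k)) * s k" by blast
    have "j \<notin> J0 \<union> J1" using j J_admissible by blast
    then have "(\<Sum>k\<in>J0 \<union> J1. int (pos B \<sigma> k T) - int (neg B \<sigma> k T)) = 0"
      using T(3) J_admissible by (intro sum.neutral) (auto simp: s_def)
    then have "pidx B T = nidx B T" using signature_sum[OF T(1,2)] by simp
    then have "pos B \<sigma> j T = neg B \<sigma> j T" using L T adm by blast
    then show False using T(3)[OF adm] dj by (simp add: s_def split: if_splits)
  qed
  have "wz = base" if wz: "wz \<in> Sol" for wz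
  proof -
    obtain w z where e: "wz = (w, z)" by (cases wz)
    have w: "w \<in> (\<Pi>\<^sub>E j\<in>J0. {0..int (ep j)})" and z: "z \<in> (\<Pi>\<^sub>E j\<in>J1. {0..int (ep j)})"
      and eq: "(\<Sum>j\<in>J0. w j) + 2 * (\<Sum>j\<in>J1. z j) = (\<Sum>j\<in>J0. w0 j) + 2 * (\<Sum>j\<in>J1. z0 j)"
      using wz by (auto simp: Sol_def e)
    have wb: "0 \<le> w j" "w j \<le> int (ep j)" if "j \<in> J0" for j using w that by auto
    have zb: "0 \<le> z j" "z j \<le> int (ep j)" if "j \<in> J1" for j using z that by auto
    define s where "s = (\<lambda>k. if k \<in> J0 then w0 k - w k else if k \<in> J1 then z0 k - z k else 0)"
    have "\<exists>T. T \<subseteq> UNIV \<and> stable \<sigma> T \<and> nondeg_on B T \<and>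
      (\<forall>k. admissible k \<longrightarrow> int (pos B \<sigma> k T) - int (neg B \<sigma> k T) = int (degree (fst k)) * s k)"
    proof (rule exists_with_signs[of "J0 \<union> J1"])
      show "finite (J0 \<union> J1)" using finite_J by simp
      show "\<And>j. j \<in> J0 \<union> J1 \<Longrightarrow> admissible j" using J_admissible by blast
      show "\<And>j. j \<notin> J0 \<union> J1 \<Longrightarrow> s j = 0" by (simp add: s_def)
      show "stable \<sigma> UNIV" "nondeg_on B UNIV" by (rule stable_UNIV, rule ndB)
      fix j assume "j \<in> J0 \<union> J1"
      then consider "j \<in> J0" | "j \<in> J1" "j \<notin> J0" using J_disjoint by blast
      then show "int (degree (fst j)) * s j \<le> int (pos B \<sigma> j UNIV)"
        "- (int (degree (fst j)) * s j) \<le> int (neg B \<sigma> j UNIV)"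
        using J0_values[of j] J1_values[of j] wb[of j] zb[of j] J0_degree[of j] J1_degree[of j]
        by (cases; simp add: s_def w0_def)+
    qed
    then obtain T where T: "stable \<sigma> T" "nondeg_on B T"
      "\<And>k. admissible k \<Longrightarrow> int (pos B \<sigma> k T) - int (neg B \<sigma> k T) = int (degree (fst k)) * s k" by blast
    have "(\<Sum>k\<in>J0 \<union> J1. int (pos B \<sigma> k T) - int (neg B \<sigma> k T)) = (\<Sum>k\<in>J0 \<union> J1. int (degree (fst k)) * s k)"
      using T(3) J_admissible by (intro sum.cong) auto
    also have "\<dots> = (\<Sum>k\<in>J0. w0 k - w k) + (\<Sum>k\<in>J1. 2 * (z0 k - z k))"
      unfolding sum_J using J0_degree J1_degree J_disjoint
      by (intro arg_cong2[where f = "(+)"] sum.cong) (auto simp: s_def)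
    also have "\<dots> = 0" using eq by (simp add: sum_subtractf sum_distrib_left[symmetric])
    finally have "pidx B T = nidx B T" using signature_sum[OF T(1,2)] by simp
    then have b: "pos B \<sigma> j T = neg B \<sigma> j T" if "admissible j" for j using L T that by blast
    have s0: "s j = 0" if "j \<in> J0 \<union> J1" for j
      using T(3)[of j] b[of j] J_admissible[OF that] J0_degree[of j] J1_degree[of j] that by auto
    have "w j = w0 j" if "j \<in> J0" for j using s0[of j] that by (simp add: s_def)
    moreover have "z j = z0 j" if "j \<in> J1" for j
    proof -
      have "j \<notin> J0" using that J_disjoint by blast
      then show ?thesis using s0[of j] that by (simp add: s_def)
    qed
    ultimately show ?thesis
      using w z unfolding e base_def by (auto simp: fun_eq_iff PiE_def extensional_def)
  qed
  then show "I1_ev \<sigma> W = {} \<and> Sol = {base}" using ev base_Sol by blast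
next
  assume R: "I1_ev \<sigma> W = {} \<and> Sol = {base}"
  show ?L
  proof (intro allI impI)
    fix U j assume U: "stable \<sigma> U \<and> nondeg_on B U \<and> pidx B U = nidx B U" and j: "admissible j"
    have st: "stable \<sigma> U" "nondeg_on B U" using U by auto
    define d where "d = (\<lambda>k. int (pos B \<sigma> k U) - int (neg B \<sigma> k U))"
    have sum0: "(\<Sum>k\<in>J0. d k) + (\<Sum>k\<in>J1. d k) = 0"
      using signature_sum[OF st] U sum_J[of d] by (simp add: d_def)
    have d1: "d k = 2 * (d k div 2)" if "k \<in> J1" for k
    proof -
      have k: "admissible k" "degree (fst k) = 2" using that J_admissible J1_degree by auto
      then have "even (d k)" using pos_even[OF k st] neg_even[OF k st] by (simp add: d_def)
      then show ?thesis by simp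
    qed
    have le: "int (pos B \<sigma> k U) \<le> int (pos B \<sigma> k UNIV)" "int (neg B \<sigma> k U) \<le> int (neg B \<sigma> k UNIV)"
      if "k \<in> J0 \<union> J1" for k
      using pos_neg_le_UNIV[OF st] J_admissible[OF that] by auto
    define w where "w = restrict (\<lambda>k. w0 k - d k) J0"
    define z where "z = restrict (\<lambda>k. z0 k - d k div 2) J1"
    have "(w, z) \<in> Sol"
    proof -
      have "w k \<in> {0..int (ep k)}" if "k \<in> J0" for k
        using that le[of k] J0_values[OF that] by (auto simp: w_def d_def w0_def)
      moreover have "z k \<in> {0..int (ep k)}" if "k \<in> J1" for k
      proof -
        have "2 * z k = 2 * z0 k - d k" using d1[OF that] that by (simp add: z_def)
        then show ?thesis using that le[of k] J1_values[OF that] by (auto simp: d_def)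
      qed
      moreover have "(\<Sum>k\<in>J0. w k) + 2 * (\<Sum>k\<in>J1. z k) = (\<Sum>k\<in>J0. w0 k) + 2 * (\<Sum>k\<in>J1. z0 k)"
      proof -
        have "(\<Sum>k\<in>J1. d k) = 2 * (\<Sum>k\<in>J1. d k div 2)"
          unfolding sum_distrib_left using d1 by (intro sum.cong) auto
        then show ?thesis using sum0 by (simp add: w_def z_def sum_subtractf)
      qed
      ultimately show ?thesis by (auto simp: Sol_def w_def z_def)
    qed
    then have "(w, z) = base" using R by blast
    then have wr: "w = restrict w0 J0" and zr: "z = restrict z0 J1" by (simp_all add: base_def)
    have dz: "d k = 0" if "k \<in> J0 \<union> J1" for k
    proof (cases "k \<in> J0")
      case True
      then show ?thesis using fun_cong[OF wr, of k] by (simp add: w_def)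
    next
      case False
      then have k: "k \<in> J1" using that by blast
      then show ?thesis using fun_cong[OF zr, of k] d1[OF k] by (simp add: z_def)
    qed
    show "pos B \<sigma> j U = neg B \<sigma> j U"
    proof (cases "j \<in> Kst")
      case True
      then have "j \<in> J0 \<union> J1" using Kst_admissible[OF True j] R by blast
      then show ?thesis using dz by (simp add: d_def)
    next
      case False
      then show ?thesis using pos_neg_le_UNIV[OF st j] pos_neg_UNIV[OF j] by simp
    qed
  qed
qed

lemma V_odd_facts: "stable \<sigma> (V_odd \<sigma> W)" "nondeg_on B (V_odd \<sigma> W)"
  "int (pidx B (V_odd \<sigma> W)) - int (nidx B (V_odd \<sigma> W))
     = (\<Sum>j\<in>J0. 2 * w0 j - int (ep j)) + (\<Sum>j\<in>J1. 4 * z0 j - 2 * int (ep j))"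
proof -
  have K: "J0 \<union> J1 \<subseteq> Idx" using J_Kst by (auto simp: Kst_def)
  have V: "V_odd \<sigma> W = UK (J0 \<union> J1)" by (simp add: V_odd_def UK_def)
  show st: "stable \<sigma> (V_odd \<sigma> W)" "nondeg_on B (V_odd \<sigma> W)"
    unfolding V by (rule UK_stable[OF K], rule UK_nondeg[OF K])
  have "int (pos B \<sigma> j (V_odd \<sigma> W)) - int (neg B \<sigma> j (V_odd \<sigma> W)) = int (pos B \<sigma> j UNIV) - int (neg B \<sigma> j UNIV)"
    if "j \<in> J0 \<union> J1" for j
    using pos_neg_UK[OF _ K, of j] finite_J J_admissible[OF that] that J_Kst pos_neg_UNIV[of j] unfolding V by auto
  then have "int (pidx B (V_odd \<sigma> W)) - int (nidx B (V_odd \<sigma> W))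
      = (\<Sum>j\<in>J0 \<union> J1. int (pos B \<sigma> j UNIV) - int (neg B \<sigma> j UNIV))"
    unfolding signature_sum[OF st] by (intro sum.cong) auto
  also have "\<dots> = (\<Sum>j\<in>J0. 2 * w0 j - int (ep j)) + (\<Sum>j\<in>J1. 4 * z0 j - 2 * int (ep j))"
    unfolding sum_J using J0_values(3) J1_values(3,4)
    by (intro arg_cong2[where f = "(+)"] sum.cong) (auto simp: w0_def)
  finally show "int (pidx B (V_odd \<sigma> W)) - int (nidx B (V_odd \<sigma> W))
     = (\<Sum>j\<in>J0. 2 * w0 j - int (ep j)) + (\<Sum>j\<in>J1. 4 * z0 j - 2 * int (ep j))" .
qed

text \<open>\<open>V_odd_facts\<close> gives r - s = 2 \<Sum> w0 - eps0 + 4 \<Sum> z0 - 2 eps1. The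
  constants of the equation are thus just such that w0 and z0 solve it.\<close>

lemma star_solutions_eq:
  assumes rs: "pidx B (V_odd \<sigma> W) = r" "nidx B (V_odd \<sigma> W) = s"
  shows "star_solutions \<sigma> W (r + s) r = Sol"
proof -
  have e: "real r - real s = (\<Sum>j\<in>J0. 2 * real_of_int (w0 j) - real (ep j)) + (\<Sum>j\<in>J1. 4 * real_of_int (z0 j) - 2 * real (ep j))"
    using arg_cong[OF V_odd_facts(3), of real_of_int] rs by simp
  have e2: "real r - real s = 2 * (\<Sum>j\<in>J0. real_of_int (w0 j)) - real (eps0 \<sigma> W)
      + 4 * (\<Sum>j\<in>J1. real_of_int (z0 j)) - 2 * real (eps1 \<sigma> W)"
    unfolding e by (simp add: sum_subtractf sum_distrib_left eps0_def eps1_def)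
  have aux: "(r' + s') / 2 - a / 2 - b + x + 2 * y = r' \<longleftrightarrow> x + 2 * y = u + 2 * v"
    if "r' - s' = 2 * u - a + 4 * v - 2 * b" for r' s' a b x y u v :: real
    using that by (auto simp: field_simps)
  have "real (r + s) / 2 - real (eps0 \<sigma> W) / 2 - real (eps1 \<sigma> W)
       + (\<Sum>j\<in>J0. real_of_int (w j)) + 2 * (\<Sum>j\<in>J1. real_of_int (z j)) = real r \<longleftrightarrow>
     (\<Sum>j\<in>J0. w j) + 2 * (\<Sum>j\<in>J1. z j) = (\<Sum>j\<in>J0. w0 j) + 2 * (\<Sum>j\<in>J1. z0 j)" (is "?l \<longleftrightarrow> ?r") for w z
  proof -
    have "?l \<longleftrightarrow> (\<Sum>j\<in>J0. real_of_int (w j)) + 2 * (\<Sum>j\<in>J1. real_of_int (z j))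
      = (\<Sum>j\<in>J0. real_of_int (w0 j)) + 2 * (\<Sum>j\<in>J1. real_of_int (z0 j))"
      unfolding of_nat_add by (rule aux[OF e2])
    also have "\<dots> \<longleftrightarrow> real_of_int ((\<Sum>j\<in>J0. w j) + 2 * (\<Sum>j\<in>J1. z j))
      = real_of_int ((\<Sum>j\<in>J0. w0 j) + 2 * (\<Sum>j\<in>J1. z0 j))" by simp
    finally show ?thesis by (simp only: of_int_eq_iff)
  qed
  then show ?thesis unfolding star_solutions_def Sol_def by blast
qed

end

section \<open>Forms on quotients\<close>

definition coset :: "'a::real_vector set \<Rightarrow> 'a \<Rightarrow> 'a set" where
  "coset M u = (+) u ` M"

lemma coset_mem_iff: "x \<in> coset M u \<longleftrightarrow> x - u \<in> M"
  by (auto simp: coset_def image_iff algebra_simps) (metis add_diff_cancel_left' diff_add_cancel add.commute)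

lemma coset_eq_iff: assumes "subspace M" shows "coset M u = coset M v \<longleftrightarrow> u - v \<in> M"
proof
  assume "coset M u = coset M v"
  moreover have "u \<in> coset M u" using assms by (simp add: coset_mem_iff subspace_0)
  ultimately show "u - v \<in> M" by (simp add: coset_mem_iff)
next
  assume uv: "u - v \<in> M"
  show "coset M u = coset M v"
  proof (rule Set.set_eqI)
    fix x
    have "x - u = (x - v) - (u - v)" "x - v = (x - u) + (u - v)" by (simp_all add: algebra_simps)
    then show "x \<in> coset M u \<longleftrightarrow> x \<in> coset M v"
      unfolding coset_mem_iff using uv assms by (metis subspace_add subspace_diff)
  qed
qed

lemma coset_zero: "coset M 0 = M"
  by (simp add: coset_def)

lemma coset_eq_self: "subspace M \<Longrightarrow> coset M u = M \<longleftrightarrow> u \<in> M"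
  using coset_eq_iff[of M u 0] by (simp add: coset_zero)

lemma coset_plus:
  assumes "subspace M" shows "{x + y | x y. x \<in> coset M u \<and> y \<in> coset M v} = coset M (u + v)"
proof (rule Set.set_eqI)
  fix z
  show "z \<in> {x + y | x y. x \<in> coset M u \<and> y \<in> coset M v} \<longleftrightarrow> z \<in> coset M (u + v)"
  proof
    assume "z \<in> {x + y | x y. x \<in> coset M u \<and> y \<in> coset M v}"
    then obtain x y where "x - u \<in> M" "y - v \<in> M" and z: "z = x + y" by (auto simp: coset_mem_iff)
    then have "(x - u) + (y - v) \<in> M" using assms by (intro subspace_add)
    moreover have "z - (u + v) = (x - u) + (y - v)" by (simp add: z)
    ultimately show "z \<in> coset M (u + v)" by (simp only: coset_mem_iff)
  next
    assume "z \<in> coset M (u + v)"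
    then have "z - (u + v) \<in> M" by (simp add: coset_mem_iff)
    then have "z - v \<in> coset M u" "v \<in> coset M v"
      using assms by (simp_all add: coset_mem_iff subspace_0 algebra_simps)
    moreover have "z = (z - v) + v" by simp
    ultimately show "z \<in> {x + y | x y. x \<in> coset M u \<and> y \<in> coset M v}" by blast
  qed
qed

lemma coset_scale:
  assumes "subspace M" shows "{a *\<^sub>R x + z | x z. x \<in> coset M u \<and> z \<in> M} = coset M (a *\<^sub>R u)"
proof (rule Set.set_eqI)
  fix y
  show "y \<in> {a *\<^sub>R x + z | x z. x \<in> coset M u \<and> z \<in> M} \<longleftrightarrow> y \<in> coset M (a *\<^sub>R u)"
  proof
    assume "y \<in> {a *\<^sub>R x + z | x z. x \<in> coset M u \<and> z \<in> M}"
    then obtain x z where x: "x - u \<in> M" "z \<in> M" "y = a *\<^sub>R x + z" by (auto simp: coset_mem_iff)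
    then have "y - a *\<^sub>R u = a *\<^sub>R (x - u) + z" by (simp add: algebra_simps)
    moreover have "a *\<^sub>R (x - u) + z \<in> M" using x assms by (simp add: subspace_add subspace_scale)
    ultimately show "y \<in> coset M (a *\<^sub>R u)" by (simp add: coset_mem_iff)
  next
    assume "y \<in> coset M (a *\<^sub>R u)"
    then have "y - a *\<^sub>R u \<in> M" by (simp add: coset_mem_iff)
    moreover have "u \<in> coset M u" using assms by (simp add: coset_mem_iff subspace_0)
    moreover have "y = a *\<^sub>R u + (y - a *\<^sub>R u)" by simp
    ultimately show "y \<in> {a *\<^sub>R x + z | x z. x \<in> coset M u \<and> z \<in> M}" by blast
  qed
qed

text \<open>\<open>induced_form\<close> picks the only element of the set of values, so the point is
  that this set is a singleton.\<close>

lemma induced_form_coset: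
  assumes M: "subspace M" and "\<And>x y. x - u \<in> M \<Longrightarrow> y - v \<in> M \<Longrightarrow> \<omega> x y = \<omega> u v"
  shows "induced_form \<omega> (coset M u) (coset M v) = \<omega> u v"
proof -
  have "(\<lambda>(u, v). \<omega> u v) ` (coset M u \<times> coset M v) = {\<omega> u v}"
  proof
    show "(\<lambda>(u, v). \<omega> u v) ` (coset M u \<times> coset M v) \<subseteq> {\<omega> u v}"
      using assms(2) by (auto simp: coset_mem_iff)
    have "(u, v) \<in> coset M u \<times> coset M v" using M by (simp add: coset_mem_iff subspace_0)
    then have "(\<lambda>(u, v). \<omega> u v) (u, v) \<in> (\<lambda>(u, v). \<omega> u v) ` (coset M u \<times> coset M v)" by (rule imageI)
    then show "{\<omega> u v} \<subseteq> (\<lambda>(u, v). \<omega> u v) ` (coset M u \<times> coset M v)" by simp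
  qed
  then show ?thesis by (simp add: induced_form_def)
qed

text \<open>Quotients and orthogonal sums consist of cosets and functions and are not subspaces of
  the type. An isometric copy D inside the type makes the calculus of indices applicable to
  them.\<close>

definition quad_model ::
  "'v quad_space \<Rightarrow> ('a::real_vector \<Rightarrow> 'a \<Rightarrow> real) \<Rightarrow> 'a set \<Rightarrow> ('a \<Rightarrow> 'v) \<Rightarrow> bool" where
  "quad_model Q \<beta> D \<psi> \<longleftrightarrow> bij_betw \<psi> D (vecs Q) \<and>
     (\<forall>x\<in>D. \<forall>y\<in>D. \<psi> (x + y) = vplus Q (\<psi> x) (\<psi> y) \<and> vform Q (\<psi> x) (\<psi> y) = \<beta> x y) \<and>
     (\<forall>a. \<forall>x\<in>D. \<psi> (a *\<^sub>R x) = vscale Q a (\<psi> x))"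

lemma coordinates_in: "coordinates Q n \<phi> \<Longrightarrow> x \<in> coord_space n \<Longrightarrow> \<phi> x \<in> vecs Q"
  by (auto simp: coordinates_def bij_betw_def)

lemma coordinates_transfer:
  assumes m: "quad_model Q \<beta> D \<psi>" and D: "subspace D"
  shows "coordinates (subspace_quad \<beta> D) n \<phi> \<Longrightarrow> coordinates Q n (\<psi> \<circ> \<phi>)"
    and "coordinates Q n \<chi> \<Longrightarrow> coordinates (subspace_quad \<beta> D) n (inv_into D \<psi> \<circ> \<chi>)"
proof -
  have bij: "bij_betw \<psi> D (vecs Q)"
    and add: "\<And>x y. x \<in> D \<Longrightarrow> y \<in> D \<Longrightarrow> \<psi> (x + y) = vplus Q (\<psi> x) (\<psi> y)"
    and sc: "\<And>a x. x \<in> D \<Longrightarrow> \<psi> (a *\<^sub>R x) = vscale Q a (\<psi> x)"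
    using m by (auto simp: quad_model_def)
  {
    assume c: "coordinates (subspace_quad \<beta> D) n \<phi>"
    have "\<And>x. x \<in> coord_space n \<Longrightarrow> \<phi> x \<in> D" using coordinates_in[OF c] by (simp add: subspace_quad_def)
    then show "coordinates Q n (\<psi> \<circ> \<phi>)"
      using c bij add sc unfolding coordinates_def subspace_quad_def
      by (auto intro: bij_betw_trans)
  }
  {
    assume c: "coordinates Q n \<chi>"
    define \<psi>' where "\<psi>' = inv_into D \<psi>"
    have inj: "inj_on \<psi> D" and im: "\<psi> ` D = vecs Q" using bij by (auto simp: bij_betw_def)
    have \<psi>': "\<psi>' y \<in> D" "\<psi> (\<psi>' y) = y" if "y \<in> vecs Q" for y
      using that im by (auto simp: \<psi>'_def inv_into_into f_inv_into_f)
    have eq: "\<psi>' z = x" if "x \<in> D" "\<psi> x = z" for x z using that inj by (auto simp: \<psi>'_def)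
    have in_Q: "\<chi> x \<in> vecs Q" if "x \<in> coord_space n" for x using coordinates_in[OF c that] .
    have "bij_betw \<psi>' (vecs Q) D" unfolding \<psi>'_def by (rule bij_betw_inv_into[OF bij])
    then have "bij_betw (\<psi>' \<circ> \<chi>) (coord_space n) D"
      using c unfolding coordinates_def by (blast intro: bij_betw_trans)
    moreover have "\<psi>' (vplus Q (\<chi> x) (\<chi> y)) = \<psi>' (\<chi> x) + \<psi>' (\<chi> y)" if "x \<in> coord_space n" "y \<in> coord_space n" for x y
      using \<psi>' in_Q that D by (intro eq) (auto simp: add subspace_add)
    moreover have "\<psi>' (vscale Q a (\<chi> x)) = a *\<^sub>R \<psi>' (\<chi> x)" if "x \<in> coord_space n" for x a
      using \<psi>' in_Q that D by (intro eq) (auto simp: sc subspace_scale)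
    ultimately show "coordinates (subspace_quad \<beta> D) n (inv_into D \<psi> \<circ> \<chi>)"
      using c unfolding coordinates_def subspace_quad_def \<psi>'_def[symmetric] by simp
  }
qed

lemma has_dim_model:
  assumes "quad_model Q \<beta> D \<psi>" "subspace D"
  shows "has_dim Q n \<longleftrightarrow> has_dim (subspace_quad \<beta> D) n"
  using coordinates_transfer[OF assms] unfolding has_dim_def by blast

lemma has_signature_model:
  assumes m: "quad_model Q \<beta> D \<psi>" and D: "subspace D"
  shows "has_signature Q r s \<longleftrightarrow> has_signature (subspace_quad \<beta> D) r s"
proof
  have bij: "bij_betw \<psi> D (vecs Q)" and f: "\<And>x y. x \<in> D \<Longrightarrow> y \<in> D \<Longrightarrow> vform Q (\<psi> x) (\<psi> y) = \<beta> x y"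
    using m by (auto simp: quad_model_def)
  show "has_signature (subspace_quad \<beta> D) r s" if h: "has_signature Q r s"
  proof -
    obtain \<phi> where c: "coordinates Q (r + s) \<phi>"
      and v: "\<And>x y. x \<in> coord_space (r + s) \<Longrightarrow> y \<in> coord_space (r + s) \<Longrightarrow>
           vform Q (\<phi> x) (\<phi> y) = (\<Sum>i<r. x i * y i) - (\<Sum>i=r..<r + s. x i * y i)"
      using h unfolding has_signature_def by blast
    have i: "inv_into D \<psi> (\<phi> x) \<in> D \<and> \<psi> (inv_into D \<psi> (\<phi> x)) = \<phi> x" if "x \<in> coord_space (r + s)" for x
      using coordinates_in[OF c that] bij by (auto simp: bij_betw_def inv_into_into f_inv_into_f)
    show ?thesis unfolding has_signature_def
    proof (intro exI conjI ballI)
      show "coordinates (subspace_quad \<beta> D) (r + s) (inv_into D \<psi> \<circ> \<phi>)" by (rule coordinates_transfer[OF m D]) (rule c)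
      fix x y assume xy: "x \<in> coord_space (r + s)" "y \<in> coord_space (r + s)"
      show "vform (subspace_quad \<beta> D) ((inv_into D \<psi> \<circ> \<phi>) x) ((inv_into D \<psi> \<circ> \<phi>) y)
        = (\<Sum>i<r. x i * y i) - (\<Sum>i=r..<r + s. x i * y i)"
        using i[OF xy(1)] i[OF xy(2)] f v[OF xy] by (simp add: subspace_quad_def) metis
    qed
  qed
  show "has_signature Q r s" if h: "has_signature (subspace_quad \<beta> D) r s"
  proof -
    obtain \<phi> where c: "coordinates (subspace_quad \<beta> D) (r + s) \<phi>"
      and v: "\<And>x y. x \<in> coord_space (r + s) \<Longrightarrow> y \<in> coord_space (r + s) \<Longrightarrow>
           \<beta> (\<phi> x) (\<phi> y) = (\<Sum>i<r. x i * y i) - (\<Sum>i=r..<r + s. x i * y i)"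
      using h unfolding has_signature_def subspace_quad_def by auto
    have i: "\<phi> x \<in> D" if "x \<in> coord_space (r + s)" for x
      using coordinates_in[OF c that] by (simp add: subspace_quad_def)
    show ?thesis unfolding has_signature_def
    proof (intro exI conjI ballI)
      show "coordinates Q (r + s) (\<psi> \<circ> \<phi>)" by (rule coordinates_transfer[OF m D]) (rule c)
      fix x y assume xy: "x \<in> coord_space (r + s)" "y \<in> coord_space (r + s)"
      show "vform Q ((\<psi> \<circ> \<phi>) x) ((\<psi> \<circ> \<phi>) y) = (\<Sum>i<r. x i * y i) - (\<Sum>i=r..<r + s. x i * y i)"
        using i xy f v by simp
    qed
  qed
qed

section \<open>Dimension and signature from coordinates\<close>

definition unit_coord :: "nat \<Rightarrow> nat \<Rightarrow> real" where
  "unit_coord i = (\<lambda>k. if k = i then 1 else 0)"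

lemma unit_coord_in: "i < n \<Longrightarrow> unit_coord i \<in> coord_space n"
  by (simp add: unit_coord_def coord_space_def)

lemma coordinates_expand:
  assumes c: "coordinates (subspace_quad \<beta> D) n \<phi>" and x: "x \<in> coord_space n"
  shows "\<phi> x = (\<Sum>i<n. x i *\<^sub>R \<phi> (unit_coord i))"
proof -
  have add: "\<And>x y. x \<in> coord_space n \<Longrightarrow> y \<in> coord_space n \<Longrightarrow> \<phi> (\<lambda>i. x i + y i) = \<phi> x + \<phi> y"
    and sc: "\<And>a x. x \<in> coord_space n \<Longrightarrow> \<phi> (\<lambda>i. a * x i) = a *\<^sub>R \<phi> x"
    using c by (auto simp: coordinates_def subspace_quad_def)
  \<comment> \<open>Induction over truncations of x, since \<phi> is given to respect sums of two
    vectors and multiples.\<close>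
  have "\<phi> (\<lambda>i. if i < m then x i else 0) = (\<Sum>i<m. x i *\<^sub>R \<phi> (unit_coord i))" if "m \<le> n" for m
    using that
  proof (induction m)
    case 0
    have "(\<lambda>i. 0 * x i) = (\<lambda>i. 0)" by simp
    then show ?case using sc[OF x, of 0] by simp
  next
    case (Suc m)
    have "(\<lambda>i. if i < Suc m then x i else 0) = (\<lambda>i. (if i < m then x i else 0) + x m * unit_coord m i)"
      by (auto simp: unit_coord_def less_Suc_eq)
    moreover have "(\<lambda>i. if i < m then x i else 0) \<in> coord_space n" "(\<lambda>i. x m * unit_coord m i) \<in> coord_space n"
      using Suc.prems by (auto simp: coord_space_def unit_coord_def)
    ultimately show ?case
      using add sc[OF unit_coord_in[of m n], of "x m"] Suc by simp
  qed
  from this[of n] have "\<phi> (\<lambda>i. if i < n then x i else 0) = (\<Sum>i<n. x i *\<^sub>R \<phi> (unit_coord i))" by simp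
  moreover have "(\<lambda>i. if i < n then x i else 0) = x" using x by (auto simp: coord_space_def)
  ultimately show ?thesis by simp
qed

context fdim begin

lemma dim_coordinates:
  fixes D :: "'a set"
  assumes c: "coordinates (subspace_quad \<beta> D) n \<phi>" and D: "subspace D" shows "dim D = n"
proof -
  define e where "e = (\<lambda>i. \<phi> (unit_coord i))"
  have bij: "bij_betw \<phi> (coord_space n) D" using c by (simp add: coordinates_def subspace_quad_def)
  have inD: "e i \<in> D" if "i < n" for i
    using coordinates_in[OF c unit_coord_in[OF that]] by (simp add: e_def subspace_quad_def)
  have z: "\<forall>i<n. f i = 0" if "(\<Sum>i<n. f i *\<^sub>R e i) = 0" for f
  proof -
    define x where "x = (\<lambda>i. if i < n then f i else 0)"
    have x: "x \<in> coord_space n" "(\<lambda>i. 0) \<in> coord_space n" by (simp_all add: x_def coord_space_def)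
    have "\<phi> x = 0" using coordinates_expand[OF c x(1)] that by (simp add: x_def e_def)
    moreover have "\<phi> (\<lambda>i. 0) = 0" using coordinates_expand[OF c x(2)] by simp
    ultimately have "x = (\<lambda>i. 0)" using bij x inj_onD[of \<phi> "coord_space n" x "\<lambda>i. 0"] by (simp add: bij_betw_def)
    then show ?thesis by (auto simp: x_def fun_eq_iff split: if_splits)
  qed
  have inj: "inj_on e {..<n}"
  proof (rule inj_onI, rule ccontr)
    fix i k assume ik: "i \<in> {..<n}" "k \<in> {..<n}" "e i = e k" "i \<noteq> k"
    have "(\<Sum>m<n. (if m = i then 1 else if m = k then - 1 else 0) *\<^sub>R e m)
        = (\<Sum>m<n. (if m = i then e m else 0) - (if m = k then e m else 0))"
      using ik by (intro sum.cong) auto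
    also have "\<dots> = 0" using ik by (simp add: sum_subtractf)
    finally show False using z[of "\<lambda>m. if m = i then 1 else if m = k then - 1 else 0"] ik by auto
  qed
  have ind: "independent (e ` {..<n})"
  proof (rule independent_if_scalars_zero)
    fix f x assume "(\<Sum>x\<in>e ` {..<n}. f x *\<^sub>R x) = 0" "x \<in> e ` {..<n}"
    then show "f x = 0" using z[of "\<lambda>k. f (e k)"] by (auto simp: sum.reindex[OF inj])
  qed simp
  have "span (e ` {..<n}) = D"
  proof (rule span_subspace)
    show "e ` {..<n} \<subseteq> D" using inD by auto
    show "D \<subseteq> span (e ` {..<n})"
    proof
      fix y assume "y \<in> D"
      then obtain x where x: "x \<in> coord_space n" "y = \<phi> x" using bij by (auto simp: bij_betw_def)
      show "y \<in> span (e ` {..<n})"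
        unfolding x(2) coordinates_expand[OF c x(1)] by (intro span_sum span_scale span_base) (auto simp: e_def)
    qed
  qed (rule D)
  then show ?thesis using dim_span_eq_card_independent[OF ind] card_image[OF inj] by simp
qed

text \<open>The images of the unit coordinate vectors form a signed basis.\<close>

lemma signature_invariants:
  fixes D :: "'a set"
  assumes \<beta>: "symform \<beta>" and D: "subspace D" and h: "has_signature (subspace_quad \<beta> D) r s"
  shows "pidx \<beta> D = r" "nidx \<beta> D = s"
proof -
  obtain \<phi> where c: "coordinates (subspace_quad \<beta> D) (r + s) \<phi>"
    and v: "\<And>x y. x \<in> coord_space (r + s) \<Longrightarrow> y \<in> coord_space (r + s) \<Longrightarrow>
         \<beta> (\<phi> x) (\<phi> y) = (\<Sum>i<r. x i * y i) - (\<Sum>i=r..<r + s. x i * y i)"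
    using h unfolding has_signature_def subspace_quad_def by auto
  have bij: "bij_betw \<phi> (coord_space (r + s)) D" using c by (simp add: coordinates_def subspace_quad_def)
  define e where "e = (\<lambda>i. \<phi> (unit_coord i))"
  have inD: "e i \<in> D" if "i < r + s" for i
    using coordinates_in[OF c unit_coord_in[OF that]] by (simp add: e_def subspace_quad_def)
  have ee: "\<beta> (e i) (e k) = (if i = k then sg r i else 0)" if ik: "i < r + s" "k < r + s" for i k
  proof -
    have "(\<Sum>m<r. unit_coord i m * unit_coord k m) = (\<Sum>m<r. if m = i then (if i = k then 1 else 0) else 0)"
      by (intro sum.cong) (auto simp: unit_coord_def)
    moreover have "(\<Sum>m=r..<r + s. unit_coord i m * unit_coord k m) = (\<Sum>m=r..<r + s. if m = i then (if i = k then 1 else 0) else 0)"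
      by (intro sum.cong) (auto simp: unit_coord_def)
    ultimately show ?thesis
      using v[OF unit_coord_in[OF ik(1)] unit_coord_in[OF ik(2)]] ik by (auto simp: e_def sg_def)
  qed
  have "span (e ` {..<r + s}) = D"
  proof (rule span_subspace)
    show "e ` {..<r + s} \<subseteq> D" using inD by auto
    show "D \<subseteq> span (e ` {..<r + s})"
    proof
      fix y assume "y \<in> D"
      then obtain x where x: "x \<in> coord_space (r + s)" "y = \<phi> x" using bij by (auto simp: bij_betw_def)
      show "y \<in> span (e ` {..<r + s})"
        unfolding x(2) coordinates_expand[OF c x(1)] by (intro span_sum span_scale span_base) (auto simp: e_def)
    qed
  qed (rule D)
  then have "signed_basis \<beta> D r s e" using inD ee by (simp add: signed_basis_def)
  from signed_basis_dims[OF \<beta> this] show "pidx \<beta> D = r" "nidx \<beta> D = s" by blast+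
qed

lemma signature_exists:
  fixes D :: "'a set"
  assumes \<beta>: "symform \<beta>" and D: "subspace D" and n: "nondeg_on \<beta> D"
  shows "has_signature (subspace_quad \<beta> D) (pidx \<beta> D) (nidx \<beta> D)"
proof -
  define r where "r = pidx \<beta> D"
  define s where "s = nidx \<beta> D"
  obtain e where e: "signed_basis \<beta> D r s e"
    unfolding r_def s_def using signed_basis_exists[OF D \<beta> n] by blast
  note R = symform_rules[OF \<beta>]
  define \<phi> where "\<phi> = (\<lambda>x :: nat \<Rightarrow> real. \<Sum>i<r + s. x i *\<^sub>R e i)"
  have inD: "\<phi> x \<in> D" for x
    using e D by (auto simp: \<phi>_def signed_basis_def intro!: subspace_sum subspace_scale)
  have b: "\<beta> (\<phi> x) (e k) = sg r k * x k" if "k < r + s" for x k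
  proof -
    have "\<beta> (\<phi> x) (e k) = (\<Sum>i<r + s. if i = k then sg r k * x k else 0)"
      unfolding \<phi>_def symform_sum[OF \<beta>] using e that by (intro sum.cong) (auto simp: R signed_basis_def)
    then show ?thesis using that by simp
  qed
  have "coordinates (subspace_quad \<beta> D) (r + s) \<phi>"
    unfolding coordinates_def
  proof (intro conjI ballI allI)
    show "bij_betw \<phi> (coord_space (r + s)) (vecs (subspace_quad \<beta> D))"
      unfolding bij_betw_def subspace_quad_def quad_space.simps
    proof
      show "inj_on \<phi> (coord_space (r + s))"
      proof (rule inj_onI)
        fix x y assume xy: "x \<in> coord_space (r + s)" "y \<in> coord_space (r + s)" "\<phi> x = \<phi> y"
        have "x k = y k" for k
        proof (cases "k < r + s")
          case True
          then have "sg r k * x k = sg r k * y k" using b[of k x] b[of k y] xy(3) by simp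
          then show ?thesis by simp
        qed (use xy in \<open>simp add: coord_space_def\<close>)
        then show "x = y" by blast
      qed
      show "\<phi> ` coord_space (r + s) = D"
      proof
        show "\<phi> ` coord_space (r + s) \<subseteq> D" using inD by blast
        show "D \<subseteq> \<phi> ` coord_space (r + s)"
        proof
          fix x assume "x \<in> D"
          then have "x = \<phi> (\<lambda>i. if i < r + s then sg r i * \<beta> x (e i) else 0)"
            using signed_expand[OF \<beta> e] by (simp add: \<phi>_def)
          moreover have "(\<lambda>i. if i < r + s then sg r i * \<beta> x (e i) else 0) \<in> coord_space (r + s)" by (simp add: coord_space_def)
          ultimately show "x \<in> \<phi> ` coord_space (r + s)" by blast
        qed
      qed
    qed
  qed (simp_all add: subspace_quad_def \<phi>_def scaleR_left_distrib sum.distrib scaleR_sum_right)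
  moreover have "\<beta> (\<phi> x) (\<phi> y) = (\<Sum>i<r. x i * y i) - (\<Sum>i=r..<r + s. x i * y i)" for x y
  proof -
    have "\<beta> (\<phi> x) (\<phi> y) = (\<Sum>i<r + s. sg r i * (x i * y i))"
      by (subst signed_form[OF \<beta> e inD], rule sum.cong) (use b in \<open>auto simp: sg_def\<close>)
    also have "\<dots> = (\<Sum>i<r. sg r i * (x i * y i)) + (\<Sum>i=r..<r + s. sg r i * (x i * y i))"
      by (subst sum.union_disjoint[symmetric]) (auto intro!: sum.cong)
    finally show ?thesis by (simp add: sg_def sum_negf)
  qed
  ultimately have "has_signature (subspace_quad \<beta> D) r s"
    unfolding has_signature_def by (intro exI[of _ \<phi>]) (simp add: subspace_quad_def)
  then show ?thesis by (simp add: r_def s_def)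
qed

text \<open>If \<beta> u v were nonzero, the value at v + t u would be a non-constant affine
  function of t and so take negative values.\<close>

lemma semidefinite_radical:
  assumes "symform \<beta>" "subspace U" "\<And>x. x \<in> U \<Longrightarrow> \<beta> x x \<ge> 0" "u \<in> U" "\<beta> u u = 0"
  shows "u \<in> rad_on \<beta> U"
proof -
  note R = symform_rules[OF assms(1)]
  have "\<beta> u v = 0" if v: "v \<in> U" for v
  proof (rule ccontr)
    assume n: "\<beta> u v \<noteq> 0"
    \<comment> \<open>Makes the value at v + t u equal to -1.\<close>
    define t where "t = - (\<beta> v v + 1) / (2 * \<beta> u v)"
    have "v + t *\<^sub>R u \<in> U" using v assms(2,4) by (simp add: subspace_add subspace_scale)
    then have "0 \<le> \<beta> (v + t *\<^sub>R u) (v + t *\<^sub>R u)" by (rule assms(3))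
    also have "\<dots> = \<beta> v v + 2 * t * \<beta> u v"
      using assms(5) symform_sym[OF assms(1), of v u] by (simp add: R)
    also have "\<dots> = - 1" using n by (simp add: t_def field_simps)
    finally show False by simp
  qed
  then show ?thesis using assms(4) by (simp add: rad_on_def)
qed

text \<open>Take D non-degenerate of maximal dimension. A vector of nonzero square in its complement
  would enlarge it, so the form vanishes on the complement, which is therefore the radical. D then
  represents the quotient of U by the radical.\<close>

lemma nondeg_complement:
  fixes U :: "'a set"
  assumes U: "subspace U" and \<beta>: "symform \<beta>"
  obtains D where "subspace D" "D \<subseteq> U" "nondeg_on \<beta> D" "U = ssum D (rad_on \<beta> U)"
    "D \<inter> rad_on \<beta> U \<subseteq> {0}" "pidx \<beta> D = pidx \<beta> U" "nidx \<beta> D = nidx \<beta> U"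
proof -
  note R = symform_rules[OF \<beta>]
  define P where "P = (\<lambda>D. subspace D \<and> D \<subseteq> U \<and> nondeg_on \<beta> D)"
  have "P {0}" using subspace_0[OF U] by (simp add: P_def subspace_single_0 nondeg_on_def)
  moreover have "\<forall>D. P D \<longrightarrow> dim D < Suc (dim U)" using fd.dim_subset by (auto simp: P_def less_Suc_eq_le)
  ultimately have "\<exists>D. P D \<and> (\<forall>D'. P D' \<longrightarrow> dim D' \<le> dim D)" by (rule ex_has_greatest_nat)
  then obtain D where D: "P D" "\<And>D'. P D' \<Longrightarrow> dim D' \<le> dim D" by blast
  have sD: "subspace D" "D \<subseteq> U" "nondeg_on \<beta> D" using D(1) by (auto simp: P_def)
  define Z where "Z = perp \<beta> U D"
  have Z: "subspace Z" "Z \<subseteq> U" using subspace_perp[OF \<beta> U] by (auto simp: Z_def perp_def)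
  have UDZ: "U = ssum D Z" using ssum_perp[OF sD(1,2) U \<beta> sD(3)] by (simp add: Z_def)
  have o: "orth \<beta> D Z" unfolding Z_def by (rule orth_perp)
  have z0: "\<beta> z z = 0" if z: "z \<in> Z" for z
  proof (rule ccontr)
    assume n: "\<beta> z z \<noteq> 0"
    let ?S = "span {z}"
    have oS: "orth \<beta> D ?S" using o z by (auto simp: orth_def span_singleton R)
    have nS: "nondeg_on \<beta> ?S" unfolding nondeg_on_def
    proof (intro ballI impI)
      fix x assume "x \<in> ?S" "\<forall>y\<in>?S. \<beta> x y = 0"
      then obtain c where "x = c *\<^sub>R z" by (auto simp: span_singleton)
      moreover have "\<beta> x z = 0" using \<open>\<forall>y\<in>?S. \<beta> x y = 0\<close> by (simp add: span_base)
      ultimately have "c * \<beta> z z = 0" by (simp add: R)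
      then show "x = 0" using n \<open>x = c *\<^sub>R z\<close> by simp
    qed
    have "P (ssum D ?S)" unfolding P_def
    proof (intro conjI)
      show "subspace (ssum D ?S)" by (intro subspace_ssum sD subspace_span)
      show "ssum D ?S \<subseteq> U" using z Z by (intro ssum_subset U sD span_minimal) auto
      show "nondeg_on \<beta> (ssum D ?S)" using nondeg_on_ssum[OF \<beta> sD(1) subspace_span oS] sD(3) nS by blast
    qed
    then have "dim (ssum D ?S) \<le> dim D" by (rule D(2))
    moreover have "dim (ssum D ?S) = dim D + dim ?S"
      by (rule dim_ssum[OF sD(1) subspace_span nondeg_on_orth_disjoint[OF sD(3) oS \<beta>]])
    moreover have "dim ?S = 1" using n by (auto simp: R(5))
    ultimately show False by linarith
  qed
  have zz: "\<beta> x y = 0" if "x \<in> Z" "y \<in> Z" for x y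
  proof -
    have "\<beta> (x + y) (x + y) = 0" using that Z by (intro z0 subspace_add)
    then show ?thesis using z0 that symform_sym[OF \<beta>, of y x] by (simp add: R)
  qed
  have "Z = rad_on \<beta> U"
  proof
    show "Z \<subseteq> rad_on \<beta> U"
    proof
      fix x assume x: "x \<in> Z"
      have "\<beta> x y = 0" if "y \<in> U" for y
      proof -
        have "y \<in> ssum D Z" using that UDZ by simp
        then obtain a b where "a \<in> D" "b \<in> Z" "y = a + b" by (rule ssumE)
        then show ?thesis using x zz orth_sym[OF \<beta> o] by (auto simp: R orth_def)
      qed
      then show "x \<in> rad_on \<beta> U" using x Z by (auto simp: rad_on_def)
    qed
    show "rad_on \<beta> U \<subseteq> Z"
      using sD(2) symform_sym[OF \<beta>] by (auto simp: rad_on_def Z_def perp_def)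
  qed
  note ZR = this
  have 0: "D \<inter> Z \<subseteq> {0}" by (rule nondeg_on_orth_disjoint[OF sD(3) o \<beta>])
  have "pidx \<beta> Z = 0" "nidx \<beta> Z = 0" unfolding nidx_def using z0 by (auto intro!: pidx_nonpos Z)
  then have "pidx \<beta> D = pidx \<beta> U" "nidx \<beta> D = nidx \<beta> U"
    using pidx_ssum[OF sD(1) Z(1) \<beta> o] nidx_ssum[OF sD(1) Z(1) \<beta> o] by (simp_all add: UDZ[symmetric])
  then show ?thesis using that[of D] sD UDZ 0 unfolding ZR by blast
qed

end

section \<open>Definiteness and signature of orthogonal sums and quotients\<close>

lemma positive_orth_sum:
  assumes J: "finite J" and z: "\<And>j. j \<in> J \<Longrightarrow> vzero (Q j) \<in> vecs (Q j)" "\<And>j. j \<in> J \<Longrightarrow> vform (Q j) (vzero (Q j)) (vzero (Q j)) = 0"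
  shows "positive_definite (orth_sum J Q) \<longleftrightarrow> (\<forall>j\<in>J. positive_definite (Q j))"
proof -
  \<comment> \<open>The embedding of the j-th summand, with \<open>vzero\<close> in all other
    components.\<close>
  define ext where "ext = (\<lambda>j v. \<lambda>k\<in>J. if k = j then v else vzero (Q k))"
  have ext: "ext j v \<in> vecs (orth_sum J Q)" "v \<noteq> vzero (Q j) \<Longrightarrow> ext j v \<noteq> vzero (orth_sum J Q)"
    "vform (orth_sum J Q) (ext j v) (ext j v) = vform (Q j) v v" if j: "j \<in> J" and v: "v \<in> vecs (Q j)" for j v
  proof -
    show "ext j v \<in> vecs (orth_sum J Q)" using v z by (auto simp: orth_sum_def ext_def)
    show "ext j v \<noteq> vzero (orth_sum J Q)" if "v \<noteq> vzero (Q j)"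
    proof
      assume "ext j v = vzero (orth_sum J Q)"
      then have "ext j v j = vzero (Q j)" using j by (simp add: orth_sum_def)
      then show False using that j by (simp add: ext_def)
    qed
    have "vform (orth_sum J Q) (ext j v) (ext j v) = (\<Sum>k\<in>J. if k = j then vform (Q j) v v else 0)"
      using z by (auto simp: orth_sum_def ext_def intro!: sum.cong)
    then show "vform (orth_sum J Q) (ext j v) (ext j v) = vform (Q j) v v" using j J by simp
  qed
  have nz: "\<exists>j\<in>J. x j \<noteq> vzero (Q j)" if "x \<in> vecs (orth_sum J Q)" "x \<noteq> vzero (orth_sum J Q)" for x
  proof (rule ccontr)
    assume "\<not> (\<exists>j\<in>J. x j \<noteq> vzero (Q j))"
    then have "x = vzero (orth_sum J Q)" using that(1) by (auto simp: orth_sum_def PiE_def extensional_def fun_eq_iff)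
    then show False using that(2) by simp
  qed
  show "positive_definite (orth_sum J Q) \<longleftrightarrow> (\<forall>j\<in>J. positive_definite (Q j))"
  proof
    assume p: "positive_definite (orth_sum J Q)"
    show "\<forall>j\<in>J. positive_definite (Q j)"
      unfolding positive_definite_def
    proof (intro ballI impI)
      fix j v assume "j \<in> J" "v \<in> vecs (Q j)" "v \<noteq> vzero (Q j)"
      then show "vform (Q j) v v > 0" using p ext[of j v] unfolding positive_definite_def by metis
    qed
  next
    assume p: "\<forall>j\<in>J. positive_definite (Q j)"
    show "positive_definite (orth_sum J Q)"
      unfolding positive_definite_def
    proof (intro ballI impI)
      fix x assume x: "x \<in> vecs (orth_sum J Q)" "x \<noteq> vzero (orth_sum J Q)"
      obtain j where j: "j \<in> J" "x j \<noteq> vzero (Q j)" using nz[OF x] by blast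
      have xj: "x k \<in> vecs (Q k)" if "k \<in> J" for k using x(1) that by (auto simp: orth_sum_def)
      have "(\<Sum>k\<in>J. vform (Q k) (x k) (x k)) > 0"
      proof (rule sum_pos2[OF J j(1)])
        show "vform (Q j) (x j) (x j) > 0" using p j xj by (auto simp: positive_definite_def)
        show "vform (Q k) (x k) (x k) \<ge> 0" if "k \<in> J" for k
          using p xj[OF that] z(2)[OF that] that by (cases "x k = vzero (Q k)") (auto simp: positive_definite_def less_imp_le)
      qed
      then show "vform (orth_sum J Q) x x > 0" by (simp add: orth_sum_def)
    qed
  qed
qed

lemma positive_orth_pair:
  assumes z: "vzero Q \<in> vecs Q" "vform Q (vzero Q) (vzero Q) = 0" "vzero R \<in> vecs R" "vform R (vzero R) (vzero R) = 0"
  shows "positive_definite (orth_pair Q R) \<longleftrightarrow> positive_definite Q \<and> positive_definite R"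
proof -
  have e: "vecs (orth_pair Q R) = vecs Q \<times> vecs R" "vzero (orth_pair Q R) = (vzero Q, vzero R)"
    "\<And>x y. vform (orth_pair Q R) (x, y) (x, y) = vform Q x x + vform R y y"
    by (simp_all add: orth_pair_def)
  show "positive_definite (orth_pair Q R) \<longleftrightarrow> positive_definite Q \<and> positive_definite R"
  proof
    assume p: "positive_definite (orth_pair Q R)"
    have "vform Q x x > 0" if "x \<in> vecs Q" "x \<noteq> vzero Q" for x
    proof -
      have "(x, vzero R) \<in> vecs (orth_pair Q R)" "(x, vzero R) \<noteq> vzero (orth_pair Q R)"
        using that z by (simp_all add: e)
      then have "vform (orth_pair Q R) (x, vzero R) (x, vzero R) > 0" using p unfolding positive_definite_def by blast
      then show ?thesis using z by (simp add: e(3))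
    qed
    moreover have "vform R x x > 0" if "x \<in> vecs R" "x \<noteq> vzero R" for x
    proof -
      have "(vzero Q, x) \<in> vecs (orth_pair Q R)" "(vzero Q, x) \<noteq> vzero (orth_pair Q R)"
        using that z by (simp_all add: e)
      then have "vform (orth_pair Q R) (vzero Q, x) (vzero Q, x) > 0" using p unfolding positive_definite_def by blast
      then show ?thesis using z by (simp add: e(3))
    qed
    ultimately show "positive_definite Q \<and> positive_definite R" by (simp add: positive_definite_def)
  next
    assume p: "positive_definite Q \<and> positive_definite R"
    have "vform Q x x + vform R y y > 0" if "x \<in> vecs Q" "y \<in> vecs R" "(x, y) \<noteq> (vzero Q, vzero R)" for x y
    proof -
      have "vform Q x x > 0 \<or> x = vzero Q" "vform R y y > 0 \<or> y = vzero R"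
        using p that by (auto simp: positive_definite_def)
      then show ?thesis using that(3) z by (elim disjE) auto
    qed
    then show "positive_definite (orth_pair Q R)" unfolding positive_definite_def e by (auto simp: e(3))
  qed
qed

lemma negative_definite_iff: "negative_definite Q \<longleftrightarrow> positive_definite (scale_form (- 1) Q)"
  by (simp add: negative_definite_def positive_definite_def scale_form_def)

lemma scale_form_orth:
  "scale_form a (orth_sum J Q) = orth_sum J (\<lambda>j. scale_form a (Q j))"
  "scale_form a (orth_pair P R) = orth_pair (scale_form a P) (scale_form a R)"
  by (simp_all add: scale_form_def orth_sum_def orth_pair_def sum_distrib_left distrib_left)

lemma negative_orth_sum:
  assumes "finite J" "\<And>j. j \<in> J \<Longrightarrow> vzero (Q j) \<in> vecs (Q j)" "\<And>j. j \<in> J \<Longrightarrow> vform (Q j) (vzero (Q j)) (vzero (Q j)) = 0"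
  shows "negative_definite (orth_sum J Q) \<longleftrightarrow> (\<forall>j\<in>J. negative_definite (Q j))"
  unfolding negative_definite_iff scale_form_orth
  by (rule positive_orth_sum) (use assms in \<open>auto simp: scale_form_def\<close>)

lemma negative_orth_pair:
  assumes "vzero Q \<in> vecs Q" "vform Q (vzero Q) (vzero Q) = 0" "vzero R \<in> vecs R" "vform R (vzero R) (vzero R) = 0"
  shows "negative_definite (orth_pair Q R) \<longleftrightarrow> negative_definite Q \<and> negative_definite R"
  unfolding negative_definite_iff scale_form_orth
  by (rule positive_orth_pair) (use assms in \<open>auto simp: scale_form_def\<close>)

lemma quotient_quad_sel:
  "vecs (quotient_quad U M \<gamma>) = coset M ` U" "vzero (quotient_quad U M \<gamma>) = M"
  "vform (quotient_quad U M \<gamma>) = \<gamma>"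
  "vplus (quotient_quad U M \<gamma>) X Y = {x + y | x y. x \<in> X \<and> y \<in> Y}"
  "vscale (quotient_quad U M \<gamma>) a X = {a *\<^sub>R x + z | x z. x \<in> X \<and> z \<in> M}"
  by (simp_all add: quotient_quad_def coset_def image_def)

lemma quotient_scale: "scale_form a (quotient_quad U M \<gamma>) = quotient_quad U M (\<lambda>X Y. a * \<gamma> X Y)"
  by (simp add: scale_form_def quotient_quad_def)

context fdim begin

lemma quotient_zero:
  fixes U :: "'a set"
  assumes "symform \<beta>" "subspace U" "\<And>u v. u \<in> U \<Longrightarrow> v \<in> U \<Longrightarrow> \<gamma> (coset M u) (coset M v) = \<beta> u v"
  shows "M \<in> coset M ` U" "\<gamma> M M = 0"
proof -
  show "M \<in> coset M ` U" using subspace_0[OF assms(2)] coset_zero[of M] by (metis imageI)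
  show "\<gamma> M M = 0"
    using assms(3)[OF subspace_0[OF assms(2)] subspace_0[OF assms(2)]] symform_rules(5)[OF assms(1)] by (simp add: coset_zero)
qed

text \<open>With negative index 0 the form is non-negative on U, and by
  \<open>semidefinite_radical\<close> it vanishes only at vectors of the radical M, which is the
  zero of the quotient.\<close>

lemma quotient_positive:
  fixes U :: "'a set"
  assumes \<beta>: "symform \<beta>" and U: "subspace U"
    and \<gamma>: "\<And>u v. u \<in> U \<Longrightarrow> v \<in> U \<Longrightarrow> \<gamma> (coset M u) (coset M v) = \<beta> u v"
    and M: "M = rad_on \<beta> U"
  shows "positive_definite (quotient_quad U M \<gamma>) \<longleftrightarrow> nidx \<beta> U = 0"
proof -
  have sM: "subspace M" unfolding M by (rule subspace_radical[OF \<beta> U])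
  have "positive_definite (quotient_quad U M \<gamma>) \<longleftrightarrow> (\<forall>u\<in>U. u \<notin> M \<longrightarrow> \<beta> u u > 0)"
    unfolding positive_definite_def quotient_quad_sel using \<gamma> coset_eq_self[OF sM] by simp
  also have "\<dots> \<longleftrightarrow> nidx \<beta> U = 0"
  proof
    assume p: "\<forall>u\<in>U. u \<notin> M \<longrightarrow> \<beta> u u > 0"
    have "- \<beta> u u \<le> 0" if "u \<in> U" for u
      using p that by (cases "u \<in> M") (auto simp: M rad_on_def less_imp_le)
    then show "nidx \<beta> U = 0" unfolding nidx_def by (rule pidx_nonpos[OF U])
  next
    assume n: "nidx \<beta> U = 0"
    have nn: "\<beta> u u \<ge> 0" if "u \<in> U" for u
    proof (rule ccontr)
      assume "\<not> \<beta> u u \<ge> 0"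
      then have "pidx (\<lambda>x y. - \<beta> x y) U > 0" by (intro pidx_pos[OF U symform_minus[OF \<beta>] that]) simp
      then show False using n by (simp add: nidx_def)
    qed
    show "\<forall>u\<in>U. u \<notin> M \<longrightarrow> \<beta> u u > 0"
    proof (intro ballI impI)
      fix u assume u: "u \<in> U" "u \<notin> M"
      have "\<beta> u u \<noteq> 0" using semidefinite_radical[OF \<beta> U nn u(1)] u(2) by (auto simp: M)
      then show "\<beta> u u > 0" using nn[OF u(1)] by simp
    qed
  qed
  finally show ?thesis .
qed

lemma quotient_negative:
  fixes U :: "'a set"
  assumes \<beta>: "symform \<beta>" and U: "subspace U"
    and \<gamma>: "\<And>u v. u \<in> U \<Longrightarrow> v \<in> U \<Longrightarrow> \<gamma> (coset M u) (coset M v) = \<beta> u v"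
    and M: "M = rad_on \<beta> U"
  shows "negative_definite (quotient_quad U M \<gamma>) \<longleftrightarrow> pidx \<beta> U = 0"
proof -
  have "negative_definite (quotient_quad U M \<gamma>) \<longleftrightarrow> positive_definite (quotient_quad U M (\<lambda>X Y. - \<gamma> X Y))"
    by (simp add: negative_definite_def positive_definite_def quotient_quad_sel)
  also have "\<dots> \<longleftrightarrow> nidx (\<lambda>x y. - \<beta> x y) U = 0"
    using \<gamma> M by (intro quotient_positive[OF symform_minus[OF \<beta>] U]) (auto simp: rad_on_def)
  finally show ?thesis by (simp add: nidx_minus)
qed

text \<open>A complement D of the radical maps isometrically onto the quotient. The sum over a
  single index appears because the vectors of \<open>q0\<close> are functions on its index set, and
  its signature is only asked for when this set is a singleton.\<close>

lemma quotient_signature: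
  fixes U :: "'a set"
  assumes \<beta>: "symform \<beta>" and U: "subspace U"
    and \<gamma>: "\<And>u v. u \<in> U \<Longrightarrow> v \<in> U \<Longrightarrow> \<gamma> (coset M u) (coset M v) = \<beta> u v"
    and M: "M = rad_on \<beta> U"
    and F: "F j = quotient_quad U M \<gamma>"
  shows "has_signature (orth_sum {j} F) r s \<longleftrightarrow> r = pidx \<beta> U \<and> s = nidx \<beta> U"
    "has_dim (orth_sum {j} F) n \<longleftrightarrow> n = pidx \<beta> U + nidx \<beta> U"
proof -
  obtain D where D: "subspace D" "D \<subseteq> U" "nondeg_on \<beta> D" "U = ssum D (rad_on \<beta> U)"
    "D \<inter> rad_on \<beta> U \<subseteq> {0}" "pidx \<beta> D = pidx \<beta> U" "nidx \<beta> D = nidx \<beta> U"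
    by (rule nondeg_complement[OF U \<beta>])
  have sM: "subspace M" unfolding M by (rule subspace_radical[OF \<beta> U])
  define \<psi> where "\<psi> = (\<lambda>x. \<lambda>k\<in>{j}. coset M x)"
  have inj: "inj_on \<psi> D"
  proof (rule inj_onI)
    fix x y assume xy: "x \<in> D" "y \<in> D" "\<psi> x = \<psi> y"
    have "\<psi> x j = \<psi> y j" using xy(3) by simp
    then have "coset M x = coset M y" by (simp add: \<psi>_def)
    then have "x - y \<in> D \<inter> M" using coset_eq_iff[OF sM] xy D(1) by (simp add: subspace_diff)
    then show "x = y" using D(5) by (auto simp: M)
  qed
  have im: "\<psi> ` D = vecs (orth_sum {j} F)"
  proof
    show "\<psi> ` D \<subseteq> vecs (orth_sum {j} F)"
      using D(2) by (auto simp: \<psi>_def orth_sum_def F quotient_quad_sel)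
    show "vecs (orth_sum {j} F) \<subseteq> \<psi> ` D"
    proof
      fix X assume "X \<in> vecs (orth_sum {j} F)"
      then have X: "X \<in> (\<Pi>\<^sub>E k\<in>{j}. coset M ` U)" by (auto simp: orth_sum_def F quotient_quad_sel PiE_iff)
      then obtain u where u: "u \<in> U" "X j = coset M u" by auto
      have "u \<in> ssum D M" using u(1) D(4) M by simp
      then obtain d m where d: "d \<in> D" "m \<in> M" "u = d + m" by (rule ssumE)
      have "coset M u = coset M d" using coset_eq_iff[OF sM] d by simp
      then have "X = \<psi> d" using X u(2) by (auto simp: \<psi>_def fun_eq_iff PiE_def extensional_def)
      then show "X \<in> \<psi> ` D" using d(1) by blast
    qed
  qed
  have m: "quad_model (orth_sum {j} F) \<beta> D \<psi>"
    unfolding quad_model_def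
  proof (intro conjI ballI allI)
    show "bij_betw \<psi> D (vecs (orth_sum {j} F))" using inj im by (simp add: bij_betw_def)
    fix x y assume xy: "x \<in> D" "y \<in> D"
    show "\<psi> (x + y) = vplus (orth_sum {j} F) (\<psi> x) (\<psi> y)"
      by (auto simp: orth_sum_def F \<psi>_def quotient_quad_sel coset_plus[OF sM] fun_eq_iff)
    show "vform (orth_sum {j} F) (\<psi> x) (\<psi> y) = \<beta> x y"
      using \<gamma> xy D(2) by (auto simp: orth_sum_def F \<psi>_def quotient_quad_sel)
  next
    fix a x assume "x \<in> D"
    show "\<psi> (a *\<^sub>R x) = vscale (orth_sum {j} F) a (\<psi> x)"
      by (auto simp: orth_sum_def F \<psi>_def quotient_quad_sel coset_scale[OF sM] fun_eq_iff)
  qed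
  have ex: "has_signature (subspace_quad \<beta> D) (pidx \<beta> U) (nidx \<beta> U)"
    using signature_exists[OF \<beta> D(1,3)] D(6,7) by simp
  show "has_signature (orth_sum {j} F) r s \<longleftrightarrow> r = pidx \<beta> U \<and> s = nidx \<beta> U"
    unfolding has_signature_model[OF m D(1)]
    using ex signature_invariants[OF \<beta> D(1), of r s] D(6,7) by auto
  have "dim D = pidx \<beta> U + nidx \<beta> U"
    using pidx_nidx_nondeg[OF D(1) \<beta> D(3)] D(6,7) by simp
  moreover have "has_dim (subspace_quad \<beta> D) (pidx \<beta> U + nidx \<beta> U)"
    using ex unfolding has_signature_def has_dim_def by blast
  ultimately show "has_dim (orth_sum {j} F) n \<longleftrightarrow> n = pidx \<beta> U + nidx \<beta> U"
    unfolding has_dim_model[OF m D(1)] using dim_coordinates[OF _ D(1)] unfolding has_dim_def by metis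
qed

end

section \<open>Hermitian forms and the definiteness of \<open>q0\<close> and
  \<open>q1\<close>\<close>

lemma upper_root_quadratic:
  assumes "b\<^sup>2 < 4"
  shows "upper_root [:1, b, 1:] = Complex (- b / 2) (sqrt (1 - b\<^sup>2 / 4))"
proof -
  define \<zeta> where "\<zeta> = Complex (- b / 2) (sqrt (1 - b\<^sup>2 / 4))"
  have s: "sqrt (1 - b\<^sup>2 / 4) > 0" "(sqrt (1 - b\<^sup>2 / 4))\<^sup>2 = 1 - b\<^sup>2 / 4" using assms by simp_all
  \<comment> \<open>The roots are \<zeta> and its conjugate, of which only \<zeta> lies in the upper
    half plane.\<close>
  have e: "poly (map_poly complex_of_real [:1, b, 1:]) z = (z - \<zeta>) * (z - cnj \<zeta>)" for z
  proof -
    have "\<zeta> + cnj \<zeta> = - complex_of_real b" "\<zeta> * cnj \<zeta> = 1"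
      using s(2) by (simp_all add: \<zeta>_def complex_eq_iff power2_eq_square field_simps)
    moreover have "(z - \<zeta>) * (z - cnj \<zeta>) = z * z - (\<zeta> + cnj \<zeta>) * z + \<zeta> * cnj \<zeta>" by (simp only: algebra_simps)
    ultimately have "(z - \<zeta>) * (z - cnj \<zeta>) = z * z + complex_of_real b * z + 1" by (simp only:) simp
    then show ?thesis by (simp add: map_poly_pCons algebra_simps)
  qed
  show ?thesis
    unfolding upper_root_def \<zeta>_def[symmetric]
  proof (rule the_equality)
    show "poly (map_poly complex_of_real [:1, b, 1:]) \<zeta> = 0 \<and> Im \<zeta> > 0" using s by (simp only: e) (simp add: \<zeta>_def)
    fix z assume z: "poly (map_poly complex_of_real [:1, b, 1:]) z = 0 \<and> Im z > 0"
    then have "(z - \<zeta>) * (z - cnj \<zeta>) = 0" by (simp only: e)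
    then have "z = \<zeta> \<or> z = cnj \<zeta>" by (simp only: mult_eq_0_iff right_minus_eq)
    moreover have "Im (cnj \<zeta>) < 0" using s by (simp add: \<zeta>_def)
    ultimately show "z = \<zeta>" using z by auto
  qed
qed

text \<open>
  The trace determines \<open>Re (h x y)\<close>, and \<open>Im (h x y)\<close> is then read off from \<open>Re (h (J x) y) = Re (\<zeta> * h x y)\<close>.
\<close>

lemma hermitian_lift:
  fixes J :: "'v \<Rightarrow> 'v"
  assumes add: "\<And>x y z. x \<in> vecs Q \<Longrightarrow> y \<in> vecs Q \<Longrightarrow> z \<in> vecs Q \<Longrightarrow> vform Q (vplus Q x y) z = vform Q x z + vform Q y z"
    and scale: "\<And>a x y. x \<in> vecs Q \<Longrightarrow> y \<in> vecs Q \<Longrightarrow> vform Q (vscale Q a x) y = a * vform Q x y"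
    and J_add: "\<And>x y. x \<in> vecs Q \<Longrightarrow> y \<in> vecs Q \<Longrightarrow> J (vplus Q x y) = vplus Q (J x) (J y)"
    and J_scale: "\<And>a x. x \<in> vecs Q \<Longrightarrow> J (vscale Q a x) = vscale Q a (J x)"
    and J_in: "\<And>x. x \<in> vecs Q \<Longrightarrow> J x \<in> vecs Q"
    and sym: "\<And>x y. x \<in> vecs Q \<Longrightarrow> y \<in> vecs Q \<Longrightarrow> vform Q x y = vform Q y x"
    and J_square: "\<And>x y. x \<in> vecs Q \<Longrightarrow> y \<in> vecs Q \<Longrightarrow> vform Q (J (J x)) y = 2 * Re \<zeta> * vform Q (J x) y - vform Q x y"
    and J_adj: "\<And>x y. x \<in> vecs Q \<Longrightarrow> y \<in> vecs Q \<Longrightarrow> vform Q (J x) y + vform Q (J y) x = 2 * Re \<zeta> * vform Q x y"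
    and \<zeta>: "cmod \<zeta> = 1" "Im \<zeta> \<noteq> 0"
  shows "\<exists>h. hermitian_form Q \<zeta> J h \<and> (\<forall>x\<in>vecs Q. \<forall>y\<in>vecs Q. complex_trace (h x y) = vform Q x y)"
proof -
  define h where "h = (\<lambda>x y. Complex (vform Q x y / 2) ((Re \<zeta> * vform Q x y - vform Q (J x) y) / (2 * Im \<zeta>)))"
  have n: "Re \<zeta> * Re \<zeta> + Im \<zeta> * Im \<zeta> = 1" using \<zeta>(1) by (simp add: cmod_def power2_eq_square real_sqrt_eq_1_iff)
  have "hermitian_form Q \<zeta> J h"
    unfolding hermitian_form_def
  proof (intro conjI ballI allI)
    fix x y z assume "x \<in> vecs Q" "y \<in> vecs Q" "z \<in> vecs Q"
    then show "h (vplus Q x y) z = h x z + h y z"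
      using \<zeta>(2) by (simp add: h_def complex_eq_iff add J_add J_in field_simps)
  next
    fix a x y assume "x \<in> vecs Q" "y \<in> vecs Q"
    then show "h (vscale Q a x) y = complex_of_real a * h x y"
      using \<zeta>(2) by (simp add: h_def complex_eq_iff scale J_scale J_in field_simps)
  next
    fix x y assume xy: "x \<in> vecs Q" "y \<in> vecs Q"
    show "h y x = cnj (h x y)"
      using \<zeta>(2) sym[OF xy] J_adj[OF xy] by (simp add: h_def complex_eq_iff field_simps)
    define v v' where "v = vform Q x y" and "v' = vform Q (J x) y"
    have "Re (h (J x) y) = Re (\<zeta> * h x y)"
      using \<zeta>(2) by (simp add: h_def field_simps)
    moreover have "Im (h (J x) y) = Im (\<zeta> * h x y)"
    proof -
      have "Im (h (J x) y) = (v - Re \<zeta> * v') / (2 * Im \<zeta>)"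
        using J_square[OF xy] by (simp add: h_def v_def v'_def field_simps)
      also have "\<dots> = ((Re \<zeta> * Re \<zeta> + Im \<zeta> * Im \<zeta>) * v - Re \<zeta> * v') / (2 * Im \<zeta>)" by (simp add: n)
      also have "\<dots> = Im (\<zeta> * h x y)" using \<zeta>(2) by (simp add: h_def v_def v'_def field_simps)
      finally show ?thesis .
    qed
    ultimately show "h (J x) y = \<zeta> * h x y" by (simp only: complex_eq_iff simp_thms)
  qed
  moreover have "\<forall>x\<in>vecs Q. \<forall>y\<in>vecs Q. complex_trace (h x y) = vform Q x y"
    by (simp add: h_def complex_trace_def)
  ultimately show ?thesis by blast
qed

context decomp begin

abbreviation "pW j \<equiv> act (fst j) ` W j"

definition cform :: "real poly \<times> nat \<Rightarrow> 'a set \<Rightarrow> 'a set \<Rightarrow> real" where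
  "cform j = induced_form (\<lambda>u v. B ((N (fst j) ^^ (snd j - 1)) u) v)"

lemma J_facts:
  assumes j: "j \<in> J0 \<union> J1"
  shows "stable \<sigma> (W j)" "subspace (W j)" "symform (\<beta> j)" "pW j = rad_on (\<beta> j) (W j)"
    "pos B \<sigma> j UNIV = pidx (\<beta> j) (W j)" "neg B \<sigma> j UNIV = nidx (\<beta> j) (W j)"
proof -
  have adm: "admissible j" and k: "j \<in> Kst" "j \<in> Idx" using j J_admissible J_Kst by (auto simp: Kst_def)
  show st: "stable \<sigma> (W j)" and "subspace (W j)" using W_stable[OF k(2)] by (auto simp: stable_def)
  show "symform (\<beta> j)" by (rule symform_bform[OF adm])
  obtain p l where jj: "j = (p, l)" by (cases j)
  obtain E where E: "quot_module_basis \<sigma> (p ^ l) (W (p, l)) E" using W_free k(2) jj by blast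
  show "pW j = rad_on (\<beta> j) (W j)"
    using radical_free[OF adm[unfolded jj] E] W_nondeg[OF k(2)] by (simp add: jj)
  have "W j \<subseteq> kerp \<sigma> j" using free_annihilated[OF E] by (auto simp: kerp_def jj)
  then have "W j \<inter> kerp \<sigma> j = W j" by blast
  then show "pos B \<sigma> j UNIV = pidx (\<beta> j) (W j)" "neg B \<sigma> j UNIV = nidx (\<beta> j) (W j)"
    using pos_neg_UNIV[OF adm] k(1) by (simp_all add: pos_def neg_def)
qed

text \<open>The subspace divided out is the radical of the local form, so the value does not depend
  on the representatives.\<close>

lemma cform_coset:
  assumes j: "j \<in> J0 \<union> J1" and uv: "u \<in> W j" "v \<in> W j"
  shows "csgn (fst j) (snd j) * cform j (coset (pW j) u) (coset (pW j) v) = \<beta> j u v"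
proof -
  note f = J_facts[OF j]
  note R = symform_rules[OF f(3)]
  have b: "\<beta> j x y = csgn (fst j) (snd j) * B ((N (fst j) ^^ (snd j - 1)) x) y" for x y
    by (cases j) (simp add: bform_def)
  have "cform j (coset (pW j) u) (coset (pW j) v) = B ((N (fst j) ^^ (snd j - 1)) u) v"
    unfolding cform_def
  proof (rule induced_form_coset)
    show "subspace (pW j)" unfolding f(4) by (rule subspace_radical[OF f(3,2)])
    fix x y assume "x - u \<in> pW j" "y - v \<in> pW j"
    then have x: "x - u \<in> rad_on (\<beta> j) (W j)" and y: "y - v \<in> rad_on (\<beta> j) (W j)" unfolding f(4) .
    have "y - v \<in> W j" using y by (simp add: rad_on_def)
    then have "v + (y - v) \<in> W j" using uv(2) f(2) by (intro subspace_add)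
    then have "\<beta> j (x - u) y = 0" using x by (simp add: rad_on_def)
    moreover have "\<beta> j (y - v) u = 0" using y uv(1) by (simp add: rad_on_def)
    ultimately have "\<beta> j x y = \<beta> j u v" using symform_sym[OF f(3)] by (simp add: R)
    then show "B ((N (fst j) ^^ (snd j - 1)) x) y = B ((N (fst j) ^^ (snd j - 1)) u) v" by (simp add: b)
  qed
  then show ?thesis by (simp add: b)
qed

lemma q0_summand:
  assumes "j \<in> J0"
  shows "(\<lambda>(t, l). scale_form ((- 1) ^ ((l - 1) div 2)) (b_space B \<sigma> W (t, l))) j =
    quotient_quad (W j) (pW j) (\<lambda>X Y. csgn (fst j) (snd j) * cform j X Y)"
proof -
  obtain p l where jj: "j = (p, l)" by (cases j)
  have "degree p = 1" using J0_degree[OF assms] jj by simp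
  then have "N p = (\<lambda>w. \<sigma> w - \<sigma>i w)" "csgn p l = (- 1) ^ ((l - 1) div 2)" by (auto simp: Nop_def csgn_def)
  then show ?thesis by (simp add: jj quotient_scale cform_def)
qed

lemma h_base_eq:
  assumes "j \<in> J1" shows "h_base B \<sigma> W j = quotient_quad (W j) (pW j) (cform j)"
proof -
  obtain p l where jj: "j = (p, l)" by (cases j)
  have "degree p = 2" using J1_degree[OF assms] jj by simp
  then have "N p = \<sigma>i \<circ> act p" by (auto simp: Nop_def)
  then show ?thesis by (simp add: jj cform_def)
qed

lemma cform_J1:
  assumes "j \<in> J1" "u \<in> W j" "v \<in> W j"
  shows "cform j (coset (pW j) u) (coset (pW j) v) = \<beta> j u v"
  using cform_coset[of j u v] assms J1_degree[of j] by (simp add: csgn_def)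

lemma sigma_coset:
  assumes "j \<in> J1" "u \<in> W j" shows "\<sigma> ` coset (pW j) u = coset (pW j) (\<sigma> u)"
proof -
  have st: "stable \<sigma> (W j)" using J_facts(1)[of j] assms by simp
  have "\<sigma> ` W j = W j"
  proof
    show "\<sigma> ` W j \<subseteq> W j" using st by (auto simp: stable_def)
    show "W j \<subseteq> \<sigma> ` W j"
    proof
      fix x assume "x \<in> W j"
      then have "\<sigma> (\<sigma>i x) \<in> \<sigma> ` W j" using stable_inv[OF st] by blast
      then show "x \<in> \<sigma> ` W j" by simp
    qed
  qed
  moreover have "\<sigma> ` pW j = act (fst j) ` (\<sigma> ` W j)" by (simp add: image_image sigma_act)
  ultimately have "\<sigma> ` pW j = pW j" by simp
  moreover have "\<sigma> ` coset (pW j) u = coset (\<sigma> ` pW j) (\<sigma> u)"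
    by (simp add: coset_def image_image linear_add[OF lin])
  ultimately show ?thesis by simp
qed

text \<open>\<open>h_form\<close> is picked by \<open>SOME\<close>, so its trace is known only after
  a suitable form has been shown to exist. On the quotient \<sigma> satisfies the equation of
  \<zeta>, because p(\<sigma>) W is the radical, and it preserves the form; from this the hypotheses
  of \<open>hermitian_lift\<close> follow.\<close>

lemma trace_form:
  assumes j: "j \<in> J1"
  shows "\<forall>X\<in>coset (pW j) ` W j. \<forall>Y\<in>coset (pW j) ` W j. complex_trace (h_form B \<sigma> W j X Y) = cform j X Y"
proof -
  have jJ: "j \<in> J0 \<union> J1" using j by simp
  note f = J_facts[OF jJ]
  note R = symform_rules[OF f(3)]
  have sd: "self_dual (fst j)" using J_admissible[OF jJ] by (cases j) (simp add: admissible_def)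
  obtain b where b: "fst j = [:1, b, 1:]" "b\<^sup>2 < 4"
    using sd J1_degree[OF j] by (cases rule: self_dual_cases) auto
  define \<zeta> where "\<zeta> = upper_root (fst j)"
  have \<zeta>: "\<zeta> = Complex (- b / 2) (sqrt (1 - b\<^sup>2 / 4))" unfolding \<zeta>_def b(1) by (rule upper_root_quadratic[OF b(2)])
  have "(b / 2)\<^sup>2 + (sqrt (1 - b\<^sup>2 / 4))\<^sup>2 = 1" using b(2) by (simp add: power_divide)
  then have n: "cmod \<zeta> = 1" "Im \<zeta> \<noteq> 0" "2 * Re \<zeta> = - b" using b(2) by (simp_all add: \<zeta> cmod_def)
  have sM: "subspace (pW j)" unfolding f(4) by (rule subspace_radical[OF f(3,2)])
  have sW: "\<sigma> u \<in> W j" if "u \<in> W j" for u using f(1) that by (simp add: stable_def)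
  have rel: "\<beta> j (\<sigma> (\<sigma> u)) v = - b * \<beta> j (\<sigma> u) v - \<beta> j u v" if "u \<in> W j" "v \<in> W j" for u v
  proof -
    have "act (fst j) u \<in> rad_on (\<beta> j) (W j)" using that(1) unfolding f(4)[symmetric] by blast
    then have "\<beta> j (act (fst j) u) v = 0" using that(2) by (simp add: rad_on_def)
    moreover have "act (fst j) u = u + b *\<^sub>R \<sigma> u + \<sigma> (\<sigma> u)"
      by (simp add: b(1) poly_act_def numeral_2_eq_2)
    ultimately show ?thesis by (simp add: R)
  qed
  \<comment> \<open>The relation \<open>rel\<close> with \<sigma> v in place of v, where \<sigma>
    cancels since it preserves the local form.\<close>
  have adj: "\<beta> j (\<sigma> u) v + \<beta> j (\<sigma> v) u = - b * \<beta> j u v" if "u \<in> W j" "v \<in> W j" for u v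
    using rel[OF that] rel[OF that(1) sW[OF that(2)]] bform_sigma[OF sd] symform_sym[OF f(3)]
    by (smt (verit) sW rel that)
  let ?Q = "quotient_quad (W j) (pW j) (cform j)"
  let ?c = "coset (pW j)"
  have "\<exists>h. hermitian_form ?Q \<zeta> ((`) \<sigma>) h \<and> (\<forall>x\<in>vecs ?Q. \<forall>y\<in>vecs ?Q. complex_trace (h x y) = vform ?Q x y)"
  proof (rule hermitian_lift; (unfold quotient_quad_sel)?)
    fix x y z assume "x \<in> ?c ` W j" "y \<in> ?c ` W j" "z \<in> ?c ` W j"
    then obtain u v w where e: "x = ?c u" "y = ?c v" "z = ?c w" and m: "u \<in> W j" "v \<in> W j" "w \<in> W j" by auto
    show "cform j {u + v | u v. u \<in> x \<and> v \<in> y} z = cform j x z + cform j y z"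
      unfolding e coset_plus[OF sM] using m subspace_add[OF f(2)] by (simp add: cform_J1[OF j] R)
  next
    fix a x y assume "x \<in> ?c ` W j" "y \<in> ?c ` W j"
    then obtain u v where e: "x = ?c u" "y = ?c v" and m: "u \<in> W j" "v \<in> W j" by auto
    show "cform j {a *\<^sub>R u + z | u z. u \<in> x \<and> z \<in> pW j} y = a * cform j x y"
      unfolding e coset_scale[OF sM] using m subspace_scale[OF f(2)] by (simp add: cform_J1[OF j] R)
  next
    fix x y assume "x \<in> ?c ` W j" "y \<in> ?c ` W j"
    then obtain u v where e: "x = ?c u" "y = ?c v" and m: "u \<in> W j" "v \<in> W j" by auto
    note sc = sigma_coset[OF j m(1)] sigma_coset[OF j m(2)] sigma_coset[OF j sW[OF m(1)]]
      sigma_coset[OF j subspace_add[OF f(2) m]]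
    show "\<sigma> ` {u + v | u v. u \<in> x \<and> v \<in> y} = {u + v | u v. u \<in> \<sigma> ` x \<and> v \<in> \<sigma> ` y}"
      unfolding e sc coset_plus[OF sM] linear_add[OF lin] ..
    show "cform j x y = cform j y x" using m symform_sym[OF f(3), of u v] by (simp add: e cform_J1[OF j])
    show "cform j (\<sigma> ` \<sigma> ` x) y = 2 * Re \<zeta> * cform j (\<sigma> ` x) y - cform j x y"
      unfolding n(3) e sc using m sW rel by (simp add: cform_J1[OF j])
    show "cform j (\<sigma> ` x) y + cform j (\<sigma> ` y) x = 2 * Re \<zeta> * cform j x y"
      unfolding n(3) e sc using m sW adj by (simp add: cform_J1[OF j])
  next
    fix a x assume "x \<in> ?c ` W j"
    then obtain u where e: "x = ?c u" and m: "u \<in> W j" by auto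
    show "\<sigma> ` {a *\<^sub>R u + z | u z. u \<in> x \<and> z \<in> pW j} = {a *\<^sub>R u + z | u z. u \<in> \<sigma> ` x \<and> z \<in> pW j}"
      unfolding e sigma_coset[OF j m] coset_scale[OF sM] sigma_coset[OF j subspace_scale[OF f(2) m]] linear_scale[OF lin] ..
    show "\<sigma> ` x \<in> ?c ` W j" unfolding e sigma_coset[OF j m] using sW[OF m] by blast
  qed (use n in auto)
  then have "\<exists>h. hermitian_form (h_base B \<sigma> W j) (upper_root (fst j)) ((`) \<sigma>) h \<and>
     (\<forall>X\<in>vecs (h_base B \<sigma> W j). \<forall>Y\<in>vecs (h_base B \<sigma> W j).
        complex_trace (h X Y) = vform (h_base B \<sigma> W j) X Y)"
    unfolding h_base_eq[OF j] \<zeta>_def .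
  from someI_ex[OF this] show ?thesis
    unfolding h_form_def[symmetric] unfolding h_base_eq[OF j] quotient_quad_sel by blast
qed

lemma q1_summand:
  "j \<in> J1 \<Longrightarrow> trace_space B \<sigma> W j = quotient_quad (W j) (pW j) (\<lambda>X Y. complex_trace (h_form B \<sigma> W j X Y))"
  by (simp add: trace_space_def h_base_eq quotient_quad_def)

lemma q0_definite:
  "positive_definite (q0 B \<sigma> W) \<longleftrightarrow> (\<forall>j\<in>J0. w0 j = int (ep j))"
  "negative_definite (q0 B \<sigma> W) \<longleftrightarrow> (\<forall>j\<in>J0. w0 j = 0)"
  "vzero (q0 B \<sigma> W) \<in> vecs (q0 B \<sigma> W)" "vform (q0 B \<sigma> W) (vzero (q0 B \<sigma> W)) (vzero (q0 B \<sigma> W)) = 0"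
proof -
  let ?Q = "\<lambda>(t, l). scale_form ((- 1) ^ ((l - 1) div 2)) (b_space B \<sigma> W (t, l))"
  have z: "vzero (?Q j) \<in> vecs (?Q j)" "vform (?Q j) (vzero (?Q j)) (vzero (?Q j)) = 0"
    and p: "positive_definite (?Q j) \<longleftrightarrow> w0 j = int (ep j)" "negative_definite (?Q j) \<longleftrightarrow> w0 j = 0" if j: "j \<in> J0" for j
  proof -
    have jJ: "j \<in> J0 \<union> J1" using j by simp
    note f = J_facts[OF jJ]
    note c = cform_coset[OF jJ]
    show "vzero (?Q j) \<in> vecs (?Q j)" "vform (?Q j) (vzero (?Q j)) (vzero (?Q j)) = 0"
      unfolding q0_summand[OF j] quotient_quad_sel
      using quotient_zero[OF f(3,2), of "\<lambda>X Y. csgn (fst j) (snd j) * cform j X Y" "pW j"] c by auto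
    show "positive_definite (?Q j) \<longleftrightarrow> w0 j = int (ep j)" "negative_definite (?Q j) \<longleftrightarrow> w0 j = 0"
      unfolding q0_summand[OF j]
      using quotient_positive[OF f(3,2) c f(4)] quotient_negative[OF f(3,2) c f(4)] J0_values(3)[OF j] f(5,6)
      by (auto simp: w0_def)
  qed
  show "positive_definite (q0 B \<sigma> W) \<longleftrightarrow> (\<forall>j\<in>J0. w0 j = int (ep j))"
    "negative_definite (q0 B \<sigma> W) \<longleftrightarrow> (\<forall>j\<in>J0. w0 j = 0)"
    unfolding q0_def using positive_orth_sum[OF finite_J(1) z] negative_orth_sum[OF finite_J(1) z] p by simp_all
  show "vzero (q0 B \<sigma> W) \<in> vecs (q0 B \<sigma> W)" "vform (q0 B \<sigma> W) (vzero (q0 B \<sigma> W)) (vzero (q0 B \<sigma> W)) = 0"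
    unfolding q0_def orth_sum_def using z by simp_all
qed

lemma q1_definite:
  "positive_definite (q1 B \<sigma> W) \<longleftrightarrow> (\<forall>j\<in>J1. z0 j = int (ep j))"
  "negative_definite (q1 B \<sigma> W) \<longleftrightarrow> (\<forall>j\<in>J1. z0 j = 0)"
  "vzero (q1 B \<sigma> W) \<in> vecs (q1 B \<sigma> W)" "vform (q1 B \<sigma> W) (vzero (q1 B \<sigma> W)) (vzero (q1 B \<sigma> W)) = 0"
proof -
  let ?Q = "trace_space B \<sigma> W"
  have z: "vzero (?Q j) \<in> vecs (?Q j)" "vform (?Q j) (vzero (?Q j)) (vzero (?Q j)) = 0"
    and p: "positive_definite (?Q j) \<longleftrightarrow> z0 j = int (ep j)" "negative_definite (?Q j) \<longleftrightarrow> z0 j = 0" if j: "j \<in> J1" for j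
  proof -
    have jJ: "j \<in> J0 \<union> J1" using j by simp
    note f = J_facts[OF jJ]
    have c: "complex_trace (h_form B \<sigma> W j (coset (pW j) u) (coset (pW j) v)) = \<beta> j u v"
      if "u \<in> W j" "v \<in> W j" for u v
      using trace_form[OF j] cform_J1[OF j that] that by simp
    show "vzero (?Q j) \<in> vecs (?Q j)" "vform (?Q j) (vzero (?Q j)) (vzero (?Q j)) = 0"
      unfolding q1_summand[OF j] quotient_quad_sel
      using quotient_zero[OF f(3,2), of "\<lambda>X Y. complex_trace (h_form B \<sigma> W j X Y)" "pW j"] c by auto
    show "positive_definite (?Q j) \<longleftrightarrow> z0 j = int (ep j)" "negative_definite (?Q j) \<longleftrightarrow> z0 j = 0"
      unfolding q1_summand[OF j]
      using quotient_positive[OF f(3,2) c f(4)] quotient_negative[OF f(3,2) c f(4)] J1_values(3,4)[OF j] f(5,6)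
      by auto
  qed
  show "positive_definite (q1 B \<sigma> W) \<longleftrightarrow> (\<forall>j\<in>J1. z0 j = int (ep j))"
    "negative_definite (q1 B \<sigma> W) \<longleftrightarrow> (\<forall>j\<in>J1. z0 j = 0)"
    unfolding q1_def using positive_orth_sum[OF finite_J(2) z] negative_orth_sum[OF finite_J(2) z] p by simp_all
  show "vzero (q1 B \<sigma> W) \<in> vecs (q1 B \<sigma> W)" "vform (q1 B \<sigma> W) (vzero (q1 B \<sigma> W)) (vzero (q1 B \<sigma> W)) = 0"
    unfolding q1_def orth_sum_def using z by simp_all
qed

lemma q_definite:
  "definite (q1 B \<sigma> W) \<longleftrightarrow> (\<forall>j\<in>J1. z0 j = int (ep j)) \<or> (\<forall>j\<in>J1. z0 j = 0)"
  "definite (q_total B \<sigma> W) \<longleftrightarrow>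
    (\<forall>j\<in>J0. w0 j = int (ep j)) \<and> (\<forall>j\<in>J1. z0 j = int (ep j)) \<or> (\<forall>j\<in>J0. w0 j = 0) \<and> (\<forall>j\<in>J1. z0 j = 0)"
  using positive_orth_pair[OF q0_definite(3,4) q1_definite(3,4)] negative_orth_pair[OF q0_definite(3,4) q1_definite(3,4)] q0_definite(1,2) q1_definite(1,2)
  by (simp_all add: definite_def q_total_def)

lemma q0_signature:
  assumes J: "J0 = {j}"
  shows "has_signature (q0 B \<sigma> W) r s \<longleftrightarrow> int r = w0 j \<and> int s = int (ep j) - w0 j"
    "has_dim (q0 B \<sigma> W) n \<longleftrightarrow> n = ep j"
proof -
  have j: "j \<in> J0" "j \<in> J0 \<union> J1" using J by auto
  note f = J_facts[OF j(2)]
  have "has_signature (q0 B \<sigma> W) r s \<longleftrightarrow> r = pidx (\<beta> j) (W j) \<and> s = nidx (\<beta> j) (W j)"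
    "has_dim (q0 B \<sigma> W) n \<longleftrightarrow> n = pidx (\<beta> j) (W j) + nidx (\<beta> j) (W j)"
    unfolding q0_def J
    by (rule quotient_signature[OF f(3,2) _ f(4)], erule (1) cform_coset[OF j(2)], rule q0_summand[OF j(1)])+
  then show "has_signature (q0 B \<sigma> W) r s \<longleftrightarrow> int r = w0 j \<and> int s = int (ep j) - w0 j"
    "has_dim (q0 B \<sigma> W) n \<longleftrightarrow> n = ep j"
    using J0_values(3)[OF j(1)] f(5,6) by (auto simp: w0_def)
qed

end

section \<open>Uniqueness of the solution\<close>

text \<open>A discrete intermediate value theorem, obtained by fixing one coordinate after the
  other.\<close>

lemma sum_between:
  fixes a b :: "'i \<Rightarrow> int"
  assumes "finite J" "\<And>j. j \<in> J \<Longrightarrow> a j \<le> b j" "sum a J \<le> t" "t \<le> sum b J"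
  shows "\<exists>w. (\<forall>j\<in>J. a j \<le> w j \<and> w j \<le> b j) \<and> sum w J = t"
  using assms
proof (induction J arbitrary: t)
  case empty
  then show ?case by simp
next
  case (insert k J)
  \<comment> \<open>The least value at k for which the other coordinates can still make up the
    rest.\<close>
  define c where "c = max (a k) (t - sum b J)"
  have ab: "sum a J \<le> sum b J" using insert.prems(1) by (intro sum_mono) auto
  have ck: "a k \<le> c" "c \<le> b k" "sum a J \<le> t - c" "t - c \<le> sum b J"
    using insert.prems insert.hyps ab by (auto simp: c_def)
  obtain w where w: "\<forall>j\<in>J. a j \<le> w j \<and> w j \<le> b j" "sum w J = t - c"
    using insert.IH[OF _ ck(3,4)] insert.prems(1) by auto
  have "sum (w(k := c)) J = sum w J" using insert.hyps by (intro sum.cong) auto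
  then show ?case using w ck insert.hyps by (intro exI[of _ "w(k := c)"]) auto
qed

lemma sum_zero_same_sign:
  fixes d :: "'i \<Rightarrow> int"
  assumes "finite J" "sum d J = 0" "(\<forall>j\<in>J. 0 \<le> d j) \<or> (\<forall>j\<in>J. d j \<le> 0)" "j \<in> J"
  shows "d j = 0"
  using assms(3)
proof
  assume "\<forall>j\<in>J. 0 \<le> d j"
  then show ?thesis using sum_nonneg_eq_0_iff[of J d] assms by auto
next
  assume "\<forall>j\<in>J. d j \<le> 0"
  then show ?thesis using sum_nonneg_eq_0_iff[of J "\<lambda>j. - d j"] assms by (auto simp: sum_negf)
qed

text \<open>Moving a unit from j to another index k is blocked only if x j = 0 or x k = e k. Hence a
  j with x j \<noteq> 0 and a k with x k \<noteq> e k must coincide, and a further index would be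
  both full and empty, against e \<ge> 1.\<close>

lemma no_exchange:
  fixes x e :: "'i \<Rightarrow> int"
  assumes J: "finite J" and x: "\<And>j. j \<in> J \<Longrightarrow> 0 \<le> x j \<and> x j \<le> e j \<and> 1 \<le> e j"
    and rigid: "\<And>w. (\<forall>j\<in>J. 0 \<le> w j \<and> w j \<le> e j) \<Longrightarrow> sum w J = sum x J \<Longrightarrow> \<forall>j\<in>J. w j = x j"
  shows "card J \<le> 1 \<or> (\<forall>j\<in>J. x j = 0) \<or> (\<forall>j\<in>J. x j = e j)"
proof -
  have ex: "x j = 0 \<or> x k = e k" if jk: "j \<in> J" "k \<in> J" "j \<noteq> k" for j k
  proof (rule ccontr)
    assume n: "\<not> (x j = 0 \<or> x k = e k)"
    define w where "w = (\<lambda>i. x i + ((if i = k then 1 else 0) - (if i = j then 1 else 0)))"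
    have "sum w J = sum x J" using J jk by (simp add: w_def sum.distrib sum_subtractf)
    moreover have "\<forall>i\<in>J. 0 \<le> w i \<and> w i \<le> e i"
    proof
      fix i assume "i \<in> J"
      then show "0 \<le> w i \<and> w i \<le> e i" using x[of i] n jk by (auto simp: w_def)
    qed
    ultimately have "w j = x j" using rigid jk(1) by blast
    then show False using jk by (simp add: w_def)
  qed
  show ?thesis
  proof (rule ccontr)
    assume "\<not> ?thesis"
    then have c: "card J > 1" and "\<exists>j\<in>J. x j \<noteq> 0" "\<exists>k\<in>J. x k \<noteq> e k" by auto
    then obtain j k where jk: "j \<in> J" "x j \<noteq> 0" "k \<in> J" "x k \<noteq> e k" by blast
    then have "j = k" using ex by blast
    moreover obtain i where "i \<in> J" "i \<noteq> j" using c J by (metis card_le_Suc0_iff_eq One_nat_def not_le)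
    then have "x i = e i" "x i = 0" using ex[of j i] ex[of i k] jk \<open>j = k\<close> by auto
    ultimately show False using x[OF \<open>i \<in> J\<close>] by simp
  qed
qed

text \<open>The elementary moves are those within w, those within z, and two units of w against one
  of z. \<open>no_exchange\<close> handles the first two kinds, \<open>down\<close> and
  \<open>up\<close> the third, and a case distinction on J sorts the outcome. For the converse,
  semidefiniteness forces all differences to have one sign, or J is a singleton {j} and parity
  helps: the difference at j is even, and a range with a single step on one side leaves no room for
  it there.\<close>

lemma rigid_iff:
  fixes w0 z0 e :: "'i \<Rightarrow> int"
  assumes J: "finite J" "finite K"
    and w0: "\<And>j. j \<in> J \<Longrightarrow> 0 \<le> w0 j \<and> w0 j \<le> e j \<and> 1 \<le> e j"
    and z0: "\<And>j. j \<in> K \<Longrightarrow> 0 \<le> z0 j \<and> z0 j \<le> e j \<and> 1 \<le> e j"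
  defines "all_pos \<equiv> \<forall>k\<in>K. z0 k = e k" and "all_neg \<equiv> \<forall>k\<in>K. z0 k = 0"
  shows "(\<forall>w z. (\<forall>j\<in>J. 0 \<le> w j \<and> w j \<le> e j) \<and> (\<forall>k\<in>K. 0 \<le> z k \<and> z k \<le> e k) \<and>
      sum w J + 2 * sum z K = sum w0 J + 2 * sum z0 K \<longrightarrow> (\<forall>j\<in>J. w j = w0 j) \<and> (\<forall>k\<in>K. z k = z0 k)) \<longleftrightarrow>
    card J + card K \<le> 1 \<or>
    ((\<forall>j\<in>J. w0 j = e j) \<and> all_pos \<or> (\<forall>j\<in>J. w0 j = 0) \<and> all_neg) \<or>
    (\<exists>j. J = {j} \<and> e j = 1 \<and> (card K = 1 \<or> all_pos \<or> all_neg)) \<or>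
    (\<exists>j. J = {j} \<and> w0 j = 1 \<and> e j = 2 \<and> (card K = 1 \<or> all_pos \<or> all_neg)) \<or>
    (\<exists>j. J = {j} \<and> (w0 j \<ge> 2 \<and> e j - w0 j = 1 \<and> all_pos \<or> w0 j = 1 \<and> e j - w0 j \<ge> 2 \<and> all_neg))"
  (is "?rigid \<longleftrightarrow> ?cond")
proof
  assume R: ?rigid
  have rigid: "(\<forall>j\<in>J. w j = w0 j) \<and> (\<forall>k\<in>K. z k = z0 k)"
    if "\<forall>j\<in>J. 0 \<le> w j \<and> w j \<le> e j" "\<forall>k\<in>K. 0 \<le> z k \<and> z k \<le> e k"
      "sum w J + 2 * sum z K = sum w0 J + 2 * sum z0 K" for w z
    using R that by blast
  have z0b: "\<forall>k\<in>K. 0 \<le> z0 k \<and> z0 k \<le> e k" and w0b: "\<forall>j\<in>J. 0 \<le> w0 j \<and> w0 j \<le> e j" using z0 w0 by blast+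
  have A: "card J \<le> 1 \<or> (\<forall>j\<in>J. w0 j = 0) \<or> (\<forall>j\<in>J. w0 j = e j)"
  proof (rule no_exchange[OF J(1) w0])
    fix w assume "\<forall>j\<in>J. 0 \<le> w j \<and> w j \<le> e j" "sum w J = sum w0 J"
    then show "\<forall>j\<in>J. w j = w0 j" by (intro conjunct1[OF rigid[OF _ z0b]]) auto
  qed
  have A': "card K \<le> 1 \<or> all_neg \<or> all_pos"
    unfolding all_pos_def all_neg_def
  proof (rule no_exchange[OF J(2) z0])
    fix z assume "\<forall>k\<in>K. 0 \<le> z k \<and> z k \<le> e k" "sum z K = sum z0 K"
    then show "\<forall>k\<in>K. z k = z0 k" by (intro conjunct2[OF rigid[OF w0b]]) auto
  qed
  \<comment> \<open>Two units that can be taken from w may be traded for one unit of z at any index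
    that is not full.\<close>
  have down: "sum w0 J \<le> 1 \<or> all_pos"
  proof (rule ccontr)
    assume "\<not> ?thesis"
    then obtain k where k: "sum w0 J \<ge> 2" "k \<in> K" "z0 k \<noteq> e k" by (auto simp: all_pos_def)
    obtain w where w: "\<forall>j\<in>J. 0 \<le> w j \<and> w j \<le> w0 j" "sum w J = sum w0 J - 2"
      using sum_between[OF J(1), of "\<lambda>_. 0" w0 "sum w0 J - 2"] w0 k(1) by auto
    define z where "z = (\<lambda>i. z0 i + (if i = k then 1 else 0))"
    have "\<forall>j\<in>J. 0 \<le> w j \<and> w j \<le> e j" using w(1) w0 by force
    moreover have "\<forall>i\<in>K. 0 \<le> z i \<and> z i \<le> e i"
    proof
      fix i assume "i \<in> K"
      then show "0 \<le> z i \<and> z i \<le> e i" using z0[of i] k(3) by (auto simp: z_def)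
    qed
    moreover have "sum z K = sum z0 K + 1" using k J by (simp add: z_def sum.distrib)
    ultimately have "(\<forall>j\<in>J. w j = w0 j) \<and> (\<forall>k\<in>K. z k = z0 k)" using w(2) by (intro rigid) auto
    then have "z k = z0 k" using k(2) by blast
    then show False by (simp add: z_def)
  qed
  have up: "sum e J - sum w0 J \<le> 1 \<or> all_neg"
  proof (rule ccontr)
    assume "\<not> ?thesis"
    then obtain k where k: "sum e J - sum w0 J \<ge> 2" "k \<in> K" "z0 k \<noteq> 0" by (auto simp: all_neg_def)
    obtain w where w: "\<forall>j\<in>J. w0 j \<le> w j \<and> w j \<le> e j" "sum w J = sum w0 J + 2"
      using sum_between[OF J(1), of w0 e "sum w0 J + 2"] w0 k(1) by auto
    define z where "z = (\<lambda>i. z0 i - (if i = k then 1 else 0))"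
    have "\<forall>j\<in>J. 0 \<le> w j \<and> w j \<le> e j" using w(1) w0 by force
    moreover have "\<forall>i\<in>K. 0 \<le> z i \<and> z i \<le> e i"
    proof
      fix i assume "i \<in> K"
      then show "0 \<le> z i \<and> z i \<le> e i" using z0[of i] k(3) by (auto simp: z_def)
    qed
    moreover have "sum z K = sum z0 K - 1" using k J by (simp add: z_def sum_subtractf)
    ultimately have "(\<forall>j\<in>J. w j = w0 j) \<and> (\<forall>k\<in>K. z k = z0 k)" using w(2) by (intro rigid) auto
    then have "z k = z0 k" using k(2) by blast
    then show False by (simp add: z_def)
  qed
  have "card J = 0 \<or> card J = 1 \<or> card J \<ge> 2" by linarith
  then have "J = {} \<or> (\<exists>j. J = {j}) \<or> card J \<ge> 2" using J(1) by (auto simp: card_1_singleton_iff)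
  then consider "J = {}" | "K = {}" | j where "J = {j}" "K \<noteq> {}" | "card J \<ge> 2" "K \<noteq> {}"
    by blast
  then show ?cond
  proof cases
    case 1
    then show ?thesis using A' by auto
  next
    case 2
    then show ?thesis using A by (auto simp: all_pos_def all_neg_def)
  next
    case (3 j)
    have c: "card K = 1 \<or> all_pos \<or> all_neg"
    proof -
      have "card K \<noteq> 0" using 3(2) J(2) by simp
      then show ?thesis using A' by linarith
    qed
    have x: "\<not> (all_pos \<and> all_neg)" using 3(2) z0 by (auto simp: all_pos_def all_neg_def) force
    have b: "0 \<le> w0 j" "w0 j \<le> e j" "1 \<le> e j" using w0 3(1) by auto
    have d: "w0 j \<le> 1 \<or> all_pos" "e j - w0 j \<le> 1 \<or> all_neg" using down up 3(1) by auto
    consider "w0 j \<le> 1" "e j - w0 j \<le> 1" | "w0 j \<ge> 2" | "w0 j \<le> 1" "e j - w0 j \<ge> 2" by linarith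
    then show ?thesis
    proof cases
      case 1
      then have "e j = 1 \<or> w0 j = 1 \<and> e j = 2" using b by linarith
      then show ?thesis using c 3(1) by blast
    next
      case 2
      then have p: all_pos "e j - w0 j \<le> 1" using d x by auto
      then have "e j - w0 j = 1 \<or> w0 j = e j" using b by linarith
      then show ?thesis using p(1) 2 3(1) by auto
    next
      case neg: 3
      then have p: all_neg using d by auto
      have "w0 j = 1 \<or> w0 j = 0" using b neg by linarith
      then show ?thesis using p neg 3(1) by auto
    qed
  next
    case 4
    have x: "\<not> (all_pos \<and> all_neg)" using 4(2) z0 by (auto simp: all_pos_def all_neg_def) force
    \<comment> \<open>With at least two indices, and w0 empty or full throughout, at least two units
      of w are free to move in one direction.\<close>
    have "int (card J) \<le> sum e J" using sum_mono[of J "\<lambda>_. 1" e] w0 by simp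
    then have e: "sum e J \<ge> 2" using 4(1) by linarith
    from A 4(1) have "(\<forall>j\<in>J. w0 j = 0) \<or> (\<forall>j\<in>J. w0 j = e j)" by linarith
    then show ?thesis
    proof
      assume z: "\<forall>j\<in>J. w0 j = 0"
      then have "sum w0 J = 0" by simp
      then show ?thesis using up e z by auto
    next
      assume z: "\<forall>j\<in>J. w0 j = e j"
      then have "sum w0 J = sum e J" by simp
      then show ?thesis using down e z by auto
    qed
  qed
next
  assume C: ?cond
  show ?rigid
  proof (intro allI impI)
    fix w z
    assume h: "(\<forall>j\<in>J. 0 \<le> w j \<and> w j \<le> e j) \<and> (\<forall>k\<in>K. 0 \<le> z k \<and> z k \<le> e k) \<and>
      sum w J + 2 * sum z K = sum w0 J + 2 * sum z0 K"
    define d where "d = (\<lambda>j. w j - w0 j)"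
    define f where "f = (\<lambda>j. z j - z0 j)"
    have eq: "sum d J + 2 * sum f K = 0" using h by (simp add: d_def f_def sum_subtractf)
    have db: "- w0 j \<le> d j" "d j \<le> e j - w0 j" if "j \<in> J" for j using h that by (auto simp: d_def)
    have fb: "- z0 k \<le> f k" "f k \<le> e k - z0 k" if "k \<in> K" for k using h that by (auto simp: f_def)
    have fp: "\<forall>k\<in>K. f k \<le> 0" "sum f K \<le> 0" if all_pos
    proof -
      show "\<forall>k\<in>K. f k \<le> 0" using fb(2) that by (force simp: all_pos_def)
      then show "sum f K \<le> 0" by (intro sum_nonpos) auto
    qed
    have fn: "\<forall>k\<in>K. 0 \<le> f k" "0 \<le> sum f K" if all_neg
    proof -
      show "\<forall>k\<in>K. 0 \<le> f k" using fb(1) that by (force simp: all_neg_def)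
      then show "0 \<le> sum f K" by (intro sum_nonneg) auto
    qed
    have f0: "\<forall>k\<in>K. f k = 0" if "sum f K = 0" "card K = 1 \<or> all_pos \<or> all_neg"
      using that(2)
    proof (elim disjE)
      assume "card K = 1"
      then obtain k where "K = {k}" by (rule card_1_singletonE)
      then show ?thesis using that(1) by simp
    next
      assume all_pos
      then show ?thesis using sum_zero_same_sign[OF J(2) that(1)] fp by blast
    next
      assume all_neg
      then show ?thesis using sum_zero_same_sign[OF J(2) that(1)] fn by blast
    qed
    from C consider (few) "card J + card K \<le> 1" | (pos) "\<forall>j\<in>J. w0 j = e j" all_pos | (neg) "\<forall>j\<in>J. w0 j = 0" all_neg
      | (line) j where "J = {j}" "e j = 1" "card K = 1 \<or> all_pos \<or> all_neg"
      | (plane) j where "J = {j}" "w0 j = 1" "e j = 2" "card K = 1 \<or> all_pos \<or> all_neg"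
      | (up) j where "J = {j}" "e j - w0 j = 1" all_pos | (down) j where "J = {j}" "w0 j = 1" all_neg
      by blast
    then have "(\<forall>j\<in>J. d j = 0) \<and> (\<forall>k\<in>K. f k = 0)"
    proof cases
      case few
      have "J = {} \<or> K = {} \<and> card J = 1" using few J by (cases "card J") auto
      then show ?thesis
      proof
        assume "J = {}"
        then have "sum f K = 0" using eq by simp
        have "K = {} \<or> card K = 1" using few J(2) by (cases "card K") auto
        then show ?thesis using f0 \<open>sum f K = 0\<close> \<open>J = {}\<close> by blast
      next
        assume k: "K = {} \<and> card J = 1"
        then obtain j where "J = {j}" by (blast elim: card_1_singletonE)
        then show ?thesis using eq k by simp
      qed
    next
      case pos
      have dn: "\<forall>j\<in>J. d j \<le> 0" using db(2) pos(1) by force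
      then have "sum d J \<le> 0" by (intro sum_nonpos) auto
      then have "sum d J = 0" "sum f K = 0" using fp(2)[OF pos(2)] eq by auto
      then show ?thesis using f0 pos(2) dn sum_zero_same_sign[OF J(1)] by blast
    next
      case neg
      have dn: "\<forall>j\<in>J. 0 \<le> d j" using db(1) neg(1) by force
      then have "0 \<le> sum d J" by (intro sum_nonneg) auto
      then have "sum d J = 0" "sum f K = 0" using fn(2)[OF neg(2)] eq by auto
      then show ?thesis using f0 neg(2) dn sum_zero_same_sign[OF J(1)] by blast
    next
      case (line j)
      have "- 1 \<le> d j" "d j \<le> 1" using db[of j] w0[of j] line(1,2) by auto
      moreover have "d j + 2 * sum f K = 0" using eq line(1) by simp
      \<comment> \<open>\<open>d j\<close> is even and of absolute value at most 1.\<close>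
      ultimately have "d j = 0 \<and> sum f K = 0" by presburger
      then show ?thesis using f0 line by blast
    next
      case (plane j)
      have "- 1 \<le> d j" "d j \<le> 1" using db[of j] plane(1,2,3) by auto
      moreover have "d j + 2 * sum f K = 0" using eq plane(1) by simp
      ultimately have "d j = 0 \<and> sum f K = 0" by presburger
      then show ?thesis using f0 plane by blast
    next
      case (up j)
      have "d j \<le> 1" using db[of j] up(1,2) by auto
      moreover have "sum f K \<le> 0" by (rule fp(2)[OF up(3)])
      moreover have "d j + 2 * sum f K = 0" using eq up(1) by simp
      \<comment> \<open>An even number \<open>d j\<close> that is at most 1 is at most 0, so the sum
        has two non-positive terms.\<close>
      ultimately have "d j = 0 \<and> sum f K = 0" by presburger
      then show ?thesis using f0 up by blast
    next
      case (down j)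
      have "- 1 \<le> d j" using db[of j] down(1,2) by auto
      moreover have "0 \<le> sum f K" by (rule fn(2)[OF down(3)])
      moreover have "d j + 2 * sum f K = 0" using eq down(1) by simp
      ultimately have "d j = 0 \<and> sum f K = 0" by presburger
      then show ?thesis using f0 down by blast
    qed
    then show "(\<forall>j\<in>J. w j = w0 j) \<and> (\<forall>k\<in>K. z k = z0 k)" by (simp add: d_def f_def)
  qed
qed

context decomp begin

text \<open>\<open>Sol\<close> consists of extensional functions, while rigidity concerns only the
  values on the index sets; restriction mediates between the two.\<close>

lemma Sol_unique_iff_rigid:
  "Sol = {base} \<longleftrightarrow> (\<forall>w z. (\<forall>j\<in>J0. 0 \<le> w j \<and> w j \<le> int (ep j)) \<and> (\<forall>k\<in>J1. 0 \<le> z k \<and> z k \<le> int (ep k)) \<and>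
      sum w J0 + 2 * sum z J1 = sum w0 J0 + 2 * sum z0 J1 \<longrightarrow> (\<forall>j\<in>J0. w j = w0 j) \<and> (\<forall>k\<in>J1. z k = z0 k))"
  (is "_ \<longleftrightarrow> ?R")
proof
  assume S: "Sol = {base}"
  show ?R
  proof (intro allI impI)
    fix w z
    assume "(\<forall>j\<in>J0. 0 \<le> w j \<and> w j \<le> int (ep j)) \<and> (\<forall>k\<in>J1. 0 \<le> z k \<and> z k \<le> int (ep k)) \<and>
      sum w J0 + 2 * sum z J1 = sum w0 J0 + 2 * sum z0 J1"
    then have "(restrict w J0, restrict z J1) \<in> Sol" by (simp add: Sol_def)
    then have e: "restrict w J0 = restrict w0 J0" "restrict z J1 = restrict z0 J1" using S by (simp_all add: base_def)
    show "(\<forall>j\<in>J0. w j = w0 j) \<and> (\<forall>k\<in>J1. z k = z0 k)"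
      using fun_cong[OF e(1)] fun_cong[OF e(2)] by (metis restrict_apply')
  qed
next
  assume R: ?R
  have "x = base" if x: "x \<in> Sol" for x
  proof -
    obtain w z where e: "x = (w, z)" by (cases x)
    have h: "w \<in> (\<Pi>\<^sub>E j\<in>J0. {0..int (ep j)})" "z \<in> (\<Pi>\<^sub>E j\<in>J1. {0..int (ep j)})"
      "sum w J0 + 2 * sum z J1 = sum w0 J0 + 2 * sum z0 J1" using x by (auto simp: Sol_def e)
    have b: "\<forall>j\<in>J0. 0 \<le> w j \<and> w j \<le> int (ep j)" "\<forall>j\<in>J1. 0 \<le> z j \<and> z j \<le> int (ep j)"
      using h(1,2) by (force dest: PiE_mem)+
    have wz: "\<forall>j\<in>J0. w j = w0 j" "\<forall>k\<in>J1. z k = z0 k" using R b h(3) by blast+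
    have "w = restrict w0 J0"
      using wz(1) h(1) by (intro extensionalityI[of _ J0]) (auto simp: PiE_def)
    moreover have "z = restrict z0 J1"
      using wz(2) h(2) by (intro extensionalityI[of _ J1]) (auto simp: PiE_def)
    ultimately show ?thesis by (simp add: e base_def)
  qed
  then show "Sol = {base}" using base_Sol by blast
qed

text \<open>In terms of \<open>w0\<close>, \<open>z0\<close> and the ranks, a positive definite form
  is one whose unknowns are all at the upper end of their range, a negative definite form one with
  all unknowns 0. This turns the five conditions into the right side of
  \<open>rigid_iff\<close>.\<close>

lemma unique_iff_conditions:
  "Sol = {base} \<longleftrightarrow> condition_i \<sigma> W \<or> condition_ii B \<sigma> W \<or> condition_iii B \<sigma> W \<or>
     condition_iv B \<sigma> W \<or> condition_v B \<sigma> W"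
proof -
  have ii: "condition_ii B \<sigma> W \<longleftrightarrow> (\<forall>j\<in>J0. w0 j = int (ep j)) \<and> (\<forall>j\<in>J1. z0 j = int (ep j)) \<or>
      (\<forall>j\<in>J0. w0 j = 0) \<and> (\<forall>j\<in>J1. z0 j = 0)"
    unfolding condition_ii_def by (rule q_definite(2))
  have c1: "card J0 = 1 \<and> P \<longleftrightarrow> (\<exists>j. J0 = {j} \<and> P)" for P by (auto simp: card_1_singleton_iff)
  have iii: "condition_iii B \<sigma> W \<longleftrightarrow> (\<exists>j. J0 = {j} \<and> int (ep j) = 1 \<and>
      (card J1 = 1 \<or> (\<forall>j\<in>J1. z0 j = int (ep j)) \<or> (\<forall>j\<in>J1. z0 j = 0)))"
    unfolding condition_iii_def c1 q_definite(1) by (rule ex_cong1, rule conj_cong[OF refl], simp only: q0_signature(2)) auto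
  have iv: "condition_iv B \<sigma> W \<longleftrightarrow> (\<exists>j. J0 = {j} \<and> w0 j = 1 \<and> int (ep j) = 2 \<and>
      (card J1 = 1 \<or> (\<forall>j\<in>J1. z0 j = int (ep j)) \<or> (\<forall>j\<in>J1. z0 j = 0)))"
  proof -
    have "hyperbolic_plane (q0 B \<sigma> W) \<longleftrightarrow> w0 j = 1 \<and> int (ep j) = 2" if "J0 = {j}" for j
      unfolding hyperbolic_plane_def q0_signature(1)[OF that] by auto
    then show ?thesis unfolding condition_iv_def c1 q_definite(1) by (intro ex_cong1 conj_cong[OF refl]) simp
  qed
  have v: "condition_v B \<sigma> W \<longleftrightarrow> (\<exists>j. J0 = {j} \<and> (w0 j \<ge> 2 \<and> int (ep j) - w0 j = 1 \<and> (\<forall>j\<in>J1. z0 j = int (ep j)) \<or>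
      w0 j = 1 \<and> int (ep j) - w0 j \<ge> 2 \<and> (\<forall>j\<in>J1. z0 j = 0)))"
  proof -
    have "(\<exists>r0 s0. has_signature (q0 B \<sigma> W) r0 s0 \<and>
        (r0 \<ge> 2 \<and> s0 = 1 \<and> P \<or> r0 = 1 \<and> s0 \<ge> 2 \<and> Q)) \<longleftrightarrow>
      (w0 j \<ge> 2 \<and> int (ep j) - w0 j = 1 \<and> P \<or> w0 j = 1 \<and> int (ep j) - w0 j \<ge> 2 \<and> Q)" (is "?l \<longleftrightarrow> ?r")
      if J: "J0 = {j}" for j P Q
    proof
      assume ?l
      then show ?r unfolding q0_signature(1)[OF J] by auto
    next
      have b: "0 \<le> w0 j" "w0 j \<le> int (ep j)" using J0_values[of j] J by auto
      assume ?r
      then show ?l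
        unfolding q0_signature(1)[OF J] using b
        by (intro exI[of _ "nat (w0 j)"] exI[of _ "nat (int (ep j) - w0 j)"]) auto
    qed
    then show ?thesis unfolding condition_v_def c1 q1_definite(1,2) by (intro ex_cong1 conj_cong[OF refl])
  qed
  show ?thesis
    unfolding Sol_unique_iff_rigid ii iii iv v condition_i_def
    by (rule rigid_iff[OF finite_J]) (use J0_values J1_values in auto)
qed

end

theorem corollary19:
  fixes B :: "'a::real_vector \<Rightarrow> 'a \<Rightarrow> real"
    and \<sigma> :: "'a \<Rightarrow> 'a"
    and W :: "real poly \<times> nat \<Rightarrow> 'a set"
    and r s n :: nat
  assumes "finite_dimensional_type TYPE('a)"
    and "nondegenerate_form B"
    and "\<sigma> \<in> O_group B"
    and "module_decomposition B \<sigma> W"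
    and "has_signature (subspace_quad B (V_odd \<sigma> W)) r s"
    and "n = r + s"
  shows
    "((\<exists>!wz. wz \<in> star_solutions \<sigma> W n r) \<longleftrightarrow>
        condition_i \<sigma> W \<or> condition_ii B \<sigma> W \<or> condition_iii B \<sigma> W \<or>
        condition_iv B \<sigma> W \<or> condition_v B \<sigma> W) \<and>
     ((\<forall>\<tau>\<in>O_group B. conjugate_in GL \<sigma> \<tau> \<longrightarrow> conjugate_in (O_group B) \<sigma> \<tau>) \<longleftrightarrow>
        I1_ev \<sigma> W = {} \<and>
        (condition_i \<sigma> W \<or> condition_ii B \<sigma> W \<or> condition_iii B \<sigma> W \<or>
         condition_iv B \<sigma> W \<or> condition_v B \<sigma> W))"
proof -
  obtain S :: "'a set" where S: "finite S" "span S = UNIV"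
    using assms(1) by (auto simp: finite_dimensional_type_def)
  obtain Bas where Bas: "Bas \<subseteq> S" "independent Bas" "S \<subseteq> span Bas"
    using maximal_independent_subset by blast
  have "span Bas = UNIV" using span_mono[OF Bas(3)] S(2) by (auto simp: span_span)
  then interpret decomp Bas B \<sigma> W
    using Bas(2) finite_subset[OF Bas(1) S(1)] assms by unfold_locales auto
  have V: "stable \<sigma> (V_odd \<sigma> W)" by (rule V_odd_facts(1))
  have "star_solutions \<sigma> W n r = Sol"
    unfolding assms(6)
    by (rule star_solutions_eq) (rule signature_invariants[OF symB stable_subspace[OF V] assms(5)])+
  \<comment> \<open>Since \<open>base\<close> always is a solution, a unique solution can only be
    \<open>base\<close>.\<close>
  moreover have "(\<exists>!wz. wz \<in> Sol) \<longleftrightarrow> Sol = {base}"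
  proof
    assume "\<exists>!wz. wz \<in> Sol"
    then show "Sol = {base}" using base_Sol by blast
  qed simp
  ultimately show ?thesis
    using conjugacy_iff_balanced balanced_iff_unique unique_iff_conditions by simp
qed

end
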